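(* ${\rm LZFC}^{spec}\vdash \text{V-P-H}$. Therefore ${\rm ZFC}\subseteq {\rm LZFC}^{spec}+VP$.
   Context: All theories are in the language $\{\in\}$; $S\subseteq T$ means that every theorem of $S$ is a theorem of $T$. BST is the theory with axioms: Empty set, Extensionality, Pair, Union, Cartesian Product, "$\omega$ exists", $\Delta_0$-Separation. $Loc({\rm ZFC})$ is the statement that every set belongs to a transitive model of ZFC; ${\rm LZFC}={\rm BST}+Loc({\rm ZFC})$. "Model" means a (set) transitive model of ZFC. A model $M$ is special if for every ordinal $\alpha\in M$, ${\rm cf}^M(\alpha)=\omega\Leftrightarrow {\rm cf}(\alpha)=\omega$. $Loc^{spec}({\rm ZFC})$ says that every set belongs to a special model, and ${\rm LZFC}^{spec}={\rm LZFC}+Loc^{spec}({\rm ZFC})$. V-P-H is the statement: for every infinite set $A$ there is a binary relation $R\subset A\times A$ such that the graph $(A,R)$ is rigid, i.e., the only endomorphism of $(A,R)$ is the identity, where an endomorphism is a map $f:A\to A$ such that $(x,y)\in R\Rightarrow (f(x),f(y))\in R$ for all $x,y\in A$. (V-P-H is a theorem of ZFC, due to Vopěnka, Pultr and Hedrlín.) $VP$ (Vopěnka's Principle) is the scheme consisting of the following statement for each formula $\phi(x)$ of the language $\{\in\}$ (set parameters allowed), where $X_\phi=\{x:\phi(x)\}$: if $X_\phi$ is a proper class of structures of some fixed first-order language, then there are distinct $x,y\in X_\phi$ and an elementary embedding $j:x\rightarrow y$ (possibly trivial, i.e. $x\prec y$). *)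

theory Defs
  imports Main
begin

section \<open>First-order logic with equality over the language of set theory\<close>

text \<open>
  Formulas use de Bruijn indices. The language has no function symbols, so a substitution is just
  a renaming of indices.
\<close>

datatype fm = Mem nat nat | Eq nat nat | Fls | Imp fm fm | All fm

primrec ren :: "(nat \<Rightarrow> nat) \<Rightarrow> fm \<Rightarrow> fm" where
  "ren f (Mem i j) = Mem (f i) (f j)"
| "ren f (Eq i j) = Eq (f i) (f j)"
| "ren f Fls = Fls"
| "ren f (Imp p q) = Imp (ren f p) (ren f q)"
| "ren f (All p) = All (ren (case_nat 0 (\<lambda>i. Suc (f i))) p)"

primrec fv :: "fm \<Rightarrow> nat set" where
  "fv (Mem i j) = {i, j}"
| "fv (Eq i j) = {i, j}"
| "fv Fls = {}"
| "fv (Imp p q) = fv p \<union> fv q"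
| "fv (All p) = {i. Suc i \<in> fv p}"

text \<open>Instantiation of index 0 (the variable of the outermost quantifier) by \<open>y\<close>.\<close>

definition inst :: "fm \<Rightarrow> nat \<Rightarrow> fm" where
  "inst p y = ren (case_nat y id) p"

definition univ_closure :: "fm \<Rightarrow> fm" where
  "univ_closure p = (All ^^ (LEAST k. fv p \<subseteq> {..<k})) p"

text \<open>
  Classical natural deduction. In \<open>AllI\<close> the shift of the context says that the generalised
  variable 0 is not free in it.
\<close>

inductive proves :: "fm set \<Rightarrow> fm \<Rightarrow> bool" (infix "\<turnstile>" 40) where
  Asm: "p \<in> \<Gamma> \<Longrightarrow> \<Gamma> \<turnstile> p"
| ImpI: "insert p \<Gamma> \<turnstile> q \<Longrightarrow> \<Gamma> \<turnstile> Imp p q"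
| ImpE: "\<Gamma> \<turnstile> Imp p q \<Longrightarrow> \<Gamma> \<turnstile> p \<Longrightarrow> \<Gamma> \<turnstile> q"
| RAA: "insert (Imp p Fls) \<Gamma> \<turnstile> Fls \<Longrightarrow> \<Gamma> \<turnstile> p"
| AllI: "ren Suc ` \<Gamma> \<turnstile> p \<Longrightarrow> \<Gamma> \<turnstile> All p"
| AllE: "\<Gamma> \<turnstile> All p \<Longrightarrow> \<Gamma> \<turnstile> inst p y"
| EqRefl: "\<Gamma> \<turnstile> Eq x x"
| EqSubst: "\<Gamma> \<turnstile> Eq x y \<Longrightarrow> \<Gamma> \<turnstile> inst p x \<Longrightarrow> \<Gamma> \<turnstile> inst p y"

definition theorems_of :: "fm set \<Rightarrow> fm set" where
  "theorems_of T = {p. T \<turnstile> p}"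

text \<open>Relativisation of all quantifiers to the (free) variable with index \<open>m\<close>.\<close>

primrec relativize :: "nat \<Rightarrow> fm \<Rightarrow> fm" where
  "relativize m (Mem i j) = Mem i j"
| "relativize m (Eq i j) = Eq i j"
| "relativize m Fls = Fls"
| "relativize m (Imp p q) = Imp (relativize m p) (relativize m q)"
| "relativize m (All p) = All (Imp (Mem 0 (Suc m)) (relativize (Suc m) p))"

text \<open>Bounded existential quantifiers are obtained from bounded universal ones by negation.\<close>

inductive Delta0 :: "fm \<Rightarrow> bool" where
  "Delta0 (Mem i j)"
| "Delta0 (Eq i j)"
| "Delta0 Fls"
| "Delta0 p \<Longrightarrow> Delta0 q \<Longrightarrow> Delta0 (Imp p q)"
| "Delta0 p \<Longrightarrow> Delta0 (All (Imp (Mem 0 (Suc i)) p))"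


section \<open>Notation for writing formulas\<close>

text \<open>
  To write formulas with ordinary bound variables, a formula is presented as a function of its
  depth \<open>n\<close>, i.e. the number of variables in scope. A variable is then named by its level: the
  variables in scope at depth \<open>n\<close> are \<open>0, \<dots>, n - 1\<close>, outermost first, and level \<open>x\<close> at
  depth \<open>n\<close> is the de Bruijn index \<open>n - Suc x\<close>. A closed formula \<open>F\<close> denotes the sentence \<open>F 0\<close>.
\<close>

type_synonym lfm = "nat \<Rightarrow> fm"

definition mem :: "nat \<Rightarrow> nat \<Rightarrow> lfm" (infix "\<^bold>\<in>" 50) where
  "(x \<^bold>\<in> y) = (\<lambda>n. Mem (n - Suc x) (n - Suc y))"

definition eq :: "nat \<Rightarrow> nat \<Rightarrow> lfm" (infix "\<^bold>=" 50) where
  "(x \<^bold>= y) = (\<lambda>n. Eq (n - Suc x) (n - Suc y))"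

definition fls :: lfm where
  "fls = (\<lambda>n. Fls)"

definition imp :: "lfm \<Rightarrow> lfm \<Rightarrow> lfm" (infixr "\<^bold>\<longrightarrow>" 25) where
  "(F \<^bold>\<longrightarrow> G) = (\<lambda>n. Imp (F n) (G n))"

definition all :: "(nat \<Rightarrow> lfm) \<Rightarrow> lfm" (binder "\<^bold>\<forall>" 10) where
  "all F = (\<lambda>n. All (F n (Suc n)))"

definition neg :: "lfm \<Rightarrow> lfm" ("\<^bold>\<not> _" [40] 40) where
  "(\<^bold>\<not> F) = (F \<^bold>\<longrightarrow> fls)"

definition conj :: "lfm \<Rightarrow> lfm \<Rightarrow> lfm" (infixr "\<^bold>\<and>" 35) where
  "(F \<^bold>\<and> G) = (\<^bold>\<not> (F \<^bold>\<longrightarrow> \<^bold>\<not> G))"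

definition disj :: "lfm \<Rightarrow> lfm \<Rightarrow> lfm" (infixr "\<^bold>\<or>" 30) where
  "(F \<^bold>\<or> G) = (\<^bold>\<not> F \<^bold>\<longrightarrow> G)"

definition iff :: "lfm \<Rightarrow> lfm \<Rightarrow> lfm" (infixr "\<^bold>\<longleftrightarrow>" 25) where
  "(F \<^bold>\<longleftrightarrow> G) = ((F \<^bold>\<longrightarrow> G) \<^bold>\<and> (G \<^bold>\<longrightarrow> F))"

definition ex :: "(nat \<Rightarrow> lfm) \<Rightarrow> lfm" (binder "\<^bold>\<exists>" 10) where
  "ex F = (\<^bold>\<not> (\<^bold>\<forall>x. \<^bold>\<not> F x))"

definition rel_to :: "nat \<Rightarrow> lfm \<Rightarrow> lfm" where
  "rel_to m F = (\<lambda>n. relativize (n - Suc m) (F n))"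

text \<open>
  \<open>at_param p x\<close> is the formula \<open>p\<close> read as \<open>p(x, parameters)\<close>: index 0 of \<open>p\<close> becomes the
  variable \<open>x\<close>, and index \<open>Suc j\<close> becomes level \<open>j\<close>, the \<open>j\<close>-th of the outermost quantified
  parameters.
\<close>

definition at_param :: "fm \<Rightarrow> nat \<Rightarrow> lfm" where
  "at_param p x = (\<lambda>n. ren (case_nat (n - Suc x) (\<lambda>j. n - Suc j)) p)"


section \<open>Templates for axioms and schemes\<close>

text \<open>
  ZFC is needed twice: as a set of sentences, and as a set of codes inside set theory (to say that
  \<open>M\<close> is a model of ZFC). Both are generated from the same list of templates, written with
  named variables \<open>v\<^sub>0, v\<^sub>1, \<dots>\<close> and a hole for the formula of a scheme.
  In the schemes, the hole is filled by a formula \<open>\<psi>\<close> that may contain any variables except the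
  auxiliary \<open>v\<^sub>3\<close> and \<open>v\<^sub>4\<close>; \<open>v\<^sub>5, v\<^sub>6, \<dots>\<close> are always available as parameters.
\<close>

datatype template = TMem nat nat | TEq nat nat | TFls | TImp template template
  | TAll nat template | THole

definition "TNeg T = TImp T TFls"
definition "TAnd T U = TNeg (TImp T (TNeg U))"
definition "TOr T U = TImp (TNeg T) U"
definition "TIff T U = TAnd (TImp T U) (TImp U T)"
definition "TEx i T = TNeg (TAll i (TNeg T))"

definition "emptyset_ax = TEx 0 (TAll 1 (TNeg (TMem 1 0)))"

definition "extensionality_ax =
  TAll 0 (TAll 1 (TImp (TAll 2 (TIff (TMem 2 0) (TMem 2 1))) (TEq 0 1)))"

definition "pair_ax =
  TAll 0 (TAll 1 (TEx 2 (TAll 3 (TIff (TMem 3 2) (TOr (TEq 3 0) (TEq 3 1))))))"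

definition "union_ax =
  TAll 0 (TEx 1 (TAll 2 (TIff (TMem 2 1) (TEx 3 (TAnd (TMem 3 0) (TMem 2 3))))))"

definition "powerset_ax =
  TAll 0 (TEx 1 (TAll 2 (TIff (TMem 2 1) (TAll 3 (TImp (TMem 3 2) (TMem 3 0))))))"

definition "foundation_ax =
  TAll 0 (TImp (TEx 1 (TMem 1 0))
    (TEx 1 (TAnd (TMem 1 0) (TNeg (TEx 2 (TAnd (TMem 2 1) (TMem 2 0)))))))"

definition "infinity_ax =
  TEx 0 (TAnd (TEx 1 (TAnd (TMem 1 0) (TAll 2 (TNeg (TMem 2 1)))))
    (TAll 1 (TImp (TMem 1 0)
      (TEx 2 (TAnd (TMem 2 0) (TAll 3 (TIff (TMem 3 2) (TOr (TMem 3 1) (TEq 3 1)))))))))"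

text \<open>Every set of nonempty pairwise disjoint sets has a transversal.\<close>

definition "choice_ax =
  TAll 0 (TImp
    (TAnd (TAll 1 (TImp (TMem 1 0) (TEx 2 (TMem 2 1))))
      (TAll 1 (TAll 2 (TImp (TAnd (TMem 1 0) (TAnd (TMem 2 0)
          (TEx 3 (TAnd (TMem 3 1) (TMem 3 2))))) (TEq 1 2)))))
    (TEx 3 (TAll 1 (TImp (TMem 1 0)
      (TEx 2 (TAll 4 (TIff (TAnd (TMem 4 3) (TMem 4 1)) (TEq 4 2))))))))"

text \<open>\<open>\<forall>v\<^sub>2 \<exists>v\<^sub>3 \<forall>v\<^sub>0 (v\<^sub>0 \<in> v\<^sub>3 \<longleftrightarrow> v\<^sub>0 \<in> v\<^sub>2 \<and> \<psi>)\<close>\<close>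

definition "separation_ax =
  TAll 2 (TEx 3 (TAll 0 (TIff (TMem 0 3) (TAnd (TMem 0 2) THole))))"

text \<open>
  \<open>\<forall>v\<^sub>2 (\<forall>v\<^sub>0 \<in> v\<^sub>2. \<exists>v\<^sub>4 \<forall>v\<^sub>1 (\<psi> \<longrightarrow> v\<^sub>1 = v\<^sub>4)) \<longrightarrow> \<exists>v\<^sub>3 \<forall>v\<^sub>1 (v\<^sub>1 \<in> v\<^sub>3 \<longleftrightarrow> \<exists>v\<^sub>0 \<in> v\<^sub>2. \<psi>)\<close>
\<close>

definition "replacement_ax =
  TAll 2 (TImp
    (TAll 0 (TImp (TMem 0 2) (TEx 4 (TAll 1 (TImp THole (TEq 1 4))))))
    (TEx 3 (TAll 1 (TIff (TMem 1 3) (TEx 0 (TAnd (TMem 0 2) THole))))))"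

definition zfc_axs :: "template list" where
  "zfc_axs = [extensionality_ax, foundation_ax, pair_ax, union_ax, powerset_ax, infinity_ax,
     choice_ax, separation_ax, replacement_ax]"

text \<open>
  Filling a template with a formula, where index \<open>i\<close> of \<open>\<psi>\<close> stands for \<open>v\<^sub>i\<close>. The environment
  \<open>e\<close> gives the de Bruijn index that currently represents each named variable; variables of the
  template may capture those of \<open>\<psi>\<close>, as intended.
\<close>

primrec fill :: "template \<Rightarrow> (nat \<Rightarrow> nat) \<Rightarrow> fm \<Rightarrow> fm" where
  "fill (TMem i j) e \<psi> = Mem (e i) (e j)"
| "fill (TEq i j) e \<psi> = Eq (e i) (e j)"
| "fill TFls e \<psi> = Fls"
| "fill (TImp T U) e \<psi> = Imp (fill T e \<psi>) (fill U e \<psi>)"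
| "fill (TAll i T) e \<psi> = All (fill T ((\<lambda>k. Suc (e k))(i := 0)) \<psi>)"
| "fill THole e \<psi> = ren e \<psi>"

definition instance_of :: "template \<Rightarrow> fm \<Rightarrow> fm" where
  "instance_of T \<psi> = univ_closure (fill T id \<psi>)"

definition ZFC :: "fm set" where
  "ZFC = {instance_of T \<psi> | T \<psi>. T \<in> set zfc_axs \<and> 3 \<notin> fv \<psi> \<and> 4 \<notin> fv \<psi>}"


section \<open>Basic set-theoretic notions as formulas\<close>

definition is_empty :: "nat \<Rightarrow> lfm" where
  "is_empty x = (\<^bold>\<forall>z. \<^bold>\<not> z \<^bold>\<in> x)"

definition is_subset :: "nat \<Rightarrow> nat \<Rightarrow> lfm" where
  "is_subset x y = (\<^bold>\<forall>z. z \<^bold>\<in> x \<^bold>\<longrightarrow> z \<^bold>\<in> y)"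

definition is_succ :: "nat \<Rightarrow> nat \<Rightarrow> lfm" where
  "is_succ y x = (\<^bold>\<forall>z. z \<^bold>\<in> y \<^bold>\<longleftrightarrow> z \<^bold>\<in> x \<^bold>\<or> z \<^bold>= x)"

definition is_union2 :: "nat \<Rightarrow> nat \<Rightarrow> nat \<Rightarrow> lfm" where
  "is_union2 u x y = (\<^bold>\<forall>z. z \<^bold>\<in> u \<^bold>\<longleftrightarrow> z \<^bold>\<in> x \<^bold>\<or> z \<^bold>\<in> y)"

definition is_upair :: "nat \<Rightarrow> nat \<Rightarrow> nat \<Rightarrow> lfm" where
  "is_upair p x y = (\<^bold>\<forall>z. z \<^bold>\<in> p \<^bold>\<longleftrightarrow> z \<^bold>= x \<^bold>\<or> z \<^bold>= y)"

definition is_pair :: "nat \<Rightarrow> nat \<Rightarrow> nat \<Rightarrow> lfm" where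
  "is_pair p x y = (\<^bold>\<exists>u v. is_upair u x x \<^bold>\<and> is_upair v x y \<^bold>\<and> is_upair p u v)"

text \<open>\<open>\<langle>x, y\<rangle> \<in> f\<close>\<close>

definition maps :: "nat \<Rightarrow> nat \<Rightarrow> nat \<Rightarrow> lfm" where
  "maps f x y = (\<^bold>\<exists>p. is_pair p x y \<^bold>\<and> p \<^bold>\<in> f)"

definition rel_on :: "nat \<Rightarrow> nat \<Rightarrow> lfm" where
  "rel_on r a = (\<^bold>\<forall>p. p \<^bold>\<in> r \<^bold>\<longrightarrow> (\<^bold>\<exists>x y. x \<^bold>\<in> a \<^bold>\<and> y \<^bold>\<in> a \<^bold>\<and> is_pair p x y))"

definition func :: "nat \<Rightarrow> nat \<Rightarrow> lfm" where
  "func f d = ((\<^bold>\<forall>p. p \<^bold>\<in> f \<^bold>\<longrightarrow> (\<^bold>\<exists>x y. x \<^bold>\<in> d \<^bold>\<and> is_pair p x y)) \<^bold>\<and>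
     (\<^bold>\<forall>x. x \<^bold>\<in> d \<^bold>\<longrightarrow> (\<^bold>\<exists>y. \<^bold>\<forall>z. maps f x z \<^bold>\<longleftrightarrow> z \<^bold>= y)))"

definition func_to :: "nat \<Rightarrow> nat \<Rightarrow> nat \<Rightarrow> lfm" where
  "func_to f d a = (func f d \<^bold>\<and> (\<^bold>\<forall>x y. maps f x y \<^bold>\<longrightarrow> y \<^bold>\<in> a))"

definition is_bij :: "nat \<Rightarrow> nat \<Rightarrow> nat \<Rightarrow> lfm" where
  "is_bij f d a = (func_to f d a \<^bold>\<and>
     (\<^bold>\<forall>x y z. maps f x z \<^bold>\<and> maps f y z \<^bold>\<longrightarrow> x \<^bold>= y) \<^bold>\<and>
     (\<^bold>\<forall>z. z \<^bold>\<in> a \<^bold>\<longrightarrow> (\<^bold>\<exists>x. maps f x z)))"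

definition is_inductive :: "nat \<Rightarrow> lfm" where
  "is_inductive w = ((\<^bold>\<exists>z. is_empty z \<^bold>\<and> z \<^bold>\<in> w) \<^bold>\<and>
     (\<^bold>\<forall>x. x \<^bold>\<in> w \<^bold>\<longrightarrow> (\<^bold>\<exists>y. is_succ y x \<^bold>\<and> y \<^bold>\<in> w)))"

definition is_omega :: "nat \<Rightarrow> lfm" where
  "is_omega w = (is_inductive w \<^bold>\<and> (\<^bold>\<forall>v. is_inductive v \<^bold>\<longrightarrow> is_subset w v))"

definition is_nat :: "nat \<Rightarrow> lfm" where
  "is_nat n = (\<^bold>\<exists>w. is_omega w \<^bold>\<and> n \<^bold>\<in> w)"

primrec is_num :: "nat \<Rightarrow> nat \<Rightarrow> lfm" where
  "is_num 0 x = is_empty x"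
| "is_num (Suc k) x = (\<^bold>\<exists>y. is_num k y \<^bold>\<and> is_succ x y)"

definition infinite_set :: "nat \<Rightarrow> lfm" where
  "infinite_set a = (\<^bold>\<not> (\<^bold>\<exists>n f. is_nat n \<^bold>\<and> is_bij f n a))"

definition transitive_set :: "nat \<Rightarrow> lfm" where
  "transitive_set m = (\<^bold>\<forall>x y. x \<^bold>\<in> m \<^bold>\<and> y \<^bold>\<in> x \<^bold>\<longrightarrow> y \<^bold>\<in> m)"

text \<open>BST has no Foundation, so well-foundedness is part of the definition of an ordinal.\<close>

definition ordinal :: "nat \<Rightarrow> lfm" where
  "ordinal a = (transitive_set a \<^bold>\<and>
     (\<^bold>\<forall>x y. x \<^bold>\<in> a \<^bold>\<and> y \<^bold>\<in> a \<^bold>\<longrightarrow> x \<^bold>\<in> y \<^bold>\<or> x \<^bold>= y \<^bold>\<or> y \<^bold>\<in> x) \<^bold>\<and>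
     (\<^bold>\<forall>z. is_subset z a \<^bold>\<and> \<^bold>\<not> is_empty z \<^bold>\<longrightarrow>
       (\<^bold>\<exists>x. x \<^bold>\<in> z \<^bold>\<and> \<^bold>\<not> (\<^bold>\<exists>y. y \<^bold>\<in> z \<^bold>\<and> y \<^bold>\<in> x))))"

definition cofinal_map :: "nat \<Rightarrow> nat \<Rightarrow> nat \<Rightarrow> lfm" where
  "cofinal_map f b a = (func_to f b a \<^bold>\<and>
     (\<^bold>\<forall>x. x \<^bold>\<in> a \<^bold>\<longrightarrow> (\<^bold>\<exists>y z. maps f y z \<^bold>\<and> (x \<^bold>\<in> z \<^bold>\<or> x \<^bold>= z))))"

definition cf_eq :: "nat \<Rightarrow> nat \<Rightarrow> lfm" where
  "cf_eq a b = (ordinal a \<^bold>\<and> ordinal b \<^bold>\<and> (\<^bold>\<exists>f. cofinal_map f b a) \<^bold>\<and>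
     \<^bold>\<not> (\<^bold>\<exists>c f. c \<^bold>\<in> b \<^bold>\<and> cofinal_map f c a))"

definition cf_omega :: "nat \<Rightarrow> lfm" where
  "cf_omega a = (\<^bold>\<exists>w. is_omega w \<^bold>\<and> cf_eq a w)"


section \<open>First-order languages and structures inside set theory\<close>

text \<open>
  A language is a triple \<open>r, g, ar\<close>: a set of relation symbols, a disjoint set of function symbols
  (constants are the nullary ones) and an arity function into \<open>\<omega>\<close>. A structure is a pair
  \<open>\<langle>A, I\<rangle>\<close> of a nonempty universe and an interpretation function. Tuples of length \<open>k\<close> are functions
  on the natural number \<open>k\<close>.
\<close>

definition is_language :: "nat \<Rightarrow> nat \<Rightarrow> nat \<Rightarrow> lfm" where
  "is_language r g ar = (\<^bold>\<not> (\<^bold>\<exists>s. s \<^bold>\<in> r \<^bold>\<and> s \<^bold>\<in> g) \<^bold>\<and>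
     (\<^bold>\<exists>d w. is_union2 d r g \<^bold>\<and> is_omega w \<^bold>\<and> func_to ar d w))"

definition is_operation :: "nat \<Rightarrow> nat \<Rightarrow> nat \<Rightarrow> lfm" where
  "is_operation h k A = (
     (\<^bold>\<forall>p. p \<^bold>\<in> h \<^bold>\<longrightarrow> (\<^bold>\<exists>t y. func_to t k A \<^bold>\<and> y \<^bold>\<in> A \<^bold>\<and> is_pair p t y)) \<^bold>\<and>
     (\<^bold>\<forall>t. func_to t k A \<^bold>\<longrightarrow> (\<^bold>\<exists>y. \<^bold>\<forall>z. maps h t z \<^bold>\<longleftrightarrow> z \<^bold>= y)))"

definition is_structure :: "nat \<Rightarrow> nat \<Rightarrow> nat \<Rightarrow> nat \<Rightarrow> nat \<Rightarrow> lfm" where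
  "is_structure r g ar A I = ((\<^bold>\<exists>a. a \<^bold>\<in> A) \<^bold>\<and> (\<^bold>\<exists>d. is_union2 d r g \<^bold>\<and> func I d) \<^bold>\<and>
     (\<^bold>\<forall>s k X. s \<^bold>\<in> r \<^bold>\<and> maps ar s k \<^bold>\<and> maps I s X \<^bold>\<longrightarrow> (\<^bold>\<forall>t. t \<^bold>\<in> X \<^bold>\<longrightarrow> func_to t k A)) \<^bold>\<and>
     (\<^bold>\<forall>f k h. f \<^bold>\<in> g \<^bold>\<and> maps ar f k \<^bold>\<and> maps I f h \<^bold>\<longrightarrow> is_operation h k A))"

text \<open>
  Codes of terms: \<open>\<langle>0, i\<rangle>\<close> for \<open>v\<^sub>i\<close> and \<open>\<langle>1, \<langle>f, t\<rangle>\<rangle>\<close> for the application of \<open>f\<close> to the tuple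
  \<open>t\<close>. Codes of formulas: \<open>\<langle>0, \<langle>t, u\<rangle>\<rangle>\<close> for \<open>t = u\<close>, \<open>\<langle>1, \<langle>R, t\<rangle>\<rangle>\<close> for \<open>R(t)\<close>,
  \<open>\<langle>2, \<emptyset>\<rangle>\<close> for falsity, \<open>\<langle>3, \<langle>\<phi>, \<psi>\<rangle>\<rangle>\<close> for \<open>\<phi> \<longrightarrow> \<psi>\<close> and \<open>\<langle>4, \<langle>i, \<phi>\<rangle>\<rangle>\<close> for \<open>\<forall>v\<^sub>i \<phi>\<close>.
\<close>

definition tag1 :: "nat \<Rightarrow> nat \<Rightarrow> nat \<Rightarrow> lfm" where
  "tag1 k x y = (\<^bold>\<exists>c. is_num k c \<^bold>\<and> is_pair x c y)"

definition tag2 :: "nat \<Rightarrow> nat \<Rightarrow> nat \<Rightarrow> nat \<Rightarrow> lfm" where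
  "tag2 k x y z = (\<^bold>\<exists>p. is_pair p y z \<^bold>\<and> tag1 k x p)"

definition "code_var x i = tag1 0 x i"
definition "code_app x f t = tag2 1 x f t"
definition "code_eq x t u = tag2 0 x t u"
definition "code_rel x R t = tag2 1 x R t"
definition "code_fls x = (\<^bold>\<exists>z. is_empty z \<^bold>\<and> tag1 2 x z)"
definition "code_imp x p q = tag2 3 x p q"
definition "code_all x i p = tag2 4 x i p"

text \<open>
  \<open>x\<close> is a term, respectively a formula, all of whose (free or bound) variables \<open>v\<^sub>i\<close> have
  \<open>i \<in> W\<close>: it is the last entry \<open>b(m)\<close> of a finite formation sequence \<open>b\<close>.
\<close>

definition is_term :: "nat \<Rightarrow> nat \<Rightarrow> nat \<Rightarrow> nat \<Rightarrow> lfm" where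
  "is_term g ar W x = (\<^bold>\<exists>m l b. is_nat m \<^bold>\<and> is_succ l m \<^bold>\<and> func b l \<^bold>\<and> maps b m x \<^bold>\<and>
     (\<^bold>\<forall>i y. maps b i y \<^bold>\<longrightarrow>
        (\<^bold>\<exists>j. j \<^bold>\<in> W \<^bold>\<and> code_var y j) \<^bold>\<or>
        (\<^bold>\<exists>f k t. f \<^bold>\<in> g \<^bold>\<and> maps ar f k \<^bold>\<and> func t k \<^bold>\<and> code_app y f t \<^bold>\<and>
           (\<^bold>\<forall>j z. maps t j z \<^bold>\<longrightarrow> (\<^bold>\<exists>i'. i' \<^bold>\<in> i \<^bold>\<and> maps b i' z)))))"

definition is_formula :: "nat \<Rightarrow> nat \<Rightarrow> nat \<Rightarrow> nat \<Rightarrow> nat \<Rightarrow> lfm" where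
  "is_formula r g ar W x = (\<^bold>\<exists>m l b. is_nat m \<^bold>\<and> is_succ l m \<^bold>\<and> func b l \<^bold>\<and> maps b m x \<^bold>\<and>
     (\<^bold>\<forall>i y. maps b i y \<^bold>\<longrightarrow>
        (\<^bold>\<exists>t u. is_term g ar W t \<^bold>\<and> is_term g ar W u \<^bold>\<and> code_eq y t u) \<^bold>\<or>
        (\<^bold>\<exists>R k t. R \<^bold>\<in> r \<^bold>\<and> maps ar R k \<^bold>\<and> func t k \<^bold>\<and> code_rel y R t \<^bold>\<and>
           (\<^bold>\<forall>j z. maps t j z \<^bold>\<longrightarrow> is_term g ar W z)) \<^bold>\<or>
        code_fls y \<^bold>\<or>
        (\<^bold>\<exists>i' j' p q. i' \<^bold>\<in> i \<^bold>\<and> j' \<^bold>\<in> i \<^bold>\<and> maps b i' p \<^bold>\<and> maps b j' q \<^bold>\<and> code_imp y p q) \<^bold>\<or>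
        (\<^bold>\<exists>j i' p. j \<^bold>\<in> W \<^bold>\<and> i' \<^bold>\<in> i \<^bold>\<and> maps b i' p \<^bold>\<and> code_all y j p)))"

text \<open>
  Satisfaction is defined for the formulas with variables among \<open>v\<^sub>0, \<dots>, v\<^sub>n\<^sub>-\<^sub>1\<close> and assignments
  \<open>s : n \<rightarrow> A\<close>. This avoids the set of all assignments \<open>\<omega> \<rightarrow> A\<close>, which need not exist without
  the power set axiom. \<open>V\<close> maps \<open>\<langle>t, s\<rangle>\<close> to the value of the term \<open>t\<close> under \<open>s\<close>, and \<open>S\<close> is
  the set of pairs \<open>\<langle>\<phi>, s\<rangle>\<close> such that \<open>s\<close> satisfies \<open>\<phi>\<close>.
\<close>

definition val :: "nat \<Rightarrow> nat \<Rightarrow> nat \<Rightarrow> nat \<Rightarrow> lfm" where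
  "val V t s y = (\<^bold>\<exists>p. is_pair p t s \<^bold>\<and> maps V p y)"

definition val_tuple :: "nat \<Rightarrow> nat \<Rightarrow> nat \<Rightarrow> nat \<Rightarrow> nat \<Rightarrow> lfm" where
  "val_tuple V k t s u = (func u k \<^bold>\<and>
     (\<^bold>\<forall>j z. maps u j z \<^bold>\<longleftrightarrow> (\<^bold>\<exists>q. maps t j q \<^bold>\<and> val V q s z)))"

definition is_evaluation :: "nat \<Rightarrow> nat \<Rightarrow> nat \<Rightarrow> nat \<Rightarrow> nat \<Rightarrow> nat \<Rightarrow> lfm" where
  "is_evaluation g ar A I n V = (\<^bold>\<forall>s. func_to s n A \<^bold>\<longrightarrow>
     (\<^bold>\<forall>x i. i \<^bold>\<in> n \<^bold>\<and> code_var x i \<^bold>\<longrightarrow> (\<^bold>\<forall>y. val V x s y \<^bold>\<longleftrightarrow> maps s i y)) \<^bold>\<and>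
     (\<^bold>\<forall>x f t k h. is_term g ar n x \<^bold>\<and> code_app x f t \<^bold>\<and> maps ar f k \<^bold>\<and> maps I f h \<^bold>\<longrightarrow>
        (\<^bold>\<forall>y. val V x s y \<^bold>\<longleftrightarrow> (\<^bold>\<exists>u. val_tuple V k t s u \<^bold>\<and> maps h u y))))"

definition is_update :: "nat \<Rightarrow> nat \<Rightarrow> nat \<Rightarrow> nat \<Rightarrow> lfm" where
  "is_update s' s i a = (\<^bold>\<forall>j y. maps s' j y \<^bold>\<longleftrightarrow>
     (j \<^bold>= i \<^bold>\<and> y \<^bold>= a) \<^bold>\<or> (\<^bold>\<not> j \<^bold>= i \<^bold>\<and> maps s j y))"

definition is_satisfaction ::
  "nat \<Rightarrow> nat \<Rightarrow> nat \<Rightarrow> nat \<Rightarrow> nat \<Rightarrow> nat \<Rightarrow> nat \<Rightarrow> lfm" where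
  "is_satisfaction r g ar A I n S = (\<^bold>\<exists>V. is_evaluation g ar A I n V \<^bold>\<and>
     (\<^bold>\<forall>x s. is_formula r g ar n x \<^bold>\<and> func_to s n A \<^bold>\<longrightarrow>
       (\<^bold>\<forall>t u. code_eq x t u \<^bold>\<longrightarrow>
          (maps S x s \<^bold>\<longleftrightarrow> (\<^bold>\<exists>y. val V t s y \<^bold>\<and> val V u s y))) \<^bold>\<and>
       (\<^bold>\<forall>R t k X. code_rel x R t \<^bold>\<and> maps ar R k \<^bold>\<and> maps I R X \<^bold>\<longrightarrow>
          (maps S x s \<^bold>\<longleftrightarrow> (\<^bold>\<exists>u. val_tuple V k t s u \<^bold>\<and> u \<^bold>\<in> X))) \<^bold>\<and>
       (code_fls x \<^bold>\<longrightarrow> \<^bold>\<not> maps S x s) \<^bold>\<and>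
       (\<^bold>\<forall>p q. code_imp x p q \<^bold>\<longrightarrow>
          (maps S x s \<^bold>\<longleftrightarrow> (maps S p s \<^bold>\<longrightarrow> maps S q s))) \<^bold>\<and>
       (\<^bold>\<forall>i p. code_all x i p \<^bold>\<longrightarrow>
          (maps S x s \<^bold>\<longleftrightarrow> (\<^bold>\<forall>a s'. a \<^bold>\<in> A \<^bold>\<and> func_to s' n A \<^bold>\<and> is_update s' s i a \<^bold>\<longrightarrow> maps S p s')))))"

definition is_comp :: "nat \<Rightarrow> nat \<Rightarrow> nat \<Rightarrow> nat \<Rightarrow> lfm" where
  "is_comp s' j s n = (func s' n \<^bold>\<and>
     (\<^bold>\<forall>i y. maps s' i y \<^bold>\<longleftrightarrow> (\<^bold>\<exists>z. maps s i z \<^bold>\<and> maps j z y)))"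

definition elem_embedding :: "nat \<Rightarrow> nat \<Rightarrow> nat \<Rightarrow> nat \<Rightarrow> nat \<Rightarrow> nat \<Rightarrow> lfm" where
  "elem_embedding r g ar j x y = (\<^bold>\<exists>A I B J. is_pair x A I \<^bold>\<and> is_pair y B J \<^bold>\<and> func_to j A B \<^bold>\<and>
     (\<^bold>\<forall>n. is_nat n \<^bold>\<longrightarrow> (\<^bold>\<exists>S S'. is_satisfaction r g ar A I n S \<^bold>\<and> is_satisfaction r g ar B J n S' \<^bold>\<and>
        (\<^bold>\<forall>p s s'. is_formula r g ar n p \<^bold>\<and> func_to s n A \<^bold>\<and> is_comp s' j s n \<^bold>\<longrightarrow>
           (maps S p s \<^bold>\<longleftrightarrow> maps S' p s')))))"


section \<open>Transitive models of ZFC\<close>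

text \<open>The language of set theory has the single binary relation symbol \<open>\<emptyset>\<close>.\<close>

definition is_eps_language :: "nat \<Rightarrow> nat \<Rightarrow> nat \<Rightarrow> lfm" where
  "is_eps_language r g ar = (\<^bold>\<exists>z two p. is_num 0 z \<^bold>\<and> is_num 2 two \<^bold>\<and> is_upair r z z \<^bold>\<and>
     is_empty g \<^bold>\<and> is_pair p z two \<^bold>\<and> is_upair ar p p)"

definition is_pair_tuple :: "nat \<Rightarrow> nat \<Rightarrow> nat \<Rightarrow> lfm" where
  "is_pair_tuple t x y = (\<^bold>\<exists>zero one two. is_num 0 zero \<^bold>\<and> is_num 1 one \<^bold>\<and> is_num 2 two \<^bold>\<and>
     func t two \<^bold>\<and> maps t zero x \<^bold>\<and> maps t one y)"

definition is_eps_interpretation :: "nat \<Rightarrow> nat \<Rightarrow> lfm" where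
  "is_eps_interpretation I M = (\<^bold>\<exists>z E p. is_num 0 z \<^bold>\<and> is_pair p z E \<^bold>\<and> is_upair I p p \<^bold>\<and>
     (\<^bold>\<forall>t. t \<^bold>\<in> E \<^bold>\<longleftrightarrow> (\<^bold>\<exists>x y. x \<^bold>\<in> M \<^bold>\<and> y \<^bold>\<in> M \<^bold>\<and> x \<^bold>\<in> y \<^bold>\<and> is_pair_tuple t x y)))"

definition code_vnum :: "nat \<Rightarrow> nat \<Rightarrow> lfm" where
  "code_vnum x i = (\<^bold>\<exists>k. is_num i k \<^bold>\<and> code_var x k)"

text \<open>\<open>x\<close> is the code of the template whose hole is filled with the code \<open>h\<close>.\<close>

primrec code_template :: "template \<Rightarrow> nat \<Rightarrow> nat \<Rightarrow> lfm" where
  "code_template (TMem i j) h x = (\<^bold>\<exists>z t u v. is_num 0 z \<^bold>\<and> code_vnum u i \<^bold>\<and> code_vnum v j \<^bold>\<and>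
     is_pair_tuple t u v \<^bold>\<and> code_rel x z t)"
| "code_template (TEq i j) h x = (\<^bold>\<exists>u v. code_vnum u i \<^bold>\<and> code_vnum v j \<^bold>\<and> code_eq x u v)"
| "code_template TFls h x = code_fls x"
| "code_template (TImp T U) h x =
     (\<^bold>\<exists>p q. code_template T h p \<^bold>\<and> code_template U h q \<^bold>\<and> code_imp x p q)"
| "code_template (TAll i T) h x =
     (\<^bold>\<exists>k p. is_num i k \<^bold>\<and> code_template T h p \<^bold>\<and> code_all x k p)"
| "code_template THole h x = (x \<^bold>= h)"

text \<open>
  The codes of axioms of ZFC. Instances of the schemes are left open here; in
  \<open>is_model\<close> they are required to hold under all assignments.
\<close>

definition is_zfc_axiom :: "nat \<Rightarrow> nat \<Rightarrow> nat \<Rightarrow> nat \<Rightarrow> lfm" where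
  "is_zfc_axiom r g ar x = (\<^bold>\<exists>W h.
     (\<^bold>\<forall>k. k \<^bold>\<in> W \<^bold>\<longleftrightarrow> is_nat k \<^bold>\<and> \<^bold>\<not> is_num 3 k \<^bold>\<and> \<^bold>\<not> is_num 4 k) \<^bold>\<and>
     is_formula r g ar W h \<^bold>\<and>
     foldr (\<lambda>T F. code_template T h x \<^bold>\<or> F) zfc_axs fls)"

definition is_model :: "nat \<Rightarrow> lfm" where
  "is_model M = (transitive_set M \<^bold>\<and>
     (\<^bold>\<exists>r g ar I. is_eps_language r g ar \<^bold>\<and> is_eps_interpretation I M \<^bold>\<and>
        is_structure r g ar M I \<^bold>\<and>
        (\<^bold>\<forall>n. is_nat n \<^bold>\<longrightarrow> (\<^bold>\<exists>S. is_satisfaction r g ar M I n S \<^bold>\<and>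
           (\<^bold>\<forall>x s. is_zfc_axiom r g ar x \<^bold>\<and> is_formula r g ar n x \<^bold>\<and> func_to s n M \<^bold>\<longrightarrow> maps S x s)))))"

definition is_special_model :: "nat \<Rightarrow> lfm" where
  "is_special_model M = (is_model M \<^bold>\<and>
     (\<^bold>\<forall>a. a \<^bold>\<in> M \<^bold>\<and> ordinal a \<^bold>\<longrightarrow> (rel_to M (cf_omega a) \<^bold>\<longleftrightarrow> cf_omega a)))"


section \<open>The theories\<close>

definition cartesian_product_ax :: fm where
  "cartesian_product_ax = (\<^bold>\<forall>a b. \<^bold>\<exists>c. \<^bold>\<forall>p. p \<^bold>\<in> c \<^bold>\<longleftrightarrow>
     (\<^bold>\<exists>x y. x \<^bold>\<in> a \<^bold>\<and> y \<^bold>\<in> b \<^bold>\<and> is_pair p x y)) 0"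

definition omega_exists_ax :: fm where
  "omega_exists_ax = (\<^bold>\<exists>w. is_omega w) 0"

definition BST :: "fm set" where
  "BST = {instance_of T Fls | T. T \<in> {emptyset_ax, extensionality_ax, pair_ax, union_ax}} \<union>
     {cartesian_product_ax, omega_exists_ax} \<union>
     {instance_of separation_ax \<psi> | \<psi>. Delta0 \<psi> \<and> 3 \<notin> fv \<psi> \<and> 4 \<notin> fv \<psi>}"

definition Loc_ZFC :: fm where
  "Loc_ZFC = (\<^bold>\<forall>x. \<^bold>\<exists>M. is_model M \<^bold>\<and> x \<^bold>\<in> M) 0"

definition Loc_spec_ZFC :: fm where
  "Loc_spec_ZFC = (\<^bold>\<forall>x. \<^bold>\<exists>M. is_special_model M \<^bold>\<and> x \<^bold>\<in> M) 0"

definition LZFC :: "fm set" where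
  "LZFC = BST \<union> {Loc_ZFC}"

definition LZFC_spec :: "fm set" where
  "LZFC_spec = LZFC \<union> {Loc_spec_ZFC}"

definition rigid :: "nat \<Rightarrow> nat \<Rightarrow> lfm" where
  "rigid A R = (\<^bold>\<forall>f. func_to f A A \<^bold>\<and>
     (\<^bold>\<forall>x y. maps R x y \<^bold>\<longrightarrow> (\<^bold>\<exists>u v. maps f x u \<^bold>\<and> maps f y v \<^bold>\<and> maps R u v)) \<^bold>\<longrightarrow>
     (\<^bold>\<forall>x. x \<^bold>\<in> A \<^bold>\<longrightarrow> maps f x x))"

definition VPH :: fm where
  "VPH = (\<^bold>\<forall>A. infinite_set A \<^bold>\<longrightarrow> (\<^bold>\<exists>R. rel_on R A \<^bold>\<and> rigid A R)) 0"

text \<open>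
  The instance of Vopenka's principle for the class \<open>X = {x. \<phi>(x)}\<close>. That \<open>X\<close> is a proper class
  means that no set has exactly the elements of \<open>X\<close>; in the absence of full Separation this is
  weaker than \<open>X\<close> not being included in a set.
\<close>

definition vopenka_instance :: "fm \<Rightarrow> lfm" where
  "vopenka_instance \<phi> = (\<^bold>\<forall>r g ar.
     is_language r g ar \<^bold>\<and>
     (\<^bold>\<forall>x. at_param \<phi> x \<^bold>\<longrightarrow> (\<^bold>\<exists>A I. is_pair x A I \<^bold>\<and> is_structure r g ar A I)) \<^bold>\<and>
     \<^bold>\<not> (\<^bold>\<exists>X. \<^bold>\<forall>x. x \<^bold>\<in> X \<^bold>\<longleftrightarrow> at_param \<phi> x) \<^bold>\<longrightarrow>
     (\<^bold>\<exists>x y j. at_param \<phi> x \<^bold>\<and> at_param \<phi> y \<^bold>\<and> \<^bold>\<not> x \<^bold>= y \<^bold>\<and> elem_embedding r g ar j x y))"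

text \<open>The \<open>k\<close> parameters are the levels \<open>0, \<dots>, k - 1\<close>, so the body is taken at depth \<open>k\<close>.\<close>

definition VP :: "fm set" where
  "VP = {(All ^^ k) (vopenka_instance \<phi> k) | \<phi> k. fv \<phi> \<subseteq> {..k}}"

end

theory Submission
  imports Defs "HOL-Library.Countable" "HOL-Library.Infinite_Set"
begin

text \<open>
  By the completeness theorem it is enough to argue inside a model \<open>(V, E)\<close> of the theory.

  Rigid graphs: given an infinite set, a special model \<open>M\<close> containing it well-orders it, and a rigid
  relation is defined on an ordinal \<open>X\<close> of the same size. The successors are tied together by edges
  from \<open>x\<close> to \<open>x + 1\<close>, and every ordinal of cofinality \<open>\<omega>\<close> receives edges from a ladder below it
  whose rungs have increasing finite parts. If an endomorphism moved a point, its iterates at the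
  least such point would increase to an ordinal of cofinality \<open>\<omega>\<close>. The endomorphism need not belong
  to \<open>M\<close>, but it lies in another model; hence the supremum has cofinality \<open>\<omega>\<close> in \<open>V\<close>, and, because
  \<open>M\<close> is special, in \<open>M\<close>. So it carries a ladder, which the endomorphism cannot respect.

  ZFC: a functional class indexed by subsets \<open>u\<close> of a set \<open>A\<close> is turned into a class of structures
  on \<open>A\<close> with a rigid relation and a predicate for \<open>u\<close>. There is no embedding between two different
  ones, so by Vopenka's principle the class is a set. This gives Separation, Power set and
  Replacement; Foundation and Choice are inherited from the models.
\<close>

section \<open>Completeness of the deductive system\<close>

text \<open>Constructions therefore take place in transitive models of ZFC containing the finitely
  many sets concerned (\<open>model_of\<close>), and only facts that are absolute for transitive
  sets are carried back; cofinality is not absolute, hence the special models. A second obstacle is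
  that \<omega> of \<open>(V, E)\<close> may be nonstandard, and then internal formulas need not
  correspond to real ones. Truth in an internal model is analysed only for standard formulas, by
  induction outside \<open>(V, E)\<close>; this covers each instance of a ZFC scheme that the
  argument applies. For the second claim, rigidity is required because the embedding given by
  Vopenka's principle may be nontrivial: the rigid relation turns it into the identity on
  \<open>A\<close>. Properness of a class means that no set has exactly its members, so a class on
  which the principle would fail is at once a set; in this way instances of Separation arise
  although no Separation for arbitrary formulas is at hand.\<close>

lemma ren_cong: "(\<And>i. i \<in> fv p \<Longrightarrow> f i = g i) \<Longrightarrow> ren f p = ren g p"
proof (induction p arbitrary: f g)
  case (Imp p q)
  have "ren f p = ren g p" by (rule Imp.IH) (simp add: Imp.prems)
  moreover have "ren f q = ren g q" by (rule Imp.IH) (simp add: Imp.prems)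
  ultimately show ?case by simp
next
  case (All p)
  have "ren (case_nat 0 (\<lambda>i. Suc (f i))) p = ren (case_nat 0 (\<lambda>i. Suc (g i))) p"
    by (rule All.IH) (use All.prems in \<open>auto split: nat.split\<close>)
  then show ?case by simp
qed simp_all

lemma case_nat_comp: "case_nat a e \<circ> case_nat 0 (\<lambda>i. Suc (f i)) = case_nat a (e \<circ> f)"
  by (rule ext) (simp split: nat.split)

lemma case_nat_Suc: "case_nat 0 (\<lambda>i. Suc i) = (\<lambda>i. i)"
  by (rule ext) (simp split: nat.split)

lemma ren_ren: "ren f (ren g p) = ren (f \<circ> g) p"
proof (induction p arbitrary: f g)
  case (All p)
  show ?case unfolding ren.simps All.IH case_nat_comp by (simp add: comp_def)
qed auto

lemma ren_id: "ren (\<lambda>i. i) p = p"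
proof (induction p)
  case (All p)
  then show ?case unfolding ren.simps case_nat_Suc by simp
qed simp_all

lemma ren_ident: "(\<And>i. i \<in> fv p \<Longrightarrow> f i = i) \<Longrightarrow> ren f p = p"
  using ren_cong[of p f "\<lambda>i. i"] by (simp add: ren_id)

lemma fv_ren: "fv (ren f p) = f ` fv p"
proof (induction p arbitrary: f)
  case (All p)
  show ?case
  proof (rule set_eqI)
    fix i
    have "Suc i \<in> case_nat 0 (\<lambda>i. Suc (f i)) ` fv p \<longleftrightarrow> (\<exists>j. Suc j \<in> fv p \<and> i = f j)"
    proof
      assume "Suc i \<in> case_nat 0 (\<lambda>i. Suc (f i)) ` fv p"
      then obtain k where "k \<in> fv p" "Suc i = case_nat 0 (\<lambda>i. Suc (f i)) k" by blast
      then show "\<exists>j. Suc j \<in> fv p \<and> i = f j" by (cases k) auto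
    qed force
    then show "i \<in> fv (ren f (All p)) \<longleftrightarrow> i \<in> f ` fv (All p)"
      by (auto simp: All.IH)
  qed
qed auto

lemma finite_fv [simp]: "finite (fv p)"
proof (induction p)
  case (All p)
  have "{i. Suc i \<in> fv p} = Suc -` fv p" by auto
  with All show ?case by (simp add: finite_vimageI)
qed auto

lemma ren_inst: "ren f (inst p y) = inst (ren (case_nat 0 (\<lambda>i. Suc (f i))) p) (f y)"
  unfolding inst_def ren_ren
  by (rule ren_cong) (auto split: nat.split)

lemma weaken: "\<Gamma> \<turnstile> p \<Longrightarrow> \<Gamma> \<subseteq> \<Delta> \<Longrightarrow> \<Delta> \<turnstile> p"
proof (induction arbitrary: \<Delta> rule: proves.induct)
  case (ImpI p \<Gamma> q)
  have "insert p \<Delta> \<turnstile> q" using ImpI by (intro ImpI.IH) auto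
  then show ?case by (rule proves.ImpI)
next
  case (RAA p \<Gamma>)
  have "insert (Imp p Fls) \<Delta> \<turnstile> Fls" using RAA by (intro RAA.IH) auto
  then show ?case by (rule proves.RAA)
next
  case (AllI \<Gamma> p)
  have "ren Suc ` \<Delta> \<turnstile> p" using AllI by (intro AllI.IH) auto
  then show ?case by (rule proves.AllI)
qed (blast intro: proves.intros)+

lemma proves_ren: "\<Gamma> \<turnstile> p \<Longrightarrow> ren f ` \<Gamma> \<turnstile> ren f p"
proof (induction arbitrary: f rule: proves.induct)
  case (AllI \<Gamma> p)
  let ?f = "case_nat 0 (\<lambda>i. Suc (f i))"
  have "ren ?f ` ren Suc ` \<Gamma> = ren Suc ` ren f ` \<Gamma>"
    unfolding image_image ren_ren by (rule image_cong) (auto intro!: ren_cong)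
  then show ?case using AllI.IH[of ?f] by (simp add: proves.AllI)
next
  case (AllE \<Gamma> p y)
  then show ?case by (simp add: ren_inst proves.AllE)
next
  case (EqSubst \<Gamma> x y p)
  then show ?case by (auto simp: ren_inst intro: proves.EqSubst)
next
  case (RAA p \<Gamma>)
  from RAA.IH[of f] show ?case by (auto intro: proves.RAA)
next
  case (ImpI p \<Gamma> q)
  from ImpI.IH[of f] show ?case by (auto intro: proves.ImpI)
next
  case (ImpE \<Gamma> p q)
  from ImpE.IH[of f] show ?case by (auto intro: proves.ImpE)
qed (auto intro: proves.intros)

lemma compactness: "\<Gamma> \<turnstile> p \<Longrightarrow> \<exists>F. finite F \<and> F \<subseteq> \<Gamma> \<and> F \<turnstile> p"
proof (induction rule: proves.induct)
  case (Asm p \<Gamma>)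
  then show ?case by (intro exI[of _ "{p}"]) (auto intro: proves.Asm)
next
  case (ImpI p \<Gamma> q)
  then obtain F where F: "finite F" "F \<subseteq> insert p \<Gamma>" "F \<turnstile> q" by blast
  then have "insert p (F - {p}) \<turnstile> q" by (auto intro: weaken)
  then have "F - {p} \<turnstile> Imp p q" by (rule proves.ImpI)
  then show ?case using F by (intro exI[of _ "F - {p}"]) auto
next
  case (ImpE \<Gamma> p q)
  then obtain F G where "finite F" "F \<subseteq> \<Gamma>" "F \<turnstile> Imp p q" "finite G" "G \<subseteq> \<Gamma>" "G \<turnstile> p" by blast
  then show ?case
    by (intro exI[of _ "F \<union> G"]) (auto intro: weaken proves.ImpE)
next
  case (RAA p \<Gamma>)
  then obtain F where F: "finite F" "F \<subseteq> insert (Imp p Fls) \<Gamma>" "F \<turnstile> Fls" by blast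
  then have "insert (Imp p Fls) (F - {Imp p Fls}) \<turnstile> Fls" by (auto intro: weaken)
  then have "F - {Imp p Fls} \<turnstile> p" by (rule proves.RAA)
  then show ?case using F by (intro exI[of _ "F - {Imp p Fls}"]) auto
next
  case (AllI \<Gamma> p)
  then obtain F where "finite F" "F \<subseteq> ren Suc ` \<Gamma>" "F \<turnstile> p" by blast
  then obtain G where "G \<subseteq> \<Gamma>" "finite G" "F = ren Suc ` G"
    by (meson finite_subset_image)
  then show ?case using \<open>F \<turnstile> p\<close> by (intro exI[of _ G]) (auto intro: proves.AllI)
next
  case (EqSubst \<Gamma> x y p)
  then obtain F G where "finite F" "F \<subseteq> \<Gamma>" "F \<turnstile> Eq x y" "finite G" "G \<subseteq> \<Gamma>" "G \<turnstile> inst p x" by blast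
  then show ?case
    by (intro exI[of _ "F \<union> G"]) (auto intro: weaken proves.EqSubst)
qed (blast intro: proves.intros)+

text \<open>At the end this reduces the inclusion of theories to the axioms of ZFC. In the case of
  \<open>AllI\<close> the context is shifted, and the derivations of its members are shifted along
  by \<open>proves_ren\<close>.\<close>

lemma cut_all: "\<Gamma> \<turnstile> p \<Longrightarrow> (\<And>q. q \<in> \<Gamma> \<Longrightarrow> \<Delta> \<turnstile> q) \<Longrightarrow> \<Delta> \<turnstile> p"
proof (induction arbitrary: \<Delta> rule: proves.induct)
  case (ImpI p \<Gamma> q)
  have "insert p \<Delta> \<turnstile> q"
    using ImpI.prems by (intro ImpI.IH) (auto intro: weaken proves.Asm)
  then show ?case by (rule proves.ImpI)
next
  case (RAA p \<Gamma>)
  have "insert (Imp p Fls) \<Delta> \<turnstile> Fls"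
    using RAA.prems by (intro RAA.IH) (auto intro: weaken proves.Asm)
  then show ?case by (rule proves.RAA)
next
  case (AllI \<Gamma> p)
  have "ren Suc ` \<Delta> \<turnstile> p"
    using AllI.prems by (intro AllI.IH) (auto intro: proves_ren)
  then show ?case by (rule proves.AllI)
next
  case (ImpE \<Gamma> p q)
  then show ?case by (meson proves.ImpE)
next
  case (EqSubst \<Gamma> x y p)
  then show ?case by (meson proves.EqSubst)
qed (auto intro: proves.intros)

section \<open>Henkin's construction\<close>

definition consistent :: "fm set \<Rightarrow> bool" where
  "consistent \<Gamma> \<longleftrightarrow> \<not> \<Gamma> \<turnstile> Fls"

lemma consistent_insert_cases:
  assumes "consistent \<Gamma>"
  shows "consistent (insert p \<Gamma>) \<or> consistent (insert (Imp p Fls) \<Gamma>)"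
  using assms unfolding consistent_def by (meson ImpE ImpI RAA)

text \<open>A fresh \<open>y\<close> can play the generalised variable: the renaming
  \<open>?f\<close> sends \<open>y\<close> to 0 and every other variable up by one. It acts as
  \<open>Suc\<close> on the context and turns \<open>inst p y\<close> back into \<open>p\<close>, so
  a derivation of \<open>inst p y\<close> becomes one of \<open>All p\<close>.\<close>

lemma consistent_witness:
  assumes c: "consistent (insert (Imp (All p) Fls) \<Gamma>)"
    and fresh: "\<And>q. q \<in> \<Gamma> \<Longrightarrow> y \<notin> fv q" "y \<notin> fv (All p)"
  shows "consistent (insert (Imp (inst p y) Fls) (insert (Imp (All p) Fls) \<Gamma>))"
  unfolding consistent_def
proof
  let ?\<Gamma> = "insert (Imp (All p) Fls) \<Gamma>"
  let ?f = "\<lambda>i. if i = y then 0 else Suc i"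
  assume "insert (Imp (inst p y) Fls) ?\<Gamma> \<turnstile> Fls"
  then have "?\<Gamma> \<turnstile> inst p y" by (rule RAA)
  then have "ren ?f ` ?\<Gamma> \<turnstile> ren ?f (inst p y)" by (rule proves_ren)
  moreover have "ren ?f q = ren Suc q" if "q \<in> ?\<Gamma>" for q
  proof (rule ren_cong)
    fix i assume "i \<in> fv q"
    with that fresh show "?f i = Suc i" by auto
  qed
  then have "ren ?f ` ?\<Gamma> = ren Suc ` ?\<Gamma>" by (rule image_cong[OF refl])
  moreover have "ren ?f (inst p y) = p"
    unfolding inst_def ren_ren using fresh(2) by (intro ren_ident) (auto split: nat.split)
  ultimately have "ren Suc ` ?\<Gamma> \<turnstile> p" by metis
  then have "?\<Gamma> \<turnstile> All p" by (rule AllI)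
  then have "?\<Gamma> \<turnstile> Fls" by (meson Asm ImpE insertI1)
  with c show False by (simp add: consistent_def)
qed

instance fm :: countable
  by countable_datatype

definition fresh :: "fm set \<Rightarrow> nat" where
  "fresh \<Gamma> = (SOME y. \<forall>q\<in>\<Gamma>. y \<notin> fv q)"

text \<open>A negated universal formula enters together with a counterexample named by a fresh
  variable; the set over \<open>q\<close> has at most one element.\<close>

definition add_fm :: "fm set \<Rightarrow> fm \<Rightarrow> fm set" where
  "add_fm \<Gamma> p = (if consistent (insert p \<Gamma>) then
     insert p (\<Gamma> \<union> {Imp (inst q (fresh (insert p \<Gamma>))) Fls | q. p = Imp (All q) Fls}) else \<Gamma>)"

primrec henkin :: "fm set \<Rightarrow> nat \<Rightarrow> fm set" where
  "henkin \<Gamma> 0 = \<Gamma>"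
| "henkin \<Gamma> (Suc n) = add_fm (henkin \<Gamma> n) (from_nat n)"

definition Henkin :: "fm set \<Rightarrow> fm set" where
  "Henkin \<Gamma> = (\<Union>n. henkin \<Gamma> n)"

context
  fixes \<Gamma> :: "fm set"
  assumes cons: "consistent \<Gamma>" and odd: "\<And>p i. p \<in> \<Gamma> \<Longrightarrow> i \<in> fv p \<Longrightarrow> odd i"
begin

lemma add_fm_finite: "finite (add_fm \<Delta> p - \<Delta>)"
proof (rule finite_subset)
  show "add_fm \<Delta> p - \<Delta> \<subseteq> insert p ((\<lambda>q. Imp (inst q (fresh (insert p \<Delta>))) Fls) ` {q. p = Imp (All q) Fls})"
    by (auto simp: add_fm_def split: if_splits)
  have "finite {q. p = Imp (All q) Fls}"
    by (rule finite_subset[of _ "{case p of Imp (All q) _ \<Rightarrow> q | _ \<Rightarrow> p}"]) auto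
  then show "finite (insert p ((\<lambda>q. Imp (inst q (fresh (insert p \<Delta>))) Fls) ` {q. p = Imp (All q) Fls}))"
    by simp
qed

lemma henkin_finite: "finite (henkin \<Gamma> n - \<Gamma>)"
proof (induction n)
  case (Suc n)
  have "henkin \<Gamma> (Suc n) - \<Gamma> \<subseteq> (henkin \<Gamma> n - \<Gamma>) \<union> (add_fm (henkin \<Gamma> n) (from_nat n) - henkin \<Gamma> n)"
    by auto
  then show ?case using Suc add_fm_finite finite_subset by blast
qed simp

text \<open>Each stage adds only finitely many formulas to \<open>\<Gamma>\<close>, whose own
  variables are odd. An even number \<open>2 * k\<close> beyond the variables of \<open>p\<close>
  and of the added formulas is therefore fresh, even if \<open>\<Gamma>\<close> uses infinitely many
  variables.\<close>

lemma fresh_henkin: "\<forall>q\<in>insert p (henkin \<Gamma> n). fresh (insert p (henkin \<Gamma> n)) \<notin> fv q"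
proof -
  let ?F = "\<Union>q\<in>insert p (henkin \<Gamma> n - \<Gamma>). fv q"
  have "finite ?F" using henkin_finite by auto
  then obtain k where k: "\<And>i. i \<in> ?F \<Longrightarrow> i < k" using finite_nat_set_iff_bounded by metis
  have "\<forall>q\<in>insert p (henkin \<Gamma> n). 2 * k \<notin> fv q"
  proof
    fix q assume q: "q \<in> insert p (henkin \<Gamma> n)"
    show "2 * k \<notin> fv q"
    proof (cases "q \<in> insert p (henkin \<Gamma> n - \<Gamma>)")
      case True
      then show ?thesis using k[of "2 * k"] by fastforce
    next
      case False
      then show ?thesis using q odd[of q "2 * k"] by auto
    qed
  qed
  then show ?thesis unfolding fresh_def by (rule someI)
qed

lemma henkin_consistent: "consistent (henkin \<Gamma> n)"
proof (induction n)
  case 0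
  then show ?case using cons by simp
next
  case (Suc n)
  let ?p = "from_nat n :: fm" and ?H = "henkin \<Gamma> n"
  show ?case
  proof (cases "consistent (insert ?p ?H)")
    case True
    show ?thesis
    proof (cases "\<exists>q. ?p = Imp (All q) Fls")
      case True
      then obtain q where q: "?p = Imp (All q) Fls" by blast
      define y where "y = fresh (insert ?p ?H)"
      have "consistent (insert (Imp (inst q y) Fls) (insert (Imp (All q) Fls) ?H))"
        using \<open>consistent (insert ?p ?H)\<close> fresh_henkin[of ?p n] unfolding q y_def
        by (intro consistent_witness) auto
      moreover have "henkin \<Gamma> (Suc n) = insert (Imp (inst q y) Fls) (insert (Imp (All q) Fls) ?H)"
        using \<open>consistent (insert ?p ?H)\<close> unfolding y_def by (auto simp: add_fm_def q)
      ultimately show ?thesis by simp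
    next
      case False
      then show ?thesis using \<open>consistent (insert ?p ?H)\<close> by (simp add: add_fm_def)
    qed
  next
    case False
    then show ?thesis using Suc by (simp add: add_fm_def)
  qed
qed

lemma henkin_mono: "m \<le> n \<Longrightarrow> henkin \<Gamma> m \<subseteq> henkin \<Gamma> n"
  by (rule lift_Suc_mono_le[of "henkin \<Gamma>"]) (auto simp: add_fm_def)

lemma Henkin_finite_subset:
  assumes "finite F" "F \<subseteq> Henkin \<Gamma>"
  shows "\<exists>n. F \<subseteq> henkin \<Gamma> n"
  using assms
proof (induction F)
  case (insert p F)
  then obtain m n where "F \<subseteq> henkin \<Gamma> m" "p \<in> henkin \<Gamma> n" by (auto simp: Henkin_def)
  then have "insert p F \<subseteq> henkin \<Gamma> (max m n)"
    using henkin_mono[of m "max m n"] henkin_mono[of n "max m n"] by auto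
  then show ?case by blast
qed simp

lemma Henkin_consistent: "consistent (Henkin \<Gamma>)"
  unfolding consistent_def
proof
  assume "Henkin \<Gamma> \<turnstile> Fls"
  then obtain F where "finite F" "F \<subseteq> Henkin \<Gamma>" "F \<turnstile> Fls" using compactness by blast
  obtain n where "F \<subseteq> henkin \<Gamma> n" using Henkin_finite_subset[OF \<open>finite F\<close> \<open>F \<subseteq> Henkin \<Gamma>\<close>] by blast
  with \<open>F \<turnstile> Fls\<close> have "henkin \<Gamma> n \<turnstile> Fls" by (rule weaken)
  then show False using henkin_consistent by (simp add: consistent_def)
qed

text \<open>\<open>p\<close> is treated at stage \<open>to_nat p\<close>, and a formula consistent
  with the limit is consistent with every stage.\<close>

lemma Henkin_maximal:
  assumes "consistent (insert p (Henkin \<Gamma>))"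
  shows "p \<in> Henkin \<Gamma>"
proof -
  have "consistent (insert p (henkin \<Gamma> (to_nat p)))"
    unfolding consistent_def
  proof
    assume "insert p (henkin \<Gamma> (to_nat p)) \<turnstile> Fls"
    then have "insert p (Henkin \<Gamma>) \<turnstile> Fls" by (rule weaken) (auto simp: Henkin_def)
    with assms show False by (simp add: consistent_def)
  qed
  then have "p \<in> henkin \<Gamma> (Suc (to_nat p))" by (simp add: add_fm_def)
  then show ?thesis unfolding Henkin_def by blast
qed

lemma Henkin_closed: "Henkin \<Gamma> \<turnstile> p \<Longrightarrow> p \<in> Henkin \<Gamma>"
  using Henkin_consistent Henkin_maximal unfolding consistent_def by (meson ImpE ImpI)

lemma Henkin_Fls: "Fls \<notin> Henkin \<Gamma>"
  using Henkin_consistent unfolding consistent_def by (meson Asm)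

lemma Henkin_neg: "Imp p Fls \<in> Henkin \<Gamma> \<longleftrightarrow> p \<notin> Henkin \<Gamma>"
proof
  assume "Imp p Fls \<in> Henkin \<Gamma>"
  then show "p \<notin> Henkin \<Gamma>" using Henkin_closed Henkin_Fls by (meson Asm ImpE)
next
  assume "p \<notin> Henkin \<Gamma>"
  then show "Imp p Fls \<in> Henkin \<Gamma>"
    using consistent_insert_cases Henkin_consistent Henkin_maximal by blast
qed

lemma Henkin_Imp: "Imp p q \<in> Henkin \<Gamma> \<longleftrightarrow> (p \<in> Henkin \<Gamma> \<longrightarrow> q \<in> Henkin \<Gamma>)"
proof
  assume "Imp p q \<in> Henkin \<Gamma>"
  then show "p \<in> Henkin \<Gamma> \<longrightarrow> q \<in> Henkin \<Gamma>" using Henkin_closed by (meson Asm ImpE)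
next
  assume *: "p \<in> Henkin \<Gamma> \<longrightarrow> q \<in> Henkin \<Gamma>"
  show "Imp p q \<in> Henkin \<Gamma>"
  proof (cases "q \<in> Henkin \<Gamma>")
    case True
    then show ?thesis by (intro Henkin_closed ImpI) (auto intro: Asm)
  next
    case False
    then have "Imp p Fls \<in> Henkin \<Gamma>" using * by (simp add: Henkin_neg)
    then have "insert p (Henkin \<Gamma>) \<turnstile> Fls" by (meson Asm ImpE insertCI)
    then have "insert p (Henkin \<Gamma>) \<turnstile> q" by (meson RAA subset_insertI weaken)
    then show ?thesis by (intro Henkin_closed ImpI)
  qed
qed

lemma Henkin_All: "All p \<in> Henkin \<Gamma> \<longleftrightarrow> (\<forall>y. inst p y \<in> Henkin \<Gamma>)"
proof
  assume "All p \<in> Henkin \<Gamma>"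
  then show "\<forall>y. inst p y \<in> Henkin \<Gamma>" by (meson AllE Asm Henkin_closed)
next
  assume *: "\<forall>y. inst p y \<in> Henkin \<Gamma>"
  show "All p \<in> Henkin \<Gamma>"
  proof (rule ccontr)
    let ?q = "Imp (All p) Fls"
    assume "All p \<notin> Henkin \<Gamma>"
    then have q: "?q \<in> Henkin \<Gamma>" by (simp add: Henkin_neg)
    \<comment> \<open>The counterexample is added when \<open>?q\<close> is processed, provided that
      \<open>?q\<close> is consistent with that stage; it is, being a member of the consistent
      limit.\<close>
    have "consistent (insert ?q (henkin \<Gamma> (to_nat ?q)))"
      unfolding consistent_def
    proof
      assume "insert ?q (henkin \<Gamma> (to_nat ?q)) \<turnstile> Fls"
      then have "Henkin \<Gamma> \<turnstile> Fls"
        by (rule weaken) (use q in \<open>auto simp: Henkin_def\<close>)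
      then show False using Henkin_consistent by (simp add: consistent_def)
    qed
    then have "\<exists>y. Imp (inst p y) Fls \<in> henkin \<Gamma> (Suc (to_nat ?q))" by (auto simp: add_fm_def)
    then obtain y where "Imp (inst p y) Fls \<in> Henkin \<Gamma>" unfolding Henkin_def by blast
    then show False using * Henkin_neg by blast
  qed
qed

end

section \<open>Tarski semantics and the term model\<close>

primrec sat :: "'a set \<Rightarrow> ('a \<Rightarrow> 'a \<Rightarrow> bool) \<Rightarrow> (nat \<Rightarrow> 'a) \<Rightarrow> fm \<Rightarrow> bool" where
  "sat D E e (Mem i j) = E (e i) (e j)"
| "sat D E e (Eq i j) = (e i = e j)"
| "sat D E e Fls = False"
| "sat D E e (Imp p q) = (sat D E e p \<longrightarrow> sat D E e q)"
| "sat D E e (All p) = (\<forall>a\<in>D. sat D E (case_nat a e) p)"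

lemma sat_ren: "sat D E e (ren f p) = sat D E (e \<circ> f) p"
proof (induction p arbitrary: e f)
  case (All p)
  show ?case unfolding ren.simps sat.simps All.IH case_nat_comp ..
qed auto

lemma sat_cong: "(\<And>i. i \<in> fv p \<Longrightarrow> e i = e' i) \<Longrightarrow> sat D E e p = sat D E e' p"
proof (induction p arbitrary: e e')
  case (Imp p q)
  have "sat D E e p = sat D E e' p" by (rule Imp.IH) (simp add: Imp.prems)
  moreover have "sat D E e q = sat D E e' q" by (rule Imp.IH) (simp add: Imp.prems)
  ultimately show ?case by simp
next
  case (All p)
  have "sat D E (case_nat a e) p = sat D E (case_nat a e') p" for a
    by (rule All.IH) (use All.prems in \<open>auto split: nat.split\<close>)
  then show ?case by simp
qed simp_all

lemma sat_image:
  assumes "bij_betw h D D'" "\<And>x y. x \<in> D \<Longrightarrow> y \<in> D \<Longrightarrow> E' (h x) (h y) \<longleftrightarrow> E x y" "\<And>i. e i \<in> D"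
  shows "sat D' E' (h \<circ> e) p \<longleftrightarrow> sat D E e p"
  using assms(3)
proof (induction p arbitrary: e)
  case (Eq i j)
  then show ?case using assms(1) by (auto simp: bij_betw_def inj_on_def)
next
  case (All p)
  have h: "h ` D = D'" using assms(1) by (auto simp: bij_betw_def)
  have 1: "case_nat (h a) (h \<circ> e) = h \<circ> case_nat a e" for a
    by (rule ext) (simp split: nat.split)
  have 2: "sat D' E' (h \<circ> case_nat a e) p \<longleftrightarrow> sat D E (case_nat a e) p" if "a \<in> D" for a
    using that All.prems by (intro All.IH) (auto split: nat.split)
  have "(\<forall>b\<in>D'. sat D' E' (case_nat b (h \<circ> e)) p) \<longleftrightarrow> (\<forall>a\<in>D. sat D' E' (case_nat (h a) (h \<circ> e)) p)"
    unfolding h[symmetric] by blast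
  then show ?case unfolding sat.simps 1 using 2 by blast
qed (use assms in auto)

text \<open>The elements are the variables modulo provable equality. Taking the least representative
  \<open>r x\<close> in place of an equivalence class keeps the domain a set of natural numbers,
  which is what \<open>completeness\<close> quantifies over.\<close>

lemma Henkin_model:
  assumes "consistent \<Gamma>" "\<And>p i. p \<in> \<Gamma> \<Longrightarrow> i \<in> fv p \<Longrightarrow> odd i"
  shows "\<exists>(D::nat set) E e. (\<forall>i. e i \<in> D) \<and> (\<forall>p\<in>\<Gamma>. sat D E e p)"
proof -
  define H where "H = Henkin \<Gamma>"
  have closed: "H \<turnstile> p \<Longrightarrow> p \<in> H" for p
    unfolding H_def by (rule Henkin_closed[OF assms])
  have HImp: "Imp p q \<in> H \<longleftrightarrow> (p \<in> H \<longrightarrow> q \<in> H)" for p q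
    unfolding H_def by (rule Henkin_Imp[OF assms])
  have HAll: "All p \<in> H \<longleftrightarrow> (\<forall>y. inst p y \<in> H)" for p
    unfolding H_def by (rule Henkin_All[OF assms])
  have HFls: "Fls \<notin> H" unfolding H_def by (rule Henkin_Fls[OF assms])
  have "\<Gamma> \<subseteq> H" unfolding H_def Henkin_def using henkin.simps(1) by blast
  have subst: "inst p y \<in> H" if "Eq x y \<in> H" "inst p x \<in> H" for p x y
    using that by (meson Asm EqSubst closed)
  \<comment> \<open>In \<open>Eq 0 (Suc x)\<close> the place of substitution is index 0, and
    instantiation turns \<open>Suc x\<close> back into \<open>x\<close>; transitivity uses the same
    trick.\<close>
  have sym: "Eq y x \<in> H" if "Eq x y \<in> H" for x y
    using that subst[of x y "Eq 0 (Suc x)"] closed[OF EqRefl[of H x]] by (simp add: inst_def)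
  have trans: "Eq x z \<in> H" if "Eq x y \<in> H" "Eq y z \<in> H" for x y z
    using that subst[of y z "Eq (Suc x) 0"] by (simp add: inst_def)
  define r where "r x = (LEAST y. Eq x y \<in> H)" for x
  have r: "Eq x (r x) \<in> H" for x
    unfolding r_def by (rule LeastI[of _ x]) (rule closed[OF EqRefl])
  have r_eq: "r x = r y \<longleftrightarrow> Eq x y \<in> H" for x y
  proof
    assume "r x = r y"
    then show "Eq x y \<in> H" using r[of x] r[of y] trans sym by metis
  next
    assume "Eq x y \<in> H"
    then have "Eq x z \<in> H \<longleftrightarrow> Eq y z \<in> H" for z using trans sym by blast
    then show "r x = r y" by (simp add: r_def)
  qed
  have r_mem: "Mem (r x) (r y) \<in> H \<longleftrightarrow> Mem x y \<in> H" for x y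
  proof -
    have "Mem x' y' \<in> H" if "Eq x x' \<in> H" "Eq y y' \<in> H" "Mem x y \<in> H" for x y x' y'
      using that subst[of x x' "Mem 0 (Suc y)"] subst[of y y' "Mem (Suc x') 0"]
      by (simp add: inst_def)
    then show ?thesis using r sym by blast
  qed
  define E where "E = (\<lambda>x y. Mem x y \<in> H)"
  have truth: "sat (range r) E (r \<circ> f) p \<longleftrightarrow> ren f p \<in> H" for f p
  proof (induction p arbitrary: f)
    case (All p)
    have *: "case_nat (r y) (r \<circ> f) = r \<circ> case_nat y f" for y
      by (rule ext) (simp split: nat.split)
    have **: "ren (case_nat y f) p = inst (ren (case_nat 0 (\<lambda>i. Suc (f i))) p) y" for y
      unfolding inst_def ren_ren by (rule ren_cong) (auto split: nat.split)
    have "sat (range r) E (r \<circ> f) (All p) \<longleftrightarrow> (\<forall>y. sat (range r) E (case_nat (r y) (r \<circ> f)) p)"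
      unfolding sat.simps by blast
    then show ?case unfolding * All.IH ** ren.simps HAll .
  qed (auto simp: E_def r_mem r_eq HFls HImp)
  have "\<forall>p\<in>\<Gamma>. sat (range r) E (r \<circ> (\<lambda>i. i)) p"
    unfolding truth ren_id using \<open>\<Gamma> \<subseteq> H\<close> by blast
  then show ?thesis by (metis comp_apply rangeI)
qed

text \<open>Renaming all variables to odd ones leaves the even ones as Henkin witnesses.\<close>

theorem model_existence:
  assumes "consistent \<Gamma>"
  shows "\<exists>(D::nat set) E e. (\<forall>i. e i \<in> D) \<and> (\<forall>p\<in>\<Gamma>. sat D E e p)"
proof -
  let ?f = "\<lambda>i. Suc (2 * i)" and ?g = "\<lambda>i. (i - 1) div 2"
  have "consistent (ren ?f ` \<Gamma>)"
    unfolding consistent_def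
  proof
    assume "ren ?f ` \<Gamma> \<turnstile> Fls"
    then have "ren ?g ` ren ?f ` \<Gamma> \<turnstile> ren ?g Fls" by (rule proves_ren)
    moreover have "ren ?g (ren ?f p) = p" for p
      unfolding ren_ren by (rule ren_ident) simp
    then have "ren ?g ` ren ?f ` \<Gamma> = \<Gamma>" by (force simp: image_image)
    ultimately show False using assms by (simp add: consistent_def)
  qed
  moreover have "odd i" if "p \<in> ren ?f ` \<Gamma>" "i \<in> fv p" for p i
    using that by (auto simp: fv_ren)
  ultimately obtain D :: "nat set" and E e
    where "\<forall>i. e i \<in> D" "\<forall>p\<in>ren ?f ` \<Gamma>. sat D E e p"
    using Henkin_model by meson
  then have "\<forall>i. (e \<circ> ?f) i \<in> D" "\<forall>p\<in>\<Gamma>. sat D E (e \<circ> ?f) p" by (auto simp: sat_ren)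
  then show ?thesis by blast
qed

text \<open>\<open>inf\<close> allows the countable model to be renumbered so that its domain is all
  of \<open>nat\<close>. From then on quantifiers over the universe are quantifiers over a type, and
  only submodels need a carrier set.\<close>

theorem completeness:
  assumes inf: "\<And>(D::nat set) E e. (\<forall>i. e i \<in> D) \<Longrightarrow> (\<And>p. p \<in> \<Gamma> \<Longrightarrow> sat D E e p) \<Longrightarrow> infinite D"
    and sat: "\<And>(E::nat \<Rightarrow> nat \<Rightarrow> bool) e. (\<And>p. p \<in> \<Gamma> \<Longrightarrow> sat UNIV E e p) \<Longrightarrow> sat UNIV E e q"
  shows "\<Gamma> \<turnstile> q"
proof (rule ccontr)
  assume "\<not> \<Gamma> \<turnstile> q"
  then have "consistent (insert (Imp q Fls) \<Gamma>)" unfolding consistent_def by (meson RAA)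
  then obtain D :: "nat set" and E e
    where e: "\<forall>i. e i \<in> D" "\<forall>p\<in>insert (Imp q Fls) \<Gamma>. sat D E e p"
    using model_existence by meson
  then have "infinite D" using inf by blast
  then have "bij_betw (Infinite_Set.enumerate D) UNIV D" by (rule bij_enumerate)
  then obtain h where h: "bij_betw h D (UNIV :: nat set)"
    using bij_betw_inv by blast
  define E' where "E' x y = E (inv_into D h x) (inv_into D h y)" for x y
  have "sat UNIV E' (h \<circ> e) p \<longleftrightarrow> sat D E e p" for p
    using e(1) h by (intro sat_image) (auto simp: E'_def bij_betw_def)
  then show False using e sat[of E' "h \<circ> e"] by auto
qed

section \<open>Evaluation of formulas with named levels\<close>

text \<open>
  The environment \<open>e\<close> is indexed by levels; \<open>g\<close> takes care of indices beyond the depth, so that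
  the quantifier rule holds without any assumption on the scope of a formula.
\<close>

definition lsat :: "'a set \<Rightarrow> ('a \<Rightarrow> 'a \<Rightarrow> bool) \<Rightarrow> (nat \<Rightarrow> 'a) \<Rightarrow> nat \<Rightarrow> (nat \<Rightarrow> 'a) \<Rightarrow> lfm \<Rightarrow> bool" where
  "lsat D E g n e F = sat D E (\<lambda>i. if i < n then e (n - Suc i) else g (i - n)) (F n)"

lemma lsat_0: "sat D E g (F 0) = lsat D E g 0 e F"
  by (simp add: lsat_def)

lemma lsat_mem [simp]: "x < n \<Longrightarrow> y < n \<Longrightarrow> lsat D E g n e (x \<^bold>\<in> y) = E (e x) (e y)"
  by (simp add: lsat_def mem_def)

lemma lsat_eq [simp]: "x < n \<Longrightarrow> y < n \<Longrightarrow> lsat D E g n e (x \<^bold>= y) = (e x = e y)"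
  by (simp add: lsat_def eq_def)

lemma lsat_fls [simp]: "lsat D E g n e fls = False"
  by (simp add: lsat_def fls_def)

lemma lsat_imp [simp]: "lsat D E g n e (F \<^bold>\<longrightarrow> G) = (lsat D E g n e F \<longrightarrow> lsat D E g n e G)"
  by (simp add: lsat_def imp_def)

lemma lsat_neg [simp]: "lsat D E g n e (\<^bold>\<not> F) = (\<not> lsat D E g n e F)"
  by (simp add: neg_def)

lemma lsat_conj [simp]: "lsat D E g n e (F \<^bold>\<and> G) = (lsat D E g n e F \<and> lsat D E g n e G)"
  by (simp add: conj_def)

lemma lsat_disj [simp]: "lsat D E g n e (F \<^bold>\<or> G) = (lsat D E g n e F \<or> lsat D E g n e G)"
  by (auto simp: disj_def)

lemma lsat_iff [simp]: "lsat D E g n e (F \<^bold>\<longleftrightarrow> G) = (lsat D E g n e F \<longleftrightarrow> lsat D E g n e G)"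
  by (auto simp: iff_def)

lemma lsat_all [simp]: "lsat D E g n e (all F) = (\<forall>a\<in>D. lsat D E g (Suc n) (e(n := a)) (F n))"
proof -
  have "case_nat a (\<lambda>i. if i < n then e (n - Suc i) else g (i - n)) =
      (\<lambda>i. if i < Suc n then (e(n := a)) (Suc n - Suc i) else g (i - Suc n))" for a
    by (rule ext) (auto split: nat.split)
  then show ?thesis by (simp add: lsat_def all_def)
qed

lemma lsat_ex [simp]: "lsat D E g n e (ex F) = (\<exists>a\<in>D. lsat D E g (Suc n) (e(n := a)) (F n))"
  by (simp add: ex_def)

text \<open>In \<open>sat\<close> the domain restricts the quantifiers alone and the environment may
  have values outside it, so relativising to a set means shrinking \<open>D\<close> while keeping
  \<open>e\<close>.\<close>

lemma sat_relativize: "sat D E e (relativize m p) = sat {x \<in> D. E x (e m)} E e p"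
  by (induction p arbitrary: e m) auto

lemma lsat_rel_to [simp]:
  "m < n \<Longrightarrow> lsat D E g n e (rel_to m F) = lsat {x \<in> D. E x (e m)} E g n e F"
  by (simp add: lsat_def rel_to_def sat_relativize)

lemma lsat_at_param:
  assumes "x < n" "fv p \<subseteq> {..n}"
  shows "lsat D E g n e (at_param p x) = sat D E (case_nat (e x) e) p"
  unfolding lsat_def at_param_def sat_ren
  by (rule sat_cong) (use assms in \<open>auto split: nat.split\<close>)

text \<open>\<open>f\<close> lists the values by index; index 0 belongs to the innermost quantifier,
  which is the one that the induction splits off.\<close>

lemma sat_All_funpow:
  assumes "\<And>i. e i \<in> D"
  shows "sat D E e ((All ^^ k) p) \<longleftrightarrow>
    (\<forall>f. (\<forall>i<k. f i \<in> D) \<longrightarrow> sat D E (\<lambda>i. if i < k then f i else e (i - k)) p)"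
  using assms
proof (induction k arbitrary: p)
  case (Suc k)
  have "sat D E e ((All ^^ Suc k) p) = sat D E e ((All ^^ k) (All p))"
    by (simp add: funpow_swap1)
  also have "\<dots> \<longleftrightarrow> (\<forall>f. (\<forall>i<k. f i \<in> D) \<longrightarrow>
      (\<forall>a\<in>D. sat D E (case_nat a (\<lambda>i. if i < k then f i else e (i - k))) p))"
    using Suc by simp
  also have "\<dots> \<longleftrightarrow> (\<forall>f. (\<forall>i<Suc k. f i \<in> D) \<longrightarrow> sat D E (\<lambda>i. if i < Suc k then f i else e (i - Suc k)) p)"
    (is "?l \<longleftrightarrow> ?r")
  proof
    have eq: "case_nat (f 0) (\<lambda>i. if i < k then f (Suc i) else e (i - k)) =
        (\<lambda>i. if i < Suc k then f i else e (i - Suc k))" for f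
      by (rule ext) (simp split: nat.split)
    {
      assume l: ?l
      show ?r
      proof (intro allI impI)
        fix f assume "\<forall>i<Suc k. f i \<in> D"
        then have "\<forall>i<k. f (Suc i) \<in> D" "f 0 \<in> D" by auto
        with l have "sat D E (case_nat (f 0) (\<lambda>i. if i < k then f (Suc i) else e (i - k))) p"
          by (elim allE[of _ "\<lambda>i. f (Suc i)"]) auto
        then show "sat D E (\<lambda>i. if i < Suc k then f i else e (i - Suc k)) p" unfolding eq .
      qed
    next
      assume r: ?r
      show ?l
      proof (intro allI impI ballI)
        fix f a assume "\<forall>i<k. f i \<in> D" "a \<in> D"
        then have "\<forall>i<Suc k. case_nat a f i \<in> D" by (auto split: nat.split)
        moreover have "case_nat a (\<lambda>i. if i < k then f i else e (i - k)) =
            (\<lambda>i. if i < Suc k then case_nat a f i else e (i - Suc k))"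
          by (rule ext) (simp split: nat.split)
        ultimately show "sat D E (case_nat a (\<lambda>i. if i < k then f i else e (i - k))) p"
          using r by metis
      qed
    }
  qed
  finally show ?case .
qed simp

lemma sat_univ_closure:
  assumes "\<And>i. e i \<in> D"
  shows "sat D E e (univ_closure p) \<longleftrightarrow> (\<forall>f. (\<forall>i. f i \<in> D) \<longrightarrow> sat D E f p)"
proof -
  define k where "k = (LEAST k. fv p \<subseteq> {..<k})"
  have "\<exists>k. fv p \<subseteq> {..<k}" by (simp add: finite_nat_iff_bounded[symmetric])
  then have k: "fv p \<subseteq> {..<k}" unfolding k_def by (rule LeastI_ex)
  have *: "sat D E (\<lambda>i. if i < k then f i else e (i - k)) p = sat D E f p" for f
    by (rule sat_cong) (use k in auto)
  show ?thesis
    unfolding univ_closure_def k_def[symmetric] sat_All_funpow[OF assms] *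
  proof (intro iffI allI impI)
    fix f assume "\<forall>f. (\<forall>i. f i \<in> D) \<longrightarrow> sat D E f p" "\<forall>i<k. f i \<in> D"
    then have "sat D E (\<lambda>i. if i < k then f i else e (i - k)) p" using assms by auto
    then show "sat D E f p" unfolding * .
  qed auto
qed

section \<open>Semantics of templates\<close>

primrec nsat :: "'a set \<Rightarrow> ('a \<Rightarrow> 'a \<Rightarrow> bool) \<Rightarrow> ((nat \<Rightarrow> 'a) \<Rightarrow> bool) \<Rightarrow> (nat \<Rightarrow> 'a) \<Rightarrow> template \<Rightarrow> bool" where
  "nsat D E H s (TMem i j) = E (s i) (s j)"
| "nsat D E H s (TEq i j) = (s i = s j)"
| "nsat D E H s TFls = False"
| "nsat D E H s (TImp T U) = (nsat D E H s T \<longrightarrow> nsat D E H s U)"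
| "nsat D E H s (TAll i T) = (\<forall>a\<in>D. nsat D E H (s(i := a)) T)"
| "nsat D E H s THole = H s"

lemma nsat_TNeg [simp]: "nsat D E H s (TNeg T) = (\<not> nsat D E H s T)"
  by (simp add: TNeg_def)

lemma nsat_TAnd [simp]: "nsat D E H s (TAnd T U) = (nsat D E H s T \<and> nsat D E H s U)"
  by (simp add: TAnd_def)

lemma nsat_TOr [simp]: "nsat D E H s (TOr T U) = (nsat D E H s T \<or> nsat D E H s U)"
  by (auto simp: TOr_def)

lemma nsat_TIff [simp]: "nsat D E H s (TIff T U) = (nsat D E H s T \<longleftrightarrow> nsat D E H s U)"
  by (auto simp: TIff_def)

lemma nsat_TEx [simp]: "nsat D E H s (TEx i T) = (\<exists>a\<in>D. nsat D E H (s(i := a)) T)"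
  by (simp add: TEx_def)

text \<open>In \<open>nsat\<close> the meaning of the hole receives the current assignment, so the
  quantifiers of the template capture variables of \<open>\<psi>\<close> on both sides
  alike.\<close>

lemma sat_fill: "sat D E e (fill T v \<psi>) = nsat D E (\<lambda>s. sat D E s \<psi>) (e \<circ> v) T"
proof (induction T arbitrary: e v)
  case (TAll i T)
  have *: "case_nat a e \<circ> ((\<lambda>k. Suc (v k))(i := 0)) = (e \<circ> v)(i := a)" for a
    by (rule ext) simp
  show ?case unfolding fill.simps sat.simps nsat.simps TAll.IH * ..
qed (auto simp: sat_ren comp_def)

lemma sat_instance:
  assumes "\<And>i. e i \<in> D"
  shows "sat D E e (instance_of T \<psi>) \<longleftrightarrow> (\<forall>s. (\<forall>i. s i \<in> D) \<longrightarrow> nsat D E (\<lambda>s. sat D E s \<psi>) s T)"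
  unfolding instance_of_def sat_univ_closure[where D=D and e=e, OF assms] sat_fill by simp

section \<open>Sets in extensional structures\<close>

locale extset =
  fixes E :: "'a \<Rightarrow> 'a \<Rightarrow> bool" (infix "\<epsilon>" 50)
  assumes ext: "(\<And>z. z \<epsilon> x \<longleftrightarrow> z \<epsilon> y) \<Longrightarrow> x = y"
    and ex_empty: "\<exists>x. \<forall>z. \<not> z \<epsilon> x"
    and ex_pair: "\<exists>p. \<forall>z. z \<epsilon> p \<longleftrightarrow> z = x \<or> z = y"
    and ex_union: "\<exists>u. \<forall>z. z \<epsilon> u \<longleftrightarrow> (\<exists>y. y \<epsilon> x \<and> z \<epsilon> y)"
begin

text \<open>Total, so that set operations can be written as terms; its value carries information
  once a set with these members is known to exist.\<close>

definition "setof P = (THE x. \<forall>z. z \<epsilon> x \<longleftrightarrow> P z)"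

lemma setof: "\<exists>x. \<forall>z. z \<epsilon> x \<longleftrightarrow> P z \<Longrightarrow> z \<epsilon> setof P \<longleftrightarrow> P z"
proof -
  assume "\<exists>x. \<forall>z. z \<epsilon> x \<longleftrightarrow> P z"
  then obtain x where x: "\<forall>z. z \<epsilon> x \<longleftrightarrow> P z" by blast
  have "\<forall>z. z \<epsilon> setof P \<longleftrightarrow> P z"
    unfolding setof_def by (rule theI[of _ x]) (use x in \<open>auto intro: ext\<close>)
  then show ?thesis by blast
qed

definition "emp = setof (\<lambda>_. False)"
definition "upr a b = setof (\<lambda>z. z = a \<or> z = b)"
definition "Uni x = setof (\<lambda>z. \<exists>y. y \<epsilon> x \<and> z \<epsilon> y)"
definition "un2 a b = Uni (upr a b)"
definition "opr a b = upr (upr a a) (upr a b)"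
definition "sc x = un2 x (upr x x)"

primrec num :: "nat \<Rightarrow> 'a" where
  "num 0 = emp"
| "num (Suc k) = sc (num k)"

primrec mks :: "'a list \<Rightarrow> 'a" where
  "mks [] = emp"
| "mks (x # xs) = un2 (upr x x) (mks xs)"

definition "sub x y \<longleftrightarrow> (\<forall>z. z \<epsilon> x \<longrightarrow> z \<epsilon> y)"

lemma emp [simp]: "\<not> z \<epsilon> emp"
  unfolding emp_def using ex_empty by (subst setof) auto

lemma upr [simp]: "z \<epsilon> upr a b \<longleftrightarrow> z = a \<or> z = b"
  unfolding upr_def using ex_pair by (subst setof) auto

lemma Uni [simp]: "z \<epsilon> Uni x \<longleftrightarrow> (\<exists>y. y \<epsilon> x \<and> z \<epsilon> y)"
  unfolding Uni_def by (rule setof[OF ex_union])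

lemma un2 [simp]: "z \<epsilon> un2 a b \<longleftrightarrow> z \<epsilon> a \<or> z \<epsilon> b"
  by (auto simp: un2_def)

lemma sc [simp]: "z \<epsilon> sc x \<longleftrightarrow> z \<epsilon> x \<or> z = x"
  by (auto simp: sc_def)

lemma mks [simp]: "z \<epsilon> mks xs \<longleftrightarrow> z \<in> set xs"
  by (induction xs) auto

lemma ext_iff: "x = y \<longleftrightarrow> (\<forall>z. z \<epsilon> x \<longleftrightarrow> z \<epsilon> y)"
  using ext by blast

lemma upr_eq: "p = upr a b \<longleftrightarrow> (\<forall>z. z \<epsilon> p \<longleftrightarrow> z = a \<or> z = b)"
  by (simp add: ext_iff[of p])

lemma upr_inject [simp]: "upr a b = upr c d \<longleftrightarrow> a = c \<and> b = d \<or> a = d \<and> b = c"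
proof
  assume *: "upr a b = upr c d"
  have "a \<epsilon> upr c d" "b \<epsilon> upr c d" "c \<epsilon> upr a b" "d \<epsilon> upr a b" using * by (auto simp: upr_eq)
  then show "a = c \<and> b = d \<or> a = d \<and> b = c" by auto
qed (auto simp: upr_eq)

lemma opr_inject [simp]: "opr a b = opr c d \<longleftrightarrow> a = c \<and> b = d"
  by (auto simp: opr_def)

text \<open>The default \<open>emp\<close> lies in every domain under consideration. Application
  thus never leaves the domain of \<open>f\<close> (\<open>app_D\<close>) and can be treated as a
  total definable term (\<open>tm_app\<close>).\<close>

definition app :: "'a \<Rightarrow> 'a \<Rightarrow> 'a" where
  "app f x = (if \<exists>y. \<forall>z. opr x z \<epsilon> f \<longleftrightarrow> z = y then THE y. opr x y \<epsilon> f else emp)"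

lemma app_eq: "y = app f x \<longleftrightarrow>
    (\<forall>z. opr x z \<epsilon> f \<longleftrightarrow> z = y) \<or> \<not> (\<exists>y. \<forall>z. opr x z \<epsilon> f \<longleftrightarrow> z = y) \<and> y = emp"
proof (cases "\<exists>y. \<forall>z. opr x z \<epsilon> f \<longleftrightarrow> z = y")
  case True
  then obtain y' where y': "\<forall>z. opr x z \<epsilon> f \<longleftrightarrow> z = y'" by blast
  then have "app f x = y'" using True by (simp add: app_def)
  then show ?thesis using y' by auto
qed (auto simp: app_def)

definition "isf f d \<longleftrightarrow> (\<forall>p. p \<epsilon> f \<longrightarrow> (\<exists>x y. x \<epsilon> d \<and> p = opr x y)) \<and>
  (\<forall>x. x \<epsilon> d \<longrightarrow> (\<exists>y. \<forall>z. opr x z \<epsilon> f \<longleftrightarrow> z = y))"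

definition "isfn f d a \<longleftrightarrow> isf f d \<and> (\<forall>x y. opr x y \<epsilon> f \<longrightarrow> y \<epsilon> a)"

lemma isf_app: "isf f d \<Longrightarrow> x \<epsilon> d \<Longrightarrow> opr x y \<epsilon> f \<longleftrightarrow> app f x = y"
proof -
  assume "isf f d" "x \<epsilon> d"
  then obtain y' where y': "\<forall>z. opr x z \<epsilon> f \<longleftrightarrow> z = y'" unfolding isf_def by blast
  then have "y' = app f x" unfolding app_eq by blast
  with y' show ?thesis by auto
qed

lemma isfn_app: "isfn f d a \<Longrightarrow> x \<epsilon> d \<Longrightarrow> opr x y \<epsilon> f \<longleftrightarrow> app f x = y"
  by (auto simp: isfn_def isf_app)

lemma isfn_in: "isfn f d a \<Longrightarrow> x \<epsilon> d \<Longrightarrow> app f x \<epsilon> a"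
  unfolding isfn_def using isf_app by blast

lemma isfn_dom: "isfn f d a \<Longrightarrow> opr x y \<epsilon> f \<Longrightarrow> x \<epsilon> d"
  unfolding isfn_def isf_def by (metis opr_inject)

lemma isf_mem:
  assumes "isf f d"
  shows "p \<epsilon> f \<longleftrightarrow> (\<exists>x. x \<epsilon> d \<and> p = opr x (app f x))"
proof
  assume "p \<epsilon> f"
  with assms obtain x y where "x \<epsilon> d" "p = opr x y" unfolding isf_def by blast
  with \<open>p \<epsilon> f\<close> show "\<exists>x. x \<epsilon> d \<and> p = opr x (app f x)"
    using isf_app[OF assms, of x y] by auto
next
  assume "\<exists>x. x \<epsilon> d \<and> p = opr x (app f x)"
  then show "p \<epsilon> f" using isf_app[OF assms] by auto
qed

lemma isf_ext:
  assumes "isf f d" "isf g d" "\<And>x. x \<epsilon> d \<Longrightarrow> app f x = app g x"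
  shows "f = g"
proof (rule ext)
  fix p
  show "p \<epsilon> f \<longleftrightarrow> p \<epsilon> g"
    unfolding isf_mem[OF assms(1)] isf_mem[OF assms(2)] using assms(3) by auto
qed

lemma isfn_intro:
  assumes "\<And>p. p \<epsilon> f \<longleftrightarrow> (\<exists>x. x \<epsilon> d \<and> p = opr x (F x))" "\<And>x. x \<epsilon> d \<Longrightarrow> F x \<epsilon> a"
  shows "isfn f d a" "\<And>x. x \<epsilon> d \<Longrightarrow> app f x = F x"
proof -
  show fn: "isfn f d a"
    unfolding isfn_def isf_def using assms by auto
  show "app f x = F x" if "x \<epsilon> d" for x
    using isfn_app[OF fn that] assms(1) that by auto
qed

definition "ind w \<longleftrightarrow> emp \<epsilon> w \<and> (\<forall>x. x \<epsilon> w \<longrightarrow> sc x \<epsilon> w)"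

definition "trs m \<longleftrightarrow> (\<forall>x y. x \<epsilon> m \<and> y \<epsilon> x \<longrightarrow> y \<epsilon> m)"

definition "lin a \<longleftrightarrow> (\<forall>x y. x \<epsilon> a \<and> y \<epsilon> a \<longrightarrow> x \<epsilon> y \<or> x = y \<or> y \<epsilon> x)"

definition "cofm f b a \<longleftrightarrow> isfn f b a \<and> (\<forall>x. x \<epsilon> a \<longrightarrow> (\<exists>y z. opr y z \<epsilon> f \<and> (x \<epsilon> z \<or> x = z)))"

end

locale omset = extset +
  assumes ex_omega: "\<exists>w. ind w \<and> (\<forall>v. ind v \<longrightarrow> sub w v)"
begin

definition "om = (THE w. ind w \<and> (\<forall>v. ind v \<longrightarrow> sub w v))"

lemma om: "ind om \<and> (\<forall>v. ind v \<longrightarrow> sub om v)"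
proof -
  obtain w where w: "ind w \<and> (\<forall>v. ind v \<longrightarrow> sub w v)" using ex_omega by blast
  then show ?thesis
    unfolding om_def by (rule theI) (use w in \<open>auto simp: sub_def intro!: ext\<close>)
qed

lemma om_0 [simp]: "emp \<epsilon> om" and om_sc [simp]: "x \<epsilon> om \<Longrightarrow> sc x \<epsilon> om"
  using om unfolding ind_def by auto

lemma num_om [simp]: "num k \<epsilon> om"
  by (induction k) auto

end

text \<open>Covers both ranges over which formulas are evaluated: the whole universe and the
  elements of a transitive model. A single family of evaluation lemmas then also expresses that the
  notions are absolute between the two.\<close>

locale dom = omset +
  fixes D :: "'a set"
  assumes trans: "x \<in> D \<Longrightarrow> y \<epsilon> x \<Longrightarrow> y \<in> D"
    and om_D [simp]: "om \<in> D"
    and upr_D [simp]: "upr x y \<in> D \<longleftrightarrow> x \<in> D \<and> y \<in> D"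
    and Un_D [simp]: "x \<in> D \<Longrightarrow> Uni x \<in> D"
begin

lemma emp_D [simp]: "emp \<in> D"
  using trans[of om emp] by simp

lemma un2_D [simp]: "x \<in> D \<Longrightarrow> y \<in> D \<Longrightarrow> un2 x y \<in> D"
  by (simp add: un2_def)

lemma opr_D [simp]: "opr x y \<in> D \<longleftrightarrow> x \<in> D \<and> y \<in> D"
  by (auto simp: opr_def)

lemma sc_D [simp]: "x \<in> D \<Longrightarrow> sc x \<in> D"
  by (simp add: sc_def)

lemma num_D [simp]: "num k \<in> D"
  by (induction k) auto

lemma opr_memD: "opr x y \<epsilon> f \<Longrightarrow> f \<in> D \<Longrightarrow> x \<in> D \<and> y \<in> D"
  using trans opr_D by blast

lemma opr_memD1: "opr x y \<epsilon> f \<Longrightarrow> f \<in> D \<Longrightarrow> x \<in> D"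
  and opr_memD2: "opr x y \<epsilon> f \<Longrightarrow> f \<in> D \<Longrightarrow> y \<in> D"
  using opr_memD by blast+

lemma app_D [simp]: "f \<in> D \<Longrightarrow> app f x \<in> D"
  using app_eq[of "app f x" f x] opr_memD by auto

lemma isf_D: "f \<in> D \<Longrightarrow> d \<in> D \<Longrightarrow> isf f d \<longleftrightarrow>
    (\<forall>p\<in>D. p \<epsilon> f \<longrightarrow> (\<exists>x\<in>D. \<exists>y\<in>D. x \<epsilon> d \<and> p = opr x y)) \<and>
    (\<forall>x\<in>D. x \<epsilon> d \<longrightarrow> (\<exists>y\<in>D. \<forall>z\<in>D. opr x z \<epsilon> f \<longleftrightarrow> z = y))"
proof -
  assume D: "f \<in> D" "d \<in> D"
  have 1: "p \<epsilon> f \<Longrightarrow> p = opr x y \<Longrightarrow> x \<in> D \<and> y \<in> D" "p \<epsilon> f \<Longrightarrow> p \<in> D"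
    "opr x y \<epsilon> f \<Longrightarrow> y \<in> D" "x \<epsilon> d \<Longrightarrow> x \<in> D" for p x y
    using opr_memD[OF _ D(1)] trans[OF D(1)] trans[OF D(2)] by blast+
  have "(\<forall>p. p \<epsilon> f \<longrightarrow> (\<exists>x y. x \<epsilon> d \<and> p = opr x y)) \<longleftrightarrow>
      (\<forall>p\<in>D. p \<epsilon> f \<longrightarrow> (\<exists>x\<in>D. \<exists>y\<in>D. x \<epsilon> d \<and> p = opr x y))"
    using 1(1,2) by blast
  moreover have "(\<exists>y. \<forall>z. opr x z \<epsilon> f \<longleftrightarrow> z = y) \<longleftrightarrow> (\<exists>y\<in>D. \<forall>z\<in>D. opr x z \<epsilon> f \<longleftrightarrow> z = y)" for x
    using 1(3) by blast
  moreover have "(\<forall>x. x \<epsilon> d \<longrightarrow> P x) \<longleftrightarrow> (\<forall>x\<in>D. x \<epsilon> d \<longrightarrow> P x)" for P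
    using 1(4) by blast
  ultimately show ?thesis unfolding isf_def by simp
qed

lemma ext_D: "x \<in> D \<Longrightarrow> y \<in> D \<Longrightarrow> x = y \<longleftrightarrow> (\<forall>z\<in>D. z \<epsilon> x \<longleftrightarrow> z \<epsilon> y)"
  by (auto intro: ext dest: trans)

abbreviation "L g n e F \<equiv> lsat D E g n e F"

lemma ev_is_empty [simp]: "x < n \<Longrightarrow> e x \<in> D \<Longrightarrow> L g n e (is_empty x) = (e x = emp)"
  by (auto simp: is_empty_def ext_D)

lemma ev_is_subset [simp]:
  "x < n \<Longrightarrow> y < n \<Longrightarrow> e x \<in> D \<Longrightarrow> L g n e (is_subset x y) = sub (e x) (e y)"
  by (auto simp: is_subset_def sub_def dest: trans)

lemma ev_is_succ [simp]:
  "x < n \<Longrightarrow> y < n \<Longrightarrow> e x \<in> D \<Longrightarrow> e y \<in> D \<Longrightarrow> L g n e (is_succ y x) = (e y = sc (e x))"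
  by (auto simp: is_succ_def ext_D)

lemma ev_is_union2 [simp]:
  "u < n \<Longrightarrow> x < n \<Longrightarrow> y < n \<Longrightarrow> e u \<in> D \<Longrightarrow> e x \<in> D \<Longrightarrow> e y \<in> D \<Longrightarrow>
    L g n e (is_union2 u x y) = (e u = un2 (e x) (e y))"
  by (auto simp: is_union2_def ext_D)

lemma ev_is_upair [simp]:
  "p < n \<Longrightarrow> x < n \<Longrightarrow> y < n \<Longrightarrow> e p \<in> D \<Longrightarrow> e x \<in> D \<Longrightarrow> e y \<in> D \<Longrightarrow>
    L g n e (is_upair p x y) = (e p = upr (e x) (e y))"
  by (auto simp: is_upair_def ext_D)

lemma ev_is_pair [simp]:
  "p < n \<Longrightarrow> x < n \<Longrightarrow> y < n \<Longrightarrow> e p \<in> D \<Longrightarrow> e x \<in> D \<Longrightarrow> e y \<in> D \<Longrightarrow>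
    L g n e (is_pair p x y) = (e p = opr (e x) (e y))"
  by (simp add: is_pair_def opr_def cong: bex_cong)

lemma ev_maps [simp]:
  "f < n \<Longrightarrow> x < n \<Longrightarrow> y < n \<Longrightarrow> e f \<in> D \<Longrightarrow> e x \<in> D \<Longrightarrow> e y \<in> D \<Longrightarrow>
    L g n e (maps f x y) = (opr (e x) (e y) \<epsilon> e f)"
  by (auto simp: maps_def cong: bex_cong)

lemma ev_rel_on [simp]:
  "r < n \<Longrightarrow> a < n \<Longrightarrow> e r \<in> D \<Longrightarrow> e a \<in> D \<Longrightarrow>
    L g n e (rel_on r a) = (\<forall>p. p \<epsilon> e r \<longrightarrow> (\<exists>x y. x \<epsilon> e a \<and> y \<epsilon> e a \<and> p = opr x y))"
  by (auto simp: rel_on_def cong: bex_cong ball_cong dest: trans)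

lemma ev_func [simp]:
  "f < n \<Longrightarrow> d < n \<Longrightarrow> e f \<in> D \<Longrightarrow> e d \<in> D \<Longrightarrow> L g n e (func f d) = isf (e f) (e d)"
  by (simp add: func_def isf_D cong: bex_cong ball_cong)

lemma ev_func_to [simp]:
  "f < n \<Longrightarrow> d < n \<Longrightarrow> a < n \<Longrightarrow> e f \<in> D \<Longrightarrow> e d \<in> D \<Longrightarrow> e a \<in> D \<Longrightarrow>
    L g n e (func_to f d a) = isfn (e f) (e d) (e a)"
  by (auto simp: func_to_def isfn_def cong: bex_cong ball_cong dest: opr_memD1 opr_memD2)

lemma ev_is_bij [simp]:
  "f < n \<Longrightarrow> d < n \<Longrightarrow> a < n \<Longrightarrow> e f \<in> D \<Longrightarrow> e d \<in> D \<Longrightarrow> e a \<in> D \<Longrightarrow>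
    L g n e (is_bij f d a) \<longleftrightarrow> isfn (e f) (e d) (e a) \<and>
      (\<forall>x y z. opr x z \<epsilon> e f \<and> opr y z \<epsilon> e f \<longrightarrow> x = y) \<and>
      (\<forall>z. z \<epsilon> e a \<longrightarrow> (\<exists>x. opr x z \<epsilon> e f))"
  apply (simp add: is_bij_def cong: bex_cong ball_cong)
  apply safe
    apply (metis opr_memD)
   apply (metis opr_memD trans)
   apply (metis opr_memD)
  apply (metis opr_memD)
  done

lemma ev_is_inductive [simp]:
  "w < n \<Longrightarrow> e w \<in> D \<Longrightarrow> L g n e (is_inductive w) = ind (e w)"
  by (auto simp: is_inductive_def ind_def cong: bex_cong ball_cong dest: trans)

lemma ev_is_omega [simp]:
  "w < n \<Longrightarrow> e w \<in> D \<Longrightarrow> L g n e (is_omega w) = (e w = om)"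
proof -
  assume *: "w < n" "e w \<in> D"
  then have "L g n e (is_omega w) \<longleftrightarrow> ind (e w) \<and> (\<forall>v\<in>D. ind v \<longrightarrow> sub (e w) v)"
    by (simp add: is_omega_def cong: bex_cong ball_cong)
  \<comment> \<open>Since \<open>om\<close> is itself an inductive member of \<open>D\<close>, being
    contained in all inductive members of \<open>D\<close> gives inclusion in \<open>om\<close>; the
    converse inclusion is the minimality of \<open>om\<close>.\<close>
  also have "\<dots> \<longleftrightarrow> e w = om"
    using om om_D by (metis ext sub_def)
  finally show ?thesis .
qed

lemma ev_is_nat [simp]:
  "k < n \<Longrightarrow> e k \<in> D \<Longrightarrow> L g n e (is_nat k) = (e k \<epsilon> om)"
  by (simp add: is_nat_def cong: bex_cong ball_cong conj_cong)

lemma ev_is_num [simp]: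
  "x < n \<Longrightarrow> e x \<in> D \<Longrightarrow> L g n e (is_num k x) = (e x = num k)"
  by (induction k arbitrary: x n e) (simp_all cong: bex_cong ball_cong)

lemma ev_infinite_set [simp]:
  "a < n \<Longrightarrow> e a \<in> D \<Longrightarrow> L g n e (infinite_set a) \<longleftrightarrow>
    \<not> (\<exists>k f. f \<in> D \<and> k \<epsilon> om \<and> isfn f k (e a) \<and> (\<forall>x y z. opr x z \<epsilon> f \<and> opr y z \<epsilon> f \<longrightarrow> x = y) \<and>
      (\<forall>z. z \<epsilon> e a \<longrightarrow> (\<exists>x. opr x z \<epsilon> f)))"
  using trans[OF om_D] by (simp add: infinite_set_def cong: bex_cong ball_cong conj_cong) fast

lemma ev_transitive_set [simp]:
  "m < n \<Longrightarrow> e m \<in> D \<Longrightarrow> L g n e (transitive_set m) = trs (e m)"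
  by (simp add: transitive_set_def trs_def cong: bex_cong ball_cong) (metis trans)

lemma ev_cofinal_map [simp]:
  "f < n \<Longrightarrow> b < n \<Longrightarrow> a < n \<Longrightarrow> e f \<in> D \<Longrightarrow> e b \<in> D \<Longrightarrow> e a \<in> D \<Longrightarrow>
    L g n e (cofinal_map f b a) = cofm (e f) (e b) (e a)"
  by (simp add: cofinal_map_def cofm_def cong: bex_cong ball_cong conj_cong) (metis opr_memD trans)

subsection \<open>Definability with parameters\<close>

text \<open>
  Even variables range over the environment and odd ones hold the parameters, so there is room for
  infinitely many of both.
\<close>

definition "mrg e c = (\<lambda>i. if even i then e (i div 2) else c (i div 2))" for e c :: "nat \<Rightarrow> 'a"

text \<open>A semantic form of definability. Instances of the schemes are obtained from its closure
  under the logical operations (the rules \<open>definable\<close>), so that no object formula has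
  to be written out for the individual constructions.\<close>

definition dfn :: "((nat \<Rightarrow> 'a) \<Rightarrow> bool) \<Rightarrow> bool" where
  "dfn P \<longleftrightarrow> (\<exists>p c. range c \<subseteq> D \<and> (\<forall>e. range e \<subseteq> D \<longrightarrow> P e = sat D E (mrg e c) p))"

lemma dfn_cong: "(\<And>e. range e \<subseteq> D \<Longrightarrow> P e = Q e) \<Longrightarrow> dfn Q \<Longrightarrow> dfn P"
  unfolding dfn_def by metis

lemma dfn_ren:
  assumes "dfn P"
  shows "dfn (\<lambda>e. P (\<lambda>i. e (f i)))"
proof -
  obtain p c where c: "range c \<subseteq> D" and p: "\<And>e. range e \<subseteq> D \<Longrightarrow> P e = sat D E (mrg e c) p"
    using assms unfolding dfn_def by blast
  have "P (\<lambda>i. e (f i)) = sat D E (mrg e c) (ren (\<lambda>i. if even i then 2 * f (i div 2) else i) p)"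
    if "range e \<subseteq> D" for e
  proof -
    have "mrg e c \<circ> (\<lambda>i. if even i then 2 * f (i div 2) else i) = mrg (\<lambda>i. e (f i)) c"
      by (rule HOL.ext) (simp add: mrg_def)
    moreover have "range (\<lambda>i. e (f i)) \<subseteq> D" using that by auto
    ultimately show ?thesis using p by (simp add: sat_ren)
  qed
  then show ?thesis unfolding dfn_def using c by blast
qed

lemma dfn_False: "dfn (\<lambda>e. False)"
  unfolding dfn_def by (rule exI[of _ Fls], rule exI[of _ "\<lambda>_. emp"]) auto

lemma dfn_mem_var: "dfn (\<lambda>e. e i \<epsilon> e j)"
  unfolding dfn_def by (rule exI[of _ "Mem (2 * i) (2 * j)"], rule exI[of _ "\<lambda>_. emp"]) (auto simp: mrg_def)

lemma dfn_eq_var: "dfn (\<lambda>e. e i = e j)"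
  unfolding dfn_def by (rule exI[of _ "Eq (2 * i) (2 * j)"], rule exI[of _ "\<lambda>_. emp"]) (auto simp: mrg_def)

lemma dfn_eq_const: "a \<in> D \<Longrightarrow> dfn (\<lambda>e. e i = a)"
  unfolding dfn_def by (rule exI[of _ "Eq (2 * i) 1"], rule exI[of _ "\<lambda>_. a"]) (auto simp: mrg_def)

lemma dfn_imp:
  assumes "dfn P" "dfn Q"
  shows "dfn (\<lambda>e. P e \<longrightarrow> Q e)"
proof -
  obtain p c where c: "range c \<subseteq> D" and p: "\<And>e. range e \<subseteq> D \<Longrightarrow> P e = sat D E (mrg e c) p"
    using assms(1) unfolding dfn_def by blast
  obtain q d where d: "range d \<subseteq> D" and q: "\<And>e. range e \<subseteq> D \<Longrightarrow> Q e = sat D E (mrg e d) q"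
    using assms(2) unfolding dfn_def by blast
  \<comment> \<open>The two parameter sequences are interleaved by \<open>mrg c d\<close>:
    \<open>p\<close> finds its parameters at the even places and \<open>q\<close> at the odd
    ones.\<close>
  let ?f = "\<lambda>i. if even i then i else Suc (2 * (2 * (i div 2)))"
  let ?h = "\<lambda>i. if even i then i else Suc (2 * Suc (2 * (i div 2)))"
  have "mrg e (mrg c d) \<circ> ?f = mrg e c" "mrg e (mrg c d) \<circ> ?h = mrg e d" for e
    by (rule HOL.ext, auto simp: mrg_def elim!: oddE)+
  then have "(P e \<longrightarrow> Q e) = sat D E (mrg e (mrg c d)) (Imp (ren ?f p) (ren ?h q))"
    if "range e \<subseteq> D" for e
    using p[OF that] q[OF that] by (simp add: sat_ren)
  moreover have "range (mrg c d) \<subseteq> D" using c d by (auto simp: mrg_def)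
  ultimately show ?thesis unfolding dfn_def by blast
qed

lemma dfn_All:
  assumes "dfn (\<lambda>e. P (e 0) (\<lambda>i. e (Suc i)))"
  shows "dfn (\<lambda>e. \<forall>x\<in>D. P x e)"
proof -
  obtain p c where c: "range c \<subseteq> D"
    and p: "\<And>e. range e \<subseteq> D \<Longrightarrow> P (e 0) (\<lambda>i. e (Suc i)) = sat D E (mrg e c) p"
    using assms unfolding dfn_def by blast
  \<comment> \<open>Index 0 is the new bound variable and all indices of \<open>mrg e c\<close> are
    shifted by one below the binder. Variable \<open>2 * Suc j\<close> now denotes
    \<open>e j\<close>, hence index \<open>Suc (2 * j)\<close>; a parameter only undergoes the
    shift.\<close>
  let ?f = "\<lambda>i. if i = 0 then 0 else if even i then i - 1 else Suc i"
  have eq: "case_nat x (mrg e c) \<circ> ?f = mrg (case_nat x e) c" for x e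
  proof (rule HOL.ext)
    fix i show "(case_nat x (mrg e c) \<circ> ?f) i = mrg (case_nat x e) c i"
    proof (cases "even i")
      case True
      then obtain j where j: "i = 2 * j" by blast
      show ?thesis by (cases j) (simp_all add: j mrg_def)
    next
      case False
      then show ?thesis by (auto simp: mrg_def elim: oddE)
    qed
  qed
  have "(\<forall>x\<in>D. P x e) = sat D E (mrg e c) (All (ren ?f p))" if "range e \<subseteq> D" for e
  proof -
    have "P x e = sat D E (mrg (case_nat x e) c) p" if "x \<in> D" for x
    proof -
      have "range (case_nat x e) \<subseteq> D"
        using that \<open>range e \<subseteq> D\<close> by (auto split: nat.split simp: image_subset_iff)
      from p[OF this] show ?thesis by simp
    qed
    then show ?thesis by (simp add: sat_ren eq)
  qed
  then show ?thesis unfolding dfn_def using c by blast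
qed

lemma dfn_neg: "dfn P \<Longrightarrow> dfn (\<lambda>e. \<not> P e)"
  using dfn_imp[OF _ dfn_False, of P] by simp

lemma dfn_conj: "dfn P \<Longrightarrow> dfn Q \<Longrightarrow> dfn (\<lambda>e. P e \<and> Q e)"
  using dfn_neg[OF dfn_imp[OF _ dfn_neg, of P Q]] by simp

lemma dfn_disj: "dfn P \<Longrightarrow> dfn Q \<Longrightarrow> dfn (\<lambda>e. P e \<or> Q e)"
  using dfn_imp[OF dfn_neg, of P Q] by (rule dfn_cong[rotated]) auto

lemma dfn_iff: "dfn P \<Longrightarrow> dfn Q \<Longrightarrow> dfn (\<lambda>e. P e = Q e)"
  using dfn_conj[OF dfn_imp dfn_imp, of P Q Q P] by (rule dfn_cong[rotated]) auto

lemma dfn_Ex: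
  assumes "dfn (\<lambda>e. P (e 0) (\<lambda>i. e (Suc i)))"
  shows "dfn (\<lambda>e. \<exists>x\<in>D. P x e)"
  using dfn_neg[OF dfn_All[of "\<lambda>x e. \<not> P x e"], OF dfn_neg, OF assms] by simp

text \<open>Substituting a term into a predicate (\<open>dfn_subst\<close>) introduces a quantifier
  over its value; this is why the values have to lie in \<open>D\<close> and the graph has to be
  definable.\<close>

definition "tm t \<longleftrightarrow> (\<forall>e. range e \<subseteq> D \<longrightarrow> t e \<in> D) \<and> dfn (\<lambda>e. e 0 = t (\<lambda>i. e (Suc i)))"

lemma tmD: "tm t \<Longrightarrow> range e \<subseteq> D \<Longrightarrow> t e \<in> D"
  by (simp add: tm_def)

lemma tm_ren: "tm t \<Longrightarrow> tm (\<lambda>e. t (\<lambda>i. e (f i)))"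
  unfolding tm_def
proof (intro conjI allI impI)
  assume *: "(\<forall>e. range e \<subseteq> D \<longrightarrow> t e \<in> D) \<and> dfn (\<lambda>e. e 0 = t (\<lambda>i. e (Suc i)))"
  show "t (\<lambda>i. e (f i)) \<in> D" if "range e \<subseteq> D" for e
  proof -
    have "range (\<lambda>i. e (f i)) \<subseteq> D" using that by auto
    then show ?thesis using * by blast
  qed
  show "dfn (\<lambda>e. e 0 = t (\<lambda>i. e (Suc (f i))))"
    using dfn_ren[of "\<lambda>e. e 0 = t (\<lambda>i. e (Suc i))" "case_nat 0 (\<lambda>i. Suc (f i))"] * by simp
qed

lemma dfn_subst:
  assumes "tm t" "dfn (\<lambda>e. P (e 0) (\<lambda>i. e (Suc i)))"
  shows "dfn (\<lambda>e. P (t e) e)"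
proof (rule dfn_cong)
  show "dfn (\<lambda>e. \<exists>x\<in>D. x = t e \<and> P x e)"
    using assms by (intro dfn_Ex dfn_conj) (auto simp: tm_def)
  show "P (t e) e = (\<exists>x\<in>D. x = t e \<and> P x e)" if "range e \<subseteq> D" for e
    using tmD[OF assms(1) that] by auto
qed

lemma tm_shift: "tm t \<Longrightarrow> tm (\<lambda>e. t (\<lambda>i. e (Suc i)))" "tm t \<Longrightarrow> tm (\<lambda>e. t (\<lambda>i. e (Suc (Suc i))))"
  "tm t \<Longrightarrow> tm (\<lambda>e. t (\<lambda>i. e (Suc (Suc (Suc i)))))"
  using tm_ren[of t Suc] tm_ren[of t "\<lambda>i. Suc (Suc i)"] tm_ren[of t "\<lambda>i. Suc (Suc (Suc i))"] by auto

lemma dfn_mem: "tm t \<Longrightarrow> tm u \<Longrightarrow> dfn (\<lambda>e. t e \<epsilon> u e)"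
  apply (rule dfn_subst[of t "\<lambda>x e. x \<epsilon> u e"], assumption)
  apply (rule dfn_subst[of "\<lambda>e. u (\<lambda>i. e (Suc i))" "\<lambda>x e. e 0 \<epsilon> x"], erule tm_shift)
  apply (rule dfn_mem_var)
  done

lemma dfn_eq: "tm t \<Longrightarrow> tm u \<Longrightarrow> dfn (\<lambda>e. t e = u e)"
  apply (rule dfn_subst[of t "\<lambda>x e. x = u e"], assumption)
  apply (rule dfn_subst[of "\<lambda>e. u (\<lambda>i. e (Suc i))" "\<lambda>x e. e 0 = x"], erule tm_shift)
  apply (rule dfn_eq_var)
  done

lemma tm_var: "tm (\<lambda>e. e i)"
  unfolding tm_def using dfn_eq_var by auto

lemma tm_const: "a \<in> D \<Longrightarrow> tm (\<lambda>e. a)"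
  unfolding tm_def using dfn_eq_const by auto

lemma dfn_ball:
  assumes "tm t" "dfn (\<lambda>e. P (e 0) (\<lambda>i. e (Suc i)))"
  shows "dfn (\<lambda>e. \<forall>x. x \<epsilon> t e \<longrightarrow> P x e)"
proof (rule dfn_cong)
  show "dfn (\<lambda>e. \<forall>x\<in>D. x \<epsilon> t e \<longrightarrow> P x e)"
    by (intro dfn_All dfn_imp dfn_mem tm_var tm_shift(1)[OF assms(1)] assms(2))
  show "(\<forall>x. x \<epsilon> t e \<longrightarrow> P x e) = (\<forall>x\<in>D. x \<epsilon> t e \<longrightarrow> P x e)" if "range e \<subseteq> D" for e
    using trans[OF tmD[OF assms(1) that]] by blast
qed

lemma dfn_bex:
  assumes "tm t" "dfn (\<lambda>e. P (e 0) (\<lambda>i. e (Suc i)))"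
  shows "dfn (\<lambda>e. \<exists>x. x \<epsilon> t e \<and> P x e)"
  using dfn_neg[OF dfn_ball[of t "\<lambda>x e. \<not> P x e"], OF assms(1) dfn_neg, OF assms(2)] by simp

lemma tmI:
  assumes "\<And>e. range e \<subseteq> D \<Longrightarrow> t e \<in> D"
    and "\<And>x e. range e \<subseteq> D \<Longrightarrow> x \<in> D \<Longrightarrow> x = t e \<longleftrightarrow> Q x e"
    and "dfn (\<lambda>e. Q (e 0) (\<lambda>i. e (Suc i)))"
  shows "tm t"
  unfolding tm_def
proof (intro conjI allI impI)
  show "dfn (\<lambda>e. e 0 = t (\<lambda>i. e (Suc i)))"
  proof (rule dfn_cong[OF _ assms(3)])
    fix e :: "nat \<Rightarrow> 'a" assume "range e \<subseteq> D"
    then show "(e 0 = t (\<lambda>i. e (Suc i))) = Q (e 0) (\<lambda>i. e (Suc i))"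
      by (intro assms(2)) auto
  qed
qed (use assms(1) in auto)

named_theorems definable

lemmas [definable] = dfn_False dfn_imp dfn_All dfn_neg dfn_conj dfn_disj dfn_iff dfn_Ex dfn_mem dfn_eq
  dfn_ball dfn_bex tm_var tm_const

lemma tm_upr [definable]: "tm t \<Longrightarrow> tm u \<Longrightarrow> tm (\<lambda>e. upr (t e) (u e))"
proof (rule tmI[where Q="\<lambda>x e. \<forall>z\<in>D. z \<epsilon> x \<longleftrightarrow> z = t e \<or> z = u e"])
  assume tu: "tm t" "tm u"
  show "dfn (\<lambda>e. \<forall>z\<in>D. z \<epsilon> e 0 \<longleftrightarrow> z = t (\<lambda>i. e (Suc i)) \<or> z = u (\<lambda>i. e (Suc i)))"
    by (intro definable tm_shift(2)[OF tu(1)] tm_shift(2)[OF tu(2)])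
qed (auto simp: tmD ext_D)

lemma tm_opr [definable]: "tm t \<Longrightarrow> tm u \<Longrightarrow> tm (\<lambda>e. opr (t e) (u e))"
  unfolding opr_def by (intro tm_upr)

lemma tm_Uni [definable]: "tm t \<Longrightarrow> tm (\<lambda>e. Uni (t e))"
proof (rule tmI[where Q="\<lambda>x e. \<forall>z\<in>D. z \<epsilon> x \<longleftrightarrow> (\<exists>y. y \<epsilon> t e \<and> z \<epsilon> y)"])
  assume t: "tm t"
  show "dfn (\<lambda>e. \<forall>z\<in>D. z \<epsilon> e 0 \<longleftrightarrow> (\<exists>y. y \<epsilon> t (\<lambda>i. e (Suc i)) \<and> z \<epsilon> y))"
    by (intro definable tm_shift(2)[OF t])
qed (auto simp: tmD ext_D)

lemma tm_un2 [definable]: "tm t \<Longrightarrow> tm u \<Longrightarrow> tm (\<lambda>e. un2 (t e) (u e))"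
  unfolding un2_def by (intro tm_Uni tm_upr)

lemma tm_sc [definable]: "tm t \<Longrightarrow> tm (\<lambda>e. sc (t e))"
  unfolding sc_def by (intro tm_un2 tm_upr)

lemma tm_if [definable]:
  assumes "dfn P" "tm t" "tm u"
  shows "tm (\<lambda>e. if P e then t e else u e)"
proof (rule tmI[where Q="\<lambda>x e. (P e \<longrightarrow> x = t e) \<and> (\<not> P e \<longrightarrow> x = u e)"])
  show "dfn (\<lambda>e. (P (\<lambda>i. e (Suc i)) \<longrightarrow> e 0 = t (\<lambda>i. e (Suc i))) \<and>
      (\<not> P (\<lambda>i. e (Suc i)) \<longrightarrow> e 0 = u (\<lambda>i. e (Suc i))))"
    by (intro definable dfn_ren[OF assms(1), of Suc] tm_shift(1)[OF assms(2)] tm_shift(1)[OF assms(3)])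
qed (use assms tmD in auto)

lemma tm_app [definable]:
  assumes "tm t" "tm u"
  shows "tm (\<lambda>e. app (t e) (u e))"
proof (rule tmI[where Q="\<lambda>x e. (\<forall>z\<in>D. opr (u e) z \<epsilon> t e \<longleftrightarrow> z = x) \<or>
    \<not> (\<exists>y\<in>D. \<forall>z\<in>D. opr (u e) z \<epsilon> t e \<longleftrightarrow> z = y) \<and> x = emp"])
  fix x and e :: "nat \<Rightarrow> 'a" assume e: "range e \<subseteq> D" and x: "x \<in> D"
  let ?U = "\<lambda>y. \<forall>z\<in>D. opr (u e) z \<epsilon> t e \<longleftrightarrow> z = y"
  have "(\<forall>z. opr (u e) z \<epsilon> t e \<longleftrightarrow> z = y) \<longleftrightarrow> y \<in> D \<and> ?U y" for y
    using opr_memD2[OF _ tmD[OF assms(1) e]] by blast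
  then show "x = app (t e) (u e) \<longleftrightarrow> ?U x \<or> \<not> (\<exists>y\<in>D. ?U y) \<and> x = emp"
    unfolding app_eq using x by auto
next
  show "dfn (\<lambda>e. (\<forall>z\<in>D. opr (u (\<lambda>i. e (Suc i))) z \<epsilon> t (\<lambda>i. e (Suc i)) \<longleftrightarrow> z = e 0) \<or>
      \<not> (\<exists>y\<in>D. \<forall>z\<in>D. opr (u (\<lambda>i. e (Suc i))) z \<epsilon> t (\<lambda>i. e (Suc i)) \<longleftrightarrow> z = y) \<and> e 0 = emp)"
    by (intro definable emp_D tm_shift[OF assms(1)] tm_shift[OF assms(2)])
qed (use assms tmD in auto)

lemma dfn_sub [definable]:
  assumes "tm t" "tm u"
  shows "dfn (\<lambda>e. sub (t e) (u e))"
  unfolding sub_def by (intro definable assms tm_shift[OF assms(2)])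

lemma dfn_isf [definable]:
  assumes "tm t" "tm u"
  shows "dfn (\<lambda>e. isf (t e) (u e))"
proof (rule dfn_cong)
  show "isf (t e) (u e) \<longleftrightarrow> (\<forall>p\<in>D. p \<epsilon> t e \<longrightarrow> (\<exists>x\<in>D. \<exists>y\<in>D. x \<epsilon> u e \<and> p = opr x y)) \<and>
    (\<forall>x\<in>D. x \<epsilon> u e \<longrightarrow> (\<exists>y\<in>D. \<forall>z\<in>D. opr x z \<epsilon> t e \<longleftrightarrow> z = y))" if "range e \<subseteq> D" for e
    using isf_D tmD[OF assms(1) that] tmD[OF assms(2) that] by blast
qed (intro definable tm_shift[OF assms(1)] tm_shift[OF assms(2)])

lemma dfn_isfn [definable]:
  assumes "tm t" "tm u" "tm v"
  shows "dfn (\<lambda>e. isfn (t e) (u e) (v e))"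
proof (rule dfn_cong)
  show "dfn (\<lambda>e. isf (t e) (u e) \<and> (\<forall>x\<in>D. \<forall>y\<in>D. opr x y \<epsilon> t e \<longrightarrow> y \<epsilon> v e))"
    by (intro definable assms tm_shift[OF assms(1)] tm_shift[OF assms(3)])
  show "isfn (t e) (u e) (v e) = (isf (t e) (u e) \<and> (\<forall>x\<in>D. \<forall>y\<in>D. opr x y \<epsilon> t e \<longrightarrow> y \<epsilon> v e))"
    if "range e \<subseteq> D" for e
    unfolding isfn_def using opr_memD[OF _ tmD[OF assms(1) that]] by blast
qed

end

section \<open>Syntax and satisfaction inside a model\<close>

sublocale omset \<subseteq> univ: dom E UNIV
  by unfold_locales auto

context omset
begin

lemma isf_eqI:
  assumes "isf f d" "isf g d" "\<And>x y. x \<epsilon> d \<Longrightarrow> opr x y \<epsilon> f \<longleftrightarrow> opr x y \<epsilon> g"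
  shows "f = g"
  by (rule isf_ext[OF assms(1,2)]) (use assms(3) isf_app[OF assms(1)] isf_app[OF assms(2)] in metis)

section \<open>Standard numerals, tuples and codes\<close>

lemma mem_num: "z \<epsilon> num k \<longleftrightarrow> (\<exists>i<k. z = num i)"
  by (induction k) (auto simp: less_Suc_eq)

lemma num_irrefl: "\<not> num k \<epsilon> num k"
proof (induction k)
  case (Suc k)
  have tr: "trs (num k)" unfolding trs_def by (metis mem_num less_trans)
  show ?case
  proof
    assume "num (Suc k) \<epsilon> num (Suc k)"
    then have "sc (num k) \<epsilon> num k \<or> sc (num k) = num k" by simp
    moreover have "num k \<epsilon> sc (num k)" by simp
    ultimately have "num k \<epsilon> num k" using tr unfolding trs_def by metis
    with Suc show False by simp
  qed
qed simp

lemma num_inject [simp]: "num i = num j \<longleftrightarrow> i = j"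
  by (metis mem_num num_irrefl linorder_neqE_nat)

lemma num_mem [simp]: "num i \<epsilon> num j \<longleftrightarrow> i < j"
  by (auto simp: mem_num)

definition "tup xs = mks (map (\<lambda>i. opr (num i) (xs ! i)) [0..<length xs])"

lemma mem_tup: "p \<epsilon> tup xs \<longleftrightarrow> (\<exists>k<length xs. p = opr (num k) (xs ! k))"
  by (auto simp: tup_def)

lemma opr_tup [simp]: "opr i y \<epsilon> tup xs \<longleftrightarrow> (\<exists>k<length xs. i = num k \<and> y = xs ! k)"
  by (auto simp: mem_tup)

lemma isf_tup: "isf (tup xs) (num (length xs))"
  unfolding isf_def by (auto simp: mem_tup mem_num)

lemma app_tup [simp]: "k < length xs \<Longrightarrow> app (tup xs) (num k) = xs ! k"
  using isf_app[OF isf_tup, of "num k" xs] by auto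

lemma isfn_tup: "(\<And>x. x \<in> set xs \<Longrightarrow> x \<epsilon> A) \<Longrightarrow> length xs = n \<Longrightarrow> isfn (tup xs) (num n) A"
  unfolding isfn_def using isf_tup by auto

text \<open>\<open>num k\<close> has just \<open>k\<close> members even if \<open>om\<close> is
  nonstandard, so an internal function on it is given by a real list.\<close>

lemma isf_num: "isf t (num k) \<Longrightarrow> t = tup (map (\<lambda>i. app t (num i)) [0..<k])"
  by (rule isf_ext[of _ "num k"]) (use isf_tup[of "map (\<lambda>i. app t (num i)) [0..<k]"] in \<open>auto simp: mem_num\<close>)

lemma tup_inject: "length xs = length ys \<Longrightarrow> tup xs = tup ys \<longleftrightarrow> xs = ys"
  by (metis app_tup nth_equalityI)

definition "cvar i = opr (num 0) i"
definition "ceq t u = opr (num 0) (opr t u)"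
definition "crel R t = opr (num 1) (opr R t)"
definition "cfls = opr (num 2) emp"
definition "cimp p q = opr (num 3) (opr p q)"
definition "call i p = opr (num 4) (opr i p)"

lemma codes_distinct [simp]:
  "ceq t u \<noteq> crel R t'" "ceq t u \<noteq> cfls" "ceq t u \<noteq> cimp p q" "ceq t u \<noteq> call i p"
  "crel R t' \<noteq> ceq t u" "crel R t' \<noteq> cfls" "crel R t' \<noteq> cimp p q" "crel R t' \<noteq> call i p"
  "cfls \<noteq> ceq t u" "cfls \<noteq> crel R t'" "cfls \<noteq> cimp p q" "cfls \<noteq> call i p"
  "cimp p q \<noteq> ceq t u" "cimp p q \<noteq> crel R t'" "cimp p q \<noteq> cfls" "cimp p q \<noteq> call i p"
  "call i p \<noteq> ceq t u" "call i p \<noteq> crel R t'" "call i p \<noteq> cfls" "call i p \<noteq> cimp p' q"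
  unfolding ceq_def crel_def cfls_def cimp_def call_def opr_inject num_inject by simp_all

lemma codes_inject [simp]: "cvar i = cvar j \<longleftrightarrow> i = j" "ceq t u = ceq t' u' \<longleftrightarrow> t = t' \<and> u = u'"
  "crel R t = crel R' t' \<longleftrightarrow> R = R' \<and> t = t'" "cimp p q = cimp p' q' \<longleftrightarrow> p = p' \<and> q = q'"
  "call i p = call j p' \<longleftrightarrow> i = j \<and> p = p'"
  by (auto simp: cvar_def ceq_def crel_def cimp_def call_def)

lemma ev_tag1: "x < n \<Longrightarrow> y < n \<Longrightarrow> lsat UNIV E g n e (tag1 k x y) = (e x = opr (num k) (e y))"
  by (simp add: tag1_def)

lemma ev_tag2: "x < n \<Longrightarrow> y < n \<Longrightarrow> z < n \<Longrightarrow>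
    lsat UNIV E g n e (tag2 k x y z) = (e x = opr (num k) (opr (e y) (e z)))"
  by (simp add: tag2_def ev_tag1)

lemma ev_codes [simp]:
  "x < n \<Longrightarrow> i < n \<Longrightarrow> lsat UNIV E g n e (code_var x i) = (e x = cvar (e i))"
  "x < n \<Longrightarrow> i < n \<Longrightarrow> j < n \<Longrightarrow> lsat UNIV E g n e (code_eq x i j) = (e x = ceq (e i) (e j))"
  "x < n \<Longrightarrow> i < n \<Longrightarrow> j < n \<Longrightarrow> lsat UNIV E g n e (code_rel x i j) = (e x = crel (e i) (e j))"
  "x < n \<Longrightarrow> lsat UNIV E g n e (code_fls x) = (e x = cfls)"
  "x < n \<Longrightarrow> i < n \<Longrightarrow> j < n \<Longrightarrow> lsat UNIV E g n e (code_imp x i j) = (e x = cimp (e i) (e j))"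
  "x < n \<Longrightarrow> i < n \<Longrightarrow> j < n \<Longrightarrow> lsat UNIV E g n e (code_all x i j) = (e x = call (e i) (e j))"
  by (simp_all only: code_var_def code_eq_def code_rel_def code_imp_def code_all_def
      cvar_def ceq_def crel_def cimp_def call_def ev_tag1 ev_tag2)
    (simp add: code_fls_def cfls_def ev_tag1)

lemma ev_is_term:
  assumes "g' < n" "ar < n" "W < n" "x < n" "e g' = emp"
  shows "lsat UNIV E g n e (is_term g' ar W x) \<longleftrightarrow> (\<exists>j. j \<epsilon> e W \<and> e x = cvar j)" (is "?l \<longleftrightarrow> ?r")
proof -
  have "?l \<longleftrightarrow> (\<exists>m b. m \<epsilon> om \<and> isf b (sc m) \<and> opr m (e x) \<epsilon> b \<and>
      (\<forall>i y. opr i y \<epsilon> b \<longrightarrow> (\<exists>j. j \<epsilon> e W \<and> y = cvar j)))"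
    using assms by (simp add: is_term_def)
  also have "\<dots> \<longleftrightarrow> ?r"
  proof
    assume ?r
    then obtain j where "j \<epsilon> e W" "e x = cvar j" by blast
    \<comment> \<open>A variable alone is a formation sequence of length one, whose last entry has
      index \<open>emp\<close>.\<close>
    then show "\<exists>m b. m \<epsilon> om \<and> isf b (sc m) \<and> opr m (e x) \<epsilon> b \<and>
        (\<forall>i y. opr i y \<epsilon> b \<longrightarrow> (\<exists>j. j \<epsilon> e W \<and> y = cvar j))"
      using isf_tup[of "[e x]"] by (intro exI[of _ emp] exI[of _ "tup [e x]"]) auto
  qed blast
  finally show ?thesis .
qed

definition "isform r ar W x \<longleftrightarrow> (\<exists>m b. m \<epsilon> om \<and> isf b (sc m) \<and> opr m x \<epsilon> b \<and>
  (\<forall>i y. opr i y \<epsilon> b \<longrightarrow>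
     (\<exists>t u. (\<exists>j. j \<epsilon> W \<and> t = cvar j) \<and> (\<exists>j. j \<epsilon> W \<and> u = cvar j) \<and> y = ceq t u) \<or>
     (\<exists>R k t. R \<epsilon> r \<and> opr R k \<epsilon> ar \<and> isf t k \<and> y = crel R t \<and>
        (\<forall>j z. opr j z \<epsilon> t \<longrightarrow> (\<exists>i. i \<epsilon> W \<and> z = cvar i))) \<or>
     y = cfls \<or>
     (\<exists>i' j' p q. i' \<epsilon> i \<and> j' \<epsilon> i \<and> opr i' p \<epsilon> b \<and> opr j' q \<epsilon> b \<and> y = cimp p q) \<or>
     (\<exists>j i' p. j \<epsilon> W \<and> i' \<epsilon> i \<and> opr i' p \<epsilon> b \<and> y = call j p)))"

lemma ev_is_formula:
  assumes "r < n" "g' < n" "ar < n" "W < n" "x < n" "e g' = emp"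
  shows "lsat UNIV E g n e (is_formula r g' ar W x) \<longleftrightarrow> isform (e r) (e ar) (e W) (e x)"
  using assms by (simp add: is_formula_def isform_def ev_is_term)

text \<open>Codes generated outside the model. A nonstandard \<open>om\<close> may admit formation
  sequences that are not of this kind, so \<open>fmc\<close> can be strictly stronger than
  \<open>isform\<close>.\<close>

inductive fmc :: "'a \<Rightarrow> 'a \<Rightarrow> 'a \<Rightarrow> 'a \<Rightarrow> bool" for r ar W where
  fmc_eq: "j \<epsilon> W \<Longrightarrow> k \<epsilon> W \<Longrightarrow> fmc r ar W (ceq (cvar j) (cvar k))"
| fmc_rel: "R \<epsilon> r \<Longrightarrow> opr R k \<epsilon> ar \<Longrightarrow> isf t k \<Longrightarrow> (\<And>j z. opr j z \<epsilon> t \<Longrightarrow> \<exists>i. i \<epsilon> W \<and> z = cvar i) \<Longrightarrow>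
    fmc r ar W (crel R t)"
| fmc_fls: "fmc r ar W cfls"
| fmc_imp: "fmc r ar W p \<Longrightarrow> fmc r ar W q \<Longrightarrow> fmc r ar W (cimp p q)"
| fmc_all: "j \<epsilon> W \<Longrightarrow> fmc r ar W p \<Longrightarrow> fmc r ar W (call j p)"

definition "lstep r ar W ps y \<longleftrightarrow>
  (\<exists>t u. (\<exists>j. j \<epsilon> W \<and> t = cvar j) \<and> (\<exists>j. j \<epsilon> W \<and> u = cvar j) \<and> y = ceq t u) \<or>
  (\<exists>R k t. R \<epsilon> r \<and> opr R k \<epsilon> ar \<and> isf t k \<and> y = crel R t \<and>
     (\<forall>j z. opr j z \<epsilon> t \<longrightarrow> (\<exists>i. i \<epsilon> W \<and> z = cvar i))) \<or>
  y = cfls \<or> (\<exists>p\<in>set ps. \<exists>q\<in>set ps. y = cimp p q) \<or> (\<exists>j. j \<epsilon> W \<and> (\<exists>p\<in>set ps. y = call j p))"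

inductive fseq :: "'a \<Rightarrow> 'a \<Rightarrow> 'a \<Rightarrow> 'a list \<Rightarrow> bool" for r ar W where
  fseq_Nil: "fseq r ar W []"
| fseq_snoc: "fseq r ar W ps \<Longrightarrow> lstep r ar W ps y \<Longrightarrow> fseq r ar W (ps @ [y])"

text \<open>A formation step stays correct when more earlier entries are at its disposal.
  Concatenation then joins the sequences of the two sides of an implication.\<close>

lemma fseq_append: "fseq r ar W qs \<Longrightarrow> fseq r ar W ps \<Longrightarrow> fseq r ar W (ps @ qs)"
proof (induction rule: fseq.induct)
  case (fseq_snoc qs y)
  have "lstep r ar W (ps @ qs) y"
    using fseq_snoc.hyps(2) unfolding lstep_def set_append by blast
  with fseq_snoc show ?case
    using fseq.fseq_snoc[of r ar W "ps @ qs" y] by simp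
qed simp

lemma fseq_nth: "fseq r ar W xs \<Longrightarrow> k < length xs \<Longrightarrow> lstep r ar W (take k xs) (xs ! k)"
  by (induction rule: fseq.induct) (auto simp: nth_append less_Suc_eq)

lemma fmc_fseq: "fmc r ar W x \<Longrightarrow> \<exists>ps. fseq r ar W (ps @ [x])"
proof (induction rule: fmc.induct)
  case (fmc_imp p q)
  then obtain ps qs where "fseq r ar W ((ps @ [p]) @ (qs @ [q]))" using fseq_append by blast
  then have "fseq r ar W (((ps @ [p]) @ (qs @ [q])) @ [cimp p q])"
    by (rule fseq_snoc) (auto simp: lstep_def)
  then show ?case by blast
next
  case (fmc_all j p)
  then obtain ps where "fseq r ar W (ps @ [p])" by blast
  then have "fseq r ar W ((ps @ [p]) @ [call j p])"
    by (rule fseq_snoc) (use fmc_all(1) in \<open>auto simp: lstep_def\<close>)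
  then show ?case by blast
next
  case (fmc_eq j k)
  then have "fseq r ar W ([] @ [ceq (cvar j) (cvar k)])"
    by (intro fseq_snoc fseq_Nil) (auto simp: lstep_def)
  then show ?case by blast
next
  case (fmc_rel R k t)
  then have "fseq r ar W ([] @ [crel R t])"
    by (intro fseq_snoc fseq_Nil) (auto simp: lstep_def)
  then show ?case by blast
next
  case fmc_fls
  have "fseq r ar W ([] @ [cfls])"
    by (intro fseq_snoc fseq_Nil) (auto simp: lstep_def)
  then show ?case by blast
qed

text \<open>The external list becomes the internal sequence \<open>tup\<close>, with the standard
  numeral \<open>num (length ps)\<close> as index of the last entry.\<close>

lemma fmc_isform:
  assumes "fmc r ar W x"
  shows "isform r ar W x"
proof -
  obtain ps where ps: "fseq r ar W (ps @ [x])" using fmc_fseq[OF assms] by blast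
  let ?xs = "ps @ [x]"
  have "isf (tup ?xs) (sc (num (length ps)))" using isf_tup[of ?xs] by simp
  moreover have "opr (num (length ps)) x \<epsilon> tup ?xs" by (auto intro!: exI[of _ "length ps"])
  moreover have "(\<exists>t u. (\<exists>j. j \<epsilon> W \<and> t = cvar j) \<and> (\<exists>j. j \<epsilon> W \<and> u = cvar j) \<and> y = ceq t u) \<or>
     (\<exists>R k t. R \<epsilon> r \<and> opr R k \<epsilon> ar \<and> isf t k \<and> y = crel R t \<and>
        (\<forall>j z. opr j z \<epsilon> t \<longrightarrow> (\<exists>i. i \<epsilon> W \<and> z = cvar i))) \<or>
     y = cfls \<or>
     (\<exists>i' j' p q. i' \<epsilon> i \<and> j' \<epsilon> i \<and> opr i' p \<epsilon> tup ?xs \<and> opr j' q \<epsilon> tup ?xs \<and> y = cimp p q) \<or>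
     (\<exists>j i' p. j \<epsilon> W \<and> i' \<epsilon> i \<and> opr i' p \<epsilon> tup ?xs \<and> y = call j p)"
    if iy: "opr i y \<epsilon> tup ?xs" for i y
  proof -
    obtain k where k: "k < length ?xs" "i = num k" "y = ?xs ! k" using iy unfolding opr_tup by blast
    have prev: "\<exists>i'. i' \<epsilon> i \<and> opr i' p \<epsilon> tup ?xs" if "p \<in> set (take k ?xs)" for p
    proof -
      obtain l where "l < k" "l < length ?xs" "p = ?xs ! l"
        using \<open>p \<in> set (take k ?xs)\<close> by (auto simp: in_set_conv_nth simp del: take_append)
      then show ?thesis unfolding opr_tup using k(2) num_mem by blast
    qed
    have st: "lstep r ar W (take k ?xs) y" using fseq_nth[OF ps k(1)] k(3) by simp
    consider p q where "p \<in> set (take k ?xs)" "q \<in> set (take k ?xs)" "y = cimp p q"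
      | j p where "j \<epsilon> W" "p \<in> set (take k ?xs)" "y = call j p"
      | "\<not> (\<exists>p\<in>set (take k ?xs). \<exists>q\<in>set (take k ?xs). y = cimp p q)"
        "\<not> (\<exists>j. j \<epsilon> W \<and> (\<exists>p\<in>set (take k ?xs). y = call j p))"
      by blast
    then show ?thesis
    proof cases
      case 1
      obtain i' j' where "i' \<epsilon> i" "opr i' p \<epsilon> tup ?xs" "j' \<epsilon> i" "opr j' q \<epsilon> tup ?xs"
        using prev[OF 1(1)] prev[OF 1(2)] by blast
      then show ?thesis using 1(3) by blast
    next
      case 2
      obtain i' where "i' \<epsilon> i" "opr i' p \<epsilon> tup ?xs" using prev[OF 2(2)] by blast
      then show ?thesis using 2(1,3) by blast
    next
      case 3
      \<comment> \<open>The first three alternatives of \<open>lstep\<close> occur literally in the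
        goal, and the other two are excluded in this case.\<close>
      have "A \<or> B \<or> C \<or> X \<or> Y" if "A \<or> B \<or> C \<or> X' \<or> Y'" "\<not> X'" "\<not> Y'" for A B C X Y X' Y'
        using that by blast
      from this[OF st[unfolded lstep_def] 3] show ?thesis .
    qed
  qed
  ultimately show ?thesis unfolding isform_def using num_om by blast
qed

section \<open>Internal satisfaction\<close>

definition "vtup V k t s u \<longleftrightarrow> isf u k \<and> (\<forall>j z. opr j z \<epsilon> u \<longleftrightarrow> (\<exists>q. opr j q \<epsilon> t \<and> opr (opr q s) z \<epsilon> V))"

definition "satrec r ar A I n V S \<longleftrightarrow> (\<forall>x s. isform r ar n x \<and> isfn s n A \<longrightarrow>
  (\<forall>t u. x = ceq t u \<longrightarrow> (opr x s \<epsilon> S \<longleftrightarrow> (\<exists>y. opr (opr t s) y \<epsilon> V \<and> opr (opr u s) y \<epsilon> V))) \<and>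
  (\<forall>R t k X. x = crel R t \<and> opr R k \<epsilon> ar \<and> opr R X \<epsilon> I \<longrightarrow>
     (opr x s \<epsilon> S \<longleftrightarrow> (\<exists>u. vtup V k t s u \<and> u \<epsilon> X))) \<and>
  (x = cfls \<longrightarrow> \<not> opr x s \<epsilon> S) \<and>
  (\<forall>p q. x = cimp p q \<longrightarrow> (opr x s \<epsilon> S \<longleftrightarrow> (opr p s \<epsilon> S \<longrightarrow> opr q s \<epsilon> S))) \<and>
  (\<forall>i p. x = call i p \<longrightarrow> (opr x s \<epsilon> S \<longleftrightarrow>
     (\<forall>a s'. a \<epsilon> A \<and> isfn s' n A \<and> (\<forall>j y. opr j y \<epsilon> s' \<longleftrightarrow> j = i \<and> y = a \<or> \<not> j = i \<and> opr j y \<epsilon> s) \<longrightarrow>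
        opr p s' \<epsilon> S))))"

lemma satrecD:
  assumes "satrec r ar A I n V S" "isfn s n A"
  shows "isform r ar n (ceq t u) \<Longrightarrow> opr (ceq t u) s \<epsilon> S \<longleftrightarrow>
      (\<exists>y. opr (opr t s) y \<epsilon> V \<and> opr (opr u s) y \<epsilon> V)"
    and "isform r ar n (crel R t) \<Longrightarrow> opr R k \<epsilon> ar \<Longrightarrow> opr R X \<epsilon> I \<Longrightarrow>
      opr (crel R t) s \<epsilon> S \<longleftrightarrow> (\<exists>u. vtup V k t s u \<and> u \<epsilon> X)"
    and "isform r ar n cfls \<Longrightarrow> \<not> opr cfls s \<epsilon> S"
    and "isform r ar n (cimp p q) \<Longrightarrow> opr (cimp p q) s \<epsilon> S \<longleftrightarrow> (opr p s \<epsilon> S \<longrightarrow> opr q s \<epsilon> S)"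
    and "isform r ar n (call i p) \<Longrightarrow> opr (call i p) s \<epsilon> S \<longleftrightarrow>
      (\<forall>a s'. a \<epsilon> A \<and> isfn s' n A \<and> (\<forall>j y. opr j y \<epsilon> s' \<longleftrightarrow> j = i \<and> y = a \<or> \<not> j = i \<and> opr j y \<epsilon> s) \<longrightarrow>
        opr p s' \<epsilon> S)"
proof -
  note * = assms(1)[unfolded satrec_def, THEN spec, THEN spec[of _ s], THEN mp, OF conjI[OF _ assms(2)]]
  show "isform r ar n (ceq t u) \<Longrightarrow> opr (ceq t u) s \<epsilon> S \<longleftrightarrow>
      (\<exists>y. opr (opr t s) y \<epsilon> V \<and> opr (opr u s) y \<epsilon> V)"
    by (drule *, elim conjE, drule spec, drule spec, erule mp) (rule refl)
  show "isform r ar n (crel R t) \<Longrightarrow> opr R k \<epsilon> ar \<Longrightarrow> opr R X \<epsilon> I \<Longrightarrow>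
      opr (crel R t) s \<epsilon> S \<longleftrightarrow> (\<exists>u. vtup V k t s u \<and> u \<epsilon> X)"
    by (drule *, elim conjE, erule allE[of _ R], erule allE[of _ t], erule allE[of _ k], erule allE[of _ X])
      simp
  show "isform r ar n cfls \<Longrightarrow> \<not> opr cfls s \<epsilon> S"
    by (drule *, elim conjE, erule mp) (rule refl)
  show "isform r ar n (cimp p q) \<Longrightarrow> opr (cimp p q) s \<epsilon> S \<longleftrightarrow> (opr p s \<epsilon> S \<longrightarrow> opr q s \<epsilon> S)"
    by (drule *, elim conjE) (simp only: codes_inject simp_thms all_simps)
  show "isform r ar n (call i p) \<Longrightarrow> opr (call i p) s \<epsilon> S \<longleftrightarrow>
      (\<forall>a s'. a \<epsilon> A \<and> isfn s' n A \<and> (\<forall>j y. opr j y \<epsilon> s' \<longleftrightarrow> j = i \<and> y = a \<or> \<not> j = i \<and> opr j y \<epsilon> s) \<longrightarrow>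
        opr p s' \<epsilon> S)"
    by (drule *, elim conjE, erule allE[of _ i], erule allE[of _ p], erule mp) (rule refl)
qed

definition "issat r ar A I n S \<longleftrightarrow> (\<exists>V.
  (\<forall>s. isfn s n A \<longrightarrow> (\<forall>i y. i \<epsilon> n \<longrightarrow> (opr (opr (cvar i) s) y \<epsilon> V \<longleftrightarrow> opr i y \<epsilon> s))) \<and>
  satrec r ar A I n V S)"

lemma ev_val [simp]: "V < n \<Longrightarrow> t < n \<Longrightarrow> s < n \<Longrightarrow> y < n \<Longrightarrow>
    lsat UNIV E g n e (val V t s y) = (opr (opr (e t) (e s)) (e y) \<epsilon> e V)"
  by (simp add: val_def)

lemma ev_val_tuple [simp]: "V < n \<Longrightarrow> k < n \<Longrightarrow> t < n \<Longrightarrow> s < n \<Longrightarrow> u < n \<Longrightarrow>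
    lsat UNIV E g n e (val_tuple V k t s u) = vtup (e V) (e k) (e t) (e s) (e u)"
  by (simp add: val_tuple_def vtup_def)

lemma ev_is_evaluation:
  assumes "g' < n" "ar < n" "A < n" "I < n" "k < n" "V < n" "e g' = emp"
    and "lsat UNIV E g n e (is_evaluation g' ar A I k V)"
  shows "\<forall>s. isfn s (e k) (e A) \<longrightarrow> (\<forall>i y. i \<epsilon> e k \<longrightarrow> (opr (opr (cvar i) s) y \<epsilon> e V \<longleftrightarrow> opr i y \<epsilon> s))"
  using assms by (simp add: is_evaluation_def)

lemma ev_is_update [simp]: "s' < n \<Longrightarrow> s < n \<Longrightarrow> i < n \<Longrightarrow> a < n \<Longrightarrow>
    lsat UNIV E g n e (is_update s' s i a) \<longleftrightarrow>
    (\<forall>j y. opr j y \<epsilon> e s' \<longleftrightarrow> j = e i \<and> y = e a \<or> \<not> j = e i \<and> opr j y \<epsilon> e s)"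
  by (simp add: is_update_def)

lemma ev_is_satisfaction:
  assumes "r < n" "g' < n" "ar < n" "A < n" "I < n" "k < n" "S < n" "e g' = emp"
    and "lsat UNIV E g n e (is_satisfaction r g' ar A I k S)"
  shows "issat (e r) (e ar) (e A) (e I) (e k) (e S)"
proof -
  have "\<exists>V. lsat UNIV E g (Suc n) (e(n := V)) (is_evaluation g' ar A I k n) \<and>
      satrec (e r) (e ar) (e A) (e I) (e k) V (e S)"
    using assms by (simp add: is_satisfaction_def ev_is_formula satrec_def del: disj_not1)
  then obtain V where "lsat UNIV E g (Suc n) (e(n := V)) (is_evaluation g' ar A I k n)"
    and S: "satrec (e r) (e ar) (e A) (e I) (e k) V (e S)" by blast
  from ev_is_evaluation[OF _ _ _ _ _ _ _ this(1)] assms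
  have "\<forall>s. isfn s (e k) (e A) \<longrightarrow> (\<forall>i y. i \<epsilon> e k \<longrightarrow> (opr (opr (cvar i) s) y \<epsilon> V \<longleftrightarrow> opr i y \<epsilon> s))"
    by simp
  with S show ?thesis unfolding issat_def by blast
qed

lemma vtup_tup:
  assumes V: "\<forall>s. isfn s (num n) A \<longrightarrow> (\<forall>i y. i \<epsilon> num n \<longrightarrow> (opr (opr (cvar i) s) y \<epsilon> V \<longleftrightarrow> opr i y \<epsilon> s))"
    and s: "isfn s (num n) A" and "\<And>i. i \<in> set is \<Longrightarrow> i < n"
  shows "vtup V (num (length is)) (tup (map (\<lambda>i. cvar (num i)) is)) s u \<longleftrightarrow>
    u = tup (map (\<lambda>i. app s (num i)) is)" (is "?l \<longleftrightarrow> u = ?u")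
proof -
  have val: "opr (opr (cvar (num i)) s) y \<epsilon> V \<longleftrightarrow> y = app s (num i)" if "i < n" for i y
    using V s isfn_app[OF s, of "num i" y] that by auto
  have mem: "(\<exists>q. opr j q \<epsilon> tup (map (\<lambda>i. cvar (num i)) is) \<and> opr (opr q s) z \<epsilon> V) \<longleftrightarrow> opr j z \<epsilon> ?u" for j z
    using val assms(3) by auto
  show ?thesis
  proof
    assume ?l
    then have "isf u (num (length is))" "\<And>j z. opr j z \<epsilon> u \<longleftrightarrow> opr j z \<epsilon> ?u"
      unfolding vtup_def mem by auto
    then show "u = ?u"
      using isf_tup[of "map (\<lambda>i. app s (num i)) is"] by (intro isf_eqI[of u "num (length is)"]) auto
  next
    assume "u = ?u"
    then show ?l unfolding vtup_def mem using isf_tup[of "map (\<lambda>i. app s (num i)) is"] by simp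
  qed
qed

section \<open>Templates inside the model and their truth\<close>

primrec ctmpl :: "template \<Rightarrow> 'a \<Rightarrow> 'a" where
  "ctmpl (TMem i j) h = crel emp (tup [cvar (num i), cvar (num j)])"
| "ctmpl (TEq i j) h = ceq (cvar (num i)) (cvar (num j))"
| "ctmpl TFls h = cfls"
| "ctmpl (TImp T U) h = cimp (ctmpl T h) (ctmpl U h)"
| "ctmpl (TAll i T) h = call (num i) (ctmpl T h)"
| "ctmpl THole h = h"

lemma num2: "num 2 = sc (sc emp)"
  by (simp add: numeral_2_eq_2)

lemma tup2_iff: "isf t (sc (sc emp)) \<and> opr emp x \<epsilon> t \<and> opr (sc emp) y \<epsilon> t \<longleftrightarrow> t = tup [x, y]"
proof
  assume *: "isf t (sc (sc emp)) \<and> opr emp x \<epsilon> t \<and> opr (sc emp) y \<epsilon> t"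
  then have "app t emp = x" "app t (sc emp) = y"
    using isf_app[of t "sc (sc emp)" emp x] isf_app[of t "sc (sc emp)" "sc emp" y] by auto
  then show "t = tup [x, y]" using isf_num[of t 2] * by (simp add: num2 numeral_2_eq_2)
next
  assume "t = tup [x, y]"
  then show "isf t (sc (sc emp)) \<and> opr emp x \<epsilon> t \<and> opr (sc emp) y \<epsilon> t"
    using isf_tup[of "[x, y]"] by (auto intro: exI[of _ 0] exI[of _ 1])
qed

lemma ev_is_pair_tuple [simp]: "t < n \<Longrightarrow> x < n \<Longrightarrow> y < n \<Longrightarrow>
    lsat UNIV E g n e (is_pair_tuple t x y) = (e t = tup [e x, e y])"
  by (simp add: is_pair_tuple_def num2 tup2_iff)

lemma ev_code_vnum [simp]: "x < n \<Longrightarrow> lsat UNIV E g n e (code_vnum x i) = (e x = cvar (num i))"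
  by (simp add: code_vnum_def)

lemma ev_code_template [simp]:
  "h < n \<Longrightarrow> x < n \<Longrightarrow> lsat UNIV E g n e (code_template T h x) = (e x = ctmpl T (e h))"
  by (induction T arbitrary: n e x) simp_all

lemma lsat_foldr_disj:
  "lsat D E' g n e (foldr (\<lambda>T F. G T \<^bold>\<or> F) Ts fls) = (\<exists>T\<in>set Ts. lsat D E' g n e (G T))"
  by (induction Ts) auto

lemma ev_is_zfc_axiom:
  assumes "r < n" "g' < n" "ar < n" "x < n" "e g' = emp"
  shows "lsat UNIV E g n e (is_zfc_axiom r g' ar x) \<longleftrightarrow>
    (\<exists>W h. (\<forall>k. k \<epsilon> W \<longleftrightarrow> k \<epsilon> om \<and> k \<noteq> num 3 \<and> k \<noteq> num 4) \<and> isform (e r) (e ar) W h \<and>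
      (\<exists>T\<in>set zfc_axs. e x = ctmpl T h))"
  using assms by (simp add: is_zfc_axiom_def ev_is_formula lsat_foldr_disj del: set_simps)

primrec tvars :: "template \<Rightarrow> nat set" where
  "tvars (TMem i j) = {i, j}"
| "tvars (TEq i j) = {i, j}"
| "tvars TFls = {}"
| "tvars (TImp T U) = tvars T \<union> tvars U"
| "tvars (TAll i T) = insert i (tvars T)"
| "tvars THole = {}"

primrec nohole :: "template \<Rightarrow> bool" where
  "nohole (TMem i j) = True"
| "nohole (TEq i j) = True"
| "nohole TFls = True"
| "nohole (TImp T U) = (nohole T \<and> nohole U)"
| "nohole (TAll i T) = nohole T"
| "nohole THole = False"

text \<open>Filling the hole with a template turns an instance of a scheme into a single template
  without a hole, to which the induction in \<open>truth\<close> applies.\<close>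

primrec tsub :: "template \<Rightarrow> template \<Rightarrow> template" where
  "tsub (TMem i j) Q = TMem i j"
| "tsub (TEq i j) Q = TEq i j"
| "tsub TFls Q = TFls"
| "tsub (TImp T U) Q = TImp (tsub T Q) (tsub U Q)"
| "tsub (TAll i T) Q = TAll i (tsub T Q)"
| "tsub THole Q = Q"

text \<open>De Bruijn formulas as templates without a hole: bound variables are named \<open>N, N + 1, \<dots>\<close>.\<close>

primrec nm :: "fm \<Rightarrow> (nat \<Rightarrow> nat) \<Rightarrow> nat \<Rightarrow> template" where
  "nm (Mem i j) v N = TMem (v i) (v j)"
| "nm (Eq i j) v N = TEq (v i) (v j)"
| "nm Fls v N = TFls"
| "nm (Imp p q) v N = TImp (nm p v N) (nm q v N)"
| "nm (All p) v N = TAll N (nm p (case_nat N v) (Suc N))"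

lemma finite_tvars [simp]: "finite (tvars T)"
  by (induction T) auto

lemma nohole_nm [simp]: "nohole (nm p v N)"
  by (induction p arbitrary: v N) auto

lemma nohole_tsub [simp]: "nohole Q \<Longrightarrow> nohole (tsub T Q)"
  by (induction T) auto

lemma ctmpl_tsub: "ctmpl (tsub T Q) h = ctmpl T (ctmpl Q h)"
  by (induction T) auto

lemma nsat_tsub: "nsat D E' H s (tsub T Q) = nsat D E' (\<lambda>s. nsat D E' H s Q) s T"
  by (induction T arbitrary: s) auto

lemma tvars_nm: "tvars (nm p v N) \<subseteq> v ` fv p \<union> {N..}"
proof (induction p arbitrary: v N)
  case (Imp p q)
  show ?case using Imp.IH(1)[of v N] Imp.IH(2)[of v N] by auto
next
  case (All p)
  have "case_nat N v ` fv p \<subseteq> v ` fv (All p) \<union> {N}"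
  proof
    fix k assume "k \<in> case_nat N v ` fv p"
    then obtain i where "i \<in> fv p" "k = case_nat N v i" by blast
    then show "k \<in> v ` fv (All p) \<union> {N}" by (cases i) auto
  qed
  moreover have "{Suc N..} \<subseteq> {N..}" by auto
  ultimately have "tvars (nm p (case_nat N v) (Suc N)) \<subseteq> v ` fv (All p) \<union> {N..}"
    using All.IH[of "case_nat N v" "Suc N"] by fastforce
  then show ?case by simp
qed auto

lemma nsat_nm: "(\<And>i. i \<in> fv p \<Longrightarrow> v i < N) \<Longrightarrow> nsat D E' H s (nm p v N) = sat D E' (s \<circ> v) p"
proof (induction p arbitrary: s v N)
  case (Imp p q)
  have "nsat D E' H s (nm p v N) = sat D E' (s \<circ> v) p" by (rule Imp.IH) (simp add: Imp.prems)
  moreover have "nsat D E' H s (nm q v N) = sat D E' (s \<circ> v) q" by (rule Imp.IH) (simp add: Imp.prems)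
  ultimately show ?case by (simp only: nm.simps nsat.simps sat.simps)
next
  case (All p)
  have "nsat D E' H (s(N := a)) (nm p (case_nat N v) (Suc N)) = sat D E' (case_nat a (s \<circ> v)) p" for a
  proof -
    have "nsat D E' H (s(N := a)) (nm p (case_nat N v) (Suc N)) = sat D E' (s(N := a) \<circ> case_nat N v) p"
    proof (rule All.IH)
      fix i assume "i \<in> fv p"
      then show "case_nat N v i < Suc N" using All.prems[of "i - 1"] by (cases i) auto
    qed
    also have "\<dots> = sat D E' (case_nat a (s \<circ> v)) p"
    proof (rule sat_cong)
      fix i assume "i \<in> fv p"
      then show "(s(N := a) \<circ> case_nat N v) i = case_nat a (s \<circ> v) i"
        using All.prems[of "i - 1"] by (cases i) auto
    qed
    finally show ?thesis .
  qed
  then show ?case by (simp only: nm.simps nsat.simps sat.simps)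
qed auto

lemma nsat_cong:
  "nohole T \<Longrightarrow> (\<And>i. i \<in> tvars T \<Longrightarrow> s i = s' i) \<Longrightarrow> nsat D E' H s T = nsat D E' H s' T"
proof (induction T arbitrary: s s')
  case (TImp T U)
  have "nsat D E' H s T = nsat D E' H s' T" by (rule TImp.IH) (use TImp.prems in auto)
  moreover have "nsat D E' H s U = nsat D E' H s' U" by (rule TImp.IH) (use TImp.prems in auto)
  ultimately show ?case by simp
next
  case (TAll i T)
  have "nsat D E' H (s(i := a)) T = nsat D E' H (s'(i := a)) T" for a
    by (rule TAll.IH) (use TAll.prems in auto)
  then show ?case by simp
qed auto

abbreviation "eps_r \<equiv> upr emp emp"
abbreviation "eps_ar \<equiv> upr (opr emp (num 2)) (opr emp (num 2))"

lemma fmc_ctmpl: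
  "nohole Q \<Longrightarrow> (\<And>i. i \<in> tvars Q \<Longrightarrow> num i \<epsilon> W) \<Longrightarrow> fmc eps_r eps_ar W (ctmpl Q h)"
proof (induction Q)
  case (TMem i j)
  show ?case unfolding ctmpl.simps
  proof (rule fmc_rel[of _ _ "num 2"])
    show "isf (tup [cvar (num i), cvar (num j)]) (num 2)"
      using isf_tup[of "[cvar (num i), cvar (num j)]"] by (simp add: num2)
    show "\<exists>i'. i' \<epsilon> W \<and> z = cvar i'" if "opr k z \<epsilon> tup [cvar (num i), cvar (num j)]" for k z
      using that TMem.prems(2) by (auto simp: less_Suc_eq)
  qed auto
qed (auto intro: fmc_eq fmc_fls fmc_imp fmc_all)

text \<open>An updated assignment is determined by the new value \<open>a\<close>; this removes the
  quantifier over assignments from the internal clause for universal formulas.\<close>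

lemma all_unique:
  "(\<And>a s'. A a \<Longrightarrow> P a s' \<longleftrightarrow> s' = t a) \<Longrightarrow> (\<forall>a s'. A a \<and> P a s' \<longrightarrow> Q s') \<longleftrightarrow> (\<forall>a. A a \<longrightarrow> Q (t a))"
  by metis

text \<open>Induction outside the model on the standard formula \<open>Q\<close>, with one internal
  Tarski clause for each connective. \<open>N\<close> bounds the bound variables as well, because
  internal assignments are functions on \<open>num N\<close> and have to be updated at them.\<close>

lemma truth:
  assumes sat: "issat eps_r eps_ar M I (num N) S"
    and I: "opr emp X \<epsilon> I" "\<And>t. t \<epsilon> X \<longleftrightarrow> (\<exists>x y. x \<epsilon> M \<and> y \<epsilon> M \<and> x \<epsilon> y \<and> t = tup [x, y])"
  shows "nohole Q \<Longrightarrow> tvars Q \<subseteq> {..<N} \<Longrightarrow> length xs = N \<Longrightarrow> (\<And>x. x \<in> set xs \<Longrightarrow> x \<epsilon> M) \<Longrightarrow>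
    opr (ctmpl Q h) (tup xs) \<epsilon> S \<longleftrightarrow> nsat {x. x \<epsilon> M} E H (\<lambda>i. xs ! i) Q"
proof (induction Q arbitrary: xs)
  case (TMem i j)
  obtain V where V: "\<forall>s. isfn s (num N) M \<longrightarrow> (\<forall>i y. i \<epsilon> num N \<longrightarrow> (opr (opr (cvar i) s) y \<epsilon> V \<longleftrightarrow> opr i y \<epsilon> s))"
    and S: "satrec eps_r eps_ar M I (num N) V S" using sat unfolding issat_def by blast
  have s: "isfn (tup xs) (num N) M" using TMem by (intro isfn_tup) auto
  have f: "isform eps_r eps_ar (num N) (ctmpl (TMem i j) h)"
    using TMem.prems by (intro fmc_isform fmc_ctmpl) auto
  have v: "vtup V (num 2) (tup [cvar (num i), cvar (num j)]) (tup xs) u \<longleftrightarrow> u = tup [xs ! i, xs ! j]" for u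
  proof -
    have "vtup V (num (length [i, j])) (tup (map (\<lambda>i. cvar (num i)) [i, j])) (tup xs) u \<longleftrightarrow>
        u = tup (map (\<lambda>i. app (tup xs) (num i)) [i, j])"
      by (rule vtup_tup[OF V s]) (use TMem.prems in auto)
    then show ?thesis using TMem.prems by (simp add: num2)
  qed
  have *: "opr (crel emp (tup [cvar (num i), cvar (num j)])) (tup xs) \<epsilon> S \<longleftrightarrow>
      (\<exists>u. vtup V (num 2) (tup [cvar (num i), cvar (num j)]) (tup xs) u \<and> u \<epsilon> X)"
    by (rule satrecD(2)[OF S s _ _ I(1)]) (use f in auto)
  have "xs ! i \<epsilon> M" "xs ! j \<epsilon> M" using TMem.prems by auto
  then show ?case unfolding ctmpl.simps * v by (auto simp: I(2) tup_inject)
next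
  case (TEq i j)
  obtain V where V: "\<forall>s. isfn s (num N) M \<longrightarrow> (\<forall>i y. i \<epsilon> num N \<longrightarrow> (opr (opr (cvar i) s) y \<epsilon> V \<longleftrightarrow> opr i y \<epsilon> s))"
    and S: "satrec eps_r eps_ar M I (num N) V S" using sat unfolding issat_def by blast
  have s: "isfn (tup xs) (num N) M" using TEq by (intro isfn_tup) auto
  have f: "isform eps_r eps_ar (num N) (ctmpl (TEq i j) h)"
    using TEq.prems by (intro fmc_isform fmc_ctmpl) auto
  have *: "opr (ceq (cvar (num i)) (cvar (num j))) (tup xs) \<epsilon> S \<longleftrightarrow>
      (\<exists>y. opr (opr (cvar (num i)) (tup xs)) y \<epsilon> V \<and> opr (opr (cvar (num j)) (tup xs)) y \<epsilon> V)"
    by (rule satrecD(1)[OF S s]) (use f in simp)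
  show ?case unfolding ctmpl.simps * using V s TEq.prems by auto
next
  case TFls
  obtain V where S: "satrec eps_r eps_ar M I (num N) V S" using sat unfolding issat_def by blast
  have s: "isfn (tup xs) (num N) M" using TFls by (intro isfn_tup) auto
  have f: "isform eps_r eps_ar (num N) cfls" by (intro fmc_isform fmc_fls)
  show ?case using satrecD(3)[OF S s f] by simp
next
  case (TImp Q1 Q2)
  obtain V where S: "satrec eps_r eps_ar M I (num N) V S" using sat unfolding issat_def by blast
  have s: "isfn (tup xs) (num N) M" using TImp.prems by (intro isfn_tup) auto
  have f: "isform eps_r eps_ar (num N) (ctmpl (TImp Q1 Q2) h)"
    using TImp.prems by (intro fmc_isform fmc_ctmpl) auto
  have *: "opr (cimp (ctmpl Q1 h) (ctmpl Q2 h)) (tup xs) \<epsilon> S \<longleftrightarrow>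
      (opr (ctmpl Q1 h) (tup xs) \<epsilon> S \<longrightarrow> opr (ctmpl Q2 h) (tup xs) \<epsilon> S)"
    by (rule satrecD(4)[OF S s]) (use f in simp)
  show ?case unfolding ctmpl.simps * using TImp by simp
next
  case (TAll i Q)
  obtain V where S: "satrec eps_r eps_ar M I (num N) V S" using sat unfolding issat_def by blast
  have s: "isfn (tup xs) (num N) M" using TAll.prems by (intro isfn_tup) auto
  have f: "isform eps_r eps_ar (num N) (ctmpl (TAll i Q) h)"
    using TAll.prems by (intro fmc_isform fmc_ctmpl) auto
  have *: "opr (call (num i) (ctmpl Q h)) (tup xs) \<epsilon> S \<longleftrightarrow>
     (\<forall>a s'. a \<epsilon> M \<and> isfn s' (num N) M \<and>
       (\<forall>j y. opr j y \<epsilon> s' \<longleftrightarrow> j = num i \<and> y = a \<or> \<not> j = num i \<and> opr j y \<epsilon> tup xs) \<longrightarrow>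
        opr (ctmpl Q h) s' \<epsilon> S)"
    by (rule satrecD(5)[OF S s]) (use f in simp)
  have i: "i < N" using TAll.prems by simp
  have upd: "isfn s' (num N) M \<and>
       (\<forall>j y. opr j y \<epsilon> s' \<longleftrightarrow> j = num i \<and> y = a \<or> \<not> j = num i \<and> opr j y \<epsilon> tup xs) \<longleftrightarrow> s' = tup (xs[i := a])"
    if "a \<epsilon> M" for a s'
  proof
    have b: "j = num i \<and> y = a \<or> \<not> j = num i \<and> opr j y \<epsilon> tup xs \<longleftrightarrow> opr j y \<epsilon> tup (xs[i := a])" for j y
      using i TAll.prems(3) by (auto simp: nth_list_update)
    have t: "isfn (tup (xs[i := a])) (num N) M"
      using TAll.prems that by (intro isfn_tup) (auto dest: set_update_subset_insert[THEN subsetD])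
    then show "isfn s' (num N) M \<and> (\<forall>j y. opr j y \<epsilon> s' \<longleftrightarrow> j = num i \<and> y = a \<or> \<not> j = num i \<and> opr j y \<epsilon> tup xs)"
      if "s' = tup (xs[i := a])" using that b by blast
    show "s' = tup (xs[i := a])"
      if "isfn s' (num N) M \<and> (\<forall>j y. opr j y \<epsilon> s' \<longleftrightarrow> j = num i \<and> y = a \<or> \<not> j = num i \<and> opr j y \<epsilon> tup xs)"
    proof (rule isf_eqI[of _ "num N"])
      show "isf s' (num N)" "isf (tup (xs[i := a])) (num N)" using that t unfolding isfn_def by auto
      show "opr j y \<epsilon> s' \<longleftrightarrow> opr j y \<epsilon> tup (xs[i := a])" for j y
        using that b by blast
    qed
  qed
  have "(\<forall>a s'. a \<epsilon> M \<and> isfn s' (num N) M \<and>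
       (\<forall>j y. opr j y \<epsilon> s' \<longleftrightarrow> j = num i \<and> y = a \<or> \<not> j = num i \<and> opr j y \<epsilon> tup xs) \<longrightarrow>
        opr (ctmpl Q h) s' \<epsilon> S) \<longleftrightarrow> (\<forall>a. a \<epsilon> M \<longrightarrow> opr (ctmpl Q h) (tup (xs[i := a])) \<epsilon> S)"
    by (rule all_unique[OF upd])
  moreover have "opr (ctmpl Q h) (tup (xs[i := a])) \<epsilon> S \<longleftrightarrow> nsat {x. x \<epsilon> M} E H ((\<lambda>i. xs ! i)(i := a)) Q"
    if "a \<epsilon> M" for a
  proof -
    have "opr (ctmpl Q h) (tup (xs[i := a])) \<epsilon> S \<longleftrightarrow> nsat {x. x \<epsilon> M} E H (\<lambda>k. xs[i := a] ! k) Q"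
      by (rule TAll.IH) (use TAll.prems that in \<open>auto dest: set_update_subset_insert[THEN subsetD]\<close>)
    also have "\<dots> \<longleftrightarrow> nsat {x. x \<epsilon> M} E H ((\<lambda>i. xs ! i)(i := a)) Q"
      using TAll.prems by (intro nsat_cong) (auto simp: nth_list_update)
    finally show ?thesis .
  qed
  ultimately show ?case unfolding ctmpl.simps * by auto
qed simp

end

text \<open>This bounded instance of Separation provides the set of variable indices other than 3
  and 4 that \<open>is_zfc_axiom\<close> allows for the formula in the hole.\<close>

locale bst = omset +
  assumes ex_diff: "\<exists>W. \<forall>k. k \<epsilon> W \<longleftrightarrow> k \<epsilon> w \<and> k \<noteq> a \<and> k \<noteq> b"
begin

text \<open>Truth of ZFC as seen from outside: the schemes are stated for real formulas, with all
  assignments in \<open>M\<close> as parameters, in place of internal codes.\<close>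

definition "zmodel M \<longleftrightarrow> trs M \<and> (\<forall>T\<in>set zfc_axs. \<forall>\<psi> s. 3 \<notin> fv \<psi> \<longrightarrow> 4 \<notin> fv \<psi> \<longrightarrow> (\<forall>i. s i \<epsilon> M) \<longrightarrow>
  nsat {x. x \<epsilon> M} E (\<lambda>s. sat {x. x \<epsilon> M} E s \<psi>) s T)"

lemma ev_is_model:
  assumes "M < n" "lsat UNIV E g n e (is_model M)"
  shows "zmodel (e M)"
proof -
  let ?M = "e M"
  have "trs ?M \<and> (\<exists>I X. opr emp X \<epsilon> I \<and> (\<forall>t. t \<epsilon> X \<longleftrightarrow> (\<exists>x y. x \<epsilon> ?M \<and> y \<epsilon> ?M \<and> x \<epsilon> y \<and> t = tup [x, y])) \<and>
     (\<forall>k. k \<epsilon> om \<longrightarrow> (\<exists>S. issat eps_r eps_ar ?M I k S \<and>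
        (\<forall>x s. (\<exists>W h. (\<forall>k. k \<epsilon> W \<longleftrightarrow> k \<epsilon> om \<and> k \<noteq> num 3 \<and> k \<noteq> num 4) \<and> isform eps_r eps_ar W h \<and>
            (\<exists>T\<in>set zfc_axs. x = ctmpl T h)) \<and> isform eps_r eps_ar k x \<and> isfn s k ?M \<longrightarrow> opr x s \<epsilon> S))))"
    (is "_ \<and> ?rhs")
  proof
    show "trs ?M" using assms by (simp add: is_model_def)
    obtain r g' ar I where *: "lsat UNIV E g (Suc (Suc (Suc (Suc n)))) (e(n := r, Suc n := g', Suc (Suc n) := ar, Suc (Suc (Suc n)) := I))
      (is_eps_language n (Suc n) (Suc (Suc n)) \<^bold>\<and> is_eps_interpretation (Suc (Suc (Suc n))) M \<^bold>\<and>
        is_structure n (Suc n) (Suc (Suc n)) M (Suc (Suc (Suc n))) \<^bold>\<and>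
        (\<^bold>\<forall>k. is_nat k \<^bold>\<longrightarrow> (\<^bold>\<exists>S. is_satisfaction n (Suc n) (Suc (Suc n)) M (Suc (Suc (Suc n))) k S \<^bold>\<and>
           (\<^bold>\<forall>x s. is_zfc_axiom n (Suc n) (Suc (Suc n)) x \<^bold>\<and> is_formula n (Suc n) (Suc (Suc n)) k x \<^bold>\<and> func_to s k M \<^bold>\<longrightarrow> maps S x s))))"
      (is "lsat UNIV E g ?n ?e _")
      using assms(2) unfolding is_model_def lsat_conj lsat_ex by blast
    have lang: "r = eps_r" "g' = emp" "ar = eps_ar"
      using * by (auto simp: is_eps_language_def)
    have "lsat UNIV E g ?n ?e (is_eps_interpretation (Suc (Suc (Suc n))) M)"
      using * by simp
    then obtain X where X: "I = upr (opr emp X) (opr emp X)"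
      "\<forall>t. t \<epsilon> X \<longleftrightarrow> (\<exists>x y. x \<epsilon> ?M \<and> y \<epsilon> ?M \<and> x \<epsilon> y \<and> t = tup [x, y])"
      using assms(1) by (auto simp: is_eps_interpretation_def)
    have "\<exists>S. issat eps_r eps_ar ?M I k S \<and>
        (\<forall>x s. (\<exists>W h. (\<forall>k. k \<epsilon> W \<longleftrightarrow> k \<epsilon> om \<and> k \<noteq> num 3 \<and> k \<noteq> num 4) \<and> isform eps_r eps_ar W h \<and>
            (\<exists>T\<in>set zfc_axs. x = ctmpl T h)) \<and> isform eps_r eps_ar k x \<and> isfn s k ?M \<longrightarrow> opr x s \<epsilon> S)"
      if k: "k \<epsilon> om" for k
    proof -
      have "\<exists>S. lsat UNIV E g (Suc (Suc ?n)) (?e(?n := k, Suc ?n := S))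
            (is_satisfaction n (Suc n) (Suc (Suc n)) M (Suc (Suc (Suc n))) ?n (Suc ?n)) \<and>
          lsat UNIV E g (Suc (Suc ?n)) (?e(?n := k, Suc ?n := S))
            (\<^bold>\<forall>x s. is_zfc_axiom n (Suc n) (Suc (Suc n)) x \<^bold>\<and> is_formula n (Suc n) (Suc (Suc n)) ?n x \<^bold>\<and> func_to s ?n M \<^bold>\<longrightarrow> maps (Suc ?n) x s)"
        using * k unfolding lsat_conj lsat_all lsat_imp lsat_ex by simp
      then obtain S where S: "lsat UNIV E g (Suc (Suc ?n)) (?e(?n := k, Suc ?n := S))
            (is_satisfaction n (Suc n) (Suc (Suc n)) M (Suc (Suc (Suc n))) ?n (Suc ?n))"
         "lsat UNIV E g (Suc (Suc ?n)) (?e(?n := k, Suc ?n := S))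
            (\<^bold>\<forall>x s. is_zfc_axiom n (Suc n) (Suc (Suc n)) x \<^bold>\<and> is_formula n (Suc n) (Suc (Suc n)) ?n x \<^bold>\<and> func_to s ?n M \<^bold>\<longrightarrow> maps (Suc ?n) x s)"
        by blast
      have "issat eps_r eps_ar ?M I k S"
        using ev_is_satisfaction[OF _ _ _ _ _ _ _ _ S(1)] assms(1) lang by simp
      moreover have "\<forall>x s. (\<exists>W h. (\<forall>k. k \<epsilon> W \<longleftrightarrow> k \<epsilon> om \<and> k \<noteq> num 3 \<and> k \<noteq> num 4) \<and> isform eps_r eps_ar W h \<and>
            (\<exists>T\<in>set zfc_axs. x = ctmpl T h)) \<and> isform eps_r eps_ar k x \<and> isfn s k ?M \<longrightarrow> opr x s \<epsilon> S"
        using S(2) assms(1) lang by (simp add: ev_is_zfc_axiom ev_is_formula)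
      ultimately show ?thesis by blast
    qed
    then show ?rhs using X(1,2) by (intro exI[of _ I] exI[of _ X]) simp
  qed
  then obtain I X where tr: "trs ?M" and IX: "opr emp X \<epsilon> I"
      "\<And>t. t \<epsilon> X \<longleftrightarrow> (\<exists>x y. x \<epsilon> ?M \<and> y \<epsilon> ?M \<and> x \<epsilon> y \<and> t = tup [x, y])"
    and sat: "\<And>k. k \<epsilon> om \<Longrightarrow> \<exists>S. issat eps_r eps_ar ?M I k S \<and>
        (\<forall>x s. (\<exists>W h. (\<forall>k. k \<epsilon> W \<longleftrightarrow> k \<epsilon> om \<and> k \<noteq> num 3 \<and> k \<noteq> num 4) \<and> isform eps_r eps_ar W h \<and>
            (\<exists>T\<in>set zfc_axs. x = ctmpl T h)) \<and> isform eps_r eps_ar k x \<and> isfn s k ?M \<longrightarrow> opr x s \<epsilon> S)"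
    by blast
  obtain W where W: "\<forall>k. k \<epsilon> W \<longleftrightarrow> k \<epsilon> om \<and> k \<noteq> num 3 \<and> k \<noteq> num 4" using ex_diff by blast
  have "nsat {x. x \<epsilon> ?M} E (\<lambda>s. sat {x. x \<epsilon> ?M} E s \<psi>) s T"
    if T: "T \<in> set zfc_axs" and \<psi>: "3 \<notin> fv \<psi>" "4 \<notin> fv \<psi>" and s: "\<forall>i. s i \<epsilon> ?M" for T \<psi> s
  proof -
    \<comment> \<open>The bound names of \<open>Q\<close> start at \<open>N > 4\<close>. With the
      condition on the free variables of \<open>\<psi>\<close>, its code avoids 3 and 4 and is
      admissible for the hole.\<close>
    obtain N where N: "\<And>i. i \<in> insert 4 (fv \<psi>) \<Longrightarrow> i < N"
      using finite_nat_set_iff_bounded[of "insert 4 (fv \<psi>)"] by auto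
    define Q where "Q = nm \<psi> (\<lambda>i. i) N"
    have "fmc eps_r eps_ar W (ctmpl Q emp)"
    proof (rule fmc_ctmpl)
      fix i assume "i \<in> tvars Q"
      then have "i \<in> fv \<psi> \<or> N \<le> i" using tvars_nm[of \<psi> "\<lambda>i. i" N] by (auto simp: Q_def)
      then have "i \<noteq> 3" "i \<noteq> 4" using \<psi> N[of 4] by auto
      then show "num i \<epsilon> W" using W by simp
    qed (simp add: Q_def)
    then have Wf: "isform eps_r eps_ar W (ctmpl Q emp)" by (rule fmc_isform)
    define U where "U = tsub T Q"
    \<comment> \<open>Internal satisfaction is used for assignments on \<open>K\<close> variables,
      enough for all variables of the filled axiom.\<close>
    obtain K where K: "\<And>i. i \<in> tvars U \<Longrightarrow> i < K"
      using finite_nat_set_iff_bounded[of "tvars U"] by auto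
    obtain S where S: "issat eps_r eps_ar ?M I (num K) S" and
      ax: "\<forall>x s. (\<exists>W h. (\<forall>k. k \<epsilon> W \<longleftrightarrow> k \<epsilon> om \<and> k \<noteq> num 3 \<and> k \<noteq> num 4) \<and> isform eps_r eps_ar W h \<and>
            (\<exists>T\<in>set zfc_axs. x = ctmpl T h)) \<and> isform eps_r eps_ar (num K) x \<and> isfn s (num K) ?M \<longrightarrow> opr x s \<epsilon> S"
      using sat[OF num_om, of K] by blast
    have hole: "nohole U" by (simp add: U_def Q_def)
    have "isform eps_r eps_ar (num K) (ctmpl U emp)"
      using K by (intro fmc_isform fmc_ctmpl hole) auto
    moreover have "isfn (tup (map s [0..<K])) (num K) ?M" using s by (intro isfn_tup) auto
    moreover have "ctmpl U emp = ctmpl T (ctmpl Q emp)" by (simp add: U_def ctmpl_tsub)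
    ultimately have "opr (ctmpl U emp) (tup (map s [0..<K])) \<epsilon> S"
      using ax W Wf T by blast
    then have "nsat {x. x \<epsilon> ?M} E (\<lambda>_. True) (\<lambda>i. map s [0..<K] ! i) U"
      using truth[OF S IX, of U "map s [0..<K]" emp "\<lambda>_. True"] hole K s by auto
    moreover have "nsat {x. x \<epsilon> ?M} E (\<lambda>_. True) (\<lambda>i. map s [0..<K] ! i) U =
        nsat {x. x \<epsilon> ?M} E (\<lambda>_. True) s U"
      using K by (intro nsat_cong hole) auto
    ultimately have "nsat {x. x \<epsilon> ?M} E (\<lambda>s. nsat {x. x \<epsilon> ?M} E (\<lambda>_. True) s Q) s T"
      by (simp add: U_def nsat_tsub)
    moreover have "nsat {x. x \<epsilon> ?M} E (\<lambda>_. True) s Q = sat {x. x \<epsilon> ?M} E s \<psi>" for s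
      using N by (simp add: Q_def nsat_nm comp_def)
    ultimately show ?thesis by simp
  qed
  with tr show ?thesis unfolding zmodel_def by blast
qed

end

section \<open>Set theory in a transitive model of ZFC\<close>

context extset
begin

definition "ord a \<longleftrightarrow> trs a \<and> lin a"
definition "suc x \<longleftrightarrow> (\<exists>y. y \<epsilon> x \<and> x = sc y)"

end

text \<open>\<open>fnd\<close> speaks about all sets of the universe: Foundation passes from the
  transitive models to the universe before this locale is instantiated.\<close>

locale zf = dom +
  assumes fnd: "x \<epsilon> a \<Longrightarrow> \<exists>y. y \<epsilon> a \<and> \<not> (\<exists>z. z \<epsilon> a \<and> z \<epsilon> y)"
    and zfc: "T \<in> set zfc_axs \<Longrightarrow> 3 \<notin> fv \<psi> \<Longrightarrow> 4 \<notin> fv \<psi> \<Longrightarrow> (\<And>i. s i \<in> D) \<Longrightarrow>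
      nsat D E (\<lambda>s. sat D E s \<psi>) s T"
begin

lemma ax: "T \<in> set zfc_axs \<Longrightarrow> nsat D E (\<lambda>s. False) (\<lambda>_. emp) T"
  using zfc[of T Fls "\<lambda>_. emp"] by simp

section \<open>Power set, Separation, Replacement and Choice in a model\<close>

definition "pw A = setof (\<lambda>x. x \<in> D \<and> sub x A)"

lemma pw:
  assumes "A \<in> D"
  shows "pw A \<in> D" "x \<epsilon> pw A \<longleftrightarrow> x \<in> D \<and> sub x A"
proof -
  have "nsat D E (\<lambda>s. False) (\<lambda>_. emp) powerset_ax" by (rule ax) (simp add: zfc_axs_def)
  then obtain P where P: "P \<in> D" "\<forall>x\<in>D. x \<epsilon> P \<longleftrightarrow> (\<forall>y\<in>D. y \<epsilon> x \<longrightarrow> y \<epsilon> A)"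
    using assms by (auto simp: powerset_ax_def)
  have P': "x \<epsilon> P \<longleftrightarrow> x \<in> D \<and> sub x A" for x
    unfolding sub_def using P(2) trans[OF P(1), of x] trans[of x] by blast
  then have "P = setof (\<lambda>x. x \<in> D \<and> sub x A)"
    by (intro ext) (auto intro!: setof[symmetric])
  then show "pw A \<in> D" "x \<epsilon> pw A \<longleftrightarrow> x \<in> D \<and> sub x A" using P(1) P' by (auto simp: pw_def)
qed

definition "col A P = setof (\<lambda>x. x \<epsilon> A \<and> P x)"

lemma sep:
  assumes "A \<in> D" "dfn (\<lambda>e. P (e 0))"
  shows "\<exists>B\<in>D. \<forall>x. x \<epsilon> B \<longleftrightarrow> x \<epsilon> A \<and> P x"
proof -
  obtain p c where c: "range c \<subseteq> D" and p: "\<And>e. range e \<subseteq> D \<Longrightarrow> P (e 0) = sat D E (mrg e c) p"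
    using assms(2) unfolding dfn_def by blast
  \<comment> \<open>\<open>P\<close> depends only on \<open>e 0\<close>, so all even variables
    become index 0, the subject of Separation. The parameters start at 5, clear of the names used by
    the templates.\<close>
  define \<psi> where "\<psi> = ren (\<lambda>i. if even i then 0 else i div 2 + 5) p"
  define s where "s = (\<lambda>i. if i < 5 then A else c (i - 5))"
  have s: "s i \<in> D" for i using assms(1) c by (auto simp: s_def)
  have "3 \<notin> fv \<psi>" "4 \<notin> fv \<psi>" by (auto simp: \<psi>_def fv_ren split: if_splits)
  then have "nsat D E (\<lambda>s. sat D E s \<psi>) s separation_ax"
    by (intro zfc s) (simp_all add: zfc_axs_def)
  then obtain B where B: "B \<in> D" "\<forall>x\<in>D. x \<epsilon> B \<longleftrightarrow> x \<epsilon> A \<and> sat D E (s(2 := A, 3 := B, 0 := x)) \<psi>"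
    using assms(1) by (auto simp: separation_ax_def)
  have "sat D E (s(2 := A, 3 := B, 0 := x)) \<psi> = P x" if "x \<in> D" for x
  proof -
    have "s(2 := A, 3 := B, 0 := x) \<circ> (\<lambda>i. if even i then 0 else i div 2 + 5) = mrg (\<lambda>_. x) c"
      by (rule HOL.ext) (simp add: s_def mrg_def)
    then show ?thesis using p[of "\<lambda>_. x"] that by (auto simp: \<psi>_def sat_ren)
  qed
  then show ?thesis using B trans[OF assms(1)] trans[OF B(1)] by blast
qed

lemma col:
  assumes "A \<in> D" "dfn (\<lambda>e. P (e 0))"
  shows "col A P \<in> D" "x \<epsilon> col A P \<longleftrightarrow> x \<epsilon> A \<and> P x"
proof -
  obtain B where B: "B \<in> D" "\<forall>x. x \<epsilon> B \<longleftrightarrow> x \<epsilon> A \<and> P x" using sep[OF assms] by blast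
  then have "B = col A P" unfolding col_def by (intro ext) (auto intro!: setof[symmetric])
  then show "col A P \<in> D" "x \<epsilon> col A P \<longleftrightarrow> x \<epsilon> A \<and> P x" using B by auto
qed

lemma repl:
  assumes "A \<in> D" "dfn (\<lambda>e. P (e 0) (e 1))"
    and "\<And>x y y'. x \<epsilon> A \<Longrightarrow> y \<in> D \<Longrightarrow> y' \<in> D \<Longrightarrow> P x y \<Longrightarrow> P x y' \<Longrightarrow> y = y'"
  shows "\<exists>B\<in>D. \<forall>y. y \<epsilon> B \<longleftrightarrow> y \<in> D \<and> (\<exists>x. x \<epsilon> A \<and> P x y)"
proof -
  obtain p c where c: "range c \<subseteq> D" and p: "\<And>e. range e \<subseteq> D \<Longrightarrow> P (e 0) (e 1) = sat D E (mrg e c) p"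
    using assms(2) unfolding dfn_def by blast
  let ?f = "\<lambda>i. if i = 0 then 0 else if even i then 1 else i div 2 + 5"
  define \<psi> where "\<psi> = ren ?f p"
  define s where "s = (\<lambda>i. if i < 5 then A else c (i - 5))"
  have s: "s i \<in> D" for i using assms(1) c by (auto simp: s_def)
  have "3 \<notin> fv \<psi>" "4 \<notin> fv \<psi>" by (auto simp: \<psi>_def fv_ren split: if_splits)
  then have ax: "nsat D E (\<lambda>s. sat D E s \<psi>) s replacement_ax"
    by (intro zfc s) (simp_all add: zfc_axs_def)
  have P: "sat D E r \<psi> = P (r 0) (r 1)"
    if "r 0 \<in> D" "r 1 \<in> D" "\<And>i. 5 \<le> i \<Longrightarrow> r i = s i" for r
  proof -
    have "r \<circ> ?f = mrg (case_nat (r 0) (\<lambda>_. r 1)) c"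
      by (rule HOL.ext) (auto simp: s_def mrg_def that(3) split: nat.split elim: evenE)
    moreover have "range (case_nat (r 0) (\<lambda>_. r 1)) \<subseteq> D"
      using that(1,2) by (auto split: nat.split simp: image_subset_iff)
    from p[OF this] have "P (r 0) (r 1) = sat D E (mrg (case_nat (r 0) (\<lambda>_. r 1)) c) p" by simp
    ultimately show ?thesis by (simp only: \<psi>_def sat_ren)
  qed
  have "(\<forall>x\<in>D. x \<epsilon> A \<longrightarrow> (\<exists>z\<in>D. \<forall>y\<in>D. P x y \<longrightarrow> y = z)) \<longrightarrow>
      (\<exists>B\<in>D. \<forall>y\<in>D. y \<epsilon> B \<longleftrightarrow> (\<exists>x\<in>D. x \<epsilon> A \<and> P x y))"
    using bspec[OF ax[unfolded replacement_ax_def nsat.simps] assms(1)]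
    by (simp add: P cong: ball_cong bex_cong)
  moreover have "\<exists>z\<in>D. \<forall>y\<in>D. P x y \<longrightarrow> y = z" if "x \<epsilon> A" for x
  proof (cases "\<exists>y\<in>D. P x y")
    case True
    then show ?thesis using assms(3)[OF that] by blast
  qed (use assms(1) in blast)
  ultimately obtain B where B: "B \<in> D" "\<forall>y\<in>D. y \<epsilon> B \<longleftrightarrow> (\<exists>x\<in>D. x \<epsilon> A \<and> P x y)" by blast
  have "\<forall>y. y \<epsilon> B \<longleftrightarrow> y \<in> D \<and> (\<exists>x. x \<epsilon> A \<and> P x y)"
    using B(2) trans[OF B(1)] trans[OF assms(1)] by blast
  with B(1) show ?thesis by blast
qed

definition "prd A B = col (pw (pw (un2 A B))) (\<lambda>p. \<exists>a. a \<epsilon> A \<and> (\<exists>b. b \<epsilon> B \<and> p = opr a b))"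

lemma prd:
  assumes "A \<in> D" "B \<in> D"
  shows "prd A B \<in> D" "p \<epsilon> prd A B \<longleftrightarrow> (\<exists>a b. a \<epsilon> A \<and> b \<epsilon> B \<and> p = opr a b)"
proof -
  have U: "pw (un2 A B) \<in> D" "pw (pw (un2 A B)) \<in> D" using assms by (simp_all add: pw)
  have dfn: "dfn (\<lambda>e. \<exists>a. a \<epsilon> A \<and> (\<exists>b. b \<epsilon> B \<and> e 0 = opr a b))"
    using assms by (intro definable; simp)
  show "prd A B \<in> D" unfolding prd_def by (rule col[OF U(2) dfn])
  have "opr a b \<epsilon> pw (pw (un2 A B))" if "a \<epsilon> A" "b \<epsilon> B" for a b
  proof -
    have D: "a \<in> D" "b \<in> D" using that assms trans by blast+
    then show ?thesis using that assms U by (auto simp: pw sub_def opr_def)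
  qed
  then show "p \<epsilon> prd A B \<longleftrightarrow> (\<exists>a b. a \<epsilon> A \<and> b \<epsilon> B \<and> p = opr a b)"
    unfolding prd_def col(2)[OF U(2) dfn] by blast
qed

lemma opr_prd: "A \<in> D \<Longrightarrow> B \<in> D \<Longrightarrow> opr a b \<epsilon> prd A B \<longleftrightarrow> a \<epsilon> A \<and> b \<epsilon> B"
  by (simp add: prd)

lemma isfn_graph:
  assumes "A \<in> D" "B \<in> D" "\<And>x. x \<epsilon> A \<Longrightarrow> F x \<epsilon> B" "\<And>i j. dfn (\<lambda>e. e i = F (e j))"
  obtains f where "f \<in> D" "isfn f A B" "\<And>x. x \<epsilon> A \<Longrightarrow> app f x = F x"
proof -
  define f where "f = col (prd A B) (\<lambda>p. \<exists>x. x \<epsilon> A \<and> (\<exists>y. y \<epsilon> B \<and> p = opr x y \<and> y = F x))"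
  have dfn: "dfn (\<lambda>e. \<exists>x. x \<epsilon> A \<and> (\<exists>y. y \<epsilon> B \<and> e 0 = opr x y \<and> y = F x))"
    using assms(1,2) by (intro definable assms(4); simp)
  have f: "f \<in> D" unfolding f_def by (rule col(1)[OF prd(1)[OF assms(1,2)] dfn])
  have f': "p \<epsilon> f \<longleftrightarrow> (\<exists>x. x \<epsilon> A \<and> p = opr x (F x))" for p
    unfolding f_def col(2)[OF prd(1)[OF assms(1,2)] dfn] prd(2)[OF assms(1,2)]
    by (auto intro: assms(3))
  show ?thesis using that[OF f] isfn_intro[OF f' assms(3)] by blast
qed

text \<open>The axiom is applied to the nonempty fibres of \<open>Z\<close>, the sets of all pairs
  in \<open>Z\<close> with a given first component. They are pairwise disjoint, and the part of
  \<open>Z\<close> inside a transversal is functional with the same domain as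
  \<open>Z\<close>.\<close>

lemma choice_rel:
  assumes Z: "Z \<in> D"
  obtains c where "c \<in> D" "sub c Z" "\<And>x y. opr x y \<epsilon> Z \<Longrightarrow> \<exists>v. \<forall>z. opr x z \<epsilon> c \<longleftrightarrow> z = v"
proof -
  let ?fib = "\<lambda>k x p. p \<epsilon> k \<longleftrightarrow> p \<epsilon> Z \<and> (\<exists>y\<in>D. p = opr x y)"
  \<comment> \<open>The conjunct \<open>p = p\<close> gives the quantifier the form demanded by
    \<open>dfn_bex\<close>.\<close>
  define F where "F = col (pw Z) (\<lambda>k. (\<exists>p. p \<epsilon> k \<and> p = p) \<and> (\<exists>x\<in>D. \<forall>p\<in>D. ?fib k x p))"
  have dfn: "dfn (\<lambda>e. (\<exists>p. p \<epsilon> e 0 \<and> p = p) \<and> (\<exists>x\<in>D. \<forall>p\<in>D. ?fib (e 0) x p))"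
    using Z by (intro definable; simp)
  have F: "F \<in> D" "k \<epsilon> F \<longleftrightarrow> (k \<in> D \<and> sub k Z) \<and> (\<exists>p. p \<epsilon> k \<and> p = p) \<and> (\<exists>x\<in>D. \<forall>p\<in>D. ?fib k x p)" for k
    unfolding F_def col(2)[OF pw(1)[OF Z] dfn] pw(2)[OF Z] using col(1)[OF pw(1)[OF Z] dfn] by auto
  have "nsat D E (\<lambda>s. False) (\<lambda>_. emp) choice_ax" by (rule ax) (simp add: zfc_axs_def)
  then have ch: "(\<forall>k\<in>D. k \<epsilon> F \<longrightarrow> (\<exists>p\<in>D. p \<epsilon> k)) \<and>
      (\<forall>k\<in>D. \<forall>l\<in>D. k \<epsilon> F \<and> l \<epsilon> F \<and> (\<exists>p\<in>D. p \<epsilon> k \<and> p \<epsilon> l) \<longrightarrow> k = l) \<longrightarrow>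
      (\<exists>t\<in>D. \<forall>k\<in>D. k \<epsilon> F \<longrightarrow> (\<exists>p\<in>D. \<forall>q\<in>D. (q \<epsilon> t \<and> q \<epsilon> k) = (q = p)))"
    using F(1) by (simp add: choice_ax_def)
  have ne: "\<forall>k\<in>D. k \<epsilon> F \<longrightarrow> (\<exists>p\<in>D. p \<epsilon> k)"
  proof (intro ballI impI)
    fix k assume k: "k \<in> D" "k \<epsilon> F"
    then obtain p where "p \<epsilon> k" unfolding F(2) by blast
    then show "\<exists>p\<in>D. p \<epsilon> k" using trans[OF k(1)] by blast
  qed
  have disj: "k = l" if kl: "k \<in> D" "l \<in> D" "k \<epsilon> F" "l \<epsilon> F" "p \<in> D" "p \<epsilon> k" "p \<epsilon> l" for k l p
  proof -
    obtain x where x: "\<forall>p\<in>D. ?fib k x p" using kl(3) unfolding F(2) by blast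
    obtain x' where x': "\<forall>p\<in>D. ?fib l x' p" using kl(4) unfolding F(2) by blast
    have xx': "x = x'" using bspec[OF x kl(5)] bspec[OF x' kl(5)] kl(6,7) by auto
    show ?thesis
      unfolding ext_D[OF kl(1,2)]
    proof
      fix z assume z: "z \<in> D"
      show "z \<epsilon> k \<longleftrightarrow> z \<epsilon> l" using bspec[OF x z] bspec[OF x' z] xx' by simp
    qed
  qed
  have "\<forall>k\<in>D. \<forall>l\<in>D. k \<epsilon> F \<and> l \<epsilon> F \<and> (\<exists>p\<in>D. p \<epsilon> k \<and> p \<epsilon> l) \<longrightarrow> k = l"
    by (intro ballI impI, elim conjE bexE) (rule disj)
  from mp[OF ch conjI[OF ne this]] obtain t where t: "t \<in> D"
    "\<forall>k\<in>D. k \<epsilon> F \<longrightarrow> (\<exists>p\<in>D. \<forall>q\<in>D. (q \<epsilon> t \<and> q \<epsilon> k) = (q = p))" by (elim bexE)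
  have dt: "dfn (\<lambda>e. e 0 \<epsilon> t)" using t(1) by (intro definable; simp)
  show ?thesis
  proof (rule that[of "col Z (\<lambda>p. p \<epsilon> t)"])
    show "col Z (\<lambda>p. p \<epsilon> t) \<in> D" "sub (col Z (\<lambda>p. p \<epsilon> t)) Z"
      using col[OF Z dt] by (auto simp: sub_def)
    fix x y assume xy: "opr x y \<epsilon> Z"
    then have xD: "x \<in> D" "y \<in> D" using opr_memD Z by blast+
    define k where "k = col Z (\<lambda>p. \<exists>y\<in>D. p = opr x y)"
    have dk: "dfn (\<lambda>e. \<exists>y\<in>D. e 0 = opr x y)" using xD by (intro definable; simp)
    have k: "k \<in> D" "p \<epsilon> k \<longleftrightarrow> p \<epsilon> Z \<and> (\<exists>y\<in>D. p = opr x y)" for p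
      using col[OF Z dk] by (auto simp: k_def)
    have "k \<epsilon> F" unfolding F(2) sub_def k(2) using xy xD k(1) by blast
    then obtain p where p: "p \<in> D" "\<forall>q\<in>D. (q \<epsilon> t \<and> q \<epsilon> k) = (q = p)"
      using bspec[OF t(2) k(1)] by blast
    then have "p \<epsilon> k" by blast
    then obtain v where v: "p = opr x v" "v \<in> D" unfolding k(2) by blast
    have "opr x z \<epsilon> col Z (\<lambda>p. p \<epsilon> t) \<longleftrightarrow> z = v" for z
    proof -
      have "opr x z \<epsilon> col Z (\<lambda>p. p \<epsilon> t) \<longleftrightarrow> opr x z \<in> D \<and> opr x z \<epsilon> t \<and> opr x z \<epsilon> k"
        unfolding col(2)[OF Z dt] k(2) using opr_memD[OF _ Z] xD by auto
      also have "\<dots> \<longleftrightarrow> z = v" using bspec[OF p(2), of "opr x z"] v p(1) by auto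
      finally show ?thesis .
    qed
    then show "\<exists>v. \<forall>z. opr x z \<epsilon> col Z (\<lambda>p. p \<epsilon> t) \<longleftrightarrow> z = v" by blast
  qed
qed

section \<open>Induction, ordinals and natural numbers\<close>

lemma om_induct:
  assumes "n \<epsilon> om" "dfn (\<lambda>e. P (e 0))" "P emp" "\<And>n. n \<epsilon> om \<Longrightarrow> P n \<Longrightarrow> P (sc n)"
  shows "P n"
proof -
  \<comment> \<open>Induction requires a definable \<open>P\<close>: its extension must be a set in
    order to be compared with \<open>om\<close>, which may contain nonstandard numbers.\<close>
  have c: "x \<epsilon> col om P \<longleftrightarrow> x \<epsilon> om \<and> P x" for x by (rule col(2)[OF om_D assms(2)])
  then have "ind (col om P)" unfolding ind_def using assms(3,4) by auto
  then have "sub om (col om P)" using om by blast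
  with assms(1) c show ?thesis unfolding sub_def by blast
qed

lemma least:
  assumes "X \<in> D" "dfn (\<lambda>e. P (e 0))" "x \<epsilon> X" "P x"
  shows "\<exists>y. y \<epsilon> X \<and> P y \<and> (\<forall>z. z \<epsilon> y \<and> z \<epsilon> X \<longrightarrow> \<not> P z)"
  using fnd[of x "col X P"] assms(3,4) unfolding col(2)[OF assms(1,2)] by blast

lemma trs_induct:
  assumes "X \<in> D" "trs X" "dfn (\<lambda>e. P (e 0))" "\<And>x. x \<epsilon> X \<Longrightarrow> (\<And>y. y \<epsilon> x \<Longrightarrow> P y) \<Longrightarrow> P x" "x \<epsilon> X"
  shows "P x"
  using least[OF assms(1) dfn_neg[OF assms(3)] assms(5)] assms(2,4) unfolding trs_def by blast

lemma mem_irrefl: "\<not> x \<epsilon> x"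
  using fnd[of x "upr x x"] by auto

lemma mem_asym: "x \<epsilon> y \<Longrightarrow> \<not> y \<epsilon> x"
  using fnd[of x "upr x y"] by auto

lemma mem_cycle3: "x \<epsilon> y \<Longrightarrow> y \<epsilon> z \<Longrightarrow> \<not> z \<epsilon> x"
  using fnd[of x "mks [x, y, z]"] by auto

lemma sc_inject [simp]: "sc x = sc y \<longleftrightarrow> x = y"
proof
  assume *: "sc x = sc y"
  have "x \<epsilon> sc y" "y \<epsilon> sc x" using * sc by metis+
  then show "x = y" using mem_asym by auto
qed simp

lemma sc_neq_emp [simp]: "sc x \<noteq> emp" "emp \<noteq> sc x"
  using sc[of x x] emp by metis+

lemma suc_sc [simp]: "suc (sc x)"
  by (auto simp: suc_def)

lemma not_suc_emp [simp]: "\<not> suc emp"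
  by (auto simp: suc_def)

lemma dfn_suc [definable]: "tm t \<Longrightarrow> dfn (\<lambda>e. suc (t e))"
  unfolding suc_def by (intro definable tm_shift)

lemma dfn_ord [definable]:
  assumes "tm t"
  shows "dfn (\<lambda>e. ord (t e))"
proof -
  have "dfn (\<lambda>e. (\<forall>x. x \<epsilon> t e \<longrightarrow> (\<forall>y. y \<epsilon> x \<longrightarrow> y \<epsilon> t e)) \<and>
      (\<forall>x. x \<epsilon> t e \<longrightarrow> (\<forall>y. y \<epsilon> t e \<longrightarrow> x \<epsilon> y \<or> x = y \<or> y \<epsilon> x)))"
    by (intro definable assms tm_shift[OF assms])
  then show ?thesis by (rule dfn_cong[rotated]) (auto simp: ord_def trs_def lin_def)
qed

lemma ord_trs: "ord a \<Longrightarrow> x \<epsilon> a \<Longrightarrow> y \<epsilon> x \<Longrightarrow> y \<epsilon> a"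
  unfolding ord_def trs_def by blast

lemma ord_lin: "ord a \<Longrightarrow> x \<epsilon> a \<Longrightarrow> y \<epsilon> a \<Longrightarrow> x \<epsilon> y \<or> x = y \<or> y \<epsilon> x"
  unfolding ord_def lin_def by blast

lemma ord_mem:
  assumes "ord a" "x \<epsilon> a"
  shows "ord x"
  unfolding ord_def trs_def lin_def
proof (intro conjI allI impI; elim conjE)
  fix y z assume yz: "y \<epsilon> x" "z \<epsilon> y"
  have "y \<epsilon> a" using ord_trs[OF assms yz(1)] .
  then have "z \<epsilon> a" using ord_trs[OF assms(1) _ yz(2)] by blast
  then show "z \<epsilon> x" using ord_lin[OF assms(1) _ assms(2)] mem_asym[OF yz(2)] mem_cycle3[OF yz(2,1)] yz(1) by blast
next
  fix y z assume "y \<epsilon> x" "z \<epsilon> x"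
  then show "y \<epsilon> z \<or> y = z \<or> z \<epsilon> y" using ord_trs[OF assms] ord_lin[OF assms(1)] by blast
qed

lemma ord_sc: "ord a \<Longrightarrow> ord (sc a)"
  unfolding ord_def trs_def lin_def sc by blast

lemma ord_emp: "ord emp"
  by (simp add: ord_def trs_def lin_def)

text \<open>The least element of \<open>b\<close> outside \<open>a\<close> has the same members as
  \<open>a\<close>.\<close>

lemma ord_psub:
  assumes "ord a" "ord b" "a \<in> D" "b \<in> D" "sub a b" "a \<noteq> b"
  shows "a \<epsilon> b"
proof -
  obtain x where x: "x \<epsilon> b" "\<not> x \<epsilon> a" using assms(5,6) ext unfolding sub_def by blast
  have "dfn (\<lambda>e. \<not> e 0 \<epsilon> a)" using assms(3) by (intro definable; simp)
  then obtain x where x: "x \<epsilon> b" "\<not> x \<epsilon> a" "\<And>z. z \<epsilon> x \<Longrightarrow> z \<epsilon> b \<Longrightarrow> z \<epsilon> a"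
    using least[OF assms(4), of "\<lambda>x. \<not> x \<epsilon> a", OF _ x] by blast
  have "x = a"
  proof (rule ext)
    fix z show "z \<epsilon> x \<longleftrightarrow> z \<epsilon> a"
    proof
      assume "z \<epsilon> x" then show "z \<epsilon> a" using x ord_trs[OF assms(2) x(1)] by blast
    next
      assume z: "z \<epsilon> a"
      then have "z \<epsilon> b" using assms(5) by (simp add: sub_def)
      then consider "z \<epsilon> x" | "z = x" | "x \<epsilon> z" using ord_lin[OF assms(2) _ x(1)] by blast
      then show "z \<epsilon> x" using z x(2) ord_trs[OF assms(1) z] by cases auto
    qed
  qed
  with x show ?thesis by simp
qed

text \<open>The intersection of two ordinals is an ordinal. Were it different from both, it would be
  a member of both by \<open>ord_psub\<close>, hence of itself.\<close>

lemma tri: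
  assumes "ord a" "ord b" "a \<in> D" "b \<in> D"
  shows "a \<epsilon> b \<or> a = b \<or> b \<epsilon> a"
proof -
  define c where "c = col a (\<lambda>x. x \<epsilon> b)"
  have "dfn (\<lambda>e. e 0 \<epsilon> b)" using assms(4) by (intro definable; simp)
  from col[OF assms(3) this] have c: "c \<in> D" "x \<epsilon> c \<longleftrightarrow> x \<epsilon> a \<and> x \<epsilon> b" for x by (auto simp: c_def)
  have "ord c"
    using assms(1,2) unfolding ord_def trs_def lin_def c(2) by blast
  moreover have "sub c a" "sub c b" by (auto simp: sub_def c)
  ultimately have "c \<epsilon> a \<or> c = a" "c \<epsilon> b \<or> c = b" using ord_psub assms c(1) by blast+
  then show ?thesis using c(2)[of c] mem_irrefl by blast
qed

lemma tri_sub: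
  assumes "ord a" "ord b" "a \<in> D" "b \<in> D" "\<not> b \<epsilon> a"
  shows "a \<epsilon> b \<or> a = b" "sub a b"
  using tri[OF assms(1-4)] assms(5) ord_trs[OF assms(2)] unfolding sub_def by blast+

lemma nat_ord: "n \<epsilon> om \<Longrightarrow> ord n"
  by (rule om_induct[where P=ord]) (auto intro!: definable ord_emp ord_sc)

lemma om_trs: "n \<epsilon> om \<Longrightarrow> x \<epsilon> n \<Longrightarrow> x \<epsilon> om"
proof -
  assume n: "n \<epsilon> om" "x \<epsilon> n"
  have "sub n om"
    by (rule om_induct[OF n(1), of "\<lambda>n. sub n om"]) (intro definable om_D, auto simp: sub_def)
  with n show ?thesis by (simp add: sub_def)
qed

lemma ord_om: "ord om"
  unfolding ord_def trs_def lin_def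
  using om_trs tri nat_ord trans[OF om_D] by blast

lemma nat_cases: "n \<epsilon> om \<Longrightarrow> n = emp \<or> (\<exists>m. m \<epsilon> om \<and> n = sc m)"
proof -
  assume n: "n \<epsilon> om"
  have "n = emp \<or> (\<exists>m. m \<epsilon> om \<and> n = sc m)"
    by (rule om_induct[OF n, of "\<lambda>n. n = emp \<or> (\<exists>m. m \<epsilon> om \<and> n = sc m)"]) (intro definable om_D emp_D, auto)
  then show ?thesis .
qed

lemma sc_le: "ord a \<Longrightarrow> a \<in> D \<Longrightarrow> x \<epsilon> a \<Longrightarrow> sc x \<epsilon> a \<or> sc x = a"
proof -
  assume a: "ord a" "a \<in> D" "x \<epsilon> a"
  then have "ord (sc x)" "sc x \<in> D" using ord_mem ord_sc trans by auto
  then show ?thesis using tri[of "sc x" a] a mem_asym[of x a] mem_irrefl by auto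
qed

lemma lim_sc: "ord a \<Longrightarrow> a \<in> D \<Longrightarrow> \<not> suc a \<Longrightarrow> x \<epsilon> a \<Longrightarrow> sc x \<epsilon> a"
  using sc_le by fastforce

lemma om_not_suc: "\<not> suc om"
  unfolding suc_def using mem_irrefl om_sc by metis

lemma ord_emp_mem: "ord a \<Longrightarrow> a \<in> D \<Longrightarrow> a \<noteq> emp \<Longrightarrow> emp \<epsilon> a"
  using tri[OF _ ord_emp, of a] by auto

text \<open>Adding one more value, the bound is either kept or moved just past that value, which is
  possible below a limit. This yields both that a finite ordinal is not cofinal in a limit and that
  a finite set cannot be mapped onto \<open>om\<close>.\<close>

lemma finite_bounded:
  assumes "n \<epsilon> om" "f \<in> D" "a \<in> D" "ord a" "a \<noteq> emp" "\<not> suc a"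
  shows "\<exists>k. k \<epsilon> a \<and> (\<forall>i. i \<epsilon> n \<longrightarrow> app f i \<epsilon> a \<longrightarrow> app f i \<epsilon> k)"
proof (rule om_induct[OF assms(1), of "\<lambda>n. \<exists>k. k \<epsilon> a \<and> (\<forall>i. i \<epsilon> n \<longrightarrow> app f i \<epsilon> a \<longrightarrow> app f i \<epsilon> k)"])
  show "dfn (\<lambda>e. \<exists>k. k \<epsilon> a \<and> (\<forall>i. i \<epsilon> e 0 \<longrightarrow> app f i \<epsilon> a \<longrightarrow> app f i \<epsilon> k))"
    using assms by (intro definable; simp)
  show "\<exists>k. k \<epsilon> a \<and> (\<forall>i. i \<epsilon> emp \<longrightarrow> app f i \<epsilon> a \<longrightarrow> app f i \<epsilon> k)"
    using assms ord_emp_mem by auto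
  fix n assume "n \<epsilon> om" "\<exists>k. k \<epsilon> a \<and> (\<forall>i. i \<epsilon> n \<longrightarrow> app f i \<epsilon> a \<longrightarrow> app f i \<epsilon> k)"
  then obtain k where k: "k \<epsilon> a" "\<And>i. i \<epsilon> n \<Longrightarrow> app f i \<epsilon> a \<Longrightarrow> app f i \<epsilon> k" by blast
  show "\<exists>k. k \<epsilon> a \<and> (\<forall>i. i \<epsilon> sc n \<longrightarrow> app f i \<epsilon> a \<longrightarrow> app f i \<epsilon> k)"
  proof (cases "app f n \<epsilon> a")
    case True
    then have s: "sc (app f n) \<epsilon> a" using lim_sc assms by blast
    consider "sc (app f n) \<epsilon> k \<or> sc (app f n) = k" | "k \<epsilon> sc (app f n)"
      using ord_lin[OF assms(4) s k(1)] by blast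
    then show ?thesis
    proof cases
      case 1
      then have "app f n \<epsilon> k" using ord_trs[OF ord_mem[OF assms(4) k(1)]] sc by blast
      then show ?thesis using k by (intro exI[of _ k]) auto
    next
      case 2
      then have "x \<epsilon> sc (app f n)" if "x \<epsilon> k" for x
        using ord_trs[OF ord_mem[OF assms(4) s]] that by blast
      then show ?thesis using k s by (intro exI[of _ "sc (app f n)"]) auto
    qed
  next
    case False
    then show ?thesis using k by (intro exI[of _ k]) auto
  qed
qed

text \<open>Recursion that restarts with \<open>a\<close> at each nonsuccessor: on \<open>om\<close>
  it is primitive recursion, on larger ordinals it computes functions of the finite part. The graph
  is the least subset of \<open>prd X Y\<close> closed under the clauses, which avoids gluing
  approximations.\<close>

lemma succ_rec:
  assumes X: "X \<in> D" "ord X" and Y: "Y \<in> D" "a \<epsilon> Y"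
    and G: "\<And>y v. y \<epsilon> X \<Longrightarrow> v \<epsilon> Y \<Longrightarrow> G y v \<epsilon> Y" "\<And>i j. tm (\<lambda>e. G (e i) (e j))"
  obtains g where "g \<in> D" "isfn g X Y" "\<And>x. x \<epsilon> X \<Longrightarrow> \<not> suc x \<Longrightarrow> app g x = a"
    "\<And>y. sc y \<epsilon> X \<Longrightarrow> app g (sc y) = G y (app g y)"
proof -
  have aD: "a \<in> D" using Y trans by blast
  define cl where "cl k \<longleftrightarrow> (\<forall>x. x \<epsilon> X \<longrightarrow> \<not> suc x \<longrightarrow> opr x a \<epsilon> k) \<and>
    (\<forall>y. y \<epsilon> X \<longrightarrow> sc y \<epsilon> X \<longrightarrow> (\<forall>v. v \<epsilon> Y \<longrightarrow> opr y v \<epsilon> k \<longrightarrow> opr (sc y) (G y v) \<epsilon> k))" for k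
  define K where "K = col (prd X Y) (\<lambda>p. \<forall>k\<in>D. sub k (prd X Y) \<and> cl k \<longrightarrow> p \<epsilon> k)"
  have P: "prd X Y \<in> D" using X Y prd by blast
  have "dfn (\<lambda>e. \<forall>k\<in>D. sub k (prd X Y) \<and> cl k \<longrightarrow> e 0 \<epsilon> k)"
    unfolding cl_def using X Y P aD by (intro definable G(2); simp)
  note K = col[OF P this, folded K_def]
  have clK: "cl K"
    unfolding cl_def
  proof (intro conjI allI impI)
    fix x assume "x \<epsilon> X" "\<not> suc x"
    then show "opr x a \<epsilon> K" unfolding K(2) cl_def using Y(2) X(1) Y(1) by (auto simp: opr_prd)
  next
    fix y v assume *: "y \<epsilon> X" "sc y \<epsilon> X" "v \<epsilon> Y" "opr y v \<epsilon> K"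
    then have "opr (sc y) (G y v) \<epsilon> prd X Y" using X(1) Y(1) G(1) by (auto simp: opr_prd)
    moreover have "opr (sc y) (G y v) \<epsilon> k" if "k \<in> D" "sub k (prd X Y)" "cl k" for k
    proof -
      have "opr y v \<epsilon> k" using *(4) that unfolding K(2) by blast
      then show ?thesis using that(3) *(1-3) unfolding cl_def by blast
    qed
    ultimately show "opr (sc y) (G y v) \<epsilon> K" unfolding K(2) by blast
  qed
  have subK: "opr x v \<epsilon> K \<Longrightarrow> x \<epsilon> X \<and> v \<epsilon> Y" for x v unfolding K(2) using X(1) Y(1) by (simp add: opr_prd)
  \<comment> \<open>Minimality of \<open>K\<close>: a pair that no clause forces could be deleted
    without destroying closure.\<close>
  have removal: False
    if "opr x w \<epsilon> K" "\<not> suc x \<Longrightarrow> w \<noteq> a"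
      "\<And>y v. x = sc y \<Longrightarrow> opr y v \<epsilon> K \<Longrightarrow> w \<noteq> G y v" for x w
  proof -
    have D: "opr x w \<in> D" using that(1) K(1) trans by blast
    have "dfn (\<lambda>e. e 0 \<noteq> opr x w)" by (intro definable; rule D)
    from col[OF K(1) this] have k: "col K (\<lambda>p. p \<noteq> opr x w) \<in> D"
      "p \<epsilon> col K (\<lambda>p. p \<noteq> opr x w) \<longleftrightarrow> p \<epsilon> K \<and> p \<noteq> opr x w" for p by auto
    have "cl (col K (\<lambda>p. p \<noteq> opr x w))"
      using clK that(2,3) unfolding cl_def k(2) opr_inject by blast
    moreover have "sub (col K (\<lambda>p. p \<noteq> opr x w)) (prd X Y)" unfolding sub_def k(2) K(2) by blast
    ultimately have "opr x w \<epsilon> col K (\<lambda>p. p \<noteq> opr x w)" using that(1) k(1) unfolding K(2) by blast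
    then show False unfolding k(2) by simp
  qed
  have dU: "dfn (\<lambda>e. \<exists>v. v \<epsilon> Y \<and> (\<forall>w\<in>D. opr (e 0) w \<epsilon> K \<longleftrightarrow> w = v))"
    using Y K(1) by (intro definable; simp)
  have U: "\<exists>v. v \<epsilon> Y \<and> (\<forall>w\<in>D. opr x w \<epsilon> K \<longleftrightarrow> w = v)" if "x \<epsilon> X" for x
  proof (rule trs_induct[OF X(1) _ dU _ that])
    show "trs X" using X(2) by (simp add: ord_def)
    fix x assume x: "x \<epsilon> X" and IH: "\<And>y. y \<epsilon> x \<Longrightarrow> \<exists>v. v \<epsilon> Y \<and> (\<forall>w\<in>D. opr y w \<epsilon> K \<longleftrightarrow> w = v)"
    show "\<exists>v. v \<epsilon> Y \<and> (\<forall>w\<in>D. opr x w \<epsilon> K \<longleftrightarrow> w = v)"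
    proof (cases "suc x")
      case False
      have "opr x a \<epsilon> K" using clK x False unfolding cl_def by blast
      moreover have "w = a" if "opr x w \<epsilon> K" for w
      proof (rule ccontr)
        assume "w \<noteq> a"
        show False by (rule removal[OF that]) (use False \<open>w \<noteq> a\<close> in auto)
      qed
      ultimately show ?thesis using Y(2) by blast
    next
      case True
      then obtain y where y: "y \<epsilon> x" "x = sc y" unfolding suc_def by blast
      then obtain v where v: "v \<epsilon> Y" "\<forall>w\<in>D. opr y w \<epsilon> K \<longleftrightarrow> w = v" using IH by blast
      have yX: "y \<epsilon> X" using ord_trs[OF X(2) x y(1)] .
      have vD: "v \<in> D" using v(1) Y(1) trans by blast
      have "opr x (G y v) \<epsilon> K" using clK yX x v vD unfolding cl_def y(2) by blast
      moreover have "w = G y v" if w: "opr x w \<epsilon> K" for w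
      proof (rule ccontr)
        assume "w \<noteq> G y v"
        show False
        proof (rule removal[OF w])
          show "w \<noteq> a" if "\<not> suc x" using that True by blast
          fix y' v' assume "x = sc y'" "opr y' v' \<epsilon> K"
          then have "y' = y" "v' = v" using y(2) v(2) subK Y(1) trans by auto
          then show "w \<noteq> G y' v'" using \<open>w \<noteq> G y v\<close> by simp
        qed
      qed
      ultimately show ?thesis using G(1)[OF yX v(1)] by blast
    qed
  qed
  have fn: "isfn K X Y"
    unfolding isfn_def isf_def
  proof (intro conjI allI impI)
    show "\<exists>x y. x \<epsilon> X \<and> p = opr x y" if "p \<epsilon> K" for p
      using that unfolding K(2) prd(2)[OF X(1) Y(1)] by blast
    show "\<exists>y. \<forall>z. opr x z \<epsilon> K \<longleftrightarrow> z = y" if "x \<epsilon> X" for x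
      using U[OF that] opr_memD2[OF _ K(1)] trans[OF Y(1)] by metis
    show "y \<epsilon> Y" if "opr x y \<epsilon> K" for x y using subK that by blast
  qed
  show ?thesis
  proof (rule that[OF K(1) fn])
    show "app K x = a" if "x \<epsilon> X" "\<not> suc x" for x
      using clK that isfn_app[OF fn that(1)] unfolding cl_def by blast
    show "app K (sc y) = G y (app K y)" if "sc y \<epsilon> X" for y
    proof -
      have yX: "y \<epsilon> X" using ord_trs[OF X(2) that, of y] by simp
      then have "app K y \<epsilon> Y" "opr y (app K y) \<epsilon> K" using isfn_in[OF fn] isfn_app[OF fn] by auto
      then have "opr (sc y) (G y (app K y)) \<epsilon> K" using clK yX that unfolding cl_def by blast
      then show ?thesis using isfn_app[OF fn that] by blast
    qed
  qed
qed

text \<open>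
  An ordinal enumeration of \<open>B\<close> is built from partial enumerations \<open>p\<close>, where \<open>p(\<beta>)\<close> is the
  element chosen by \<open>c\<close> from what is left after stage \<open>\<beta>\<close>. By Replacement on \<open>B\<close>, the stages
  reached by partial enumerations form a set.
\<close>

context
  fixes B c
  assumes B: "B \<in> D" and c: "c \<in> D" "\<And>S x. S \<in> D \<Longrightarrow> sub S B \<Longrightarrow> x \<epsilon> S \<Longrightarrow> app c S \<epsilon> S"
begin

definition "rest p b = col B (\<lambda>z. \<not> (\<exists>d. d \<epsilon> b \<and> app p d = z))"

definition "penum p a \<longleftrightarrow> ord a \<and> isfn p a B \<and> (\<forall>b. b \<epsilon> a \<longrightarrow> app p b \<epsilon> rest p b \<and> app p b = app c (rest p b))"

lemma rest:
  assumes "p \<in> D" "b \<in> D"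
  shows "rest p b \<in> D" "z \<epsilon> rest p b \<longleftrightarrow> z \<epsilon> B \<and> \<not> (\<exists>d. d \<epsilon> b \<and> app p d = z)" "sub (rest p b) B"
proof -
  have "dfn (\<lambda>e. \<not> (\<exists>d. d \<epsilon> b \<and> app p d = e 0))" using assms by (intro definable; simp)
  from col[OF B this] show "rest p b \<in> D" "z \<epsilon> rest p b \<longleftrightarrow> z \<epsilon> B \<and> \<not> (\<exists>d. d \<epsilon> b \<and> app p d = z)"
    "sub (rest p b) B" by (auto simp: rest_def sub_def)
qed

lemma rest_cong:
  assumes "p \<in> D" "q \<in> D" "b \<in> D" "\<And>d. d \<epsilon> b \<Longrightarrow> app p d = app q d"
  shows "rest p b = rest q b"
  by (rule ext) (use assms in \<open>auto simp: rest\<close>)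

lemma dfn_penum: "dfn (\<lambda>e. penum (e i) (e j))"
proof -
  have tm: "tm (\<lambda>e. rest (e k) (e l))" for k l
  proof (rule tmI)
    show "rest (e k) (e l) \<in> D" if "range e \<subseteq> D" for e
      using rest(1)[of "e k" "e l"] that by auto
    show "x = rest (e k) (e l) \<longleftrightarrow> (\<forall>z\<in>D. z \<epsilon> x \<longleftrightarrow> z \<epsilon> B \<and> \<not> (\<exists>d. d \<epsilon> e l \<and> app (e k) d = z))"
      if e: "range e \<subseteq> D" and x: "x \<in> D" for x e
    proof -
      have "e k \<in> D" "e l \<in> D" using e by auto
      then show ?thesis using ext_D[OF x rest(1)] rest(2) by auto
    qed
    show "dfn (\<lambda>e. \<forall>z\<in>D. z \<epsilon> e 0 \<longleftrightarrow> z \<epsilon> B \<and> \<not> (\<exists>d. d \<epsilon> e (Suc l) \<and> app (e (Suc k)) d = z))"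
      by (intro definable B)
  qed
  show ?thesis unfolding penum_def by (intro definable tm B c(1))
qed

text \<open>At the least stage where the two partial enumerations differ, the same elements are left
  over, and \<open>c\<close> makes the same choice from them.\<close>

lemma penum_agree:
  assumes p: "p \<in> D" "a \<in> D" "penum p a" and q: "q \<in> D" "penum q b" and d: "d \<epsilon> a" "d \<epsilon> b"
  shows "app p d = app q d"
proof (rule ccontr)
  assume "app p d \<noteq> app q d"
  moreover have "dfn (\<lambda>e. e 0 \<epsilon> b \<and> app p (e 0) \<noteq> app q (e 0))" if "b \<in> D"
    using that p q by (intro definable; simp)
  ultimately obtain d where d: "d \<epsilon> a" "d \<epsilon> b" "app p d \<noteq> app q d"
    "\<And>z. z \<epsilon> d \<Longrightarrow> z \<epsilon> a \<Longrightarrow> z \<epsilon> b \<Longrightarrow> app p z = app q z"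
  proof -
    have "dfn (\<lambda>e. app p (e 0) \<noteq> app q (e 0))" using p q by (intro definable; simp)
    with \<open>app p d \<noteq> app q d\<close> obtain d' where "d' \<epsilon> a" "app p d' \<noteq> app q d'"
      "\<And>z. z \<epsilon> d' \<Longrightarrow> z \<epsilon> a \<Longrightarrow> app p z = app q z"
      using least[OF p(2) _ d(1), of "\<lambda>x. app p x \<noteq> app q x"] by blast
    moreover have "d' \<epsilon> b"
    proof -
      have "d' \<epsilon> d \<or> d' = d \<or> d \<epsilon> d'" using ord_lin \<open>d' \<epsilon> a\<close> d(1) p(3) unfolding penum_def by blast
      then show ?thesis
        using calculation(3) \<open>app p d \<noteq> app q d\<close> d ord_trs[of b d d'] q(2) unfolding penum_def by blast
    qed
    ultimately show ?thesis using that by blast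
  qed
  have "ord a" "ord b" using p q by (auto simp: penum_def)
  then have "app p z = app q z" if "z \<epsilon> d" for z
    using that d ord_trs by blast
  moreover have "d \<in> D" using d(1) p(2) trans by blast
  ultimately have "rest p d = rest q d" using p q by (intro rest_cong) auto
  then show False using d p(3) q(2) unfolding penum_def by metis
qed

text \<open>The later of two stages chooses among elements that the earlier one has not
  taken.\<close>

lemma penum_inj:
  assumes p: "p \<in> D" "a \<in> D" "penum p a" and d: "d \<epsilon> a" "d' \<epsilon> a" "app p d = app p d'"
  shows "d = d'"
proof -
  have *: "\<not> x \<epsilon> y" if "x \<epsilon> a" "y \<epsilon> a" "app p x = app p y" for x y
  proof
    assume "x \<epsilon> y"
    have "y \<in> D" using that(2) p(2) trans by blast
    moreover have "app p y \<epsilon> rest p y" using p(3) that(2) unfolding penum_def by blast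
    ultimately show False using rest(2)[OF p(1)] that(3) \<open>x \<epsilon> y\<close> by blast
  qed
  then show ?thesis using ord_lin[of a d d'] p(3) d unfolding penum_def by metis
qed

lemma enumeration: "\<exists>a\<in>D. \<exists>p\<in>D. ord a \<and> isfn p a B \<and> (\<forall>d d'. d \<epsilon> a \<longrightarrow> d' \<epsilon> a \<longrightarrow> app p d = app p d' \<longrightarrow> d = d') \<and>
  (\<forall>z. z \<epsilon> B \<longrightarrow> (\<exists>d. d \<epsilon> a \<and> app p d = z))"
proof -
  define Q where "Q d z \<longleftrightarrow> (\<exists>p\<in>D. \<exists>a\<in>D. penum p a \<and> d \<epsilon> a \<and> app p d = z)" for d z
  have dQ: "dfn (\<lambda>e. Q (e i) (e j))" for i j
    unfolding Q_def by (intro definable dfn_penum)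
  have Qf: "z = z'" if "Q d z" "Q d z'" for d z z'
    using that penum_agree unfolding Q_def by metis
  have Qi: "d = d'" if dd: "Q d z" "Q d' z" for d d' z
  proof -
    obtain p a p' a' where p: "p \<in> D" "a \<in> D" "penum p a" "d \<epsilon> a" "app p d = z"
      and p': "p' \<in> D" "a' \<in> D" "penum p' a'" "d' \<epsilon> a'" "app p' d' = z"
      using dd unfolding Q_def by blast
    have "ord a" "ord a'" using p(3) p'(3) by (auto simp: penum_def)
    then have "sub a a' \<or> sub a' a"
      using tri_sub(2)[of a a'] tri_sub(2)[of a' a] mem_asym p(2) p'(2) by blast
    then show ?thesis
    proof
      assume "sub a a'"
      then have "d \<epsilon> a'" using p(4) by (simp add: sub_def)
      then have "app p' d = app p' d'" using penum_agree[OF p(1-3) p'(1,3) p(4)] p(5) p'(5) by simp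
      then show ?thesis using penum_inj[OF p'(1-3) \<open>d \<epsilon> a'\<close> p'(4)] by simp
    next
      assume "sub a' a"
      then have "d' \<epsilon> a" using p'(4) by (simp add: sub_def)
      then have "app p d' = app p d" using penum_agree[OF p(1-3) p'(1,3) _ p'(4)] p(5) p'(5) by simp
      then show ?thesis using penum_inj[OF p(1-3) \<open>d' \<epsilon> a\<close> p(4)] by simp
    qed
  qed
  obtain O1 where O1: "O1 \<in> D" "\<And>d. d \<epsilon> O1 \<longleftrightarrow> d \<in> D \<and> (\<exists>z. z \<epsilon> B \<and> Q d z)"
    using repl[OF B, of "\<lambda>z d. Q d z"] dQ Qi by blast
  have QB: "Q d z \<Longrightarrow> d \<epsilon> O1 \<and> z \<epsilon> B" for d z
    unfolding O1(2) unfolding Q_def penum_def using isfn_in trans by metis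
  have ordO: "ord O1"
    unfolding ord_def trs_def lin_def
  proof (intro conjI allI impI; elim conjE)
    fix d d' assume "d \<epsilon> O1" "d' \<epsilon> d"
    then obtain p a where p: "p \<in> D" "a \<in> D" "penum p a" "d \<epsilon> a" unfolding O1(2) Q_def by blast
    then have "d' \<epsilon> a" using \<open>d' \<epsilon> d\<close> ord_trs unfolding penum_def by blast
    then have "Q d' (app p d')" using p unfolding Q_def by blast
    then show "d' \<epsilon> O1" using QB by blast
  next
    fix d d' assume "d \<epsilon> O1" "d' \<epsilon> O1"
    then have "ord d" "ord d'" "d \<in> D" "d' \<in> D"
      unfolding O1(2) Q_def penum_def using ord_mem by blast+
    then show "d \<epsilon> d' \<or> d = d' \<or> d' \<epsilon> d" using tri by blast
  qed
  define P where "P = col (prd O1 B) (\<lambda>p. \<exists>d\<in>D. \<exists>z\<in>D. p = opr d z \<and> Q d z)"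
  have "dfn (\<lambda>e. \<exists>d\<in>D. \<exists>z\<in>D. e 0 = opr d z \<and> Q d z)" by (intro definable dQ)
  note P = col[OF prd(1)[OF O1(1) B] this, folded P_def]
  have oP: "opr d z \<epsilon> P \<longleftrightarrow> Q d z" for d z
    unfolding P(2) prd(2)[OF O1(1) B] using QB trans[OF O1(1)] trans[OF B] by auto
  have fn: "isfn P O1 B"
    unfolding isfn_def isf_def oP
  proof (intro conjI allI impI)
    show "\<exists>x y. x \<epsilon> O1 \<and> p = opr x y" if "p \<epsilon> P" for p
      using that unfolding P(2) prd(2)[OF O1(1) B] by blast
    show "\<exists>y. \<forall>z. Q x z \<longleftrightarrow> z = y" if "x \<epsilon> O1" for x using that Qf unfolding O1(2) by blast
    show "y \<epsilon> B" if "Q x y" for x y using that QB by blast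
  qed
  have appP: "app P d = z \<longleftrightarrow> Q d z" if "d \<epsilon> O1" for d z using isfn_app[OF fn that] oP by blast
  have penumP: "penum P O1"
    unfolding penum_def
  proof (intro conjI allI impI ordO fn)
    fix b assume b: "b \<epsilon> O1"
    then obtain p a where p: "p \<in> D" "a \<in> D" "penum p a" "b \<epsilon> a" unfolding O1(2) Q_def by blast
    have *: "app P d = app p d" if "d \<epsilon> a" for d
    proof -
      have "Q d (app p d)" using p that unfolding Q_def by blast
      then show ?thesis using appP QB by blast
    qed
    have "ord a" using p(3) by (simp add: penum_def)
    then have "rest P b = rest p b"
      using p ord_trs[OF _ p(4)] * P(1) trans by (intro rest_cong) auto
    then show "app P b \<epsilon> rest P b" "app P b = app c (rest P b)"
      using p(3,4) *[OF p(4)] unfolding penum_def by auto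
  qed
  have surj: "\<exists>d. d \<epsilon> O1 \<and> app P d = z" if z: "z \<epsilon> B" for z
  proof (rule ccontr)
    assume no: "\<not> (\<exists>d. d \<epsilon> O1 \<and> app P d = z)"
    \<comment> \<open>If an element were left over, \<open>P\<close> could be extended by a stage
      \<open>O1\<close>. That stage would belong to the set \<open>O1\<close> of all stages, against
      Foundation.\<close>
    let ?v = "app c (rest P O1)"
    have v: "?v \<epsilon> rest P O1" using c(2)[OF rest(1,3)[OF P(1) O1(1)], of z] rest(2)[OF P(1) O1(1)] z no by blast
    then have vB: "?v \<epsilon> B" using rest(2)[OF P(1) O1(1)] by blast
    define P' where "P' = un2 P (upr (opr O1 ?v) (opr O1 ?v))"
    have vD: "?v \<in> D" using vB B trans by blast
    have P'D: "P' \<in> D" unfolding P'_def using P(1) O1(1) vD by simp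
    have P': "p \<epsilon> P' \<longleftrightarrow> (\<exists>x. x \<epsilon> sc O1 \<and> p = opr x (if x = O1 then ?v else app P x))" for p
    proof -
      have "p \<epsilon> P \<longleftrightarrow> (\<exists>x. x \<epsilon> O1 \<and> p = opr x (app P x))"
        using isf_mem[of P O1 p] fn unfolding isfn_def by blast
      then have "p \<epsilon> P' \<longleftrightarrow> (\<exists>x. x \<epsilon> O1 \<and> p = opr x (app P x)) \<or> p = opr O1 ?v"
        by (simp add: P'_def)
      moreover define g where "g = (\<lambda>x. if x = O1 then ?v else app P x)"
      have "g x = app P x" if "x \<epsilon> O1" for x using that mem_irrefl[of O1] by (auto simp: g_def)
      then have "(\<exists>x. x \<epsilon> O1 \<and> p = opr x (app P x)) \<longleftrightarrow> (\<exists>x. x \<epsilon> O1 \<and> p = opr x (g x))" by auto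
      moreover have "?v = g O1" by (simp add: g_def)
      ultimately have "p \<epsilon> P' \<longleftrightarrow> (\<exists>x. x \<epsilon> O1 \<and> p = opr x (g x)) \<or> p = opr O1 (g O1)" by metis
      also have "\<dots> \<longleftrightarrow> (\<exists>x. x \<epsilon> sc O1 \<and> p = opr x (g x))" unfolding sc by blast
      finally have "p \<epsilon> P' \<longleftrightarrow> (\<exists>x. x \<epsilon> sc O1 \<and> p = opr x (g x))" .
      then show ?thesis by (simp only: g_def)
    qed
    have vals: "(if x = O1 then ?v else app P x) \<epsilon> B" if "x \<epsilon> sc O1" for x
    proof (cases "x = O1")
      case True
      then show ?thesis using vB by simp
    next
      case False
      then have "app P x \<epsilon> B" using that isfn_in[OF fn, of x] by simp
      then show ?thesis using False by simp
    qed
    have fn': "isfn P' (sc O1) B" by (rule isfn_intro(1)[OF P' vals])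
    have app': "app P' x = (if x = O1 then ?v else app P x)" if "x \<epsilon> sc O1" for x
      by (rule isfn_intro(2)[OF P' vals that])
    have r: "rest P' b = rest P b" if b: "b \<epsilon> sc O1" for b
    proof (rule rest_cong[OF P'D P(1)])
      show "b \<in> D" using trans[OF sc_D[OF O1(1)] b] .
      show "app P' d = app P d" if "d \<epsilon> b" for d
      proof -
        have "d \<epsilon> O1" using b that ord_trs[OF ordO, of b d] unfolding sc by blast
        then show ?thesis using app'[of d] mem_irrefl[of O1] unfolding sc by metis
      qed
    qed
    have "penum P' (sc O1)"
      unfolding penum_def
    proof (intro conjI allI impI fn' ord_sc[OF ordO])
      fix b assume b: "b \<epsilon> sc O1"
      have "app P' b \<epsilon> rest P b \<and> app P' b = app c (rest P b)"
      proof (cases "b = O1")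
        case True
        then show ?thesis using app'[OF b] v by simp
      next
        case False
        then have "b \<epsilon> O1" using b by simp
        then have 1: "app P b \<epsilon> rest P b" "app P b = app c (rest P b)"
          using penumP unfolding penum_def by blast+
        have 2: "app P' b = app P b" using app'[OF b] False by (simp only: if_False)
        show ?thesis unfolding 2 by (rule conjI[OF 1])
      qed
      then show "app P' b \<epsilon> rest P' b" "app P' b = app c (rest P' b)" unfolding r[OF b] by blast+
    qed
    moreover have "O1 \<epsilon> sc O1" by simp
    moreover have "app P' O1 = ?v" using app'[of O1] by simp
    ultimately have "Q O1 ?v" unfolding Q_def using P'D sc_D[OF O1(1)] by blast
    then show False using QB mem_irrefl by blast
  qed
  show ?thesis using O1(1) P(1) ordO fn surj penum_inj[OF P(1) O1(1) penumP] by blast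
qed

end

theorem numeration:
  assumes B: "B \<in> D"
  obtains a p where "a \<in> D" "p \<in> D" "ord a" "isfn p a B"
    "\<And>d d'. d \<epsilon> a \<Longrightarrow> d' \<epsilon> a \<Longrightarrow> app p d = app p d' \<Longrightarrow> d = d'"
    "\<And>z. z \<epsilon> B \<Longrightarrow> \<exists>d. d \<epsilon> a \<and> app p d = z"
proof -
  \<comment> \<open>The membership relation on subsets of \<open>B\<close>; uniformising it by
    \<open>choice_rel\<close> gives a choice function for the nonempty subsets.\<close>
  define Z where "Z = col (prd (pw B) B) (\<lambda>p. \<exists>S\<in>D. \<exists>b. b \<epsilon> S \<and> p = opr S b)"
  have "dfn (\<lambda>e. \<exists>S\<in>D. \<exists>b. b \<epsilon> S \<and> e 0 = opr S b)" by (intro definable)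
  note Z = col[OF prd(1)[OF pw(1)[OF B] B] this, folded Z_def]
  obtain c where c: "c \<in> D" "sub c Z" "\<And>x y. opr x y \<epsilon> Z \<Longrightarrow> \<exists>v. \<forall>z. opr x z \<epsilon> c \<longleftrightarrow> z = v"
    using choice_rel[OF Z(1)] by metis
  have choose: "app c S \<epsilon> S" if S: "S \<in> D" "sub S B" "x \<epsilon> S" for S x
  proof -
    have "x \<epsilon> B" using S by (simp add: sub_def)
    then have "opr S x \<epsilon> prd (pw B) B" using S by (simp add: opr_prd pw B)
    moreover have "\<exists>S'\<in>D. \<exists>b. b \<epsilon> S' \<and> opr S x = opr S' b" using S by blast
    ultimately have "opr S x \<epsilon> Z" unfolding Z(2) by blast
    then obtain v where v: "\<forall>z. opr S z \<epsilon> c \<longleftrightarrow> z = v" using c(3) by blast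
    then have "v = app c S" unfolding app_eq by blast
    then have "opr S (app c S) \<epsilon> c" using v by blast
    then have "opr S (app c S) \<epsilon> Z" using c(2) unfolding sub_def by blast
    then obtain S' b where "b \<epsilon> S'" "opr S (app c S) = opr S' b" unfolding Z(2) by blast
    then show ?thesis by (metis opr_inject)
  qed
  have "\<exists>a\<in>D. \<exists>p\<in>D. ord a \<and> isfn p a B \<and>
      (\<forall>d d'. d \<epsilon> a \<longrightarrow> d' \<epsilon> a \<longrightarrow> app p d = app p d' \<longrightarrow> d = d') \<and> (\<forall>z. z \<epsilon> B \<longrightarrow> (\<exists>d. d \<epsilon> a \<and> app p d = z))"
    by (rule enumeration[OF B c(1) choose])
  then obtain a p where ap: "a \<in> D" "p \<in> D" "ord a" "isfn p a B"
    "\<forall>d d'. d \<epsilon> a \<longrightarrow> d' \<epsilon> a \<longrightarrow> app p d = app p d' \<longrightarrow> d = d'"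
    "\<forall>z. z \<epsilon> B \<longrightarrow> (\<exists>d. d \<epsilon> a \<and> app p d = z)"
    by (elim bexE conjE)
  show ?thesis by (rule that[OF ap(1-4)]) (use ap(5,6) in auto)
qed

end

section \<open>A rigid relation on a successor ordinal\<close>

context omset
begin

definition "lim x \<longleftrightarrow> x \<noteq> emp \<and> \<not> suc x"

text \<open>
  The relation lives on \<open>X = {x. x \<le> t}\<close> with \<open>t = sc s\<close>. The vertex \<open>t\<close> singles out the
  successors; \<open>emp\<close> is fixed because of the edge from 0 to 2; \<open>off\<close> gives the finite part of an
  ordinal and \<open>par\<close> its parity. A limit \<open>y\<close> receives edges from the odd successors below it,
  and, if \<open>L\<close> provides a ladder for \<open>y\<close>, from the rungs, which are even and have increasing
  finite parts.
\<close>

definition "edge s par L x y \<longleftrightarrow>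
  y \<epsilon> sc s \<and> y = sc x \<or>
  x = emp \<and> y = sc (sc emp) \<or>
  y \<epsilon> sc s \<and> lim y \<and> x \<epsilon> y \<and> suc x \<and> app par x \<noteq> emp \<or>
  opr y x \<epsilon> L \<or>
  y = sc s \<and> x \<epsilon> sc s \<and> (suc x \<or> x = s)"

text \<open>No domain is mentioned, so a frame built inside one transitive model can be used as it
  stands inside another one that contains the endomorphism.\<close>

definition "frame s off par L R \<longleftrightarrow> ord s \<and> sub om s \<and>
  isfn off (sc (sc s)) om \<and> (\<forall>x. x \<epsilon> sc (sc s) \<longrightarrow> \<not> suc x \<longrightarrow> app off x = emp) \<and>
  (\<forall>y. sc y \<epsilon> sc (sc s) \<longrightarrow> app off (sc y) = sc (app off y)) \<and>
  (\<forall>x. x \<epsilon> sc (sc s) \<longrightarrow> \<not> suc x \<longrightarrow> app par x = emp) \<and>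
  (\<forall>y. sc y \<epsilon> sc (sc s) \<longrightarrow> app par (sc y) = (if app par y = emp then sc emp else emp)) \<and>
  (\<forall>y x. opr y x \<epsilon> L \<longrightarrow> y \<epsilon> sc s \<and> lim y \<and> x \<epsilon> y \<and> suc x \<and> app par x = emp \<and>
     (\<forall>z. z \<epsilon> y \<longrightarrow> (\<exists>x'. opr y x' \<epsilon> L \<and> z \<epsilon> x')) \<and>
     (\<forall>x'. opr y x' \<epsilon> L \<longrightarrow> x \<epsilon> x' \<longrightarrow> app off x \<epsilon> app off x')) \<and>
  (\<forall>p. p \<epsilon> R \<longrightarrow> (\<exists>x y. p = opr x y)) \<and>
  (\<forall>x y. opr x y \<epsilon> R \<longleftrightarrow> x \<epsilon> sc (sc s) \<and> y \<epsilon> sc (sc s) \<and> edge s par L x y)"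

definition "cof_om g y \<longleftrightarrow> isfn g om y \<and> (\<forall>x. x \<epsilon> y \<longrightarrow> (\<exists>n. n \<epsilon> om \<and> x \<epsilon> app g n))"

end

text \<open>\<open>D\<close> is a model containing the endomorphism \<open>f\<close>, in general not
  the one in which the frame was built. \<open>ladder\<close> is the form in which specialness
  enters: a limit that has a cofinal \<omega>-sequence in \<open>D\<close> carries rungs.\<close>

locale rigid_frame = zf +
  fixes s off par Lad R f
  assumes in_D [simp]: "s \<in> D" "off \<in> D" "par \<in> D" "Lad \<in> D" "R \<in> D" "f \<in> D"
    and frame: "frame s off par Lad R"
    and ladder: "\<And>y g. y \<epsilon> sc s \<Longrightarrow> lim y \<Longrightarrow> g \<in> D \<Longrightarrow> cof_om g y \<Longrightarrow> \<exists>x. opr y x \<epsilon> Lad"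
    and fn: "isfn f (sc (sc s)) (sc (sc s))"
    and endo: "\<And>x y. opr x y \<epsilon> R \<Longrightarrow> opr (app f x) (app f y) \<epsilon> R"
begin

section \<open>Endomorphisms of a frame\<close>

abbreviation "t \<equiv> sc s"
abbreviation "X \<equiv> sc t"
abbreviation "F \<equiv> app f"

lemma ords: "ord s" "ord t" "ord X"
  using frame ord_sc unfolding frame_def by auto

lemma om_s: "x \<epsilon> om \<Longrightarrow> x \<epsilon> s"
  using frame unfolding frame_def sub_def by blast

lemma R: "opr x y \<epsilon> R \<longleftrightarrow> x \<epsilon> X \<and> y \<epsilon> X \<and> edge s par Lad x y"
  using frame unfolding frame_def by blast

lemma Lad:
  assumes "opr y x \<epsilon> Lad"
  shows "y \<epsilon> t" "lim y" "x \<epsilon> y" "suc x" "app par x = emp"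
    "\<And>z. z \<epsilon> y \<Longrightarrow> \<exists>x'. opr y x' \<epsilon> Lad \<and> z \<epsilon> x'"
    "\<And>x'. opr y x' \<epsilon> Lad \<Longrightarrow> x \<epsilon> x' \<Longrightarrow> app off x \<epsilon> app off x'"
  using frame assms unfolding frame_def by meson+

lemma offs: "x \<epsilon> X \<Longrightarrow> app off x \<epsilon> om" "x \<epsilon> X \<Longrightarrow> \<not> suc x \<Longrightarrow> app off x = emp"
  "sc y \<epsilon> X \<Longrightarrow> app off (sc y) = sc (app off y)"
  using frame isfn_in unfolding frame_def by meson+

lemma pars: "x \<epsilon> X \<Longrightarrow> \<not> suc x \<Longrightarrow> app par x = emp"
  "sc y \<epsilon> X \<Longrightarrow> app par (sc y) = (if app par y = emp then sc emp else emp)"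
  using frame unfolding frame_def by meson+

lemma X_trs: "x \<epsilon> X \<Longrightarrow> y \<epsilon> x \<Longrightarrow> y \<epsilon> X"
  using ord_trs[OF ords(3)] .

lemma in_X [simp]: "x \<epsilon> X \<Longrightarrow> x \<in> D"
  using trans[of X x] by simp

lemma ordX: "x \<epsilon> X \<Longrightarrow> ord x"
  using ord_mem[OF ords(3)] .

lemma in_t: "x \<epsilon> t \<Longrightarrow> x \<epsilon> X"
  unfolding sc by blast

lemma X_induct:
  assumes "dfn (\<lambda>e. P (e 0))" "\<And>x. x \<epsilon> X \<Longrightarrow> (\<And>y. y \<epsilon> x \<Longrightarrow> P y) \<Longrightarrow> P x" "x \<epsilon> X"
  shows "P x"
  by (rule trs_induct[OF _ _ assms]) (use ords(3) in \<open>auto simp: ord_def\<close>)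

lemma F_in: "x \<epsilon> X \<Longrightarrow> F x \<epsilon> X"
  using isfn_in[OF fn] .

lemma R_less:
  assumes "opr x y \<epsilon> R"
  shows "x \<epsilon> y"
proof -
  have "edge s par Lad x y" using assms R by blast
  then show ?thesis unfolding edge_def using Lad(3) by auto
qed

lemma F_edge: "x \<epsilon> X \<Longrightarrow> y \<epsilon> X \<Longrightarrow> edge s par Lad x y \<Longrightarrow> F x \<epsilon> F y \<and> edge s par Lad (F x) (F y)"
proof -
  assume "x \<epsilon> X" "y \<epsilon> X" "edge s par Lad x y"
  then have "opr (F x) (F y) \<epsilon> R" using R endo by blast
  then show ?thesis using R R_less by blast
qed

lemma edge_sc: "sc x \<epsilon> X \<Longrightarrow> edge s par Lad x (sc x)"
  unfolding edge_def sc[of _ t] by auto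

lemma lim_closed: "y \<epsilon> X \<Longrightarrow> lim y \<Longrightarrow> x \<epsilon> y \<Longrightarrow> sc x \<epsilon> y"
  using lim_sc[OF ordX in_X] unfolding lim_def by blast

text \<open>Parity alternates, so one of the next two successors of \<open>x\<close> is odd, and
  both are still below the limit.\<close>

lemma odd_cofinal:
  assumes "y \<epsilon> X" "lim y" "x \<epsilon> y"
  shows "\<exists>z. z \<epsilon> y \<and> x \<epsilon> z \<and> suc z \<and> app par z \<noteq> emp"
proof (cases "app par x = emp")
  case True
  have "sc x \<epsilon> y" using lim_closed assms by blast
  moreover have "app par (sc x) \<noteq> emp" using pars(2)[OF X_trs[OF assms(1) \<open>sc x \<epsilon> y\<close>]] True by simp
  ultimately show ?thesis by (intro exI[of _ "sc x"]) simp
next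
  case False
  have 1: "sc x \<epsilon> y" using lim_closed assms by blast
  then have 2: "sc (sc x) \<epsilon> y" using lim_closed assms by blast
  have "app par (sc x) = emp" using pars(2)[OF X_trs[OF assms(1) 1]] False by simp
  then have "app par (sc (sc x)) \<noteq> emp" using pars(2)[OF X_trs[OF assms(1) 2]] by simp
  then show ?thesis using 2 by (intro exI[of _ "sc (sc x)"]) simp
qed

text \<open>Edges point upwards, and every member of \<open>x\<close> lies at or below some
  \<open>z\<close> with an edge to \<open>x\<close>: the predecessor if \<open>x\<close> is a
  successor, otherwise one of the odd successors cofinal in \<open>x\<close>. So preserving edges
  forces preserving the order.\<close>

lemma mono: "x \<epsilon> X \<Longrightarrow> y \<epsilon> x \<Longrightarrow> F y \<epsilon> F x"
proof -
  have "\<forall>y. y \<epsilon> x \<longrightarrow> F y \<epsilon> F x" if "x \<epsilon> X"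
  proof (rule X_induct[OF _ _ that])
    show "dfn (\<lambda>e. \<forall>y. y \<epsilon> e 0 \<longrightarrow> F y \<epsilon> F (e 0))" by (intro definable in_D)
    fix x assume x: "x \<epsilon> X" and IH: "\<And>z. z \<epsilon> x \<Longrightarrow> \<forall>y. y \<epsilon> z \<longrightarrow> F y \<epsilon> F z"
    have step: "F y \<epsilon> F x" if "z \<epsilon> x" "edge s par Lad z x" "y \<epsilon> z \<or> y = z" for y z
    proof -
      have "F z \<epsilon> F x" using F_edge X_trs x that by blast
      moreover have "F y \<epsilon> F z \<or> F y = F z" using IH that by blast
      ultimately show ?thesis using ord_trs[OF ordX[OF F_in[OF x]], of "F z" "F y"] by metis
    qed
    show "\<forall>y. y \<epsilon> x \<longrightarrow> F y \<epsilon> F x"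
    proof (intro allI impI)
      fix y assume y: "y \<epsilon> x"
      show "F y \<epsilon> F x"
      proof (cases "suc x")
        case True
        then obtain w where w: "w \<epsilon> x" "x = sc w" unfolding suc_def by blast
        show ?thesis
          by (rule step[OF w(1)]) (use edge_sc[of w] x y w(2) in auto)
      next
        case False
        have "lim x" using False y by (auto simp: lim_def)
        moreover have "x \<epsilon> t" using x False unfolding sc[of x t] by auto
        moreover obtain z where "z \<epsilon> x" "y \<epsilon> z" "suc z" "app par z \<noteq> emp"
          using odd_cofinal[OF x \<open>lim x\<close> y] by blast
        ultimately show ?thesis by (intro step[of z]) (auto simp: edge_def)
      qed
    qed
  qed
  then show "x \<epsilon> X \<Longrightarrow> y \<epsilon> x \<Longrightarrow> F y \<epsilon> F x" by blast
qed

lemma not_below: "x \<epsilon> X \<Longrightarrow> \<not> F x \<epsilon> x"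
proof (rule X_induct[of "\<lambda>x. \<not> F x \<epsilon> x"])
  show "dfn (\<lambda>e. \<not> F (e 0) \<epsilon> e 0)" by (intro definable in_D)
  fix x assume "x \<epsilon> X" "\<And>y. y \<epsilon> x \<Longrightarrow> \<not> F y \<epsilon> y"
  then show "\<not> F x \<epsilon> x" using mono by blast
qed

lemma above: "x \<epsilon> X \<Longrightarrow> x = F x \<or> x \<epsilon> F x"
  using not_below ord_lin[OF ords(3) _ F_in] by blast

text \<open>A map that never descends fixes the greatest point; \<open>F_s\<close> repeats this one
  step lower.\<close>

lemma F_t: "F t = t"
proof -
  have "t \<epsilon> X" by simp
  then show ?thesis using above[of t] F_in[of t] mem_asym[of t "F t"] sc[of "F t" t] by metis
qed

lemma F_below_t: "x \<epsilon> t \<Longrightarrow> F x \<epsilon> t"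
  using mono[of t x] F_t by simp

lemma F_s: "F s = s"
  using above[of s] F_below_t[of s] mem_asym by (auto simp: sc)

lemma F_below_s: "x \<epsilon> s \<Longrightarrow> F x \<epsilon> s"
  using mono[of s x] F_s by (simp add: sc)

lemma t_not_small: "t \<noteq> sc (sc emp)"
proof
  assume "t = sc (sc emp)"
  moreover have "sc (sc emp) \<epsilon> t" using om_s[of "sc (sc emp)"] by simp
  ultimately show False using mem_irrefl[of t] by simp
qed

text \<open>Apart from \<open>s\<close>, only successors have an edge to the fixed vertex
  \<open>t\<close>. If the image is \<open>s\<close>, then \<open>x\<close> is \<open>s\<close>
  itself, because points below \<open>s\<close> stay below \<open>s\<close>.\<close>

lemma F_suc:
  assumes "x \<epsilon> t" "suc x"
  shows "suc (F x)"
proof -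
  have "edge s par Lad x t" using assms by (simp add: edge_def)
  then have "edge s par Lad (F x) t" using F_edge[of x t] F_t in_t[OF assms(1)] by simp
  then have "suc (F x) \<or> F x = s"
    unfolding edge_def using t_not_small Lad(1)[of t "F x"] mem_irrefl[of t] by blast
  then show ?thesis
  proof
    assume "F x = s"
    then have "\<not> x \<epsilon> s" using F_below_s[of x] mem_irrefl[of s] by auto
    then show ?thesis using assms \<open>F x = s\<close> by simp
  qed
qed

lemma edge_to_suc:
  assumes "edge s par Lad x y" "y \<epsilon> t" "suc y"
  shows "y = sc x \<or> x = emp \<and> y = sc (sc emp)"
  using assms Lad(2) mem_irrefl[of t] unfolding edge_def lim_def by blast

lemma small: "emp \<epsilon> t" "sc emp \<epsilon> t" "sc (sc emp) \<epsilon> t"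
  using om_s by simp_all

text \<open>The point 2 is the only successor below \<open>t\<close> that receives edges from two
  different points. Its image is such a successor too, hence equals 2, and its members are fixed
  with it.\<close>

lemma F_small: "F emp = emp" "F (sc emp) = sc emp"
proof -
  let ?two = "sc (sc emp)"
  have 2: "suc (F ?two)" "F ?two \<epsilon> t" using F_suc F_below_t small by simp_all
  have "edge s par Lad (sc emp) ?two" "edge s par Lad emp ?two"
    using small(3) by (simp_all add: edge_def)
  then have e: "edge s par Lad (F (sc emp)) (F ?two)" "edge s par Lad (F emp) (F ?two)"
    and less: "F (sc emp) \<epsilon> F ?two"
    using F_edge[of "sc emp" ?two] F_edge[of emp ?two] small[THEN in_t] by simp_all
  have 01: "F emp \<epsilon> F (sc emp)" using mono[of "sc emp" emp] small[THEN in_t] by simp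
  have "F ?two = ?two"
    using edge_to_suc[OF e(1) 2(2,1)] edge_to_suc[OF e(2) 2(2,1)] 01 mem_irrefl by auto
  then have "F (sc emp) = emp \<or> F (sc emp) = sc emp" using less by auto
  then show "F (sc emp) = sc emp" using 01 by auto
  with 01 show "F emp = emp" by simp
qed

lemma F_sc:
  assumes "sc x \<epsilon> X"
  shows "F (sc x) = sc (F x)"
proof (cases "sc x \<epsilon> t")
  case True
  have x: "x \<epsilon> X" using X_trs[OF assms] by simp
  have "edge s par Lad (F x) (F (sc x))" using F_edge[OF x assms edge_sc[OF assms]] by blast
  moreover have "suc (F (sc x))" "F (sc x) \<epsilon> t" using F_suc[OF True] F_below_t[OF True] by simp_all
  ultimately have "F (sc x) = sc (F x) \<or> F x = emp \<and> F (sc x) = sc (sc emp)"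
    using edge_to_suc by blast
  then show ?thesis
  proof
    assume *: "F x = emp \<and> F (sc x) = sc (sc emp)"
    then have "x = emp" using above[OF x] by auto
    then show ?thesis using * F_small by simp
  qed
next
  case False
  then have "x = s" using assms unfolding sc[of _ t] by simp
  then show ?thesis using F_t F_s by simp
qed

text \<open>The fixed odd point 1 has an edge to \<open>y\<close>, hence to \<open>F y\<close>.
  Edges from 1 end in 2, in a limit or in \<open>t\<close>; here 2 is too small, and points below
  \<open>t\<close> stay below \<open>t\<close>.\<close>

lemma F_lim:
  assumes "y \<epsilon> t" "lim y"
  shows "lim (F y)"
proof -
  have y: "y \<epsilon> X" using in_t[OF assms(1)] .
  have "emp \<epsilon> y" using ord_emp_mem[OF ordX[OF y] in_X[OF y]] assms(2) by (simp add: lim_def)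
  then have 1: "sc emp \<epsilon> y" using lim_closed[OF y assms(2)] by blast
  have 2: "sc (sc emp) \<epsilon> y" using lim_closed[OF y assms(2) 1] .
  have "app par (sc emp) \<noteq> emp"
    using pars(1)[of emp] pars(2)[of emp] small[THEN in_t] by simp
  then have "edge s par Lad (sc emp) y" using assms 1 by (simp add: edge_def)
  then have e: "edge s par Lad (sc emp) (F y)"
    using F_edge[of "sc emp" y] small(2)[THEN in_t] y F_small by simp
  have "F y \<noteq> sc (sc emp)"
    using above[OF y] 2 mem_asym[of "sc (sc emp)" y] mem_irrefl[of "sc (sc emp)"] by auto
  moreover have "F y \<noteq> t" using F_below_t[OF assms(1)] mem_irrefl[of t] by auto
  ultimately show ?thesis using e Lad(2) unfolding edge_def by blast
qed

lemma F_not_suc: "x \<epsilon> X \<Longrightarrow> \<not> suc x \<Longrightarrow> \<not> suc (F x)"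
proof -
  assume x: "x \<epsilon> X" "\<not> suc x"
  then have "x \<epsilon> t" unfolding sc[of x t] by auto
  then show ?thesis using F_lim[of x] F_small x unfolding lim_def by (cases "x = emp") auto
qed

text \<open>A label that restarts at nonsuccessors and is propagated along successors depends only
  on the finite part of a point. \<open>F\<close> preserves that part, as it commutes with
  \<open>sc\<close> and maps nonsuccessors to nonsuccessors.\<close>

lemma label_invariant:
  assumes h: "h \<in> D" "\<And>x. x \<epsilon> X \<Longrightarrow> \<not> suc x \<Longrightarrow> app h x = a"
    and step: "\<And>y y'. sc y \<epsilon> X \<Longrightarrow> sc y' \<epsilon> X \<Longrightarrow> app h y = app h y' \<Longrightarrow> app h (sc y) = app h (sc y')"
    and x: "x \<epsilon> X"
  shows "app h (F x) = app h x"
proof (rule X_induct[OF _ _ x])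
  show "dfn (\<lambda>e. app h (F (e 0)) = app h (e 0))" using h(1) by (intro definable in_D)
  fix x assume x: "x \<epsilon> X" and IH: "\<And>y. y \<epsilon> x \<Longrightarrow> app h (F y) = app h y"
  show "app h (F x) = app h x"
  proof (cases "suc x")
    case True
    then obtain w where w: "w \<epsilon> x" "x = sc w" unfolding suc_def by blast
    have "sc w \<epsilon> X" "F (sc w) \<epsilon> X" using x w F_in by blast+
    then have "app h (sc (F w)) = app h (sc w)"
      by (intro step IH w(1)) (simp_all only: F_sc)
    then show ?thesis using F_sc[of w] \<open>sc w \<epsilon> X\<close> w(2) by simp
  next
    case False
    then show ?thesis using h(2) x F_in F_not_suc by simp
  qed
qed

lemma off_F: "x \<epsilon> X \<Longrightarrow> app off (F x) = app off x"
  by (rule label_invariant[of off emp]) (simp_all add: offs del: sc)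

lemma par_F: "x \<epsilon> X \<Longrightarrow> app par (F x) = app par x"
  by (rule label_invariant[of par emp]) (simp_all add: pars del: sc)

text \<open>The image of a ladder edge again starts at an even point and ends in a limit below
  \<open>t\<close>; every edge of this kind comes from \<open>Lad\<close>.\<close>

lemma F_Lad:
  assumes "opr y x \<epsilon> Lad"
  shows "opr (F y) (F x) \<epsilon> Lad"
proof -
  note L = Lad[OF assms]
  have y: "y \<epsilon> X" and x: "x \<epsilon> X" using in_t[OF L(1)] X_trs[OF in_t[OF L(1)] L(3)] by auto
  have "edge s par Lad x y" using assms by (simp add: edge_def)
  then have e: "edge s par Lad (F x) (F y)" using F_edge x y by blast
  have "app par (F x) = emp" using par_F[OF x] L(5) by simp
  moreover have "lim (F y)" using F_lim L(1,2) by blast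
  moreover have "F y \<noteq> t" using F_below_t[OF L(1)] mem_irrefl[of t] by auto
  ultimately show ?thesis using e unfolding edge_def lim_def by auto
qed

text \<open>There is no last rung and \<open>off\<close> increases strictly along the rungs, so each
  further rung passes one further natural number.\<close>

lemma off_unbounded:
  assumes "opr y x0 \<epsilon> Lad" "n \<epsilon> om"
  shows "\<exists>x. opr y x \<epsilon> Lad \<and> \<not> app off x \<epsilon> n"
proof -
  have y: "y \<in> D" using in_t[OF Lad(1)[OF assms(1)]] by simp
  have "\<exists>x\<in>D. opr y x \<epsilon> Lad \<and> \<not> app off x \<epsilon> n"
  proof (rule om_induct[OF assms(2), of "\<lambda>n. \<exists>x\<in>D. opr y x \<epsilon> Lad \<and> \<not> app off x \<epsilon> n"])
    show "dfn (\<lambda>e. \<exists>x\<in>D. opr y x \<epsilon> Lad \<and> \<not> app off x \<epsilon> e 0)"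
      using y by (intro definable in_D)
    show "\<exists>x\<in>D. opr y x \<epsilon> Lad \<and> \<not> app off x \<epsilon> emp"
      using assms(1) opr_memD[OF assms(1)] by auto
    fix n assume n: "n \<epsilon> om" and "\<exists>x\<in>D. opr y x \<epsilon> Lad \<and> \<not> app off x \<epsilon> n"
    then obtain x where x: "opr y x \<epsilon> Lad" "\<not> app off x \<epsilon> n" by blast
    obtain x' where x': "opr y x' \<epsilon> Lad" "x \<epsilon> x'" using Lad(6)[OF x(1) Lad(3)[OF x(1)]] by blast
    have o: "app off x \<epsilon> app off x'" using Lad(7)[OF x(1) x'] .
    then have "\<not> app off x' \<epsilon> sc n" using x(2) ord_trs[OF nat_ord[OF n]] unfolding sc by blast
    then show "\<exists>x\<in>D. opr y x \<epsilon> Lad \<and> \<not> app off x \<epsilon> sc n" using x'(1) opr_memD[OF x'(1)] by auto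
  qed
  then show ?thesis by blast
qed

lemma orbit:
  assumes a: "a \<epsilon> t" "a \<epsilon> F a"
  obtains g y where "g \<in> D" "y \<epsilon> t" "lim y" "cof_om g y" "app g emp = a"
    "\<And>n. n \<epsilon> om \<Longrightarrow> app g (sc n) = F (app g n)" "\<And>n. n \<epsilon> om \<Longrightarrow> app g n \<epsilon> y"
    "\<And>x. x \<epsilon> y \<longleftrightarrow> x \<epsilon> X \<and> (\<exists>n. n \<epsilon> om \<and> x \<epsilon> app g n)"
proof -
  obtain g where g: "g \<in> D" "isfn g om t" "app g emp = a" "\<And>n. sc n \<epsilon> om \<Longrightarrow> app g (sc n) = F (app g n)"
  proof (rule succ_rec[OF om_D ord_om _ a(1), of "\<lambda>y v. F v"])
    show "t \<in> D" by simp
    show "F v \<epsilon> t" if "v \<epsilon> t" for v using F_below_t that .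
    show "tm (\<lambda>e. F (e j))" for j by (intro definable in_D)
  qed (use that in simp)
  have gt: "app g n \<epsilon> t" if "n \<epsilon> om" for n using isfn_in[OF g(2) that] .
  have inc: "app g n \<epsilon> app g (sc n)" if "n \<epsilon> om" for n
  proof (rule om_induct[OF that])
    show "dfn (\<lambda>e. app g (e 0) \<epsilon> app g (sc (e 0)))" using g(1) by (intro definable)
    show "app g emp \<epsilon> app g (sc emp)" using g(3) g(4)[of emp] a(2) by simp
    fix n assume n: "n \<epsilon> om" and IH: "app g n \<epsilon> app g (sc n)"
    have "F (app g n) \<epsilon> F (app g (sc n))" using mono[OF in_t[OF gt[OF om_sc[OF n]]] IH] .
    then show "app g (sc n) \<epsilon> app g (sc (sc n))" using g(4)[of n] g(4)[of "sc n"] n by simp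
  qed
  define y where "y = col X (\<lambda>x. \<exists>n. n \<epsilon> om \<and> x \<epsilon> app g n)"
  have "dfn (\<lambda>e. \<exists>n. n \<epsilon> om \<and> e 0 \<epsilon> app g n)" using g(1) by (intro definable om_D)
  from col[OF _ this, of X] have y: "y \<in> D" "x \<epsilon> y \<longleftrightarrow> x \<epsilon> X \<and> (\<exists>n. n \<epsilon> om \<and> x \<epsilon> app g n)" for x
    by (simp_all only: y_def in_D sc_D)
  have "ord y"
    unfolding ord_def trs_def lin_def
  proof (intro conjI allI impI; elim conjE)
    fix x z assume "x \<epsilon> y" "z \<epsilon> x"
    then obtain n where "x \<epsilon> X" "n \<epsilon> om" "x \<epsilon> app g n" using y(2) by blast
    moreover have "z \<epsilon> app g n"
      using ord_trs[OF ordX[OF in_t[OF gt[OF \<open>n \<epsilon> om\<close>]]] \<open>x \<epsilon> app g n\<close> \<open>z \<epsilon> x\<close>] .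
    ultimately show "z \<epsilon> y" using y(2) X_trs \<open>z \<epsilon> x\<close> by blast
  next
    fix x z assume "x \<epsilon> y" "z \<epsilon> y"
    then show "x \<epsilon> z \<or> x = z \<or> z \<epsilon> x" using y(2) ord_lin[OF ords(3)] by blast
  qed
  have gy: "app g n \<epsilon> y" if "n \<epsilon> om" for n
    using y(2) inc[OF that] in_t[OF gt[OF that]] om_sc[OF that] by blast
  \<comment> \<open>The iterates lie at or below \<open>s\<close>. If their supremum were
    \<open>t\<close>, some iterate would lie above \<open>s\<close>.\<close>
  have yt: "y \<epsilon> t"
  proof -
    have "\<not> t \<epsilon> y" using y(2) gt mem_asym by blast
    moreover have "y \<noteq> t"
    proof
      assume "y = t"
      then have "s \<epsilon> y" by simp
      then obtain n where n: "n \<epsilon> om" "s \<epsilon> app g n" using y(2) by blast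
      then have "app g n \<epsilon> s \<or> app g n = s" using gt sc by blast
      then show False using n(2) mem_asym mem_irrefl by metis
    qed
    ultimately show ?thesis using tri[OF \<open>ord y\<close> ords(2) y(1)] by simp
  qed
  have "lim y"
    unfolding lim_def
  proof
    show "y \<noteq> emp" using gy[of emp] by auto
    show "\<not> suc y"
    proof
      assume "suc y"
      then obtain w where w: "w \<epsilon> y" "y = sc w" unfolding suc_def by blast
      then obtain n where n: "n \<epsilon> om" "w \<epsilon> app g n" using y(2) by blast
      then have "app g n \<epsilon> w \<or> app g n = w" using gy w(2) sc by blast
      then show False using n(2) mem_asym mem_irrefl by metis
    qed
  qed
  moreover have "cof_om g y"
    unfolding cof_om_def
  proof (intro conjI allI impI)
    show "isfn g om y"
      using g(2) gy isfn_app[OF g(2)] isfn_dom[OF g(2)] unfolding isfn_def by metis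
    show "\<exists>n. n \<epsilon> om \<and> x \<epsilon> app g n" if "x \<epsilon> y" for x using that y(2) by blast
  qed
  ultimately show ?thesis using g yt gy y(2) by (intro that[of g y]) auto
qed

theorem rigid:
  assumes "a \<epsilon> X"
  shows "F a = a"
proof (rule ccontr)
  assume "F a \<noteq> a"
  then have a: "a \<epsilon> F a" using above[OF assms] by auto
  have "a \<noteq> t" using \<open>F a \<noteq> a\<close> F_t by auto
  then have "a \<epsilon> t" using assms unfolding sc[of a t] by blast
  from orbit[OF this a] obtain g y where g: "g \<in> D" "y \<epsilon> t" "lim y" "cof_om g y" "app g emp = a"
    "\<And>n. n \<epsilon> om \<Longrightarrow> app g (sc n) = F (app g n)" "\<And>n. n \<epsilon> om \<Longrightarrow> app g n \<epsilon> y"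
    and y: "\<And>x. x \<epsilon> y \<longleftrightarrow> x \<epsilon> X \<and> (\<exists>n. n \<epsilon> om \<and> x \<epsilon> app g n)" by blast
  obtain x0 where x0: "opr y x0 \<epsilon> Lad" using ladder[OF g(2,3,1,4)] by blast
  have yX: "y \<epsilon> X" using in_t[OF g(2)] .
  have Fy: "F x \<epsilon> y" if xy: "x \<epsilon> y" for x
  proof -
    obtain n where n: "n \<epsilon> om" "x \<epsilon> app g n" using xy unfolding y by blast
    have "F x \<epsilon> F (app g n)" using mono[OF X_trs[OF yX g(7)[OF n(1)]] n(2)] .
    then have "F x \<epsilon> app g (sc n)" using g(6)[OF n(1)] by simp
    then show ?thesis unfolding y using F_in[OF X_trs[OF yX xy]] om_sc[OF n(1)] by blast
  qed
  consider "F y = y" | "y \<epsilon> F y" using above[OF yX] by auto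
  then show False
  proof cases
    case 1
    \<comment> \<open>A rung above \<open>a\<close> lies between two successive iterates, so its
      image is a later rung of the same ladder. This contradicts the invariance of
      \<open>off\<close>, which increases strictly along rungs.\<close>
    obtain x where x: "opr y x \<epsilon> Lad" "a \<epsilon> x"
      using Lad(6)[OF x0, of a] g(5) g(7)[of emp] by auto
    have xy: "x \<epsilon> y" using Lad(3)[OF x(1)] .
    have xX: "x \<epsilon> X" using X_trs[OF yX xy] .
    have L: "opr y (F x) \<epsilon> Lad" using F_Lad[OF x(1)] 1 by simp
    have "x \<epsilon> F x"
    proof -
      have "dfn (\<lambda>e. x \<epsilon> app g (e 0))" using g(1) in_X[OF xX] by (intro definable)
      then obtain n where n: "n \<epsilon> om" "x \<epsilon> app g n" "\<And>m. m \<epsilon> n \<Longrightarrow> m \<epsilon> om \<Longrightarrow> \<not> x \<epsilon> app g m"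
        using least[OF om_D, of "\<lambda>n. x \<epsilon> app g n"] xy unfolding y by blast
      have "n \<noteq> emp" using n(2) g(5) x(2) mem_asym by metis
      then obtain m where m: "m \<epsilon> om" "n = sc m" using nat_cases[OF n(1)] by blast
      have "\<not> x \<epsilon> app g m" using n(3)[OF _ m(1)] m(2) by simp
      then have "app g m \<epsilon> x \<or> app g m = x"
        using ord_lin[OF ords(3) xX X_trs[OF yX g(7)[OF m(1)]]] by blast
      then have "F (app g m) \<epsilon> F x \<or> F (app g m) = F x" using mono[OF xX, of "app g m"] by auto
      then have "app g n \<epsilon> F x \<or> app g n = F x" using g(6)[OF m(1)] m(2) by simp
      then show ?thesis using n(2) ord_trs[OF ordX[OF F_in[OF xX]], of "app g n" x] by auto
    qed
    then have "app off x \<epsilon> app off (F x)" using Lad(7)[OF x(1) L] by blast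
    then show False using off_F[OF xX] mem_irrefl by simp
  next
    case 2
    \<comment> \<open>The rungs of \<open>y\<close> are mapped to rungs of \<open>F y\<close> that
      lie below \<open>y\<close>, hence below one fixed rung \<open>x'\<close> of
      \<open>F y\<close>. Their unchanged finite parts would then be bounded by that of
      \<open>x'\<close>.\<close>
    from Lad(6)[OF F_Lad[OF x0] 2] obtain x' where x': "opr (F y) x' \<epsilon> Lad" "y \<epsilon> x'" by blast
    have x'X: "x' \<epsilon> X" using X_trs[OF F_in[OF yX] Lad(3)[OF x'(1)]] .
    from off_unbounded[OF x0 offs(1)[OF x'X]]
    obtain x where x: "opr y x \<epsilon> Lad" "\<not> app off x \<epsilon> app off x'" by blast
    have xy: "x \<epsilon> y" using Lad(3)[OF x(1)] .
    have "F x \<epsilon> x'" using ord_trs[OF ordX[OF x'X] x'(2) Fy[OF xy]] .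
    then have "app off (F x) \<epsilon> app off x'" using Lad(7)[OF F_Lad[OF x(1)] x'(1)] by blast
    then show False using x(2) off_F[OF X_trs[OF yX xy]] by simp
  qed
qed

end

section \<open>Ladders\<close>

context zf
begin

lemma dfn_lim [definable]: "tm t \<Longrightarrow> dfn (\<lambda>e. lim (t e))"
  unfolding lim_def by (intro definable emp_D)

lemma nat_lin: "n \<epsilon> om \<Longrightarrow> m \<epsilon> om \<Longrightarrow> n \<epsilon> m \<or> n = m \<or> m \<epsilon> n"
  using ord_lin[OF ord_om] .

text \<open>The conjunct \<open>x = x\<close> puts the quantifier into the shape of the definability rules.\<close>

definition "is_ladder off par y l \<longleftrightarrow> sub l y \<and> (\<exists>x. x \<epsilon> l \<and> x = x) \<and> (\<forall>z. z \<epsilon> y \<longrightarrow> (\<exists>x. x \<epsilon> l \<and> z \<epsilon> x)) \<and>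
  (\<forall>x. x \<epsilon> l \<longrightarrow> suc x \<and> app par x = emp \<and> (\<forall>x'. x' \<epsilon> l \<longrightarrow> x \<epsilon> x' \<longrightarrow> app off x \<epsilon> app off x'))"

lemma dfn_is_ladder: "off \<in> D \<Longrightarrow> par \<in> D \<Longrightarrow> dfn (\<lambda>e. is_ladder off par (e i) (e j))"
  unfolding is_ladder_def by (intro definable emp_D)

context
  fixes s off par
  assumes s: "s \<in> D" "ord s" and off_D: "off \<in> D" and par_D: "par \<in> D"
    and off_om': "\<forall>x. x \<epsilon> sc (sc s) \<longrightarrow> app off x \<epsilon> om"
    and off_sc': "\<forall>y. sc y \<epsilon> sc (sc s) \<longrightarrow> app off (sc y) = sc (app off y)"
    and par_sc': "\<forall>y. sc y \<epsilon> sc (sc s) \<longrightarrow> app par (sc y) = (if app par y = emp then sc emp else emp)"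
begin

lemmas off_om = off_om'[rule_format] and off_sc = off_sc'[rule_format] and par_sc = par_sc'[rule_format]

context
  fixes y
  assumes y: "y \<epsilon> sc s" "lim y"
begin

lemma y_D: "y \<in> D" "ord y" "sub y (sc (sc s))"
proof -
  have "ord (sc s)" "sc s \<in> D" using s ord_sc by auto
  then show "y \<in> D" "ord y" using y(1) trans ord_mem by blast+
  show "sub y (sc (sc s))" unfolding sub_def using ord_trs[OF \<open>ord (sc s)\<close> y(1)] by auto
qed

lemma y_X: "x \<epsilon> y \<Longrightarrow> x \<epsilon> sc (sc s)"
  using y_D(3) unfolding sub_def by blast

lemma y_sc: "x \<epsilon> y \<Longrightarrow> sc x \<epsilon> y"
  using lim_sc[OF y_D(2,1)] y(2) unfolding lim_def by blast

text \<open>Every successor step raises \<open>off\<close> by one and stays below the limit, so any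
  given natural number is exceeded above \<open>z\<close>.\<close>

lemma off_large:
  assumes "k \<epsilon> om" "z \<epsilon> y"
  shows "\<exists>x. x \<epsilon> y \<and> z \<epsilon> x \<and> k \<epsilon> app off x"
proof -
  have "\<forall>z. z \<epsilon> y \<longrightarrow> (\<exists>x. x \<epsilon> y \<and> z \<epsilon> x \<and> k \<epsilon> app off x)"
  proof (rule om_induct[OF assms(1)])
    show "dfn (\<lambda>e. \<forall>z. z \<epsilon> y \<longrightarrow> (\<exists>x. x \<epsilon> y \<and> z \<epsilon> x \<and> e 0 \<epsilon> app off x))"
      using y_D(1) off_D by (intro definable)
    show "\<forall>z. z \<epsilon> y \<longrightarrow> (\<exists>x. x \<epsilon> y \<and> z \<epsilon> x \<and> emp \<epsilon> app off x)"
    proof (intro allI impI)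
      fix z assume z: "z \<epsilon> y"
      have n: "sc (app off z) \<epsilon> om" using off_om[OF y_X[OF z]] by simp
      have "emp \<epsilon> app off (sc z)"
        using off_sc[OF y_X[OF y_sc[OF z]]] ord_emp_mem[OF nat_ord[OF n]] trans[OF om_D n] by auto
      then show "\<exists>x. x \<epsilon> y \<and> z \<epsilon> x \<and> emp \<epsilon> app off x"
        using y_sc[OF z] by (intro exI[of _ "sc z"]) simp
    qed
    fix n assume n: "n \<epsilon> om" and IH: "\<forall>z. z \<epsilon> y \<longrightarrow> (\<exists>x. x \<epsilon> y \<and> z \<epsilon> x \<and> n \<epsilon> app off x)"
    show "\<forall>z. z \<epsilon> y \<longrightarrow> (\<exists>x. x \<epsilon> y \<and> z \<epsilon> x \<and> sc n \<epsilon> app off x)"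
    proof (intro allI impI)
      fix z assume "z \<epsilon> y"
      then obtain x where x: "x \<epsilon> y" "z \<epsilon> x" "n \<epsilon> app off x" using IH by blast
      have "app off x \<epsilon> om" using off_om[OF y_X[OF x(1)]] .
      then have "sc n \<epsilon> app off x \<or> sc n = app off x"
        using sc_le[OF nat_ord _ x(3)] trans[OF om_D] by blast
      then have "sc n \<epsilon> app off (sc x)" using off_sc[OF y_X[OF y_sc[OF x(1)]]] by auto
      then show "\<exists>x. x \<epsilon> y \<and> z \<epsilon> x \<and> sc n \<epsilon> app off x"
        using y_sc[OF x(1)] x(2) by (intro exI[of _ "sc x"]) simp
    qed
  qed
  then show ?thesis using assms(2) by blast
qed

definition "rung w v x \<longleftrightarrow> v \<epsilon> x \<and> w \<epsilon> x \<and> app off v \<epsilon> app off x \<and> suc x \<and> app par x = emp"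

text \<open>First pass \<open>v\<close> and \<open>w\<close> at a point whose finite part exceeds
  that of \<open>v\<close>; at least one of its next two successors is even.\<close>

lemma next_rung:
  assumes "w \<epsilon> y" "v \<epsilon> y"
  shows "\<exists>x. x \<epsilon> y \<and> rung w v x"
proof -
  obtain m where m: "m \<epsilon> y" "v \<epsilon> m \<or> v = m" "w \<epsilon> m \<or> w = m"
    using ord_lin[OF y_D(2) assms] assms by blast
  obtain x where x: "x \<epsilon> y" "m \<epsilon> x" "app off v \<epsilon> app off x"
    using off_large[OF off_om[OF y_X[OF assms(2)]] m(1)] by blast
  have "ord x" using ord_mem[OF y_D(2) x(1)] .
  then have vw: "v \<epsilon> x" "w \<epsilon> x" using m(2,3) x(2) ord_trs by blast+
  have 1: "sc x \<epsilon> y" "app off (sc x) = sc (app off x)" using y_sc[OF x(1)] off_sc y_X by blast+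
  have 2: "sc (sc x) \<epsilon> y" "app off (sc (sc x)) = sc (sc (app off x))"
    using y_sc[OF 1(1)] off_sc[OF y_X[OF y_sc[OF 1(1)]]] 1(2) by simp_all
  show ?thesis
  proof (cases "app par (sc x) = emp")
    case True
    then show ?thesis using 1 vw x(3) by (intro exI[of _ "sc x"]) (simp add: rung_def)
  next
    case False
    then have "app par (sc (sc x)) = emp" using par_sc[OF y_X[OF 2(1)]] by simp
    then show ?thesis using 2 vw x(3) by (intro exI[of _ "sc (sc x)"]) (simp add: rung_def)
  qed
qed

lemma ladder_exists:
  assumes g: "g \<in> D" "cof_om g y"
  shows "\<exists>l\<in>D. is_ladder off par y l"
proof -
  note D = y_D(1) off_D par_D g(1) om_D emp_D
  have gy: "app g n \<epsilon> y" if "n \<epsilon> om" for n using g(2) isfn_in that unfolding cof_om_def by blast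
  \<comment> \<open>The next rung is chosen above the previous one and above \<open>g n\<close>; the
    latter makes the ladder cofinal in \<open>y\<close>.\<close>
  define Z where "Z = col (prd (prd om y) y) (\<lambda>p. \<exists>n\<in>D. \<exists>v\<in>D. \<exists>x\<in>D. p = opr (opr n v) x \<and> rung (app g n) v x)"
  have "dfn (\<lambda>e. \<exists>n\<in>D. \<exists>v\<in>D. \<exists>x\<in>D. e 0 = opr (opr n v) x \<and> rung (app g n) v x)"
    unfolding rung_def using D by (intro definable)
  note Z = col[OF prd(1)[OF prd(1)[OF om_D y_D(1)] y_D(1)] this, folded Z_def]
  obtain c where c: "c \<in> D" "sub c Z" "\<And>x y. opr x y \<epsilon> Z \<Longrightarrow> \<exists>v. \<forall>z. opr x z \<epsilon> c \<longleftrightarrow> z = v"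
    using choice_rel[OF Z(1)] by metis
  have G: "app c (opr n v) \<epsilon> y \<and> rung (app g n) v (app c (opr n v))" if n: "n \<epsilon> om" and v: "v \<epsilon> y" for n v
  proof -
    obtain x where x: "x \<epsilon> y" "rung (app g n) v x" using next_rung[OF gy[OF n] v] by blast
    have nD: "n \<in> D" "v \<in> D" "x \<in> D" using n v x(1) trans[OF om_D] trans[OF y_D(1)] by auto
    have "opr (opr n v) x \<epsilon> prd (prd om y) y"
      using n v x(1) y_D(1) by (simp add: opr_prd prd(1))
    then have "opr (opr n v) x \<epsilon> Z" unfolding Z(2) using x(2) nD by blast
    then obtain u where u: "\<forall>z. opr (opr n v) z \<epsilon> c \<longleftrightarrow> z = u" using c(3) by blast
    then have u': "u = app c (opr n v)" unfolding app_eq by blast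
    have "opr (opr n v) u \<epsilon> Z" using u c(2) unfolding sub_def by blast
    then have "u \<epsilon> y \<and> rung (app g n) v u"
      unfolding Z(2) opr_prd[OF prd(1)[OF om_D y_D(1)] y_D(1)] by auto
    then show ?thesis unfolding u' .
  qed
  obtain x0 where x0: "x0 \<epsilon> y" "rung (app g emp) (app g emp) x0" using next_rung[OF gy[OF om_0] gy[OF om_0]] by blast
  obtain h where h: "h \<in> D" "isfn h om y" "app h emp = x0"
    "\<And>n. sc n \<epsilon> om \<Longrightarrow> app h (sc n) = app c (opr n (app h n))"
  proof (rule succ_rec[OF om_D ord_om y_D(1) x0(1), of "\<lambda>n v. app c (opr n v)"])
    show "app c (opr n v) \<epsilon> y" if "n \<epsilon> om" "v \<epsilon> y" for n v using G that by blast
    show "tm (\<lambda>e. app c (opr (e i) (e j)))" for i j using c(1) by (intro definable)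
  qed (use that in simp)
  have hy: "app h n \<epsilon> y" if "n \<epsilon> om" for n using isfn_in[OF h(2) that] .
  have step: "rung (app g n) (app h n) (app h (sc n))" if "n \<epsilon> om" for n
    using G[OF that hy[OF that]] h(4) that by simp
  have even: "suc (app h n) \<and> app par (app h n) = emp" if "n \<epsilon> om" for n
    using nat_cases[OF that] step x0(2) h(3) unfolding rung_def by auto
  have mono: "\<forall>n. n \<epsilon> m \<longrightarrow> app h n \<epsilon> app h m \<and> app off (app h n) \<epsilon> app off (app h m)" if "m \<epsilon> om" for m
  proof (rule om_induct[OF that, of "\<lambda>m. \<forall>n. n \<epsilon> m \<longrightarrow> app h n \<epsilon> app h m \<and> app off (app h n) \<epsilon> app off (app h m)"])
    show "dfn (\<lambda>e. \<forall>n. n \<epsilon> e 0 \<longrightarrow> app h n \<epsilon> app h (e 0) \<and> app off (app h n) \<epsilon> app off (app h (e 0)))"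
      using D h(1) by (intro definable)
    fix m assume m: "m \<epsilon> om" and IH: "\<forall>n. n \<epsilon> m \<longrightarrow> app h n \<epsilon> app h m \<and> app off (app h n) \<epsilon> app off (app h m)"
    have st: "app h m \<epsilon> app h (sc m)" "app off (app h m) \<epsilon> app off (app h (sc m))"
      using step[OF m] unfolding rung_def by blast+
    have o: "ord (app h (sc m))" "ord (app off (app h (sc m)))"
      using hy[OF om_sc[OF m]] ord_mem[OF y_D(2)] nat_ord off_om y_X by blast+
    show "\<forall>n. n \<epsilon> sc m \<longrightarrow> app h n \<epsilon> app h (sc m) \<and> app off (app h n) \<epsilon> app off (app h (sc m))"
    proof (intro allI impI)
      fix n assume "n \<epsilon> sc m"
      then consider "n = m" | "n \<epsilon> m" by auto
      then show "app h n \<epsilon> app h (sc m) \<and> app off (app h n) \<epsilon> app off (app h (sc m))"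
      proof cases
        case 2
        then show ?thesis using IH ord_trs[OF o(1) st(1)] ord_trs[OF o(2) st(2)] by blast
      qed (use st in simp)
    qed
  qed simp
  define l where "l = col y (\<lambda>x. \<exists>n. n \<epsilon> om \<and> app h n = x)"
  have "dfn (\<lambda>e. \<exists>n. n \<epsilon> om \<and> app h n = e 0)" using D h(1) by (intro definable)
  note l = col[OF y_D(1) this, folded l_def]
  have hl: "app h n \<epsilon> l" if "n \<epsilon> om" for n using l(2) hy that by blast
  have "is_ladder off par y l"
    unfolding is_ladder_def
  proof (intro conjI allI impI)
    show "sub l y" using l(2) by (simp add: sub_def)
    show "\<exists>x. x \<epsilon> l \<and> x = x" using hl[OF om_0] by blast
    fix z assume "z \<epsilon> y"
    then obtain n where n: "n \<epsilon> om" "z \<epsilon> app g n" using g(2) unfolding cof_om_def by blast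
    have "app g n \<epsilon> app h (sc n)" using step[OF n(1)] unfolding rung_def by blast
    then have "z \<epsilon> app h (sc n)"
      using ord_trs[OF ord_mem[OF y_D(2) hy[OF om_sc[OF n(1)]]]] n(2) by blast
    then show "\<exists>x. x \<epsilon> l \<and> z \<epsilon> x" using hl[OF om_sc[OF n(1)]] by blast
  next
    fix x assume "x \<epsilon> l"
    then obtain n where n: "n \<epsilon> om" "app h n = x" unfolding l(2) by blast
    show "suc x" "app par x = emp" using even[OF n(1)] n(2) by simp_all
    fix x' assume "x' \<epsilon> l" "x \<epsilon> x'"
    then obtain m where m: "m \<epsilon> om" "app h m = x'" unfolding l(2) by blast
    have "n \<epsilon> m"
      using nat_lin[OF n(1) m(1)] mono[OF n(1)] n(2) m(2) \<open>x \<epsilon> x'\<close> mem_asym mem_irrefl by metis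
    then show "app off x \<epsilon> app off x'" using mono[OF m(1)] n(2) m(2) by blast
  qed
  then show ?thesis using l(1) by blast
qed

end

end

text \<open>One ladder is selected for each limit that has any in the model. Storing only the
  selected ones matters: \<open>off\<close> increases along a single ladder but not along the union
  of two.\<close>

theorem frame_exists:
  assumes s: "s \<in> D" "ord s" "sub om s"
  shows "\<exists>off\<in>D. \<exists>par\<in>D. \<exists>Lad\<in>D. \<exists>R\<in>D. frame s off par Lad R \<and>
    (\<forall>y g. y \<epsilon> sc s \<longrightarrow> lim y \<longrightarrow> g \<in> D \<longrightarrow> cof_om g y \<longrightarrow> (\<exists>x. opr y x \<epsilon> Lad))"
proof -
  let ?t = "sc s" and ?X = "sc (sc s)"
  have X: "?X \<in> D" "ord ?X" and t: "?t \<in> D" using s ord_sc by auto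
  obtain off where off: "off \<in> D" "isfn off ?X om" "\<And>x. x \<epsilon> ?X \<Longrightarrow> \<not> suc x \<Longrightarrow> app off x = emp"
    "\<And>y. sc y \<epsilon> ?X \<Longrightarrow> app off (sc y) = sc (app off y)"
  proof (rule succ_rec[OF X om_D om_0, of "\<lambda>y v. sc v"])
    show "tm (\<lambda>e. sc (e j))" for j by (intro definable)
  qed (use that in auto)
  obtain par where par: "par \<in> D" "\<And>x. x \<epsilon> ?X \<Longrightarrow> \<not> suc x \<Longrightarrow> app par x = emp"
    "\<And>y. sc y \<epsilon> ?X \<Longrightarrow> app par (sc y) = (if app par y = emp then sc emp else emp)"
  proof (rule succ_rec[OF X om_D om_0, of "\<lambda>y v. if v = emp then sc emp else emp"])
    show "tm (\<lambda>e. if e j = emp then sc emp else emp)" for j by (intro definable emp_D)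
  qed (use that in auto)
  have "\<forall>x. x \<epsilon> ?X \<longrightarrow> app off x \<epsilon> om" using isfn_in[OF off(2)] by blast
  moreover have "\<forall>y. sc y \<epsilon> ?X \<longrightarrow> app off (sc y) = sc (app off y)" using off(4) by blast
  moreover have "\<forall>y. sc y \<epsilon> ?X \<longrightarrow> app par (sc y) = (if app par y = emp then sc emp else emp)"
    using par(3) by blast
  ultimately have ladders: "\<exists>l\<in>D. is_ladder off par y l" if "y \<epsilon> ?t" "lim y" "g \<in> D" "cof_om g y" for y g
    using ladder_exists[OF s(1,2) off(1) par(1)] that by blast
  let ?il = "\<lambda>y l. is_ladder off par y l"
  define Z where "Z = col (prd ?t (pw ?t)) (\<lambda>p. \<exists>y\<in>D. \<exists>l\<in>D. p = opr y l \<and> lim y \<and> ?il y l)"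
  have "dfn (\<lambda>e. \<exists>y\<in>D. \<exists>l\<in>D. e 0 = opr y l \<and> lim y \<and> ?il y l)"
    by (intro definable dfn_is_ladder[OF off(1) par(1)])
  note Z = col[OF prd(1)[OF t pw(1)[OF t]] this, folded Z_def]
  have oZ: "opr y l \<epsilon> Z \<longleftrightarrow> y \<epsilon> ?t \<and> l \<in> D \<and> lim y \<and> ?il y l" for y l
  proof -
    have "opr y l \<epsilon> Z \<longleftrightarrow> y \<epsilon> ?t \<and> (l \<in> D \<and> sub l ?t) \<and> lim y \<and> ?il y l"
      unfolding Z(2) opr_prd[OF t pw(1)[OF t]] pw(2)[OF t] using trans[OF t, of y] by auto
    moreover have "sub l ?t" if "y \<epsilon> ?t" "?il y l"
      using that ord_trs[OF ord_sc[OF s(2)] that(1)]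
      unfolding is_ladder_def sub_def by blast
    ultimately show ?thesis by blast
  qed
  obtain c where c: "c \<in> D" "sub c Z" "\<And>x y. opr x y \<epsilon> Z \<Longrightarrow> \<exists>v. \<forall>z. opr x z \<epsilon> c \<longleftrightarrow> z = v"
    using choice_rel[OF Z(1)] by metis
  define Lad where "Lad = col (prd ?t ?t) (\<lambda>p. \<exists>y\<in>D. \<exists>l\<in>D. opr y l \<epsilon> c \<and> (\<exists>x. x \<epsilon> l \<and> p = opr y x))"
  have "dfn (\<lambda>e. \<exists>y\<in>D. \<exists>l\<in>D. opr y l \<epsilon> c \<and> (\<exists>x. x \<epsilon> l \<and> e 0 = opr y x))"
    using c(1) by (intro definable)
  note Lad = col[OF prd(1)[OF t t] this, folded Lad_def]
  have cl: "y \<epsilon> ?t \<and> l \<in> D \<and> lim y \<and> ?il y l" if "opr y l \<epsilon> c" for y l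
    using that c(2) oZ unfolding sub_def by blast
  have oL: "opr y x \<epsilon> Lad \<longleftrightarrow> (\<exists>l. opr y l \<epsilon> c \<and> x \<epsilon> l)" for y x
  proof
    assume "opr y x \<epsilon> Lad"
    then show "\<exists>l. opr y l \<epsilon> c \<and> x \<epsilon> l" unfolding Lad(2) by auto
  next
    assume "\<exists>l. opr y l \<epsilon> c \<and> x \<epsilon> l"
    then obtain l where l: "opr y l \<epsilon> c" "x \<epsilon> l" by blast
    have yl: "y \<epsilon> ?t" "l \<in> D" "?il y l" using cl[OF l(1)] by auto
    have "x \<epsilon> y" using yl(3) l(2) unfolding is_ladder_def sub_def by blast
    then have "x \<epsilon> ?t" using ord_trs[OF ord_sc[OF s(2)] yl(1)] by blast
    then show "opr y x \<epsilon> Lad"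
      unfolding Lad(2) opr_prd[OF t t] using yl l trans[OF t yl(1)] by blast
  qed
  have Lprop: "y \<epsilon> ?t \<and> lim y \<and> x \<epsilon> y \<and> suc x \<and> app par x = emp \<and>
     (\<forall>z. z \<epsilon> y \<longrightarrow> (\<exists>x'. opr y x' \<epsilon> Lad \<and> z \<epsilon> x')) \<and>
     (\<forall>x'. opr y x' \<epsilon> Lad \<longrightarrow> x \<epsilon> x' \<longrightarrow> app off x \<epsilon> app off x')" if yx: "opr y x \<epsilon> Lad" for y x
  proof -
    obtain l where l: "opr y l \<epsilon> c" "x \<epsilon> l" using yx unfolding oL by blast
    have yl: "y \<epsilon> ?t" "lim y" "?il y l" using cl[OF l(1)] by auto
    have uniq: "opr y x' \<epsilon> Lad \<longleftrightarrow> x' \<epsilon> l" for x'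
    proof -
      have "opr y l \<epsilon> Z" using l(1) c(2) unfolding sub_def by blast
      then obtain v where "\<forall>z. opr y z \<epsilon> c \<longleftrightarrow> z = v" using c(3) by blast
      then show ?thesis unfolding oL using l(1) by auto
    qed
    show ?thesis using yl l(2) unfolding uniq is_ladder_def sub_def by blast
  qed
  define R where "R = col (prd ?X ?X) (\<lambda>p. \<exists>x\<in>D. \<exists>y\<in>D. p = opr x y \<and> edge s par Lad x y)"
  have "dfn (\<lambda>e. \<exists>x\<in>D. \<exists>y\<in>D. e 0 = opr x y \<and> edge s par Lad x y)"
    unfolding edge_def using s(1) par(1) Lad(1) by (intro definable; simp)
  note R = col[OF prd(1)[OF X(1) X(1)] this, folded R_def]
  have Rp: "\<exists>x y. p = opr x y" if "p \<epsilon> R" for p using that unfolding R(2) by blast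
  have oR: "opr x y \<epsilon> R \<longleftrightarrow> x \<epsilon> ?X \<and> y \<epsilon> ?X \<and> edge s par Lad x y" for x y
    unfolding R(2) opr_prd[OF X(1) X(1)] using trans[OF X(1)] by auto
  show ?thesis
  proof (rule bexI[OF _ off(1)], rule bexI[OF _ par(1)], rule bexI[OF _ Lad(1)], rule bexI[OF _ R(1)],
      intro conjI allI impI)
    have off4: "\<forall>y. sc y \<epsilon> ?X \<longrightarrow> app off (sc y) = sc (app off y)" using off(4) by blast
    have par3: "\<forall>y. sc y \<epsilon> ?X \<longrightarrow> app par (sc y) = (if app par y = emp then sc emp else emp)"
      using par(3) by blast
    have nonsuc: "\<forall>x. x \<epsilon> ?X \<longrightarrow> \<not> suc x \<longrightarrow> app off x = emp"
      "\<forall>x. x \<epsilon> ?X \<longrightarrow> \<not> suc x \<longrightarrow> app par x = emp"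
      using off(3) par(2) by blast+
    have L: "\<forall>y x. opr y x \<epsilon> Lad \<longrightarrow> y \<epsilon> ?t \<and> lim y \<and> x \<epsilon> y \<and> suc x \<and> app par x = emp \<and>
     (\<forall>z. z \<epsilon> y \<longrightarrow> (\<exists>x'. opr y x' \<epsilon> Lad \<and> z \<epsilon> x')) \<and>
     (\<forall>x'. opr y x' \<epsilon> Lad \<longrightarrow> x \<epsilon> x' \<longrightarrow> app off x \<epsilon> app off x')"
      by (intro allI impI Lprop)
    have Rp': "\<forall>p. p \<epsilon> R \<longrightarrow> (\<exists>x y. p = opr x y)" by (intro allI impI Rp)
    have oR': "\<forall>x y. opr x y \<epsilon> R \<longleftrightarrow> x \<epsilon> ?X \<and> y \<epsilon> ?X \<and> edge s par Lad x y" by (intro allI oR)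
    show "frame s off par Lad R"
      unfolding frame_def by (intro conjI s(2) s(3) off(2) nonsuc off4 par3 L Rp' oR')
    fix y g assume y: "y \<epsilon> ?t" "lim y" and g: "g \<in> D" "cof_om g y"
    obtain l where l: "l \<in> D" "?il y l" using ladders[OF y g] by blast
    then have "opr y l \<epsilon> Z" using oZ y by blast
    then obtain v where v: "opr y v \<epsilon> c" using c(3) by blast
    then obtain x where "x \<epsilon> v" using cl[OF v] unfolding is_ladder_def by blast
    then show "\<exists>x. opr y x \<epsilon> Lad" using v oL by blast
  qed
qed

end

section \<open>Rigid graphs from special models\<close>

text \<open>Common ground of the models and the universe. The universe satisfies Foundation but is
  not yet known to satisfy ZFC, and the meaning of \<open>cf_omega\<close> has to be compared
  between it and a model.\<close>

locale fdom = dom +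
  assumes fnd: "x \<epsilon> a \<Longrightarrow> \<exists>y. y \<epsilon> a \<and> \<not> (\<exists>z. z \<epsilon> a \<and> z \<epsilon> y)"
begin

definition "cfo a \<longleftrightarrow> ord a \<and> (\<exists>f\<in>D. cofm f om a) \<and> \<not> (\<exists>c f. f \<in> D \<and> c \<epsilon> om \<and> cofm f c a)"

text \<open>The well-foundedness clause of \<open>ordinal\<close> is a consequence of Foundation,
  and the other two clauses are absolute.\<close>

lemma ev_ordinal [simp]: "a < n \<Longrightarrow> e a \<in> D \<Longrightarrow> lsat D E g n e (ordinal a) = ord (e a)"
proof -
  assume a: "a < n" "e a \<in> D"
  have 1: "(\<forall>x\<in>D. \<forall>y\<in>D. x \<epsilon> e a \<and> y \<epsilon> e a \<longrightarrow> x \<epsilon> y \<or> x = y \<or> y \<epsilon> x) \<longleftrightarrow> lin (e a)"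
    unfolding lin_def using trans[OF a(2)] by blast
  have 2: "\<forall>z\<in>D. sub z (e a) \<and> z \<noteq> emp \<longrightarrow> (\<exists>x\<in>D. x \<epsilon> z \<and> (\<forall>y\<in>D. y \<epsilon> z \<longrightarrow> \<not> y \<epsilon> x))"
  proof (intro ballI impI)
    fix z assume z: "z \<in> D" "sub z (e a) \<and> z \<noteq> emp"
    then obtain w where "w \<epsilon> z" using ext[of z emp] by auto
    from fnd[OF this] obtain x where "x \<epsilon> z" "\<not> (\<exists>y. y \<epsilon> z \<and> y \<epsilon> x)" by blast
    then show "\<exists>x\<in>D. x \<epsilon> z \<and> (\<forall>y\<in>D. y \<epsilon> z \<longrightarrow> \<not> y \<epsilon> x)" using trans[OF z(1)] by blast
  qed
  show ?thesis
    using a 1 2 by (simp add: ordinal_def ord_def cong: ball_cong bex_cong)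
qed

end

lemma (in zf) fdom: "fdom E D"
  by unfold_locales (rule fnd)

locale loc = bst +
  assumes loc: "\<exists>M. x \<epsilon> M \<and> zmodel M"
begin

lemma zmodel_ax:
  assumes "zmodel M" "T \<in> set zfc_axs" "x \<epsilon> M"
  shows "nsat {x. x \<epsilon> M} E (\<lambda>s. False) (\<lambda>_. x) T"
proof -
  have "nsat {x. x \<epsilon> M} E (\<lambda>s. sat {x. x \<epsilon> M} E s Fls) (\<lambda>_. x) T"
    using assms unfolding zmodel_def by (metis empty_iff fv.simps(3))
  then show ?thesis by simp
qed

lemma zmodel_trs: "zmodel M \<Longrightarrow> x \<epsilon> M \<Longrightarrow> y \<epsilon> x \<Longrightarrow> y \<epsilon> M"
  unfolding zmodel_def trs_def by blast

text \<open>A transitive model containing \<open>a\<close> contains all members of \<open>a\<close>,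
  so an element minimal from the point of view of the model is minimal outright.\<close>

lemma foundation: "x \<epsilon> a \<Longrightarrow> \<exists>y. y \<epsilon> a \<and> \<not> (\<exists>z. z \<epsilon> a \<and> z \<epsilon> y)"
proof -
  assume x: "x \<epsilon> a"
  obtain M where M: "a \<epsilon> M" "zmodel M" using loc by blast
  have "nsat {x. x \<epsilon> M} E (\<lambda>s. False) (\<lambda>_. a) foundation_ax"
    by (rule zmodel_ax[OF M(2) _ M(1)]) (simp add: zfc_axs_def)
  then obtain y where y: "y \<epsilon> a" "\<forall>z. z \<epsilon> M \<longrightarrow> \<not> (z \<epsilon> y \<and> z \<epsilon> a)"
    using M(1) x zmodel_trs[OF M(2,1) x] by (auto simp: foundation_ax_def)
  then show ?thesis using zmodel_trs[OF M(2,1)] by blast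
qed

lemma zf_model:
  assumes M: "zmodel M" "om \<epsilon> M"
  shows "zf E {x. x \<epsilon> M}"
proof unfold_locales
  show "om \<in> {x. x \<epsilon> M}" using M by simp
  show tr: "x \<in> {x. x \<epsilon> M} \<Longrightarrow> y \<epsilon> x \<Longrightarrow> y \<in> {x. x \<epsilon> M}" for x y
    using zmodel_trs[OF M(1)] by blast
  show "upr x y \<in> {x. x \<epsilon> M} \<longleftrightarrow> x \<in> {x. x \<epsilon> M} \<and> y \<in> {x. x \<epsilon> M}" for x y
  proof
    assume "x \<in> {x. x \<epsilon> M} \<and> y \<in> {x. x \<epsilon> M}"
    then have xy: "x \<epsilon> M" "y \<epsilon> M" by auto
    have "nsat {x. x \<epsilon> M} E (\<lambda>s. False) (\<lambda>_. x) pair_ax"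
      by (rule zmodel_ax[OF M(1) _ xy(1)]) (simp add: zfc_axs_def)
    then have "\<forall>x. x \<epsilon> M \<longrightarrow> (\<forall>y. y \<epsilon> M \<longrightarrow> (\<exists>p. p \<epsilon> M \<and> (\<forall>z. z \<epsilon> M \<longrightarrow> (z \<epsilon> p) = (z = x \<or> z = y))))"
      by (simp add: pair_ax_def)
    then obtain p where p: "p \<epsilon> M" "\<forall>z. z \<epsilon> M \<longrightarrow> (z \<epsilon> p \<longleftrightarrow> z = x \<or> z = y)"
      using xy by blast
    have "p = upr x y" by (rule ext) (use p xy zmodel_trs[OF M(1) p(1)] in auto)
    then show "upr x y \<in> {x. x \<epsilon> M}" using p(1) by simp
  next
    assume "upr x y \<in> {x. x \<epsilon> M}"
    then show "x \<in> {x. x \<epsilon> M} \<and> y \<in> {x. x \<epsilon> M}" using zmodel_trs[OF M(1), of "upr x y"] by simp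
  qed
  show "Uni x \<in> {x. x \<epsilon> M}" if "x \<in> {x. x \<epsilon> M}" for x
  proof -
    have x: "x \<epsilon> M" using that by simp
    have "nsat {x. x \<epsilon> M} E (\<lambda>s. False) (\<lambda>_. x) union_ax"
      by (rule zmodel_ax[OF M(1) _ x]) (simp add: zfc_axs_def)
    then have "\<forall>x. x \<epsilon> M \<longrightarrow> (\<exists>u. u \<epsilon> M \<and> (\<forall>z. z \<epsilon> M \<longrightarrow> (z \<epsilon> u) = (\<exists>y. y \<epsilon> M \<and> y \<epsilon> x \<and> z \<epsilon> y)))"
      by (simp add: union_ax_def)
    then obtain u where u: "u \<epsilon> M" "\<forall>z. z \<epsilon> M \<longrightarrow> (z \<epsilon> u \<longleftrightarrow> (\<exists>y. y \<epsilon> M \<and> y \<epsilon> x \<and> z \<epsilon> y))"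
      using x by blast
    have "u = Uni x"
    proof (rule ext)
      fix z show "z \<epsilon> u \<longleftrightarrow> z \<epsilon> Uni x"
        unfolding Uni using u zmodel_trs[OF M(1) u(1)] zmodel_trs[OF M(1) x] zmodel_trs[OF M(1)] by metis
    qed
    then show ?thesis using u(1) by simp
  qed
  show "x \<epsilon> a \<Longrightarrow> \<exists>y. y \<epsilon> a \<and> \<not> (\<exists>z. z \<epsilon> a \<and> z \<epsilon> y)" for x a by (rule foundation)
  show "nsat {x. x \<epsilon> M} E (\<lambda>s. sat {x. x \<epsilon> M} E s \<psi>) s T"
    if "T \<in> set zfc_axs" "3 \<notin> fv \<psi>" "4 \<notin> fv \<psi>" "\<And>i. s i \<in> {x. x \<epsilon> M}" for T \<psi> s
    using M(1) that unfolding zmodel_def by auto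
qed

text \<open>A transitive model containing the finite set of the listed elements contains each of
  them. Arguments about finitely many sets may therefore use all of ZFC.\<close>

lemma model_of:
  obtains M where "zf E {x. x \<epsilon> M}" "\<And>x. x \<in> set xs \<Longrightarrow> x \<epsilon> M"
proof -
  obtain M where M: "mks (om # xs) \<epsilon> M" "zmodel M" using loc by blast
  then have "x \<epsilon> M" if "x \<in> set (om # xs)" for x
    using zmodel_trs[OF M(2,1), of x] that unfolding mks by blast
  then show ?thesis using zf_model[OF M(2)] by (intro that[of M]) auto
qed

end

sublocale loc \<subseteq> univf: fdom E UNIV
  by unfold_locales (rule foundation)

locale spec = loc +
  assumes spec: "\<exists>M. x \<epsilon> M \<and> zmodel M \<and> (\<forall>a. a \<epsilon> M \<and> ord a \<longrightarrow> (fdom.cfo E {x. x \<epsilon> M} a \<longleftrightarrow> univf.cfo a))"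
begin

definition "infin A \<longleftrightarrow> \<not> (\<exists>k f. k \<epsilon> om \<and> isfn f k A \<and> (\<forall>x y z. opr x z \<epsilon> f \<and> opr y z \<epsilon> f \<longrightarrow> x = y) \<and>
  (\<forall>z. z \<epsilon> A \<longrightarrow> (\<exists>x. opr x z \<epsilon> f)))"

definition "rgd A R \<longleftrightarrow> (\<forall>f. isfn f A A \<and>
  (\<forall>x y. opr x y \<epsilon> R \<longrightarrow> (\<exists>u v. opr x u \<epsilon> f \<and> opr y v \<epsilon> f \<and> opr u v \<epsilon> R)) \<longrightarrow> (\<forall>x. x \<epsilon> A \<longrightarrow> opr x x \<epsilon> f))"

text \<open>That a finite ordinal is not cofinal in a limit needs an induction; it is carried out in
  a model containing the supposed cofinal map.\<close>

lemma cfo_sup: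
  assumes y: "ord y" "lim y" and g: "cof_om g y"
  shows "univf.cfo y"
  unfolding univf.cfo_def
proof (intro conjI)
  show "ord y" by fact
  show "\<exists>f\<in>UNIV. cofm f om y"
    using g isfn_app[of g om y] unfolding cof_om_def cofm_def by blast
  show "\<not> (\<exists>c f. f \<in> UNIV \<and> c \<epsilon> om \<and> cofm f c y)"
  proof (intro notI, elim exE conjE)
    fix c f assume c: "c \<epsilon> om" and f: "cofm f c y"
    obtain N where N: "zf E {x. x \<epsilon> N}" "\<And>x. x \<in> set [f, y] \<Longrightarrow> x \<epsilon> N" using model_of by metis
    obtain k where k: "k \<epsilon> y" "\<And>i. i \<epsilon> c \<Longrightarrow> app f i \<epsilon> y \<Longrightarrow> app f i \<epsilon> k"
      using zf.finite_bounded[OF N(1) c, of f y] N(2) y unfolding lim_def by auto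
    have fn: "isfn f c y" using f by (simp add: cofm_def)
    obtain i z where i: "opr i z \<epsilon> f" "k \<epsilon> z \<or> k = z" using f k(1) unfolding cofm_def by blast
    have "i \<epsilon> c" using isfn_dom[OF fn i(1)] .
    then have "z \<epsilon> k" using k(2) isfn_in[OF fn] isfn_app[OF fn] i(1) by auto
    then show False using i(2) zf.mem_asym[OF N(1)] zf.mem_irrefl[OF N(1)] by blast
  qed
qed

theorem rigid_exists:
  assumes A: "infin A"
  obtains R where "\<And>p. p \<epsilon> R \<Longrightarrow> \<exists>x y. x \<epsilon> A \<and> y \<epsilon> A \<and> p = opr x y" "rgd A R"
proof -
  obtain M where M: "upr A om \<epsilon> M" "zmodel M"
    and sp: "\<And>a. a \<epsilon> M \<Longrightarrow> ord a \<Longrightarrow> fdom.cfo E {x. x \<epsilon> M} a \<longleftrightarrow> univf.cfo a" using spec[of "upr A om"] by blast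
  have AM: "A \<epsilon> M" "om \<epsilon> M" using zmodel_trs[OF M(2,1)] by simp_all
  interpret m: zf E "{x. x \<epsilon> M}" using zf_model[OF M(2) AM(2)] .
  obtain a0 where a0: "a0 \<epsilon> A"
  proof (rule ccontr)
    assume "\<not> thesis"
    then have "\<not> z \<epsilon> A" for z using that by blast
    moreover have "isfn emp emp A" by (simp add: isfn_def isf_def)
    ultimately show False using A unfolding infin_def by (metis om_0 emp)
  qed
  obtain a1 where a1: "a1 \<epsilon> A" "a1 \<noteq> a0"
  proof (rule ccontr)
    assume "\<not> thesis"
    then have one: "z = a0" if "z \<epsilon> A" for z using that \<open>\<And>a1. a1 \<epsilon> A \<Longrightarrow> a1 \<noteq> a0 \<Longrightarrow> thesis\<close> by blast
    have "isfn (tup [a0]) (num 1) A" by (rule isfn_tup) (use a0 in auto)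
    moreover have "\<forall>x y z. opr x z \<epsilon> tup [a0] \<and> opr y z \<epsilon> tup [a0] \<longrightarrow> x = y" by auto
    moreover have "\<forall>z. z \<epsilon> A \<longrightarrow> (\<exists>x. opr x z \<epsilon> tup [a0])" using one by auto
    ultimately show False using A num_om unfolding infin_def by blast
  qed
  have aM: "a0 \<epsilon> M" "a1 \<epsilon> M" using zmodel_trs[OF M(2) AM(1)] a0 a1 by blast+
  \<comment> \<open>Two points are set aside for the top vertices \<open>s\<close> and
    \<open>sc s\<close>, and the remaining ones are numerated by \<open>s\<close>; this makes the
    size of \<open>A\<close> that of \<open>sc (sc s)\<close>.\<close>
  have "m.dfn (\<lambda>e. e 0 \<noteq> a0 \<and> e 0 \<noteq> a1)" using aM by (intro m.definable) simp_all
  from m.col[OF _ this, of A] AM obtain B where B: "B \<epsilon> M" "\<And>z. z \<epsilon> B \<longleftrightarrow> z \<epsilon> A \<and> z \<noteq> a0 \<and> z \<noteq> a1"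
    by auto
  obtain s p where s: "s \<epsilon> M" "p \<epsilon> M" "ord s" "isfn p s B"
    "\<And>d d'. d \<epsilon> s \<Longrightarrow> d' \<epsilon> s \<Longrightarrow> app p d = app p d' \<Longrightarrow> d = d'"
    "\<And>z. z \<epsilon> B \<Longrightarrow> \<exists>d. d \<epsilon> s \<and> app p d = z"
    using m.numeration[of B] B(1) by auto
  let ?X = "sc (sc s)"
  define Pf where "Pf x = (if x = sc s then a1 else if x = s then a0 else app p x)" for x
  have irr: "s \<noteq> sc s" "\<not> s \<epsilon> s" "\<not> sc s \<epsilon> s" "\<And>x. x \<epsilon> s \<Longrightarrow> x \<noteq> s \<and> x \<noteq> sc s"
    using m.mem_irrefl m.mem_asym[of s "sc s"] sc[of s s] by metis+
  have pB: "x \<epsilon> s \<Longrightarrow> app p x \<epsilon> B" for x using isfn_in[OF s(4)] .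
  have PA: "Pf x \<epsilon> A" if "x \<epsilon> ?X" for x
    using that pB[of x] B(2)[of "app p x"] a0 a1 by (auto simp: Pf_def)
  have "m.dfn (\<lambda>e. e i = Pf (e j))" for i j
    unfolding Pf_def using s aM by (intro m.definable) simp_all
  then obtain P where P: "P \<epsilon> M" "isfn P ?X A" "\<And>x. x \<epsilon> ?X \<Longrightarrow> app P x = Pf x"
    using m.isfn_graph[of ?X A Pf] PA s(1) AM m.sc_D by auto
  have Pinj: "x = y" if "x \<epsilon> ?X" "y \<epsilon> ?X" "app P x = app P y" for x y
  proof -
    have "Pf x = Pf y" using P(3) that by simp
    moreover have "Pf z \<noteq> a0 \<and> Pf z \<noteq> a1" if "z \<epsilon> s" for z
      using that irr(4)[OF that] pB[OF that] B(2)[of "app p z"] by (auto simp: Pf_def)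
    moreover have "Pf z = app p z" if "z \<epsilon> s" for z using irr(4)[OF that] by (simp add: Pf_def)
    moreover have "Pf s = a0" "Pf (sc s) = a1" using irr(1) by (simp_all add: Pf_def)
    ultimately show ?thesis using that(1,2) a1(2) s(5) unfolding sc by metis
  qed
  have Psurj: "\<exists>x. x \<epsilon> ?X \<and> app P x = z" if z: "z \<epsilon> A" for z
  proof -
    consider "z = a0" | "z = a1" | "z \<epsilon> B" using B(2) z by blast
    then show ?thesis
    proof cases
      case 1
      then show ?thesis using P(3)[of s] irr(1) by (intro exI[of _ s]) (simp add: Pf_def)
    next
      case 2
      then show ?thesis using P(3)[of "sc s"] by (intro exI[of _ "sc s"]) (simp add: Pf_def)
    next
      case 3
      then obtain d where d: "d \<epsilon> s" "app p d = z" using s(6) by blast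
      then show ?thesis using P(3)[of d] irr(4)[OF d(1)] by (intro exI[of _ d]) (simp add: Pf_def)
    qed
  qed
  have "\<not> s \<epsilon> om"
  proof
    assume "s \<epsilon> om"
    then have k: "?X \<epsilon> om" by simp
    have "\<forall>x y z. opr x z \<epsilon> P \<and> opr y z \<epsilon> P \<longrightarrow> x = y"
      using Pinj isfn_dom[OF P(2)] isfn_app[OF P(2)] by metis
    moreover have "\<forall>z. z \<epsilon> A \<longrightarrow> (\<exists>x. opr x z \<epsilon> P)"
      using Psurj isfn_app[OF P(2)] by metis
    ultimately show False using A k P(2) unfolding infin_def by blast
  qed
  then have om_s: "sub om s" using m.tri_sub(2)[OF m.ord_om s(3)] s(1) AM by simp
  obtain off par Lad R where fr: "off \<epsilon> M" "par \<epsilon> M" "Lad \<epsilon> M" "R \<epsilon> M" "frame s off par Lad R"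
    and lad: "\<And>y g. y \<epsilon> sc s \<Longrightarrow> lim y \<Longrightarrow> g \<epsilon> M \<Longrightarrow> cof_om g y \<Longrightarrow> \<exists>x. opr y x \<epsilon> Lad"
    using m.frame_exists[OF _ s(3) om_s] s(1) unfolding mem_Collect_eq Bex_def by metis
  have oR: "x \<epsilon> ?X" "y \<epsilon> ?X" if "opr x y \<epsilon> R" for x y
    using fr(5) that unfolding frame_def by blast+
  define Q where "Q = m.col (m.prd A A) (\<lambda>q. \<exists>x\<in>{x. x \<epsilon> M}. \<exists>y\<in>{x. x \<epsilon> M}. opr x y \<epsilon> R \<and> q = opr (app P x) (app P y))"
  have "m.dfn (\<lambda>e. \<exists>x\<in>{x. x \<epsilon> M}. \<exists>y\<in>{x. x \<epsilon> M}. opr x y \<epsilon> R \<and> e 0 = opr (app P x) (app P y))"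
    using fr(4) P(1) by (intro m.definable) simp_all
  note Q = m.col[OF m.prd(1) this, of A A, folded Q_def]
  have AD: "A \<in> {x. x \<epsilon> M}" using AM by simp
  have Qp: "\<exists>x y. x \<epsilon> A \<and> y \<epsilon> A \<and> q = opr x y" if "q \<epsilon> Q" for q
    using that unfolding Q(2)[OF AD AD] m.prd(2)[OF AD AD] by blast
  have oQ: "opr (app P x) (app P y) \<epsilon> Q \<longleftrightarrow> opr x y \<epsilon> R" if xy: "x \<epsilon> ?X" "y \<epsilon> ?X" for x y
  proof
    assume "opr (app P x) (app P y) \<epsilon> Q"
    then obtain x' y' where x': "opr x' y' \<epsilon> R" "app P x = app P x'" "app P y = app P y'"
      unfolding Q(2)[OF AD AD] by auto
    then have "x = x'" "y = y'" using Pinj xy oR[OF x'(1)] by blast+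
    with x' show "opr x y \<epsilon> R" by simp
  next
    assume xyR: "opr x y \<epsilon> R"
    have "x \<epsilon> M" "y \<epsilon> M" using m.opr_memD[OF xyR] fr(4) by simp_all
    then show "opr (app P x) (app P y) \<epsilon> Q"
      unfolding Q(2)[OF AD AD] m.opr_prd[OF AD AD] using xyR isfn_in[OF P(2)] xy by blast
  qed
  have "rgd A Q"
    unfolding rgd_def
  proof (intro allI impI; elim conjE)
    fix f a assume f: "isfn f A A"
      and fe: "\<forall>x y. opr x y \<epsilon> Q \<longrightarrow> (\<exists>u v. opr x u \<epsilon> f \<and> opr y v \<epsilon> f \<and> opr u v \<epsilon> Q)" and a: "a \<epsilon> A"
    \<comment> \<open>\<open>f\<close> is transported along \<open>P\<close> to a map
      \<open>f'\<close> of the ordinal within \<open>N\<close>, since \<open>M\<close> need not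
      contain \<open>f\<close>.\<close>
    obtain N where N: "zf E {x. x \<epsilon> N}" "\<And>x. x \<in> set [f, P, s, off, par, Lad, R] \<Longrightarrow> x \<epsilon> N"
      using model_of by metis
    interpret n: zf E "{x. x \<epsilon> N}" by (rule N(1))
    have XN: "?X \<in> {x. x \<epsilon> N}" using N(2)[of s] n.sc_D by simp
    define f' where "f' = n.col (n.prd ?X ?X) (\<lambda>q. \<exists>x\<in>{x. x \<epsilon> N}. \<exists>y\<in>{x. x \<epsilon> N}. q = opr x y \<and> app P y = app f (app P x))"
    have "n.dfn (\<lambda>e. \<exists>x\<in>{x. x \<epsilon> N}. \<exists>y\<in>{x. x \<epsilon> N}. e 0 = opr x y \<and> app P y = app f (app P x))"
      using N(2) by (intro n.definable) simp_all
    note f' = n.col[OF n.prd(1)[OF XN XN] this, folded f'_def]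
    have of': "opr x y \<epsilon> f' \<longleftrightarrow> x \<epsilon> ?X \<and> y \<epsilon> ?X \<and> app P y = app f (app P x)" for x y
      unfolding f'(2) n.opr_prd[OF XN XN] using n.trans[OF XN] by auto
    have fn': "isfn f' ?X ?X"
      unfolding isfn_def isf_def of'
    proof (intro conjI allI impI)
      show "\<exists>x y. x \<epsilon> ?X \<and> q = opr x y" if "q \<epsilon> f'" for q
        using that unfolding f'(2) n.prd(2)[OF XN XN] by blast
      show "\<exists>y. \<forall>z. (x \<epsilon> ?X \<and> z \<epsilon> ?X \<and> app P z = app f (app P x)) = (z = y)" if x: "x \<epsilon> ?X" for x
      proof -
        obtain y where y: "y \<epsilon> ?X" "app P y = app f (app P x)"
          using Psurj[OF isfn_in[OF f isfn_in[OF P(2) x]]] by blast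
        have "(x \<epsilon> ?X \<and> z \<epsilon> ?X \<and> app P z = app f (app P x)) = (z = y)" for z
        proof
          assume "x \<epsilon> ?X \<and> z \<epsilon> ?X \<and> app P z = app f (app P x)"
          then show "z = y" using Pinj[of z y] y by simp
        qed (use x y in blast)
        then show ?thesis by blast
      qed
    qed blast
    have app': "app f' x \<epsilon> ?X" "app P (app f' x) = app f (app P x)" if "x \<epsilon> ?X" for x
      using isfn_app[OF fn' that, of "app f' x"] of' by blast+
    interpret rf: rigid_frame E "{x. x \<epsilon> N}" s off par Lad R f'
    proof (unfold_locales, goal_cases)
      \<comment> \<open>The application of specialness: \<open>g\<close> in \<open>N\<close> shows
        that \<open>y\<close> has cofinality \<omega> in the universe, hence in \<open>M\<close>. A
        cofinal map \<open>h\<close> in \<open>M\<close> then guarantees the ladder built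
        there.\<close>
      case (8 y g)
      have oy: "ord y" and yM: "y \<epsilon> M"
        using m.ord_mem[OF m.ord_sc[OF s(3)] 8(1)] m.trans[OF _ 8(1)] m.sc_D s(1) by auto
      have "fdom.cfo E {x. x \<epsilon> M} y" using sp[OF yM oy] cfo_sup[OF oy 8(2,4)] by blast
      then obtain h where h: "h \<epsilon> M" "cofm h om y" unfolding fdom.cfo_def[OF m.fdom] by blast
      have hf: "isfn h om y" using h(2) by (simp add: cofm_def)
      have "cof_om h y"
        unfolding cof_om_def
      proof (intro conjI allI impI hf)
        fix x assume "x \<epsilon> y"
        \<comment> \<open>\<open>cofm\<close> admits equality, \<open>cof_om\<close> does not;
          passing from \<open>x\<close> to \<open>sc x\<close> makes up for the difference.\<close>
        then have "sc x \<epsilon> y" using m.lim_sc[OF oy] yM 8(2) unfolding lim_def by auto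
        then obtain k z where k: "opr k z \<epsilon> h" "sc x \<epsilon> z \<or> sc x = z" using h(2) unfolding cofm_def by blast
        have "k \<epsilon> om" using isfn_dom[OF hf k(1)] .
        then have z: "z = app h k" using isfn_app[OF hf, of k z] k(1) by simp
        have "ord z" using m.ord_mem[OF oy] isfn_in[OF hf \<open>k \<epsilon> om\<close>] z by simp
        then have "x \<epsilon> z" using k(2) m.ord_trs[of z "sc x" x] by auto
        then show "\<exists>k. k \<epsilon> om \<and> x \<epsilon> app h k" using z \<open>k \<epsilon> om\<close> by blast
      qed
      then show ?case using lad[OF 8(1,2) h(1)] by blast
    next
      case (10 x y)
      have xy: "x \<epsilon> ?X" "y \<epsilon> ?X" using oR[OF 10] .
      have "opr (app P x) (app P y) \<epsilon> Q" using oQ[OF xy] 10 by blast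
      then obtain u v where "opr (app P x) u \<epsilon> f" "opr (app P y) v \<epsilon> f" "opr u v \<epsilon> Q" using fe by blast
      then have "opr (app f (app P x)) (app f (app P y)) \<epsilon> Q"
        using isfn_app[OF f] isfn_dom[OF f] by metis
      then have "opr (app P (app f' x)) (app P (app f' y)) \<epsilon> Q" using app' xy by simp
      then show ?case using oQ app'(1) xy by blast
    qed (use N(2) f'(1) fr(5) fn' in simp_all)
    obtain x where x: "x \<epsilon> ?X" "app P x = a" using Psurj[OF a] by blast
    have "app f a = a" using rf.rigid[OF x(1)] app'(2)[OF x(1)] x(2) by simp
    then show "opr a a \<epsilon> f" using isfn_app[OF f a] by blast
  qed
  with Qp show ?thesis using that by blast
qed

end

section \<open>The instances of Vopenka's principle\<close>

context dom
begin

text \<open>Connects the object formula of a scheme with semantic definability: one or two of its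
  variables stay free and the others become parameters.\<close>

lemma dfn_sat:
  assumes "\<And>i. c i \<in> D"
  shows "dfn (\<lambda>e. sat D E (c(0 := e 0)) \<psi>)" "dfn (\<lambda>e. sat D E (c(0 := e i, 1 := e j)) \<psi>)"
proof -
  have "mrg e c \<circ> (\<lambda>i. if i = 0 then 0 else Suc (2 * i)) = c(0 := e 0)" for e
    by (rule HOL.ext) (simp add: mrg_def)
  then have "sat D E (c(0 := e 0)) \<psi> = sat D E (mrg e c) (ren (\<lambda>i. if i = 0 then 0 else Suc (2 * i)) \<psi>)" for e
    by (simp add: sat_ren)
  then show "dfn (\<lambda>e. sat D E (c(0 := e 0)) \<psi>)"
    unfolding dfn_def using assms by blast
  let ?f = "\<lambda>k. if k = 0 then 2 * i else if k = 1 then 2 * j else Suc (2 * k)"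
  have "mrg e c \<circ> ?f = c(0 := e i, 1 := e j)" for e
    by (rule HOL.ext) (simp add: mrg_def)
  then have "sat D E (c(0 := e i, 1 := e j)) \<psi> = sat D E (mrg e c) (ren ?f \<psi>)" for e
    by (simp add: sat_ren)
  then show "dfn (\<lambda>e. sat D E (c(0 := e i, 1 := e j)) \<psi>)"
    unfolding dfn_def using assms by blast
qed

end

context omset
begin

lemma tup1: "tup [x] = upr (opr emp x) (opr emp x)"
  by (rule ext) (auto simp: mem_tup)

lemma tup2: "tup [x, y] = upr (opr emp x) (opr (sc emp) y)"
  by (rule ext) (auto simp: mem_tup less_Suc_eq)

lemma tup3: "tup [x, y, z] = un2 (upr (opr emp x) (opr (sc emp) y)) (upr (opr (sc (sc emp)) z) (opr (sc (sc emp)) z))"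
  by (rule ext) (auto simp: tup_def upt_rec)

end

context dom
begin

lemma tup1_D: "x \<in> D \<Longrightarrow> tup [x] \<in> D"
  unfolding tup1 by simp

lemma tup2_D: "x \<in> D \<Longrightarrow> y \<in> D \<Longrightarrow> tup [x, y] \<in> D"
  unfolding tup2 by simp

end

context omset
begin

text \<open>What elementarity says about atomic formulas with the variables in their natural order.
  The arity is a standard numeral, so tuples are given by lists.\<close>

definition "elem r ar j x y \<longleftrightarrow> (\<exists>A I B J. x = opr A I \<and> y = opr B J \<and> isfn j A B \<and>
  (\<forall>R k X X' xs. R \<epsilon> r \<longrightarrow> opr R (num k) \<epsilon> ar \<longrightarrow> opr R X \<epsilon> I \<longrightarrow> opr R X' \<epsilon> J \<longrightarrow> length xs = k \<longrightarrow>
    (\<forall>a\<in>set xs. a \<epsilon> A) \<longrightarrow> (tup xs \<epsilon> X \<longleftrightarrow> tup (map (app j) xs) \<epsilon> X')))"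

text \<open>With the variables listed in order, the tuple of values coincides with the
  assignment.\<close>

lemma sat_atomic:
  assumes "issat r ar A I (num k) S" "R \<epsilon> r" "opr R (num k) \<epsilon> ar" "opr R X \<epsilon> I" "length xs = k" "\<forall>a\<in>set xs. a \<epsilon> A"
  shows "isform r ar (num k) (crel R (tup (map (\<lambda>i. cvar (num i)) [0..<k])))" (is "isform _ _ _ ?p")
    and "opr (crel R (tup (map (\<lambda>i. cvar (num i)) [0..<k]))) (tup xs) \<epsilon> S \<longleftrightarrow> tup xs \<epsilon> X"
proof -
  obtain V where V: "\<forall>s. isfn s (num k) A \<longrightarrow> (\<forall>i y. i \<epsilon> num k \<longrightarrow> (opr (opr (cvar i) s) y \<epsilon> V \<longleftrightarrow> opr i y \<epsilon> s))"
    and S: "satrec r ar A I (num k) V S" using assms(1) unfolding issat_def by blast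
  have s: "isfn (tup xs) (num k) A" using assms(5,6) by (intro isfn_tup) auto
  show f: "isform r ar (num k) ?p"
  proof (intro fmc_isform fmc_rel[of _ _ "num k"] assms(2,3))
    show "isf (tup (map (\<lambda>i. cvar (num i)) [0..<k])) (num k)"
      using isf_tup[of "map (\<lambda>i. cvar (num i)) [0..<k]"] by simp
    show "\<exists>i. i \<epsilon> num k \<and> z = cvar i" if "opr j z \<epsilon> tup (map (\<lambda>i. cvar (num i)) [0..<k])" for j z
      using that by auto
  qed
  have "vtup V (num (length [0..<k])) (tup (map (\<lambda>i. cvar (num i)) [0..<k])) (tup xs) u \<longleftrightarrow>
      u = tup (map (\<lambda>i. app (tup xs) (num i)) [0..<k])" for u
    by (rule vtup_tup[OF V s]) simp
  moreover have "map (\<lambda>i. app (tup xs) (num i)) [0..<k] = xs"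
    using assms(5) by (intro nth_equalityI) auto
  ultimately have "vtup V (num k) (tup (map (\<lambda>i. cvar (num i)) [0..<k])) (tup xs) u \<longleftrightarrow> u = tup xs" for u
    by simp
  then show "opr ?p (tup xs) \<epsilon> S \<longleftrightarrow> tup xs \<epsilon> X"
    using satrecD(2)[OF S s f assms(3,4)] by simp
qed

lemma ev_is_comp [simp]: "s' < n \<Longrightarrow> j < n \<Longrightarrow> s < n \<Longrightarrow> k < n \<Longrightarrow>
    lsat UNIV E g n e (is_comp s' j s k) \<longleftrightarrow> isf (e s') (e k) \<and>
      (\<forall>i y. opr i y \<epsilon> e s' \<longleftrightarrow> (\<exists>z. opr i z \<epsilon> e s \<and> opr z y \<epsilon> e j))"
  by (simp add: is_comp_def)

lemma ev_elem_embedding: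
  assumes "r < n" "g' < n" "ar < n" "j < n" "x < n" "y < n" "e g' = emp"
    and "lsat UNIV E g n e (elem_embedding r g' ar j x y)"
  shows "elem (e r) (e ar) (e j) (e x) (e y)"
proof -
  obtain A I B J where AB: "e x = opr A I" "e y = opr B J" "isfn (e j) A B"
    and *: "lsat UNIV E g (Suc (Suc (Suc (Suc n)))) (e(n := A, Suc n := I, Suc (Suc n) := B, Suc (Suc (Suc n)) := J))
     (\<^bold>\<forall>k. is_nat k \<^bold>\<longrightarrow> (\<^bold>\<exists>S S'. is_satisfaction r g' ar n (Suc n) k S \<^bold>\<and>
        is_satisfaction r g' ar (Suc (Suc n)) (Suc (Suc (Suc n))) k S' \<^bold>\<and>
        (\<^bold>\<forall>p s s'. is_formula r g' ar k p \<^bold>\<and> func_to s k n \<^bold>\<and> is_comp s' j s k \<^bold>\<longrightarrow>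
           (maps S p s \<^bold>\<longleftrightarrow> maps S' p s'))))" (is "lsat UNIV E g ?n ?e _")
    using assms unfolding elem_embedding_def lsat_ex lsat_conj by auto
  have "tup xs \<epsilon> X \<longleftrightarrow> tup (map (app (e j)) xs) \<epsilon> X'"
    if R: "R \<epsilon> e r" "opr R (num k) \<epsilon> e ar" and X: "opr R X \<epsilon> I" "opr R X' \<epsilon> J"
      and xs: "length xs = k" "\<forall>a\<in>set xs. a \<epsilon> A" for R k X X' xs
  proof -
    let ?k = "?n" and ?e' = "\<lambda>S S'. ?e(?n := num k, Suc ?n := S, Suc (Suc ?n) := S')"
    have "\<exists>S S'. lsat UNIV E g (Suc (Suc (Suc ?n))) (?e' S S') (is_satisfaction r g' ar n (Suc n) ?n (Suc ?n) \<^bold>\<and>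
        is_satisfaction r g' ar (Suc (Suc n)) (Suc (Suc (Suc n))) ?n (Suc (Suc ?n)) \<^bold>\<and>
        (\<^bold>\<forall>p s s'. is_formula r g' ar ?n p \<^bold>\<and> func_to s ?n n \<^bold>\<and> is_comp s' j s ?n \<^bold>\<longrightarrow>
           (maps (Suc ?n) p s \<^bold>\<longleftrightarrow> maps (Suc (Suc ?n)) p s')))"
      using * unfolding lsat_all lsat_imp lsat_ex by simp
    then obtain S S' where
      S: "lsat UNIV E g (Suc (Suc (Suc ?n))) (?e' S S') (is_satisfaction r g' ar n (Suc n) ?n (Suc ?n))"
        "lsat UNIV E g (Suc (Suc (Suc ?n))) (?e' S S') (is_satisfaction r g' ar (Suc (Suc n)) (Suc (Suc (Suc n))) ?n (Suc (Suc ?n)))"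
        "lsat UNIV E g (Suc (Suc (Suc ?n))) (?e' S S') (\<^bold>\<forall>p s s'. is_formula r g' ar ?n p \<^bold>\<and> func_to s ?n n \<^bold>\<and> is_comp s' j s ?n \<^bold>\<longrightarrow>
           (maps (Suc ?n) p s \<^bold>\<longleftrightarrow> maps (Suc (Suc ?n)) p s'))"
      unfolding lsat_conj by blast
    have s1: "issat (e r) (e ar) A I (num k) S"
      using ev_is_satisfaction[OF _ _ _ _ _ _ _ _ S(1)] assms by simp
    have s2: "issat (e r) (e ar) B J (num k) S'"
      using ev_is_satisfaction[OF _ _ _ _ _ _ _ _ S(2)] assms by simp
    have s3: "\<forall>p s s'. isform (e r) (e ar) (num k) p \<and> isfn s (num k) A \<and> isf s' (num k) \<and>
        (\<forall>i y. opr i y \<epsilon> s' \<longleftrightarrow> (\<exists>z. opr i z \<epsilon> s \<and> opr z y \<epsilon> e j)) \<longrightarrow> (opr p s \<epsilon> S \<longleftrightarrow> opr p s' \<epsilon> S')"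
      using S(3) assms by (simp add: ev_is_formula)
    let ?p = "crel R (tup (map (\<lambda>i. cvar (num i)) [0..<k]))" and ?s' = "tup (map (app (e j)) xs)"
    have B: "\<forall>a\<in>set (map (app (e j)) xs). a \<epsilon> B" using xs(2) isfn_in[OF AB(3)] by auto
    have "isfn (tup xs) (num k) A" using xs by (intro isfn_tup) auto
    moreover have "isf ?s' (num k)" using isf_tup[of "map (app (e j)) xs"] xs(1) by simp
    moreover have "opr i y \<epsilon> ?s' \<longleftrightarrow> (\<exists>z. opr i z \<epsilon> tup xs \<and> opr z y \<epsilon> e j)" for i y
    proof -
      have "opr (xs ! l) y \<epsilon> e j \<longleftrightarrow> y = app (e j) (xs ! l)" if "l < length xs" for l
        using isfn_app[OF AB(3), of "xs ! l" y] xs(2) that by auto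
      then show ?thesis by auto
    qed
    ultimately have "opr ?p (tup xs) \<epsilon> S \<longleftrightarrow> opr ?p ?s' \<epsilon> S'"
      using s3 sat_atomic(1)[OF s1 R X(1) xs] by blast
    then show ?thesis
      using sat_atomic(2)[OF s1 R X(1) xs] sat_atomic(2)[OF s2 R X(2) _ B] xs(1) by simp
  qed
  then show ?thesis unfolding elem_def using AB by blast
qed

end

section \<open>Vopenka's principle for definable classes\<close>

locale vopenka = spec +
  fixes g :: "nat \<Rightarrow> 'a"
  assumes vp: "fv \<phi> \<subseteq> {..k} \<Longrightarrow> sat UNIV E g ((All ^^ k) (vopenka_instance \<phi> k))"
begin

text \<open>The principle is instantiated with the empty set of function symbols, and the parameters
  defining \<open>C\<close> become its outermost quantified variables.\<close>

lemma vopenka: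
  assumes C: "univ.dfn (\<lambda>e. C (e 0))"
    and lang: "isfn ar r om"
    and str: "\<And>x. C x \<Longrightarrow> \<exists>A I. x = opr A I \<and> (\<exists>a. a \<epsilon> A) \<and> isf I r \<and>
      (\<forall>s k X. s \<epsilon> r \<and> opr s k \<epsilon> ar \<and> opr s X \<epsilon> I \<longrightarrow> (\<forall>t. t \<epsilon> X \<longrightarrow> isfn t k A))"
    and proper: "\<not> (\<exists>X. \<forall>x. x \<epsilon> X \<longleftrightarrow> C x)"
  obtains x y j where "C x" "C y" "x \<noteq> y" "elem r ar j x y"
proof -
  obtain p c where p: "\<And>e. C (e 0) = sat UNIV E (univ.mrg e c) p"
    using C unfolding univ.dfn_def by auto
  \<comment> \<open>The numbering expected by \<open>at_param\<close>: even variables become index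
    0, the member of the class, and parameter \<open>j\<close> becomes index
    \<open>Suc j\<close>.\<close>
  let ?f = "\<lambda>i. if even i then 0 else Suc (i div 2)"
  define \<phi> where "\<phi> = ren ?f p"
  obtain k where k: "\<And>i. i \<in> fv \<phi> \<Longrightarrow> i < k"
    using finite_nat_set_iff_bounded[of "fv \<phi>"] by auto
  then have fv: "fv \<phi> \<subseteq> {..k}" by (auto intro: less_imp_le)
  have at: "lsat UNIV E g n e (at_param \<phi> x) = C (e x)"
    if "x < n" "k \<le> n" "\<And>j. j < k \<Longrightarrow> e j = c j" for n e x
  proof -
    have "fv \<phi> \<subseteq> {..n}" using fv that(2) by auto
    then have "lsat UNIV E g n e (at_param \<phi> x) = sat UNIV E (case_nat (e x) e) \<phi>"
      using lsat_at_param that(1) by blast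
    also have "\<dots> = sat UNIV E (case_nat (e x) c) \<phi>"
      using that(3) k by (intro sat_cong) (auto split: nat.split dest: Suc_lessD)
    also have "\<dots> = sat UNIV E (univ.mrg (\<lambda>_. e x) c) p"
    proof -
      have "case_nat (e x) c \<circ> ?f = univ.mrg (\<lambda>_. e x) c"
        by (rule HOL.ext) (simp add: univ.mrg_def)
      then show ?thesis by (simp add: \<phi>_def sat_ren)
    qed
    also have "\<dots> = C (e x)" using p[of "\<lambda>_. e x"] by simp
    finally show ?thesis .
  qed
  \<comment> \<open>The universal closure takes its values by index, innermost first, whereas level
    \<open>j\<close> is to carry \<open>c j\<close>; hence the reversal
    \<open>k - Suc i\<close>.\<close>
  have "lsat UNIV E g k c (vopenka_instance \<phi>)"
    using vp[OF fv] unfolding sat_All_funpow[of g UNIV, simplified] lsat_def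
    by (elim allE[of _ "\<lambda>i. c (k - Suc i)"])
  then have "lsat UNIV E g (Suc (Suc (Suc k))) (c(k := r, Suc k := emp, Suc (Suc k) := ar))
     (is_language k (Suc k) (Suc (Suc k)) \<^bold>\<and>
     (\<^bold>\<forall>x. at_param \<phi> x \<^bold>\<longrightarrow> (\<^bold>\<exists>A I. is_pair x A I \<^bold>\<and> is_structure k (Suc k) (Suc (Suc k)) A I)) \<^bold>\<and>
     \<^bold>\<not> (\<^bold>\<exists>X. \<^bold>\<forall>x. x \<^bold>\<in> X \<^bold>\<longleftrightarrow> at_param \<phi> x) \<^bold>\<longrightarrow>
     (\<^bold>\<exists>x y j. at_param \<phi> x \<^bold>\<and> at_param \<phi> y \<^bold>\<and> \<^bold>\<not> x \<^bold>= y \<^bold>\<and> elem_embedding k (Suc k) (Suc (Suc k)) j x y))"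
    (is "lsat UNIV E g ?n ?e (?F1 \<^bold>\<and> ?F2 \<^bold>\<and> ?F3 \<^bold>\<longrightarrow> ?G)")
    unfolding vopenka_instance_def lsat_all by blast
  moreover have "lsat UNIV E g ?n ?e ?F1"
  proof -
    have "un2 r emp = r" by (rule ext) simp
    then show ?thesis using lang by (simp add: is_language_def)
  qed
  moreover have "lsat UNIV E g ?n ?e ?F2"
  proof -
    have r: "un2 r emp = r" by (rule ext) simp
    show ?thesis
      using str by (simp add: at is_structure_def r)
  qed
  moreover have "lsat UNIV E g ?n ?e ?F3"
    using proper by (simp add: at)
  ultimately have "lsat UNIV E g ?n ?e ?G" unfolding lsat_imp lsat_conj by blast
  then obtain x y j where xyj: "C x" "C y" "x \<noteq> y"
    "lsat UNIV E g (Suc (Suc (Suc ?n))) (?e(?n := x, Suc ?n := y, Suc (Suc ?n) := j))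
      (elem_embedding k (Suc k) (Suc (Suc k)) (Suc (Suc ?n)) ?n (Suc ?n))"
    unfolding lsat_ex lsat_conj by (auto simp: at)
  have "elem r ar j x y"
    using ev_elem_embedding[OF _ _ _ _ _ _ _ xyj(4)] by simp
  with xyj that show ?thesis by blast
qed

text \<open>Adjoining \<open>om\<close> makes any set infinite, so a rigid relation can be used for
  arbitrary \<open>A\<close>. A finite enumeration would leave a bound of its values in
  \<open>om\<close> uncovered.\<close>

lemma infin_un2_om: "infin (un2 A om)"
  unfolding infin_def
proof (intro notI, elim exE conjE)
  fix k f assume k: "k \<epsilon> om" and f: "isfn f k (un2 A om)"
    and surj: "\<forall>z. z \<epsilon> un2 A om \<longrightarrow> (\<exists>x. opr x z \<epsilon> f)"
  obtain N where N: "zf E {x. x \<epsilon> N}" "\<And>x. x \<in> set [f] \<Longrightarrow> x \<epsilon> N" using model_of by metis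
  interpret n: zf E "{x. x \<epsilon> N}" by (rule N(1))
  have "om \<noteq> emp" using om_0 emp by metis
  then obtain b where b: "b \<epsilon> om" "\<And>i. i \<epsilon> k \<Longrightarrow> app f i \<epsilon> om \<Longrightarrow> app f i \<epsilon> b"
    using n.finite_bounded[OF k _ n.om_D n.ord_om _ n.om_not_suc, of f] N(2) by auto
  obtain x where x: "opr x b \<epsilon> f" using surj b(1) by auto
  have "x \<epsilon> k" using isfn_dom[OF f x] .
  then have "app f x = b" using isfn_app[OF f, of x b] x by simp
  then show False using b(2)[OF \<open>x \<epsilon> k\<close>] b(1) n.mem_irrefl[of b] by simp
qed

text \<open>Replacement is not yet known in the universe but holds in a model containing
  \<open>u\<close>; all the tuples concerned lie in that model.\<close>

lemma ex_tups: "\<exists>W. \<forall>w. w \<epsilon> W \<longleftrightarrow> (\<exists>x. x \<epsilon> u \<and> w = tup [x])"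
proof -
  obtain N where N: "zf E {x. x \<epsilon> N}" "\<And>x. x \<in> set [u] \<Longrightarrow> x \<epsilon> N" using model_of by metis
  interpret n: zf E "{x. x \<epsilon> N}" by (rule N(1))
  have u: "u \<in> {x. x \<epsilon> N}" using N(2) by simp
  have "n.dfn (\<lambda>e. e 1 = tup [e 0])" unfolding tup1 by (intro n.definable n.emp_D)
  from n.repl[OF u this] obtain W where "\<And>w. w \<epsilon> W \<longleftrightarrow> w \<epsilon> N \<and> (\<exists>x. x \<epsilon> u \<and> w = tup [x])" by auto
  moreover have "tup [x] \<epsilon> N" if "x \<epsilon> u" for x
    using n.tup1_D[OF n.trans[OF u that]] by simp
  ultimately show ?thesis by (intro exI[of _ W]) blast
qed

lemma ex_tups2: "\<exists>W. \<forall>w. w \<epsilon> W \<longleftrightarrow> (\<exists>x y. opr x y \<epsilon> R \<and> w = tup [x, y])"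
proof -
  obtain N where N: "zf E {x. x \<epsilon> N}" "\<And>x. x \<in> set [R] \<Longrightarrow> x \<epsilon> N" using model_of by metis
  interpret n: zf E "{x. x \<epsilon> N}" by (rule N(1))
  have R: "R \<in> {x. x \<epsilon> N}" using N(2) by simp
  have "n.dfn (\<lambda>e. \<exists>x\<in>{x. x \<epsilon> N}. \<exists>y\<in>{x. x \<epsilon> N}. e 0 = opr x y \<and> e 1 = tup [x, y])"
    unfolding tup2 by (intro n.definable n.emp_D)
  then have "\<exists>W\<in>{x. x \<epsilon> N}. \<forall>w. w \<epsilon> W \<longleftrightarrow> w \<in> {x. x \<epsilon> N} \<and>
      (\<exists>p. p \<epsilon> R \<and> (\<exists>x\<in>{x. x \<epsilon> N}. \<exists>y\<in>{x. x \<epsilon> N}. p = opr x y \<and> w = tup [x, y]))"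
    by (rule n.repl[OF R]) auto
  then obtain W where
    W: "\<And>w. w \<epsilon> W \<longleftrightarrow> w \<epsilon> N \<and> (\<exists>p. p \<epsilon> R \<and> (\<exists>x. x \<epsilon> N \<and> (\<exists>y. y \<epsilon> N \<and> p = opr x y \<and> w = tup [x, y])))"
    by auto
  have "tup [x, y] \<epsilon> N \<and> x \<epsilon> N \<and> y \<epsilon> N" if "opr x y \<epsilon> R" for x y
  proof -
    have "x \<in> {x. x \<epsilon> N} \<and> y \<in> {x. x \<epsilon> N}" using n.opr_memD[OF that R] .
    then show ?thesis using n.tup2_D[of x y] by simp
  qed
  then show ?thesis using W by (intro exI[of _ W]) blast
qed

text \<open>
  The structures are expanded by a rigid relation on \<open>A\<close> and by predicates for \<open>A\<close> and for the
  index \<open>u \<subseteq> A\<close>, so that there is no embedding between different structures of the class. The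
  element \<open>t\<close> attached to \<open>u\<close> only serves to make it retrievable from the class.
\<close>

definition "expansion A R2 A1 W t = opr (un2 A (upr t t)) (tup [R2, A1, W])"

lemma tm_expansion: "univ.tm (\<lambda>e. expansion A R2 A1 (e i) (e j))"
  unfolding expansion_def tup3 by (intro univ.definable UNIV_I)

text \<open>\<open>A1\<close> ensures that an embedding \<open>j\<close> maps \<open>A\<close> into
  \<open>A\<close>, although the structures also contain the points \<open>t\<close>. Then
  \<open>j\<close> acts on \<open>A\<close> as an endomorphism of the rigid relation, so it is the
  identity there, and the predicates for \<open>u\<close> and \<open>u'\<close> coincide. Since
  \<open>u\<close> determines \<open>t\<close>, the two structures are equal.\<close>

lemma class_is_set:
  assumes R: "\<And>p. p \<epsilon> R \<Longrightarrow> \<exists>x y. x \<epsilon> A \<and> y \<epsilon> A \<and> p = opr x y" and rigid: "rgd A R"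
    and R2: "\<And>w. w \<epsilon> R2 \<longleftrightarrow> (\<exists>x y. opr x y \<epsilon> R \<and> w = tup [x, y])"
    and A1: "\<And>w. w \<epsilon> A1 \<longleftrightarrow> (\<exists>x. x \<epsilon> A \<and> w = tup [x])"
    and K: "\<And>i j. univ.dfn (\<lambda>e. K (e i) (e j))" "\<And>u t. K u t \<Longrightarrow> sub u A"
      "\<And>u t t'. K u t \<Longrightarrow> K u t' \<Longrightarrow> t = t'"
  shows "\<exists>X. \<forall>s. s \<epsilon> X \<longleftrightarrow> (\<exists>u t W. K u t \<and> (\<forall>w. w \<epsilon> W \<longleftrightarrow> (\<exists>x. x \<epsilon> u \<and> w = tup [x])) \<and>
    s = expansion A R2 A1 W t)"
    (is "\<exists>X. \<forall>s. s \<epsilon> X \<longleftrightarrow> ?C s")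
proof (rule ccontr)
  assume proper: "\<not> (\<exists>X. \<forall>s. s \<epsilon> X \<longleftrightarrow> ?C s)"
  let ?ar = "tup [num 2, num 1, num 1]"
  have "univ.dfn (\<lambda>e. \<exists>u\<in>UNIV. \<exists>t\<in>UNIV. \<exists>W\<in>UNIV. K u t \<and> (\<forall>w\<in>UNIV. w \<epsilon> W \<longleftrightarrow> (\<exists>x. x \<epsilon> u \<and> w = tup [x])) \<and>
    e 0 = expansion A R2 A1 W t)"
    unfolding tup1 by (intro univ.definable K(1) tm_expansion UNIV_I)
  then have dC: "univ.dfn (\<lambda>e. ?C (e 0))" by (rule univ.dfn_cong[rotated]) auto
  have lang: "isfn ?ar (num 3) om" by (rule isfn_tup) auto
  have cases3: "k = 0 \<or> k = 1 \<or> k = 2" if "k < 3" for k :: nat using that by auto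
  have str: "\<exists>B I. s = opr B I \<and> (\<exists>a. a \<epsilon> B) \<and> isf I (num 3) \<and>
      (\<forall>l k X. l \<epsilon> num 3 \<and> opr l k \<epsilon> ?ar \<and> opr l X \<epsilon> I \<longrightarrow> (\<forall>t. t \<epsilon> X \<longrightarrow> isfn t k B))" if "?C s" for s
  proof -
    obtain u t W where utW: "K u t" "\<forall>w. w \<epsilon> W \<longleftrightarrow> (\<exists>x. x \<epsilon> u \<and> w = tup [x])" "s = expansion A R2 A1 W t"
      using \<open>?C s\<close> by blast
    let ?B = "un2 A (upr t t)" and ?I = "tup [R2, A1, W]"
    have "isf ?I (num 3)" using isf_tup[of "[R2, A1, W]"] by (simp add: numeral_3_eq_3)
    moreover have "isfn v k ?B" if lkX: "opr l k \<epsilon> ?ar" "opr l X \<epsilon> ?I" "v \<epsilon> X" for l k X v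
    proof -
      obtain i where i: "i < 3" "l = num i" "k = [num 2, num 1, num 1] ! i" "X = [R2, A1, W] ! i"
        using lkX(1,2) by auto
      have sA: "x \<epsilon> A" if "x \<epsilon> u" for x using K(2)[OF utW(1)] that by (simp add: sub_def)
      consider "i = 0" | "i = 1" | "i = 2" using cases3[OF i(1)] by blast
      then show ?thesis
      proof cases
        case 1
        then obtain x y where xy: "opr x y \<epsilon> R" "v = tup [x, y]" using lkX(3) i(4) R2 by auto
        then have "x \<epsilon> A" "y \<epsilon> A" using R[OF xy(1)] by auto
        then show ?thesis using isfn_tup[of "[x, y]" ?B 2] 1 i(3) xy(2) by auto
      next
        case 2
        then obtain x where "x \<epsilon> A" "v = tup [x]" using lkX(3) i(4) A1 by auto
        then show ?thesis using isfn_tup[of "[x]" ?B 1] 2 i(3) by auto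
      next
        case 3
        then obtain x where "x \<epsilon> u" "v = tup [x]" using lkX(3) i(4) utW(2) by auto
        then show ?thesis using isfn_tup[of "[x]" ?B 1] 3 i(3) sA by auto
      qed
    qed
    moreover have "t \<epsilon> ?B" by simp
    ultimately show ?thesis using utW(3) unfolding expansion_def by blast
  qed
  obtain x y j where xy: "?C x" "?C y" "x \<noteq> y" "elem (num 3) ?ar j x y"
    by (rule vopenka[OF dC lang str proper])
  obtain u t W where 1: "K u t" "\<forall>w. w \<epsilon> W \<longleftrightarrow> (\<exists>x. x \<epsilon> u \<and> w = tup [x])" "x = expansion A R2 A1 W t"
    using xy(1) by blast
  obtain u' t' W' where 2: "K u' t'" "\<forall>w. w \<epsilon> W' \<longleftrightarrow> (\<exists>x. x \<epsilon> u' \<and> w = tup [x])" "y = expansion A R2 A1 W' t'"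
    using xy(2) by blast
  have j: "isfn j (un2 A (upr t t)) (un2 A (upr t' t'))"
    and el: "\<And>i xs. i < 3 \<Longrightarrow> num (length xs) = [num 2, num 1, num 1] ! i \<Longrightarrow> \<forall>a\<in>set xs. a \<epsilon> A \<Longrightarrow>
      tup xs \<epsilon> [R2, A1, W] ! i \<longleftrightarrow> tup (map (app j) xs) \<epsilon> [R2, A1, W'] ! i"
  proof -
    from xy(4) have "isfn j (un2 A (upr t t)) (un2 A (upr t' t')) \<and>
      (\<forall>R k X X' xs. R \<epsilon> num 3 \<longrightarrow> opr R (num k) \<epsilon> ?ar \<longrightarrow> opr R X \<epsilon> tup [R2, A1, W] \<longrightarrow>
        opr R X' \<epsilon> tup [R2, A1, W'] \<longrightarrow> length xs = k \<longrightarrow>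
       (\<forall>a\<in>set xs. a \<epsilon> un2 A (upr t t)) \<longrightarrow> (tup xs \<epsilon> X \<longleftrightarrow> tup (map (app j) xs) \<epsilon> X'))"
      unfolding elem_def 1(3) 2(3) expansion_def opr_inject by blast
    then have j': "isfn j (un2 A (upr t t)) (un2 A (upr t' t'))"
      and e: "\<And>R k X X' xs. R \<epsilon> num 3 \<Longrightarrow> opr R (num k) \<epsilon> ?ar \<Longrightarrow> opr R X \<epsilon> tup [R2, A1, W] \<Longrightarrow>
        opr R X' \<epsilon> tup [R2, A1, W'] \<Longrightarrow> length xs = k \<Longrightarrow>
       (\<forall>a\<in>set xs. a \<epsilon> un2 A (upr t t)) \<Longrightarrow> (tup xs \<epsilon> X \<longleftrightarrow> tup (map (app j) xs) \<epsilon> X')" by blast+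
    show "isfn j (un2 A (upr t t)) (un2 A (upr t' t'))" by (rule j')
    show "tup xs \<epsilon> [R2, A1, W] ! i \<longleftrightarrow> tup (map (app j) xs) \<epsilon> [R2, A1, W'] ! i"
      if "i < 3" "num (length xs) = [num 2, num 1, num 1] ! i" "\<forall>a\<in>set xs. a \<epsilon> A" for i xs
      by (rule e[of "num i" "length xs"]) (use that in auto)
  qed
  have el0: "tup [app j a, app j b] \<epsilon> R2" if "opr a b \<epsilon> R" for a b
    using el[of 0 "[a, b]"] R[OF that] R2 that by (auto simp: num2)
  have el1: "app j a \<epsilon> A" if "a \<epsilon> A" for a
    using el[of 1 "[a]"] A1 that by (auto simp: tup_inject)
  have el2: "a \<epsilon> u \<longleftrightarrow> app j a \<epsilon> u'" if "a \<epsilon> A" for a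
    using el[of 2 "[a]"] 1(2) 2(2) that by (auto simp: tup_inject)
  \<comment> \<open>The restriction of \<open>j\<close> to \<open>A\<close> is formed as a set
    inside a model, so that rigidity can be applied to it.\<close>
  obtain N where N: "zf E {x. x \<epsilon> N}" "\<And>x. x \<in> set [j, A] \<Longrightarrow> x \<epsilon> N" using model_of by metis
  interpret n: zf E "{x. x \<epsilon> N}" by (rule N(1))
  have AN: "A \<in> {x. x \<epsilon> N}" and jN: "j \<in> {x. x \<epsilon> N}" using N(2) by simp_all
  have "n.dfn (\<lambda>e. e k = app j (e l))" for k l using jN by (intro n.definable)
  then obtain f where f: "isfn f A A" "\<And>a. a \<epsilon> A \<Longrightarrow> app f a = app j a"
    using n.isfn_graph[OF AN AN, of "app j"] el1 by metis
  have fix_j: "app j a = a" if a: "a \<epsilon> A" for a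
  proof -
    have "\<forall>x y. opr x y \<epsilon> R \<longrightarrow> (\<exists>v w. opr x v \<epsilon> f \<and> opr y w \<epsilon> f \<and> opr v w \<epsilon> R)"
    proof (intro allI impI)
      fix x y assume xyR: "opr x y \<epsilon> R"
      then have xA: "x \<epsilon> A" "y \<epsilon> A" using R[OF xyR] by auto
      obtain v w where vw: "opr v w \<epsilon> R" "tup [app j x, app j y] = tup [v, w]" using el0[OF xyR] R2 by blast
      then have "v = app f x" "w = app f y" using f(2) xA by (auto simp: tup_inject)
      then show "\<exists>v w. opr x v \<epsilon> f \<and> opr y w \<epsilon> f \<and> opr v w \<epsilon> R"
        using vw(1) isfn_app[OF f(1)] xA by blast
    qed
    then have "opr a a \<epsilon> f" using rigid f(1) a unfolding rgd_def by blast
    then show ?thesis using isfn_app[OF f(1) a] f(2)[OF a] by simp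
  qed
  have "u = u'"
  proof (rule ext)
    fix a
    have "a \<epsilon> u \<Longrightarrow> a \<epsilon> A" "a \<epsilon> u' \<Longrightarrow> a \<epsilon> A" using K(2)[OF 1(1)] K(2)[OF 2(1)] by (auto simp: sub_def)
    then show "a \<epsilon> u \<longleftrightarrow> a \<epsilon> u'" using el2[of a] fix_j[of a] by auto
  qed
  then have "t = t'" using K(3) 1(1) 2(1) by blast
  moreover have "W = W'" by (rule ext) (use 1(2) 2(2) \<open>u = u'\<close> in auto)
  ultimately show False using xy(3) 1(3) 2(3) by simp
qed

definition "expands A R R2 A1 \<longleftrightarrow> (\<forall>p. p \<epsilon> R \<longrightarrow> (\<exists>x y. x \<epsilon> A \<and> y \<epsilon> A \<and> p = opr x y)) \<and> rgd A R \<and>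
  (\<forall>w. w \<epsilon> R2 \<longleftrightarrow> (\<exists>x y. opr x y \<epsilon> R \<and> w = tup [x, y])) \<and> (\<forall>w. w \<epsilon> A1 \<longleftrightarrow> (\<exists>x. x \<epsilon> A \<and> w = tup [x]))"

lemma rigid_expansion: "\<exists>R R2 A1. expands (un2 A om) R R2 A1"
proof (rule rigid_exists[OF infin_un2_om[of A]])
  fix R assume R: "\<And>p. p \<epsilon> R \<Longrightarrow> \<exists>x y. x \<epsilon> un2 A om \<and> y \<epsilon> un2 A om \<and> p = opr x y" "rgd (un2 A om) R"
  obtain R2 where R2: "\<forall>w. w \<epsilon> R2 \<longleftrightarrow> (\<exists>x y. opr x y \<epsilon> R \<and> w = tup [x, y])" using ex_tups2[of R] ..
  obtain A1 where A1: "\<forall>w. w \<epsilon> A1 \<longleftrightarrow> (\<exists>x. x \<epsilon> un2 A om \<and> w = tup [x])" using ex_tups[of "un2 A om"] ..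
  have "expands (un2 A om) R R2 A1"
    unfolding expands_def by (intro conjI R2 A1 R(2) allI impI R(1))
  then show ?thesis by blast
qed

lemma expansion_class:
  assumes "expands A R R2 A1" "\<And>i j. univ.dfn (\<lambda>e. K (e i) (e j))" "\<And>u t. K u t \<Longrightarrow> sub u A"
    "\<And>u t t'. K u t \<Longrightarrow> K u t' \<Longrightarrow> t = t'"
  shows "\<exists>X. \<forall>s. s \<epsilon> X \<longleftrightarrow> (\<exists>u t W. K u t \<and> (\<forall>w. w \<epsilon> W \<longleftrightarrow> (\<exists>x. x \<epsilon> u \<and> w = tup [x])) \<and>
    s = expansion A R2 A1 W t)"
  by (rule class_is_set[of R A R2 A1 K]) (use assms(1) in \<open>simp add: expands_def\<close>, use assms(1) in \<open>simp add: expands_def\<close>,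
    use assms(1) in \<open>simp add: expands_def\<close>, use assms(1) in \<open>simp add: expands_def\<close>, fact+)

text \<open>A form of Collection. A structure with universe \<open>B\<close> has \<open>{B}\<close>
  as a member, so three unions lead from the set of structures to the attached points
  \<open>t\<close>.\<close>

lemma collect:
  assumes "\<And>i j. univ.dfn (\<lambda>e. K (e i) (e j))" "\<And>u t. K u t \<Longrightarrow> sub u (un2 A om)"
    "\<And>u t t'. K u t \<Longrightarrow> K u t' \<Longrightarrow> t = t'"
  shows "\<exists>Y. \<forall>u t. K u t \<longrightarrow> t \<epsilon> Y"
proof -
  obtain R R2 A1 where R: "expands (un2 A om) R R2 A1" using rigid_expansion[of A] by blast
  have "\<exists>X. \<forall>s. s \<epsilon> X \<longleftrightarrow> (\<exists>u t W. K u t \<and> (\<forall>w. w \<epsilon> W \<longleftrightarrow> (\<exists>x. x \<epsilon> u \<and> w = tup [x])) \<and>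
    s = expansion (un2 A om) R2 A1 W t)"
    by (rule expansion_class[OF R]) (fact assms)+
  then obtain X where X: "\<forall>s. s \<epsilon> X \<longleftrightarrow> (\<exists>u t W. K u t \<and> (\<forall>w. w \<epsilon> W \<longleftrightarrow> (\<exists>x. x \<epsilon> u \<and> w = tup [x])) \<and>
    s = expansion (un2 A om) R2 A1 W t)" ..
  have "t \<epsilon> Uni (Uni (Uni X))" if ut: "K u t" for u t
  proof -
    obtain W where "\<forall>w. w \<epsilon> W \<longleftrightarrow> (\<exists>x. x \<epsilon> u \<and> w = tup [x])" using ex_tups by blast
    then have s: "expansion (un2 A om) R2 A1 W t \<epsilon> X" using ut unfolding X[rule_format] by blast
    let ?B = "un2 (un2 A om) (upr t t)"
    have "upr ?B ?B \<epsilon> expansion (un2 A om) R2 A1 W t" unfolding expansion_def opr_def by simp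
    then have 1: "upr ?B ?B \<epsilon> Uni X" using s unfolding Uni by blast
    have 2: "?B \<epsilon> upr ?B ?B" "t \<epsilon> ?B" by simp_all
    have "?B \<epsilon> Uni (Uni X)" unfolding Uni[of _ "Uni X"] using 1 2(1) by blast
    then show ?thesis unfolding Uni[of _ "Uni (Uni X)"] using 2(2) by blast
  qed
  then show ?thesis by blast
qed

text \<open>The elements satisfying \<open>P\<close> are indexed by their singletons, with
  \<open>emp\<close> as attached point. The resulting set \<open>X\<close> of structures records
  where \<open>P\<close> holds in the universe; with \<open>X\<close> as a parameter, the subset can
  be separated inside a model, where \<open>P\<close> itself could mean something else.\<close>

theorem separation:
  assumes P: "\<And>i. univ.dfn (\<lambda>e. P (e i))"
  shows "\<exists>B. \<forall>x. x \<epsilon> B \<longleftrightarrow> x \<epsilon> A \<and> P x"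
proof -
  obtain R R2 A1 where R: "expands (un2 A om) R R2 A1" using rigid_expansion[of A] by blast
  define K where "K u t \<longleftrightarrow> (\<exists>x. x \<epsilon> A \<and> u = upr x x \<and> P x \<and> t = emp)" for u t
  have K1: "univ.dfn (\<lambda>e. K (e i) (e j))" for i j unfolding K_def by (intro univ.definable P UNIV_I)
  have K2: "sub u (un2 A om)" if "K u t" for u t using that unfolding K_def sub_def by auto
  have K3: "t = t'" if "K u t" "K u t'" for u t t' using that unfolding K_def by auto
  have "\<exists>X. \<forall>s. s \<epsilon> X \<longleftrightarrow> (\<exists>u t W. K u t \<and> (\<forall>w. w \<epsilon> W \<longleftrightarrow> (\<exists>x. x \<epsilon> u \<and> w = tup [x])) \<and>
    s = expansion (un2 A om) R2 A1 W t)"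
    by (rule expansion_class[OF R]) (fact K1 K2 K3)+
  then obtain X where X: "\<forall>s. s \<epsilon> X \<longleftrightarrow> (\<exists>u t W. K u t \<and> (\<forall>w. w \<epsilon> W \<longleftrightarrow> (\<exists>x. x \<epsilon> u \<and> w = tup [x])) \<and>
    s = expansion (un2 A om) R2 A1 W t)" ..
  obtain N where N: "zf E {x. x \<epsilon> N}" "\<And>x. x \<in> set [X, A, R2, A1] \<Longrightarrow> x \<epsilon> N" using model_of by metis
  interpret n: zf E "{x. x \<epsilon> N}" by (rule N(1))
  have AN: "A \<in> {x. x \<epsilon> N}" using N(2) by simp
  have "n.dfn (\<lambda>e. \<exists>W\<in>{x. x \<epsilon> N}. expansion (un2 A om) R2 A1 W emp \<epsilon> X \<and> tup [e 0] \<epsilon> W)"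
    unfolding expansion_def tup1 tup3
    by (intro n.definable n.om_D n.emp_D n.sc_D n.un2_D) (use N(2) in simp_all)
  from n.sep[OF AN this] obtain B where
    B: "\<And>x. x \<epsilon> B \<longleftrightarrow> x \<epsilon> A \<and> (\<exists>W. W \<epsilon> N \<and> expansion (un2 A om) R2 A1 W emp \<epsilon> X \<and> tup [x] \<epsilon> W)" by auto
  have "(\<exists>W. W \<epsilon> N \<and> expansion (un2 A om) R2 A1 W emp \<epsilon> X \<and> tup [x] \<epsilon> W) \<longleftrightarrow> P x" if x: "x \<epsilon> A" for x
  proof
    assume "P x"
    let ?W = "upr (tup [x]) (tup [x])"
    have "?W \<epsilon> N" using n.upr_D[of "tup [x]" "tup [x]"] n.tup1_D[OF n.trans[OF AN x]] by simp
    moreover have "K (upr x x) emp" unfolding K_def using x \<open>P x\<close> by blast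
    then have "expansion (un2 A om) R2 A1 ?W emp \<epsilon> X"
      unfolding X[rule_format] by (intro exI[of _ "upr x x"] exI[of _ emp] exI[of _ ?W]) auto
    ultimately show "\<exists>W. W \<epsilon> N \<and> expansion (un2 A om) R2 A1 W emp \<epsilon> X \<and> tup [x] \<epsilon> W"
      by (intro exI[of _ ?W]) auto
  next
    assume "\<exists>W. W \<epsilon> N \<and> expansion (un2 A om) R2 A1 W emp \<epsilon> X \<and> tup [x] \<epsilon> W"
    then obtain W where W: "expansion (un2 A om) R2 A1 W emp \<epsilon> X" "tup [x] \<epsilon> W" by blast
    then obtain u t W' where W': "K u t" "\<forall>w. w \<epsilon> W' \<longleftrightarrow> (\<exists>x. x \<epsilon> u \<and> w = tup [x])"
      "expansion (un2 A om) R2 A1 W emp = expansion (un2 A om) R2 A1 W' t" unfolding X[rule_format] by blast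
    have "tup [R2, A1, W] = tup [R2, A1, W']" using W'(3) by (simp add: expansion_def)
    then have "W = W'" by (simp add: tup_inject)
    then obtain x' where "x' \<epsilon> u" "tup [x] = tup [x']" using W(2) W'(2) by blast
    then have "x \<epsilon> u" by (simp add: tup_inject)
    then show "P x" using W'(1) unfolding K_def by auto
  qed
  then show ?thesis using B by (intro exI[of _ B]) blast
qed

text \<open>Each subset is used as its own attached point, so \<open>collect\<close> puts all
  subsets into one set.\<close>

theorem powerset: "\<exists>B. \<forall>x. x \<epsilon> B \<longleftrightarrow> sub x A"
proof -
  have "\<exists>Y. \<forall>u t. sub u (un2 A om) \<and> t = u \<longrightarrow> t \<epsilon> Y"
    by (rule collect) (intro univ.definable UNIV_I, auto)
  then obtain Y where Y: "\<And>u. sub u (un2 A om) \<Longrightarrow> u \<epsilon> Y" by blast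
  obtain B where B: "\<And>x. x \<epsilon> B \<longleftrightarrow> x \<epsilon> Y \<and> sub x A"
    using separation[of "\<lambda>x. sub x A" Y] univ.dfn_sub[OF univ.tm_var univ.tm_const] by auto
  have "sub x A \<Longrightarrow> x \<epsilon> Y" for x using Y[of x] by (simp add: sub_def)
  then show ?thesis using B by blast
qed

text \<open>Singletons of members of \<open>A\<close> serve as indices and their images as attached
  points; functionality of \<open>P\<close> is the uniqueness that \<open>collect\<close> asks
  for.\<close>

theorem replacement:
  assumes P: "\<And>i j. univ.dfn (\<lambda>e. P (e i) (e j))" "\<And>x y y'. x \<epsilon> A \<Longrightarrow> P x y \<Longrightarrow> P x y' \<Longrightarrow> y = y'"
  shows "\<exists>B. \<forall>y. y \<epsilon> B \<longleftrightarrow> (\<exists>x. x \<epsilon> A \<and> P x y)"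
proof -
  have "\<exists>Y. \<forall>u t. (\<exists>x. x \<epsilon> A \<and> u = upr x x \<and> P x t) \<longrightarrow> t \<epsilon> Y"
  proof (rule collect)
    show "univ.dfn (\<lambda>e. \<exists>x. x \<epsilon> A \<and> e i = upr x x \<and> P x (e j))" for i j
      by (intro univ.definable UNIV_I P(1))
  qed (use P(2) in \<open>auto simp: sub_def\<close>)
  then obtain Y where Y: "\<And>x t. x \<epsilon> A \<Longrightarrow> P x t \<Longrightarrow> t \<epsilon> Y" by blast
  have "univ.dfn (\<lambda>e. \<exists>x. x \<epsilon> A \<and> P x (e i))" for i by (intro univ.definable UNIV_I P(1))
  from separation[OF this, of Y] show ?thesis using Y by blast
qed

text \<open>Being a transversal of \<open>F\<close> is absolute for a transitive model containing
  \<open>F\<close>, and Choice holds in the model.\<close>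

theorem choice:
  assumes "\<And>x. x \<epsilon> F \<Longrightarrow> \<exists>y. y \<epsilon> x" "\<And>x y z. x \<epsilon> F \<Longrightarrow> y \<epsilon> F \<Longrightarrow> z \<epsilon> x \<Longrightarrow> z \<epsilon> y \<Longrightarrow> x = y"
  shows "\<exists>t. \<forall>x. x \<epsilon> F \<longrightarrow> (\<exists>y. \<forall>z. (z \<epsilon> t \<and> z \<epsilon> x) = (z = y))"
proof -
  obtain N where N: "zf E {x. x \<epsilon> N}" "\<And>x. x \<in> set [F] \<Longrightarrow> x \<epsilon> N" using model_of by metis
  interpret n: zf E "{x. x \<epsilon> N}" by (rule N(1))
  have F: "F \<epsilon> N" using N(2) by simp
  have tr: "y \<epsilon> N" if "x \<epsilon> N" "y \<epsilon> x" for x y using n.trans[of x y] that by simp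
  have "nsat {x. x \<epsilon> N} E (\<lambda>s. False) (\<lambda>_. emp) choice_ax" by (rule n.ax) (simp add: zfc_axs_def)
  then have ch: "(\<forall>k. k \<epsilon> N \<longrightarrow> k \<epsilon> F \<longrightarrow> (\<exists>p. p \<epsilon> N \<and> p \<epsilon> k)) \<and>
      (\<forall>k. k \<epsilon> N \<longrightarrow> (\<forall>l. l \<epsilon> N \<longrightarrow> k \<epsilon> F \<and> l \<epsilon> F \<and> (\<exists>p. p \<epsilon> N \<and> p \<epsilon> k \<and> p \<epsilon> l) \<longrightarrow> k = l)) \<longrightarrow>
      (\<exists>t. t \<epsilon> N \<and> (\<forall>k. k \<epsilon> N \<longrightarrow> k \<epsilon> F \<longrightarrow> (\<exists>p. p \<epsilon> N \<and> (\<forall>q. q \<epsilon> N \<longrightarrow> (q \<epsilon> t \<and> q \<epsilon> k) = (q = p)))))"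
    using F by (simp add: choice_ax_def)
  have a: "\<forall>k. k \<epsilon> N \<longrightarrow> k \<epsilon> F \<longrightarrow> (\<exists>p. p \<epsilon> N \<and> p \<epsilon> k)"
  proof (intro allI impI)
    fix k assume k: "k \<epsilon> N" "k \<epsilon> F"
    obtain p where "p \<epsilon> k" using assms(1)[OF k(2)] by (elim exE)
    with tr[OF k(1) this] show "\<exists>p. p \<epsilon> N \<and> p \<epsilon> k" by (intro exI conjI)
  qed
  have b: "\<forall>k. k \<epsilon> N \<longrightarrow> (\<forall>l. l \<epsilon> N \<longrightarrow> k \<epsilon> F \<and> l \<epsilon> F \<and> (\<exists>p. p \<epsilon> N \<and> p \<epsilon> k \<and> p \<epsilon> l) \<longrightarrow> k = l)"
    by (intro allI impI, elim conjE exE) (rule assms(2))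
  obtain t where t: "t \<epsilon> N"
    "\<forall>k. k \<epsilon> N \<longrightarrow> k \<epsilon> F \<longrightarrow> (\<exists>p. p \<epsilon> N \<and> (\<forall>q. q \<epsilon> N \<longrightarrow> (q \<epsilon> t \<and> q \<epsilon> k) = (q = p)))"
    using mp[OF ch conjI[OF a b]] by (elim exE conjE)
  have "\<exists>y. \<forall>z. (z \<epsilon> t \<and> z \<epsilon> x) = (z = y)" if x: "x \<epsilon> F" for x
  proof -
    obtain p where p: "p \<epsilon> N" "\<forall>q. q \<epsilon> N \<longrightarrow> (q \<epsilon> t \<and> q \<epsilon> x) = (q = p)"
      using t(2)[rule_format, OF tr[OF F x] x] by (elim exE conjE)
    have "(z \<epsilon> t \<and> z \<epsilon> x) = (z = p)" for z using p tr[OF t(1), of z] by blast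
    then show ?thesis by blast
  qed
  then show ?thesis by blast
qed

theorem zfc_axiom:
  assumes T: "T \<in> set zfc_axs" and \<psi>: "3 \<notin> fv \<psi>" "4 \<notin> fv \<psi>"
  shows "nsat UNIV E (\<lambda>s. sat UNIV E s \<psi>) s T"
proof -
  \<comment> \<open>The template also assigns values to its auxiliary variables 3 and 4. They are
    not free in \<open>\<psi>\<close>, so its truth is unaffected and the predicates get the form
    handled by \<open>dfn_sat\<close>.\<close>
  have c1: "sat UNIV E (s(2 := a, 3 := b, 0 := x)) \<psi> = sat UNIV E ((s(2 := a))(0 := x)) \<psi>" for s a b x
    by (rule sat_cong) (use \<psi> in auto)
  have c2: "sat UNIV E (s(2 := a, 0 := x, 4 := z, 1 := y)) \<psi> = sat UNIV E ((s(2 := a))(0 := x, 1 := y)) \<psi>"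
    "sat UNIV E (s(2 := a, 3 := b, 1 := y, 0 := x)) \<psi> = sat UNIV E ((s(2 := a))(0 := x, 1 := y)) \<psi>" for s a b x y z
    by (rule sat_cong, (use \<psi> in auto)[1])+
  consider "T = extensionality_ax" | "T = foundation_ax" | "T = pair_ax" | "T = union_ax" | "T = powerset_ax"
    | "T = infinity_ax" | "T = choice_ax" | "T = separation_ax" | "T = replacement_ax"
    using T by (auto simp: zfc_axs_def)
  then show ?thesis
  proof cases
    case 1
    then show ?thesis using ext by (auto simp: extensionality_ax_def)
  next
    case 2
    have "\<forall>a. (\<exists>x. x \<epsilon> a) \<longrightarrow> (\<exists>y. y \<epsilon> a \<and> (\<forall>z. z \<epsilon> y \<longrightarrow> \<not> z \<epsilon> a))" using foundation by blast
    then show ?thesis by (simp add: 2 foundation_ax_def)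
  next
    case 3
    then show ?thesis using ex_pair by (simp add: pair_ax_def)
  next
    case 4
    then show ?thesis using ex_union by (simp add: union_ax_def)
  next
    case 5
    then show ?thesis using powerset by (simp add: powerset_ax_def sub_def)
  next
    case 6
    have "\<exists>w. (\<exists>x. x \<epsilon> w \<and> (\<forall>y. \<not> y \<epsilon> x)) \<and>
        (\<forall>x. x \<epsilon> w \<longrightarrow> (\<exists>y. y \<epsilon> w \<and> (\<forall>z. z \<epsilon> y \<longleftrightarrow> z \<epsilon> x \<or> z = x)))"
      by (rule exI[of _ om], rule conjI) (use om_0 emp in metis, use om_sc sc in metis)
    then show ?thesis by (simp add: 6 infinity_ax_def)
  next
    case 7
    have "\<forall>F. (\<forall>x. x \<epsilon> F \<longrightarrow> (\<exists>y. y \<epsilon> x)) \<and> (\<forall>x y. x \<epsilon> F \<and> y \<epsilon> F \<and> (\<exists>z. z \<epsilon> x \<and> z \<epsilon> y) \<longrightarrow> x = y) \<longrightarrow>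
        (\<exists>t. \<forall>x. x \<epsilon> F \<longrightarrow> (\<exists>y. \<forall>z. (z \<epsilon> t \<and> z \<epsilon> x) = (z = y)))"
    proof (intro allI impI, elim conjE)
      fix F assume "\<forall>x. x \<epsilon> F \<longrightarrow> (\<exists>y. y \<epsilon> x)" "\<forall>x y. x \<epsilon> F \<and> y \<epsilon> F \<and> (\<exists>z. z \<epsilon> x \<and> z \<epsilon> y) \<longrightarrow> x = y"
      then show "\<exists>t. \<forall>x. x \<epsilon> F \<longrightarrow> (\<exists>y. \<forall>z. (z \<epsilon> t \<and> z \<epsilon> x) = (z = y))" by (intro choice) blast+
    qed
    then show ?thesis by (simp add: 7 choice_ax_def)
  next
    case 8
    have "\<exists>b. \<forall>x. x \<epsilon> b \<longleftrightarrow> x \<epsilon> a \<and> sat UNIV E ((s(2 := a))(0 := x)) \<psi>" for a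
    proof (rule separation)
      show "univ.dfn (\<lambda>e. sat UNIV E ((s(2 := a))(0 := e i)) \<psi>)" for i
        using univ.dfn_ren[OF univ.dfn_sat(1)[of "s(2 := a)" \<psi>], of "\<lambda>_. i"] by simp
    qed
    then show ?thesis by (simp add: 8 separation_ax_def c1)
  next
    case 9
    have "\<exists>b. \<forall>y. y \<epsilon> b \<longleftrightarrow> (\<exists>x. x \<epsilon> a \<and> sat UNIV E ((s(2 := a))(0 := x, 1 := y)) \<psi>)"
      if "\<forall>x. x \<epsilon> a \<longrightarrow> (\<exists>z. \<forall>y. sat UNIV E ((s(2 := a))(0 := x, 1 := y)) \<psi> \<longrightarrow> y = z)" for a
    proof (rule replacement)
      show "univ.dfn (\<lambda>e. sat UNIV E ((s(2 := a))(0 := e i, 1 := e j)) \<psi>)" for i j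
        by (rule univ.dfn_sat(2)) simp
    qed (use that in blast)
    then show ?thesis unfolding 9 replacement_ax_def by (simp only: nsat.simps nsat_TEx nsat_TIff nsat_TAnd c2) simp
  qed
qed

end

section \<open>Models of the theories\<close>

text \<open>Proved before \<open>omset\<close> is available, since it serves to translate the axiom
  on \<omega> into the assumption of that locale.\<close>

lemma (in extset) ev_inductive_extset:
  "w < n \<Longrightarrow> lsat UNIV E g n e (is_inductive w) = ind (e w)"
proof -
  have 1: "(\<forall>y. \<not> y \<epsilon> z) \<longleftrightarrow> z = emp" for z by (auto simp: ext_iff)
  have 2: "(\<forall>z. z \<epsilon> y \<longleftrightarrow> z \<epsilon> x \<or> z = x) \<longleftrightarrow> y = sc x" for x y by (auto simp: ext_iff[of y])
  show "w < n \<Longrightarrow> lsat UNIV E g n e (is_inductive w) = ind (e w)"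
    by (simp add: is_inductive_def is_empty_def is_succ_def 1 2 ind_def)
qed

lemma (in fdom) ev_cf_omega:
  assumes "ord om" "a < n" "e a \<in> D"
  shows "lsat D E g n e (cf_omega a) = cfo (e a)"
  using assms trans[OF om_D]
  by (auto simp: cf_omega_def cf_eq_def cfo_def cong: bex_cong)

lemma sat_BST_instance:
  assumes "\<And>p. p \<in> LZFC_spec \<Longrightarrow> sat D E e p" "\<And>i. e i \<in> D"
    and "T \<in> {emptyset_ax, extensionality_ax, pair_ax, union_ax}"
  shows "nsat D E (\<lambda>s. False) e T"
proof -
  have "instance_of T Fls \<in> LZFC_spec"
    using assms(3) unfolding LZFC_spec_def LZFC_def BST_def by blast
  from assms(1)[OF this] show ?thesis using assms(2) sat_instance[of e D E T Fls] by simp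
qed

lemma sat_BST_separation:
  assumes "\<And>p. p \<in> LZFC_spec \<Longrightarrow> sat D E e p" "\<And>i. e i \<in> D"
    and "Delta0 \<psi>" "3 \<notin> fv \<psi>" "4 \<notin> fv \<psi>" "\<And>i. s i \<in> D"
  shows "nsat D E (\<lambda>s. sat D E s \<psi>) s separation_ax"
proof -
  have "instance_of separation_ax \<psi> \<in> LZFC_spec"
    using assms(3-5) unfolding LZFC_spec_def LZFC_def BST_def by blast
  from assms(1)[OF this] show ?thesis using assms(2,6) sat_instance[of e D E separation_ax \<psi>] by blast
qed

lemma spec_model:
  fixes E :: "'a \<Rightarrow> 'a \<Rightarrow> bool"
  assumes sat: "\<And>p. p \<in> LZFC_spec \<Longrightarrow> sat UNIV E e p"
  shows "spec E"
proof -
  note inst = sat_BST_instance[OF sat, simplified]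
  interpret extset E
  proof
    show "x = y" if "\<And>z. E z x = E z y" for x y
      using inst[of extensionality_ax] that by (auto simp: extensionality_ax_def)
    show "\<exists>x. \<forall>z. \<not> E z x" using inst[of emptyset_ax] by (simp add: emptyset_ax_def)
    show "\<exists>p. \<forall>z. E z p = (z = x \<or> z = y)" for x y
      using inst[of pair_ax] by (simp add: pair_ax_def)
    show "\<exists>u. \<forall>z. E z u = (\<exists>y. E y x \<and> E z y)" for x
      using inst[of union_ax] by (simp add: union_ax_def)
  qed
  interpret omset E
  proof
    have "omega_exists_ax \<in> LZFC_spec" by (simp add: LZFC_spec_def LZFC_def BST_def)
    from sat[OF this] have "lsat UNIV E e 0 e (\<^bold>\<exists>w. is_omega w)"
      unfolding omega_exists_ax_def lsat_0[of UNIV E e _ e] .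
    then show "\<exists>w. ind w \<and> (\<forall>v. ind v \<longrightarrow> sub w v)"
      by (simp add: is_omega_def ev_inductive_extset is_subset_def sub_def)
  qed
  interpret bst E
  proof
    fix w a b
    \<comment> \<open>The formula says that \<open>v0\<close> differs from \<open>v5\<close> and
      from \<open>v6\<close>; the assignment puts \<open>a\<close> at 5 and \<open>b\<close> at
      6.\<close>
    let ?\<psi> = "Imp (Imp (Imp (Eq 0 5) Fls) (Imp (Imp (Eq 0 6) Fls) Fls)) Fls"
    have "Delta0 ?\<psi>" by (intro Delta0.intros)
    then have "nsat UNIV E (\<lambda>s. sat UNIV E s ?\<psi>) ((\<lambda>_. a)(6 := b)) separation_ax"
      by (intro sat_BST_separation[OF sat]) auto
    then show "\<exists>W. \<forall>k. E k W = (E k w \<and> k \<noteq> a \<and> k \<noteq> b)"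
      by (simp add: separation_ax_def)
  qed
  have "Loc_spec_ZFC \<in> LZFC_spec" by (simp add: LZFC_spec_def)
  from sat[OF this] have loc: "lsat UNIV E e 0 e (\<^bold>\<forall>x. \<^bold>\<exists>M. is_special_model M \<^bold>\<and> x \<^bold>\<in> M)"
    unfolding Loc_spec_ZFC_def lsat_0[of UNIV E e _ e] .
  have M: "\<exists>M. E x M \<and> lsat UNIV E e 2 (e(0 := x, 1 := M)) (is_special_model 1)" for x
  proof -
    from loc have "\<exists>M. lsat UNIV E e (Suc (Suc 0)) (e(0 := x, Suc 0 := M)) (is_special_model (Suc 0) \<^bold>\<and> 0 \<^bold>\<in> Suc 0)"
      unfolding lsat_all lsat_ex by blast
    then show ?thesis by (auto simp: numeral_2_eq_2)
  qed
  interpret loc E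
  proof
    show "\<exists>M. E x M \<and> zmodel M" for x
      using M[of x] ev_is_model[of 1 2 e "e(0 := x, 1 := _)"] unfolding is_special_model_def lsat_conj by auto
  qed
  have ord_om: "ord om"
  proof -
    obtain N where "zf E {x. E x N}" using model_of[of "[]"] by blast
    then show ?thesis by (rule zf.ord_om)
  qed
  show ?thesis
  proof
    fix x
    \<comment> \<open>\<open>om\<close> is included because \<open>zf\<close> requires it in the
      domain; transitivity then gives back \<open>x\<close> as a member of the model.\<close>
    obtain M where M: "E (mks [x, om]) M" "lsat UNIV E e 2 (e(0 := mks [x, om], 1 := M)) (is_special_model 1)"
      using M by blast
    let ?e = "e(0 := mks [x, om], 1 := M)"
    have zm: "zmodel M"
      using M(2) ev_is_model[of 1 2 e ?e] unfolding is_special_model_def lsat_conj by simp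
    have xM: "E x M" "E om M" using zmodel_trs[OF zm M(1)] by simp_all
    interpret m: zf E "{x. E x M}" by (rule zf_model[OF zm xM(2)])
    interpret mf: fdom E "{x. E x M}" by (rule m.fdom)
    have "mf.cfo a \<longleftrightarrow> univf.cfo a" if "E a M" "ord a" for a
    proof -
      have "\<forall>a. lsat UNIV E e 3 (?e(2 := a)) (2 \<^bold>\<in> 1 \<^bold>\<and> ordinal 2 \<^bold>\<longrightarrow> (rel_to 1 (cf_omega 2) \<^bold>\<longleftrightarrow> cf_omega 2))"
        using M(2) unfolding is_special_model_def lsat_conj lsat_all by (simp add: numeral_3_eq_3 numeral_2_eq_2)
      then have "lsat UNIV E e 3 (?e(2 := a)) (rel_to 1 (cf_omega 2) \<^bold>\<longleftrightarrow> cf_omega 2)"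
        using that by (simp add: univf.ev_ordinal)
      then have "lsat {x. E x M} E e 3 (?e(2 := a)) (cf_omega 2) \<longleftrightarrow> lsat UNIV E e 3 (?e(2 := a)) (cf_omega 2)"
        by simp
      then show ?thesis using mf.ev_cf_omega[OF ord_om] univf.ev_cf_omega[OF ord_om] that by simp
    qed
    then show "\<exists>M. E x M \<and> zmodel M \<and> (\<forall>a. E a M \<and> ord a \<longrightarrow> fdom.cfo E {x. E x M} a = univf.cfo a)"
      using xM(1) zm by blast
  qed
qed

text \<open>In a finite model, Pair and Union would gather all elements into one set, and bounded
  Separation would turn it into the Russell set.\<close>

lemma infinite_model:
  fixes D :: "'a set"
  assumes e: "\<forall>i. e i \<in> D" and sat: "\<And>p. p \<in> LZFC_spec \<Longrightarrow> sat D E e p"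
  shows "infinite D"
proof
  assume fin: "finite D"
  note inst = sat_BST_instance[OF sat e[rule_format], simplified]
  have pair: "\<exists>p\<in>D. \<forall>z\<in>D. E z p = (z = x \<or> z = y)" if "x \<in> D" "y \<in> D" for x y
    using inst[of pair_ax] that by (auto simp: pair_ax_def)
  have union: "\<exists>u\<in>D. \<forall>z\<in>D. E z u = (\<exists>y\<in>D. E y x \<and> E z y)" if "x \<in> D" for x
    using inst[of union_ax] that by (auto simp: union_ax_def)
  have "\<exists>u\<in>D. \<forall>x\<in>F. E x u" if "finite F" "F \<subseteq> D" for F
    using that
  proof (induction F)
    case empty
    then show ?case using e by blast
  next
    case (insert x F)
    then obtain u where u: "u \<in> D" "\<forall>x\<in>F. E x u" by blast
    have x: "x \<in> D" using insert by simp
    obtain p where p: "p \<in> D" "\<forall>z\<in>D. E z p = (z = x \<or> z = x)" using pair[OF x x] by blast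
    obtain q where q: "q \<in> D" "\<forall>z\<in>D. E z q = (z = u \<or> z = p)" using pair[OF u(1) p(1)] by blast
    obtain w where w: "w \<in> D" "\<forall>z\<in>D. E z w = (\<exists>y\<in>D. E y q \<and> E z y)" using union[OF q(1)] by blast
    have "E y w" if "y \<in> insert x F" for y
    proof -
      have "y \<in> D" "E y u \<or> E y p" using that insert.prems u x p by auto
      then show ?thesis using w(2) q(2) u(1) p(1) by blast
    qed
    then show ?case using w(1) by blast
  qed
  then obtain u where u: "u \<in> D" "\<forall>x\<in>D. E x u" using fin by blast
  have "nsat D E (\<lambda>s. sat D E s (Imp (Mem 0 0) Fls)) (\<lambda>_. u) separation_ax"
    by (intro sat_BST_separation[OF sat e[rule_format]] Delta0.intros u) auto
  then have "\<exists>r\<in>D. \<forall>x\<in>D. E x r = (E x u \<and> \<not> E x x)" using u(1) by (simp add: separation_ax_def)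
  then show False using u(2) by blast
qed

lemma VPH_in_model:
  fixes E :: "'a \<Rightarrow> 'a \<Rightarrow> bool"
  assumes "\<And>p. p \<in> LZFC_spec \<Longrightarrow> sat UNIV E e p"
  shows "sat UNIV E e VPH"
proof -
  interpret spec E by (rule spec_model[OF assms])
  have "\<forall>A. infin A \<longrightarrow> (\<exists>R. (\<forall>p. E p R \<longrightarrow> (\<exists>x y. E x A \<and> E y A \<and> p = opr x y)) \<and> rgd A R)"
    using rigid_exists by metis
  then have "lsat UNIV E e 0 e (\<^bold>\<forall>A. infinite_set A \<^bold>\<longrightarrow> (\<^bold>\<exists>R. rel_on R A \<^bold>\<and> rigid A R))"
    by (simp add: rigid_def infin_def rgd_def)
  then show ?thesis unfolding VPH_def lsat_0[of UNIV E e _ e] .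
qed

lemma ZFC_in_model:
  fixes E :: "'a \<Rightarrow> 'a \<Rightarrow> bool"
  assumes sat: "\<And>p. p \<in> LZFC_spec \<union> VP \<Longrightarrow> sat UNIV E e p" and "q \<in> ZFC"
  shows "sat UNIV E e q"
proof -
  interpret spec E by (rule spec_model) (use sat in blast)
  interpret vopenka E e
    by unfold_locales (use sat in \<open>auto simp: VP_def\<close>)
  obtain T \<psi> where q: "q = instance_of T \<psi>" "T \<in> set zfc_axs" "3 \<notin> fv \<psi>" "4 \<notin> fv \<psi>"
    using assms(2) unfolding ZFC_def by blast
  show ?thesis unfolding q(1) sat_instance[of e UNIV, simplified] using zfc_axiom[OF q(2-4)] by blast
qed

theorem theorem6p8:
  shows "LZFC_spec \<turnstile> VPH \<and> theorems_of ZFC \<subseteq> theorems_of (LZFC_spec \<union> VP)"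
proof
  show "LZFC_spec \<turnstile> VPH"
    by (rule completeness) (use infinite_model VPH_in_model in blast)+
  have "LZFC_spec \<union> VP \<turnstile> q" if "q \<in> ZFC" for q
  proof (rule completeness)
    show "infinite D" if "\<forall>i. e i \<in> D" "\<And>p. p \<in> LZFC_spec \<union> VP \<Longrightarrow> sat D E e p" for D :: "nat set" and E e
      using that by (intro infinite_model) auto
    show "sat UNIV E e q" if "\<And>p. p \<in> LZFC_spec \<union> VP \<Longrightarrow> sat UNIV E e p" for E :: "nat \<Rightarrow> nat \<Rightarrow> bool" and e
      using that \<open>q \<in> ZFC\<close> by (rule ZFC_in_model)
  qed
  then show "theorems_of ZFC \<subseteq> theorems_of (LZFC_spec \<union> VP)"
    unfolding theorems_of_def using cut_all by blast
qed

end
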